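(* Let $\Omega\subset\mathbb{C}^d$ be a bounded convex domain, let $H_\Omega$ be its Hilbert distance (viewing $\mathbb{C}^d=\mathbb{R}^{2d}$), and let $d_\Omega$ be the distance induced by its complete Kähler-Einstein metric with Ricci curvature $-1$. If $(\Omega,H_\Omega)$ is Gromov hyperbolic, then $(\Omega,d_\Omega)$ is Gromov hyperbolic.
   Context: Hilbert distance: for a bounded convex domain $\Omega$ in a real vector space and distinct $x,y\in\Omega$, let $a,b\in\partial\Omega$ be the endpoints of the intersection of $\overline{\Omega}$ with the real line through $x,y$, ordered $a,x,y,b$. Then $$H_\Omega(x,y)=\frac12\log\frac{\|x-b\|\,\|y-a\|}{\|y-b\|\,\|x-a\|},$$ and $H_\Omega(x,x)=0$. A metric space $(X,d)$ is Gromov hyperbolic if there is $\delta\ge 0$ with $(x|z)_w \geq \min\{(x|y)_w,(y|z)_w\}-\delta$ for all $x,y,z,w\in X$, where $(x|y)_w=\frac12(d(x,w)+d(w,y)-d(x,y))$. *)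

theory Defs
  imports "HOL-Analysis.Analysis"
begin

section \<open>The Hilbert distance\<close>

(* The pair (a, b): endpoints of the chord of closure \<Omega> through x and y, in the order a, x, y, b. *)
definition hilbert_endpoints :: "'a::euclidean_space set \<Rightarrow> 'a \<Rightarrow> 'a \<Rightarrow> 'a \<times> 'a" where
  "hilbert_endpoints \<Omega> x y = (THE (a, b).
     a \<in> frontier \<Omega> \<and> b \<in> frontier \<Omega> \<and>
     closure \<Omega> \<inter> affine hull {x, y} = closed_segment a b \<and>
     x \<in> open_segment a y \<and> y \<in> open_segment x b)"

lemma hilbert_endpoints_unique:
  fixes \<Omega> :: "'a::euclidean_space set"
  assumes "open \<Omega>" "bounded \<Omega>" "convex \<Omega>" "x \<in> \<Omega>" "y \<in> \<Omega>" "x \<noteq> y"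
  shows "\<exists>!(a, b).
     a \<in> frontier \<Omega> \<and> b \<in> frontier \<Omega> \<and>
     closure \<Omega> \<inter> affine hull {x, y} = closed_segment a b \<and>
     x \<in> open_segment a y \<and> y \<in> open_segment x b"
proof -
  define p where "p t = x + t *\<^sub>R (y - x)" for t :: real
  define T where "T = {t. p t \<in> closure \<Omega>}"
  have p_seg: "p ((1 - u) * s + u * t) = (1 - u) *\<^sub>R p s + u *\<^sub>R p t" for u s t
    by (simp add: p_def algebra_simps)
  have p_eq: "p s = p t \<longleftrightarrow> s = t" for s t
    using assms by (simp add: p_def)
  have p01: "p 0 = x" "p 1 = y" by (simp_all add: p_def)
  have p_cont: "continuous_on UNIV p" unfolding p_def by (intro continuous_intros)
  have hull: "affine hull {x, y} = range p"
    unfolding affine_hull_2 p_def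
  proof safe
    fix u v :: real assume "u + v = 1"
    then have "u *\<^sub>R x + v *\<^sub>R y = x + v *\<^sub>R (y - x)"
      by (simp add: algebra_simps flip: scaleR_add_left add.assoc)
    then show "u *\<^sub>R x + v *\<^sub>R y \<in> range (\<lambda>t. x + t *\<^sub>R (y - x))"
      by blast
  next
    fix t :: real
    show "\<exists>u v. x + t *\<^sub>R (y - x) = u *\<^sub>R x + v *\<^sub>R y \<and> u + v = 1"
      by (intro exI[of _ "1 - t"] exI[of _ t]) (simp add: algebra_simps)
  qed
  have "convex T"
    unfolding convex_alt T_def using convex_closure[OF assms(3), unfolded convex_alt]
    by (simp add: p_seg)
  moreover have "closed T"
    unfolding T_def using closed_vimage[OF closed_closure p_cont] by (simp add: vimage_def)
  moreover have "bounded T"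
  proof -
    obtain B where B: "\<And>z. z \<in> closure \<Omega> \<Longrightarrow> norm z \<le> B"
      using bounded_closure[OF assms(2)] by (auto simp: bounded_iff)
    have "\<bar>t\<bar> \<le> (B + norm x) / norm (y - x)" if "t \<in> T" for t
    proof -
      have "norm (t *\<^sub>R (y - x)) \<le> norm (p t) + norm x"
        unfolding p_def using norm_triangle_ineq4[of "x + t *\<^sub>R (y - x)" x] by simp
      also have "\<dots> \<le> B + norm x" using B that by (simp add: T_def)
      finally have "\<bar>t\<bar> * norm (y - x) \<le> B + norm x" by (simp only: norm_scaleR)
      then show ?thesis using assms(6) by (simp add: pos_le_divide_eq)
    qed
    then show ?thesis by (auto simp: bounded_iff)
  qed
  ultimately obtain s t where T: "T = {s..t}"
    using connected_compact_interval_1[of T] convex_connected compact_eq_bounded_closed by auto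
  have opn: "\<exists>e>0. \<forall>r. \<bar>r - q\<bar> \<le> e \<longrightarrow> r \<in> T" if "p q \<in> \<Omega>" for q
  proof -
    have "open (p -` \<Omega>)" using assms(1) p_cont by (rule open_vimage)
    moreover have "q \<in> p -` \<Omega>" using that by simp
    ultimately obtain e where e: "e > 0" "cball q e \<subseteq> p -` \<Omega>"
      unfolding open_contains_cball by blast
    have "r \<in> T" if "\<bar>r - q\<bar> \<le> e" for r
    proof -
      have "r \<in> cball q e" using that by (simp add: dist_real_def abs_minus_commute)
      then show ?thesis using e closure_subset[of \<Omega>] unfolding T_def by blast
    qed
    then show ?thesis using e by blast
  qed
  have s0: "s < 0"
  proof -
    obtain e where "e > 0" "\<forall>r. \<bar>r - 0\<bar> \<le> e \<longrightarrow> r \<in> T" using opn[of 0] assms p01 by auto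
    then have "- e \<in> T" by simp
    then show ?thesis using \<open>e > 0\<close> T by auto
  qed
  have t1: "1 < t"
  proof -
    obtain e where "e > 0" "\<forall>r. \<bar>r - 1\<bar> \<le> e \<longrightarrow> r \<in> T" using opn[of 1] assms p01 by auto
    then have "1 + e \<in> T" by simp
    then show ?thesis using \<open>e > 0\<close> T by auto
  qed
  have "p s \<notin> \<Omega>"
  proof
    assume "p s \<in> \<Omega>"
    then obtain e where "e > 0" "\<forall>r. \<bar>r - s\<bar> \<le> e \<longrightarrow> r \<in> T" using opn by blast
    then have "s - e \<in> T" by simp
    then show False using \<open>e > 0\<close> T by auto
  qed
  moreover have "p t \<notin> \<Omega>"
  proof
    assume "p t \<in> \<Omega>"
    then obtain e where "e > 0" "\<forall>r. \<bar>r - t\<bar> \<le> e \<longrightarrow> r \<in> T" using opn by blast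
    then have "t + e \<in> T" by simp
    then show False using \<open>e > 0\<close> T by auto
  qed
  moreover have "p s \<in> closure \<Omega>" "p t \<in> closure \<Omega>"
  proof -
    have "s \<in> T" "t \<in> T" using T s0 t1 by simp_all
    then show "p s \<in> closure \<Omega>" "p t \<in> closure \<Omega>" by (simp_all add: T_def)
  qed
  ultimately have fr: "p s \<in> frontier \<Omega>" "p t \<in> frontier \<Omega>"
    using assms(1) by (auto simp: frontier_def interior_open)
  have p_open: "p c \<in> open_segment (p a) (p b)" if "a < c" "c < b" for a b c
  proof -
    define u where "u = (c - a) / (b - a)"
    have "0 < u" "u < 1" using that by (simp_all add: u_def)
    moreover have "(1 - u) * a + u * b = c"
    proof -
      have "u * (b - a) = c - a" using that by (simp add: u_def)
      then show ?thesis by (simp add: algebra_simps)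
    qed
    then have "p c = (1 - u) *\<^sub>R p a + u *\<^sub>R p b" by (simp flip: p_seg)
    moreover have "p a \<noteq> p b" using that p_eq by simp
    ultimately show ?thesis unfolding in_segment by blast
  qed
  have seg: "closure \<Omega> \<inter> affine hull {x, y} = closed_segment (p s) (p t)"
  proof -
    have "closure \<Omega> \<inter> affine hull {x, y} = p ` T" unfolding hull T_def by auto
    also have "\<dots> = p ` closed_segment s t"
      using T s0 t1 by (simp add: closed_segment_eq_real_ivl)
    also have "\<dots> = closed_segment (p s) (p t)"
    proof (intro set_eqI iffI)
      fix z assume "z \<in> p ` closed_segment s t"
      then obtain u where u: "0 \<le> u" "u \<le> 1" and "z = p ((1 - u) * s + u * t)"
        by (auto simp: in_segment)
      then have "z = (1 - u) *\<^sub>R p s + u *\<^sub>R p t" by (simp only: p_seg)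
      with u show "z \<in> closed_segment (p s) (p t)" unfolding in_segment by blast
    next
      fix z assume "z \<in> closed_segment (p s) (p t)"
      then obtain u where "0 \<le> u" "u \<le> 1" "z = p ((1 - u) * s + u * t)"
        unfolding in_segment using p_seg by metis
      moreover from this have "(1 - u) * s + u * t \<in> closed_segment s t"
        unfolding in_segment by auto
      ultimately show "z \<in> p ` closed_segment s t" by blast
    qed
    finally show ?thesis .
  qed
  have ord: "x \<in> open_segment (p s) y" "y \<in> open_segment x (p t)"
    using p_open[of s 0 1] p_open[of 0 1 t] s0 t1 p01 by auto
  show ?thesis
  proof (rule ex1I[of _ "(p s, p t)"])
    show "case (p s, p t) of (a, b) \<Rightarrow> a \<in> frontier \<Omega> \<and> b \<in> frontier \<Omega> \<and>
      closure \<Omega> \<inter> affine hull {x, y} = closed_segment a b \<and>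
      x \<in> open_segment a y \<and> y \<in> open_segment x b"
      using fr seg ord by simp
  next
    fix ab
    assume *: "case ab of (a, b) \<Rightarrow> a \<in> frontier \<Omega> \<and> b \<in> frontier \<Omega> \<and>
      closure \<Omega> \<inter> affine hull {x, y} = closed_segment a b \<and>
      x \<in> open_segment a y \<and> y \<in> open_segment x b"
    obtain a b where ab: "ab = (a, b)" by (cases ab)
    have "closed_segment (p s) (p t) = closed_segment a b"
      using * unfolding ab seg by simp
    then have "{p s, p t} = {a, b}" by (simp only: closed_segment_eq)
    moreover have "\<not> (a = p t \<and> b = p s)"
    proof
      assume "a = p t \<and> b = p s"
      then obtain u where "0 < u" "u < 1" "p 0 = (1 - u) *\<^sub>R p t + u *\<^sub>R p 1"
        using * unfolding ab p01 by (auto simp: in_segment)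
      then have "0 = (1 - u) * t + u * 1" unfolding p_seg[symmetric] p_eq by simp
      moreover have "(1 - u) * t > 0" using \<open>u < 1\<close> t1 by simp
      ultimately show False using \<open>0 < u\<close> by simp
    qed
    ultimately show "ab = (p s, p t)" using ab by (auto simp: doubleton_eq_iff)
  qed
qed

(* Only the values on \<Omega> \<times> \<Omega> matter; it is 0 elsewhere. *)
definition hilbert_dist :: "'a::euclidean_space set \<Rightarrow> 'a \<Rightarrow> 'a \<Rightarrow> real" where
  "hilbert_dist \<Omega> x y =
     (if x \<in> \<Omega> \<and> y \<in> \<Omega> \<and> x \<noteq> y
      then (case hilbert_endpoints \<Omega> x y of (a, b) \<Rightarrow>
        1 / 2 * ln ((norm (x - b) * norm (y - a)) / (norm (y - b) * norm (x - a))))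
      else 0)"


section \<open>Gromov hyperbolicity\<close>

definition gromov_product :: "('a \<Rightarrow> 'a \<Rightarrow> real) \<Rightarrow> 'a \<Rightarrow> 'a \<Rightarrow> 'a \<Rightarrow> real" where
  "gromov_product d w x y = 1 / 2 * (d x w + d w y - d x y)"

definition gromov_hyperbolic :: "'a set \<Rightarrow> ('a \<Rightarrow> 'a \<Rightarrow> real) \<Rightarrow> bool" where
  "gromov_hyperbolic X d \<longleftrightarrow>
     (\<exists>\<delta>\<ge>0. \<forall>x\<in>X. \<forall>y\<in>X. \<forall>z\<in>X. \<forall>w\<in>X.
        gromov_product d w x z \<ge> min (gromov_product d w x y) (gromov_product d w y z) - \<delta>)"


section \<open>Riemannian metrics on open subsets of a Euclidean space\<close>

definition dir_deriv ::
  "('a::real_normed_vector \<Rightarrow> 'b::real_normed_vector) \<Rightarrow> 'a \<Rightarrow> 'a \<Rightarrow> 'b" where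
  "dir_deriv f z u = frechet_derivative f (at z) u"

primrec C_k_on ::
  "nat \<Rightarrow> ('a::real_normed_vector \<Rightarrow> 'b::real_normed_vector) \<Rightarrow> 'a set \<Rightarrow> bool" where
  "C_k_on 0 f S \<longleftrightarrow> continuous_on S f"
| "C_k_on (Suc k) f S \<longleftrightarrow>
     (\<forall>z\<in>S. f differentiable (at z)) \<and> (\<forall>u. C_k_on k (\<lambda>z. dir_deriv f z u) S)"

definition smooth_on ::
  "('a::real_normed_vector \<Rightarrow> 'b::real_normed_vector) \<Rightarrow> 'a set \<Rightarrow> bool" where
  "smooth_on f S \<longleftrightarrow> (\<forall>k. C_k_on k f S)"

(* All tangent spaces are identified with 'a, so a metric on \<Omega> is given by the real inner
   products g z u v of tangent vectors u, v at z \<in> \<Omega>. *)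
definition riemannian_metric_on ::
  "'a::euclidean_space set \<Rightarrow> ('a \<Rightarrow> 'a \<Rightarrow> 'a \<Rightarrow> real) \<Rightarrow> bool" where
  "riemannian_metric_on \<Omega> g \<longleftrightarrow>
     (\<forall>u v. smooth_on (\<lambda>z. g z u v) \<Omega>) \<and>
     (\<forall>z\<in>\<Omega>. bilinear (g z) \<and> (\<forall>u v. g z u v = g z v u) \<and> (\<forall>u. u \<noteq> 0 \<longrightarrow> g z u u > 0))"

(* The Levi-Civita connection on constant vector fields: \<nabla>_u v at the point z, from the Koszul
   formula (the Lie bracket terms vanish). *)
definition levi_civita ::
  "('a::euclidean_space \<Rightarrow> 'a \<Rightarrow> 'a \<Rightarrow> real) \<Rightarrow> 'a \<Rightarrow> 'a \<Rightarrow> 'a \<Rightarrow> 'a" where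
  "levi_civita g z u v = (THE c. \<forall>w.
     g z c w = 1 / 2 * (dir_deriv (\<lambda>z. g z v w) z u + dir_deriv (\<lambda>z. g z u w) z v
                        - dir_deriv (\<lambda>z. g z u v) z w))"

(* R(u,v)w = \<nabla>_u \<nabla>_v w - \<nabla>_v \<nabla>_u w for constant vector fields u, v, w. *)
definition riemann_curvature ::
  "('a::euclidean_space \<Rightarrow> 'a \<Rightarrow> 'a \<Rightarrow> real) \<Rightarrow> 'a \<Rightarrow> 'a \<Rightarrow> 'a \<Rightarrow> 'a \<Rightarrow> 'a" where
  "riemann_curvature g z u v w =
     dir_deriv (\<lambda>z. levi_civita g z v w) z u + levi_civita g z u (levi_civita g z v w)
     - dir_deriv (\<lambda>z. levi_civita g z u w) z v - levi_civita g z v (levi_civita g z u w)"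

(* Ric(v,w) is the trace of the endomorphism u \<mapsto> R(u,v)w. The trace does not depend on the basis,
   so the standard basis, orthonormal for the Euclidean inner product, may be used. *)
definition ricci_curvature ::
  "('a::euclidean_space \<Rightarrow> 'a \<Rightarrow> 'a \<Rightarrow> real) \<Rightarrow> 'a \<Rightarrow> 'a \<Rightarrow> 'a \<Rightarrow> real" where
  "ricci_curvature g z v w = (\<Sum>e\<in>Basis. riemann_curvature g z e v w \<bullet> e)"

(* The library's piecewise C1 paths may have an unbounded derivative near the finitely many
   exceptional points, and integral is 0 for non-integrable functions; has_integral excludes the
   paths of infinite length. *)
definition riemannian_lengths ::
  "'a::euclidean_space set \<Rightarrow> ('a \<Rightarrow> 'a \<Rightarrow> 'a \<Rightarrow> real) \<Rightarrow> 'a \<Rightarrow> 'a \<Rightarrow> real set" where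
  "riemannian_lengths \<Omega> g x y =
     {L. \<exists>\<gamma>. valid_path \<gamma> \<and> path_image \<gamma> \<subseteq> \<Omega> \<and> pathstart \<gamma> = x \<and> pathfinish \<gamma> = y \<and>
          ((\<lambda>t. sqrt (g (\<gamma> t) (vector_derivative \<gamma> (at t)) (vector_derivative \<gamma> (at t))))
             has_integral L) {0..1}}"

(* Meant for connected \<Omega>. Only the values on \<Omega> \<times> \<Omega> matter; it is 0 elsewhere. *)
definition riemannian_dist ::
  "'a::euclidean_space set \<Rightarrow> ('a \<Rightarrow> 'a \<Rightarrow> 'a \<Rightarrow> real) \<Rightarrow> 'a \<Rightarrow> 'a \<Rightarrow> real" where
  "riemannian_dist \<Omega> g x y =
     (if x \<in> \<Omega> \<and> y \<in> \<Omega> then Inf (riemannian_lengths \<Omega> g x y) else 0)"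

definition complete_riemannian_metric_on ::
  "'a::euclidean_space set \<Rightarrow> ('a \<Rightarrow> 'a \<Rightarrow> 'a \<Rightarrow> real) \<Rightarrow> bool" where
  "complete_riemannian_metric_on \<Omega> g \<longleftrightarrow>
     riemannian_metric_on \<Omega> g \<and> Metric_space.mcomplete \<Omega> (riemannian_dist \<Omega> g)"


section \<open>Kaehler-Einstein metrics on open subsets of complex Euclidean space\<close>

definition fundamental_form ::
  "(complex ^ 'n \<Rightarrow> complex ^ 'n \<Rightarrow> complex ^ 'n \<Rightarrow> real) \<Rightarrow>
    complex ^ 'n \<Rightarrow> complex ^ 'n \<Rightarrow> complex ^ 'n \<Rightarrow> real" where
  "fundamental_form g z u v = g z (\<i> *s u) v"

(* A Hermitian metric whose fundamental form \<omega> is closed: the cyclic sum is d\<omega>(u,v,w) for constant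
   vector fields u, v, w. *)
definition kaehler_metric_on ::
  "(complex ^ 'n) set \<Rightarrow> (complex ^ 'n \<Rightarrow> complex ^ 'n \<Rightarrow> complex ^ 'n \<Rightarrow> real) \<Rightarrow> bool" where
  "kaehler_metric_on \<Omega> g \<longleftrightarrow>
     riemannian_metric_on \<Omega> g \<and>
     (\<forall>z\<in>\<Omega>. \<forall>u v. g z (\<i> *s u) (\<i> *s v) = g z u v) \<and>
     (\<forall>z\<in>\<Omega>. \<forall>u v w.
        dir_deriv (\<lambda>z. fundamental_form g z v w) z u
        + dir_deriv (\<lambda>z. fundamental_form g z w u) z v
        + dir_deriv (\<lambda>z. fundamental_form g z u v) z w = 0)"

(* "Ricci curvature c" means Ric = c g as real symmetric 2-tensors. *)
definition kaehler_einstein_metric_on ::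
  "real \<Rightarrow> (complex ^ 'n) set \<Rightarrow>
    (complex ^ 'n \<Rightarrow> complex ^ 'n \<Rightarrow> complex ^ 'n \<Rightarrow> real) \<Rightarrow> bool" where
  "kaehler_einstein_metric_on c \<Omega> g \<longleftrightarrow>
     kaehler_metric_on \<Omega> g \<and> (\<forall>z\<in>\<Omega>. \<forall>v w. ricci_curvature g z v w = c * g z v w)"

end

theory Submission
  imports Defs
begin

text \<open>Let \<open>\<psi>\<close> be the logarithm of the volume density of the Kaehler-Einstein metric \<open>g\<close>; the Einstein
  equation says that the complex Hessian of \<open>\<psi>\<close> is a multiple of \<open>g\<close>. If \<open>h\<close> is a positive
  real affine function on \<open>\<Omega>\<close>, Bochner's formula yields \<open>\<Delta> ln f \<ge> 2 f - 2\<close> for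
  \<open>f = |dh|\<^sup>2 / h\<^sup>2\<close>, and testing this with high powers of \<open>f\<close> and the cutoff functions provided by
  completeness shows \<open>f \<le> 2\<close>. In the other direction the maximum principle for \<open>\<psi>\<close> on ellipsoids bounds the
  volume density of \<open>g\<close> from above. Both bounds together say that the unit ball of \<open>g\<close> at \<open>z\<close> is
  comparable to \<open>{v. z + \<zeta> v \<in> \<Omega> for all |\<zeta>| \<le> 1}\<close>, with constants depending on the dimension only.

  Fix a base point and measure depth by the gauge of \<open>\<Omega>\<close>. If the Hilbert distance is hyperbolic, a segment
  centred at a point of \<open>\<Omega>\<close> can be doubled in length after moving its centre towards the base point until the
  depth has grown by a fixed factor. By the comparison above, the radial retraction onto a level of depth therefore
  contracts \<open>g\<close> exponentially in the distance to that level. Since radial segments are quasi-geodesics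
  for \<open>g\<close> (the estimate \<open>f \<le> 2\<close> makes the logarithm of the depth a Lipschitz function), near-geodesics of
  \<open>g\<close> track radial segments, as in a hyperbolic cone, and the four point condition follows.\<close>

section \<open>Expansion of chords in hyperbolic Hilbert geometries\<close>

text \<open>The obstacle is that \<open>hilbert_dist\<close> measures real chords while g measures
  complex discs, so the two distances are never compared with each other. What passes from one to
  the other is an expansion property of chords with a prescribed centre: it holds in every
  direction, and a complex disc is the union of its diameters, which share the centre. Expansion of
  chords thus becomes expansion of discs, and hence contraction of g under the retraction.
  Completeness gives cutoff functions with small gradient but no control of their second
  derivatives. Therefore the inequality for ln f is not evaluated at a maximum; it is multiplied by
  f^p, integrated against a cutoff and compared with Lebesgue volume, which is finite because
  \<Omega> is bounded. A maximum principle would suggest f \<le> 1; the slack up to 2 absorbs the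
  constant factors of the integral estimate in one step. Geodesics are replaced by finite chains
  throughout, since the Riemannian distance is only given as an infimum of lengths.\<close>

lemma gromov_product_eq: "2 * gromov_product d w x y = d x w + d w y - d x y"
  by (simp add: gromov_product_def)

text \<open>Replaces the definite description of the endpoints by two overshoots s and t beyond p
  and q, measured in units of q - p. All later estimates of the distance are estimates of
  overshoots.\<close>

lemma hilbert_chord:
  fixes \<Omega> :: "'a::euclidean_space set"
  assumes "open \<Omega>" "bounded \<Omega>" "convex \<Omega>" "p \<in> \<Omega>" "q \<in> \<Omega>" "p \<noteq> q"
  obtains s t where "s > 0" "t > 0" "hilbert_dist \<Omega> p q = 1/2 * ln ((1 + t) * (1 + s) / (t * s))"
    "\<And>r. p + r *\<^sub>R (q - p) \<in> closure \<Omega> \<longleftrightarrow> - s \<le> r \<and> r \<le> 1 + t"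
proof -
  obtain a b where ab: "hilbert_endpoints \<Omega> p q = (a, b)" by force
  have "case hilbert_endpoints \<Omega> p q of (a, b) \<Rightarrow> a \<in> frontier \<Omega> \<and> b \<in> frontier \<Omega> \<and>
     closure \<Omega> \<inter> affine hull {p, q} = closed_segment a b \<and>
     p \<in> open_segment a q \<and> q \<in> open_segment p b"
    using theI'[OF hilbert_endpoints_unique[OF assms]] unfolding hilbert_endpoints_def .
  then have seg: "closure \<Omega> \<inter> affine hull {p, q} = closed_segment a b"
    and p: "p \<in> open_segment a q" and q: "q \<in> open_segment p b" using ab by auto
  define v where "v = q - p"
  have v0: "v \<noteq> 0" using assms by (simp add: v_def)
  obtain c where c: "0 < c" "c < 1" "p = (1 - c) *\<^sub>R a + c *\<^sub>R q" using p by (auto simp: in_segment)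
  obtain e where e: "0 < e" "e < 1" "q = (1 - e) *\<^sub>R p + e *\<^sub>R b" using q by (auto simp: in_segment)
  \<comment> \<open>p divides the segment from a to q in the ratio c : (1 - c), and q divides the
    segment from p to b in the ratio e : (1 - e).\<close>
  define s where "s = c / (1 - c)"
  define t where "t = (1 - e) / e"
  have st: "s > 0" "t > 0" using c e by (auto simp: s_def t_def)
  have "(1 - c) *\<^sub>R (p - a) = c *\<^sub>R v"
    unfolding v_def using c(3) by (simp add: algebra_simps)
  then have "p - a = s *\<^sub>R v" unfolding s_def using c
    by (metis (no_types, lifting) divide_inverse_commute less_irrefl right_minus_eq scaleR_left_imp_eq scaleR_scaleR
        divideR_right)
  then have a: "a = p - s *\<^sub>R v" by (simp add: algebra_simps)
  have "e *\<^sub>R (b - p) = v" unfolding v_def using e(3) by (simp add: algebra_simps)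
  then have "b - p = (1 / e) *\<^sub>R v" using e by auto
  moreover have "1 / e = 1 + t" using e by (simp add: t_def field_simps)
  ultimately have b: "b = p + (1 + t) *\<^sub>R v" by (simp add: algebra_simps)
  have comb: "(1 - k) *\<^sub>R a + k *\<^sub>R b = p + (- (1 - k) * s + k * (1 + t)) *\<^sub>R v" for k
    unfolding a b by (simp add: algebra_simps)
  have pt: "p + r *\<^sub>R v \<in> closed_segment a b \<longleftrightarrow> - s \<le> r \<and> r \<le> 1 + t" for r
  proof
    assume "p + r *\<^sub>R v \<in> closed_segment a b"
    then obtain k where k: "0 \<le> k" "k \<le> 1" "p + r *\<^sub>R v = (1 - k) *\<^sub>R a + k *\<^sub>R b"
      by (auto simp: in_segment)
    then have "r *\<^sub>R v = (- (1 - k) * s + k * (1 + t)) *\<^sub>R v" using comb[of k] by simp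
    then have r: "r = - (1 - k) * s + k * (1 + t)" using v0 by simp
    have "r + s = k * (1 + t + s)" "1 + t - r = (1 - k) * (1 + t + s)" using r by (auto simp: algebra_simps)
    then show "- s \<le> r \<and> r \<le> 1 + t"
      using k st by (smt (verit) mult_nonneg_nonneg)
  next
    assume r: "- s \<le> r \<and> r \<le> 1 + t"
    define k where "k = (r + s) / (1 + t + s)"
    have k: "0 \<le> k" "k \<le> 1" using r st by (auto simp: k_def)
    have "k * (1 + t + s) = r + s" using st by (simp add: k_def)
    then have "r = - (1 - k) * s + k * (1 + t)" by (simp add: algebra_simps)
    then have "p + r *\<^sub>R v = (1 - k) *\<^sub>R a + k *\<^sub>R b" using comb[of k] by simp
    then show "p + r *\<^sub>R v \<in> closed_segment a b" using k by (auto simp: in_segment)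
  qed
  have hull: "p + r *\<^sub>R v \<in> affine hull {p, q}" for r
    unfolding affine_hull_2 v_def
    by (rule CollectI, rule exI[of _ "1 - r"], rule exI[of _ r]) (simp add: algebra_simps)
  have iff: "p + r *\<^sub>R (q - p) \<in> closure \<Omega> \<longleftrightarrow> - s \<le> r \<and> r \<le> 1 + t" for r
    using pt[of r] hull[of r] seg unfolding v_def by blast
  have n: "norm (p - b) = (1 + t) * norm v" "norm (q - a) = (1 + s) * norm v"
    "norm (q - b) = t * norm v" "norm (p - a) = s * norm v"
  proof -
    have "p - b = - (1 + t) *\<^sub>R v" "q - a = (1 + s) *\<^sub>R v" "q - b = (- t) *\<^sub>R v" "p - a = s *\<^sub>R v"
      unfolding a b v_def by (simp_all add: algebra_simps)
    then show "norm (p - b) = (1 + t) * norm v" "norm (q - a) = (1 + s) * norm v"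
      "norm (q - b) = t * norm v" "norm (p - a) = s * norm v" using st by simp_all
  qed
  have "hilbert_dist \<Omega> p q = 1/2 * ln ((1 + t) * (1 + s) / (t * s))"
    unfolding hilbert_dist_def ab using assms n v0 by simp
  then show thesis using that st iff by blast
qed

text \<open>A longer chord gives a smaller distance, so any two points of the closure on the line,
  one beyond p and one beyond q, may stand for the endpoints.\<close>

lemma hilbert_dist_upper:
  fixes \<Omega> :: "'a::euclidean_space set"
  assumes \<Omega>: "open \<Omega>" "bounded \<Omega>" "convex \<Omega>" "p \<in> \<Omega>" "q \<in> \<Omega>"
    and s: "\<sigma> > 0" "p - \<sigma> *\<^sub>R (q - p) \<in> closure \<Omega>" and t: "\<tau> > 0" "q + \<tau> *\<^sub>R (q - p) \<in> closure \<Omega>"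
  shows "hilbert_dist \<Omega> p q \<le> 1/2 * ln ((1 + 1 / \<sigma>) * (1 + 1 / \<tau>))"
proof (cases "p = q")
  case True
  have "(1 + 1 / \<sigma>) * (1 + 1 / \<tau>) \<ge> 1 * 1" using s t by (intro mult_mono) auto
  then show ?thesis using True by (simp add: hilbert_dist_def)
next
  case False
  obtain a b where ab: "a > 0" "b > 0" "hilbert_dist \<Omega> p q = 1/2 * ln ((1 + b) * (1 + a) / (b * a))"
    "\<And>r. p + r *\<^sub>R (q - p) \<in> closure \<Omega> \<longleftrightarrow> - a \<le> r \<and> r \<le> 1 + b"
    using hilbert_chord[OF \<Omega> False] by blast
  have "p + (- \<sigma>) *\<^sub>R (q - p) \<in> closure \<Omega>" "p + (1 + \<tau>) *\<^sub>R (q - p) \<in> closure \<Omega>"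
    using s t by (auto simp: algebra_simps)
  then have le: "\<sigma> \<le> a" "\<tau> \<le> b" using ab(4)[of "- \<sigma>"] ab(4)[of "1 + \<tau>"] by simp_all
  have "(1 + b) * (1 + a) / (b * a) = (1 + 1 / a) * (1 + 1 / b)" using ab by (simp add: field_simps)
  also have "\<dots> \<le> (1 + 1 / \<sigma>) * (1 + 1 / \<tau>)"
    using le ab s t by (intro mult_mono add_left_mono divide_left_mono) auto
  finally have "(1 + b) * (1 + a) / (b * a) \<le> (1 + 1 / \<sigma>) * (1 + 1 / \<tau>)" .
  moreover have "0 < (1 + b) * (1 + a) / (b * a)" using ab by auto
  ultimately have "ln ((1 + b) * (1 + a) / (b * a)) \<le> ln ((1 + 1 / \<sigma>) * (1 + 1 / \<tau>))"
    by (intro ln_mono) auto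
  then show ?thesis using ab(3) by simp
qed

text \<open>Along the line, an affine function that is nonnegative at an end of the chord cannot
  grow by a larger factor than the affine function vanishing there. One function is used at each
  end; a constant function makes one of the two factors 1.\<close>

lemma hilbert_dist_lower:
  fixes \<Omega> :: "'a::euclidean_space set"
  assumes \<Omega>: "open \<Omega>" "bounded \<Omega>" "convex \<Omega>" "p \<in> \<Omega>" "q \<in> \<Omega>"
    and f: "\<And>x. x \<in> \<Omega> \<Longrightarrow> 0 \<le> c1 - a1 \<bullet> x" "\<And>x. x \<in> \<Omega> \<Longrightarrow> 0 \<le> c2 - a2 \<bullet> x"
    and pos: "0 < c1 - a1 \<bullet> p" "0 < c1 - a1 \<bullet> q" "0 < c2 - a2 \<bullet> p" "0 < c2 - a2 \<bullet> q"
    and R: "0 < R1" "R1 * (c1 - a1 \<bullet> p) \<le> c1 - a1 \<bullet> q" "0 < R2" "R2 * (c2 - a2 \<bullet> q) \<le> c2 - a2 \<bullet> p"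
  shows "1/2 * ln (R1 * R2) \<le> hilbert_dist \<Omega> p q"
proof (cases "p = q")
  case True
  then have "R1 \<le> 1" "R2 \<le> 1" using R pos by auto
  then have "R1 * R2 \<le> 1" using R by (simp add: mult_le_one)
  then show ?thesis using True R by (simp add: hilbert_dist_def ln_le_zero_iff)
next
  case False
  obtain a b where ab: "a > 0" "b > 0" "hilbert_dist \<Omega> p q = 1/2 * ln ((1 + b) * (1 + a) / (b * a))"
    "\<And>r. p + r *\<^sub>R (q - p) \<in> closure \<Omega> \<longleftrightarrow> - a \<le> r \<and> r \<le> 1 + b"
    using hilbert_chord[OF \<Omega> False] by blast
  have cl: "0 \<le> c1 - a1 \<bullet> x" "0 \<le> c2 - a2 \<bullet> x" if "x \<in> closure \<Omega>" for x
  proof -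
    have "continuous_on (closure \<Omega>) (\<lambda>x. c1 - a1 \<bullet> x)" "continuous_on (closure \<Omega>) (\<lambda>x. c2 - a2 \<bullet> x)"
      by (intro continuous_intros)+
    then show "0 \<le> c1 - a1 \<bullet> x" "0 \<le> c2 - a2 \<bullet> x"
      using continuous_ge_on_closure[OF _ that] f by blast+
  qed
  define F where "F = c1 - a1 \<bullet> p" define F' where "F' = c1 - a1 \<bullet> q"
  define G where "G = c2 - a2 \<bullet> p" define G' where "G' = c2 - a2 \<bullet> q"
  have in_cl: "p + (- a) *\<^sub>R (q - p) \<in> closure \<Omega>" "p + (1 + b) *\<^sub>R (q - p) \<in> closure \<Omega>"
    using ab(1,2) ab(4)[of "- a"] ab(4)[of "1 + b"] by simp_all
  have "0 \<le> c1 - a1 \<bullet> (p + (- a) *\<^sub>R (q - p))" using cl(1) in_cl(1) by blast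
  also have "\<dots> = (1 + a) * F - a * F'" unfolding F_def F'_def by (simp add: inner_simps algebra_simps)
  finally have 1: "a * F' \<le> (1 + a) * F" by simp
  have "0 \<le> c2 - a2 \<bullet> (p + (1 + b) *\<^sub>R (q - p))" using cl(2) in_cl(2) by blast
  also have "\<dots> = (1 + b) * G' - b * G" unfolding G_def G'_def by (simp add: inner_simps algebra_simps)
  finally have 2: "b * G \<le> (1 + b) * G'" by simp
  have p: "F > 0" "G' > 0" using pos unfolding F_def G'_def by auto
  have "a * R1 * F \<le> a * F'" using R ab unfolding F_def F'_def by simp
  then have "a * R1 * F \<le> (1 + a) * F" using 1 by simp
  then have "a * R1 \<le> 1 + a" using p by simp
  then have R1: "R1 \<le> (1 + a) / a" using ab by (simp add: pos_le_divide_eq mult.commute)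
  have "b * R2 * G' \<le> b * G" using R ab unfolding G_def G'_def by simp
  then have "b * R2 * G' \<le> (1 + b) * G'" using 2 by simp
  then have "b * R2 \<le> 1 + b" using p by simp
  then have R2: "R2 \<le> (1 + b) / b" using ab by (simp add: pos_le_divide_eq mult.commute)
  have "R1 * R2 \<le> (1 + a) / a * ((1 + b) / b)" using R R1 R2 by (intro mult_mono) auto
  also have "\<dots> = (1 + b) * (1 + a) / (b * a)" by (simp add: mult_ac)
  finally have "R1 * R2 \<le> (1 + b) * (1 + a) / (b * a)" .
  then have "ln (R1 * R2) \<le> ln ((1 + b) * (1 + a) / (b * a))" using R by (intro ln_mono) auto
  then show ?thesis using ab(3) by simp
qed

section \<open>Polar set and gauge of a convex domain\<close>

definition polar_at :: "'a::euclidean_space \<Rightarrow> 'a set \<Rightarrow> 'a set" where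
  "polar_at c \<Omega> = {a. \<forall>x\<in>\<Omega>. a \<bullet> (x - c) \<le> 1}"

text \<open>The Minkowski gauge of \<Omega> around c, written as the support function of the polar
  set. In this form every value comes with an affine functional attaining it, and
  \<open>1 - gauge_at c \<Omega> z\<close> is the depth of z seen from c.\<close>

definition gauge_at :: "'a::euclidean_space \<Rightarrow> 'a set \<Rightarrow> 'a \<Rightarrow> real" where
  "gauge_at c \<Omega> z = (SUP a\<in>polar_at c \<Omega>. a \<bullet> (z - c))"

context
  fixes \<Omega> :: "'a::euclidean_space set" and c :: 'a
  assumes \<Omega>: "open \<Omega>" "bounded \<Omega>" "convex \<Omega>" and c: "c \<in> \<Omega>"
begin

lemma compact_polar_at: "compact (polar_at c \<Omega>)"
proof -
  obtain r where r: "r > 0" "cball c r \<subseteq> \<Omega>" using \<Omega>(1) c open_contains_cball by blast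
  have "norm a \<le> 1 / r" if "a \<in> polar_at c \<Omega>" for a
  proof (cases "a = 0")
    case False
    have "c + (r / norm a) *\<^sub>R a \<in> cball c r" using r False by (simp add: dist_norm)
    then have "a \<bullet> ((r / norm a) *\<^sub>R a) \<le> 1" using that r unfolding polar_at_def by force
    then have "r * norm a \<le> 1" using False by (simp add: power2_norm_eq_inner[symmetric] power2_eq_square)
    then show ?thesis using r by (simp add: field_simps)
  qed (use r in auto)
  then have "bounded (polar_at c \<Omega>)" by (auto simp: bounded_iff)
  moreover have "closed (polar_at c \<Omega>)"
  proof -
    have "polar_at c \<Omega> = (\<Inter>x\<in>\<Omega>. {a. a \<bullet> (x - c) \<le> 1})" unfolding polar_at_def by auto
    then show ?thesis by (auto intro!: closed_INT closed_Collect_le continuous_intros)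
  qed
  ultimately show ?thesis by (simp add: compact_eq_bounded_closed)
qed

lemma zero_in_polar_at: "0 \<in> polar_at c \<Omega>" by (simp add: polar_at_def)

lemma gauge_at_attained: "\<exists>a\<in>polar_at c \<Omega>. gauge_at c \<Omega> z = a \<bullet> (z - c)"
  and gauge_at_upper: "a \<in> polar_at c \<Omega> \<Longrightarrow> a \<bullet> (z - c) \<le> gauge_at c \<Omega> z"
proof -
  have "continuous_on (polar_at c \<Omega>) (\<lambda>a. a \<bullet> (z - c))" by (intro continuous_intros)
  then obtain b where b: "b \<in> polar_at c \<Omega>" "\<And>a. a \<in> polar_at c \<Omega> \<Longrightarrow> a \<bullet> (z - c) \<le> b \<bullet> (z - c)"
    using continuous_attains_sup[OF compact_polar_at] zero_in_polar_at by blast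
  then have "gauge_at c \<Omega> z = b \<bullet> (z - c)" unfolding gauge_at_def
    by (intro cSup_eq_maximum) auto
  then show "\<exists>a\<in>polar_at c \<Omega>. gauge_at c \<Omega> z = a \<bullet> (z - c)"
    "a \<in> polar_at c \<Omega> \<Longrightarrow> a \<bullet> (z - c) \<le> gauge_at c \<Omega> z" using b by auto
qed

lemma gauge_at_nonneg: "0 \<le> gauge_at c \<Omega> z"
  using gauge_at_upper[OF zero_in_polar_at, of z] by simp

lemma gauge_at_scale:
  assumes "0 \<le> r" shows "gauge_at c \<Omega> (c + r *\<^sub>R v) = r * gauge_at c \<Omega> (c + v)"
proof (rule antisym)
  obtain a where a: "a \<in> polar_at c \<Omega>" "gauge_at c \<Omega> (c + r *\<^sub>R v) = a \<bullet> (r *\<^sub>R v)"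
    using gauge_at_attained[of "c + r *\<^sub>R v"] by auto
  then show "gauge_at c \<Omega> (c + r *\<^sub>R v) \<le> r * gauge_at c \<Omega> (c + v)"
    using gauge_at_upper[OF a(1), of "c + v"] assms by (simp add: mult_left_mono)
  obtain a where a: "a \<in> polar_at c \<Omega>" "gauge_at c \<Omega> (c + v) = a \<bullet> v"
    using gauge_at_attained[of "c + v"] by auto
  then show "r * gauge_at c \<Omega> (c + v) \<le> gauge_at c \<Omega> (c + r *\<^sub>R v)"
    using gauge_at_upper[OF a(1), of "c + r *\<^sub>R v"] by simp
qed

lemma gauge_at_less_1: assumes "z \<in> \<Omega>" shows "gauge_at c \<Omega> z < 1"
proof -
  obtain a where a: "a \<in> polar_at c \<Omega>" "gauge_at c \<Omega> z = a \<bullet> (z - c)"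
    using gauge_at_attained[of z] by auto
  show ?thesis
  proof (cases "a = 0")
    case False
    obtain r where r: "r > 0" "cball z r \<subseteq> \<Omega>" using \<Omega>(1) assms open_contains_cball by blast
    have "z + (r / norm a) *\<^sub>R a \<in> cball z r" using r False by (simp add: dist_norm)
    then have "a \<bullet> (z + (r / norm a) *\<^sub>R a - c) \<le> 1" using a r unfolding polar_at_def by force
    moreover have "0 < a \<bullet> ((r / norm a) *\<^sub>R a)" using r False by simp
    ultimately show ?thesis using a by (simp add: inner_simps)
  qed (use a in simp)
qed

text \<open>The bipolar theorem: a hyperplane separating z from the closure, normalised by its value
  at c, becomes an element of the polar set that exceeds 1 at z.\<close>

lemma closure_of_gauge_at: assumes "gauge_at c \<Omega> z \<le> 1" shows "z \<in> closure \<Omega>"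
proof (rule ccontr)
  assume "z \<notin> closure \<Omega>"
  then obtain a b where ab: "a \<bullet> z < b" "\<And>x. x \<in> closure \<Omega> \<Longrightarrow> b < a \<bullet> x"
    using separating_hyperplane_closed_point[of "closure \<Omega>" z] convex_closure \<Omega> by auto
  have cb: "a \<bullet> c - b > 0" using ab(2)[of c] c closure_subset by auto
  define e where "e = (- 1 / (a \<bullet> c - b)) *\<^sub>R a"
  have eq: "e \<bullet> (x - c) = (a \<bullet> c - a \<bullet> x) / (a \<bullet> c - b)" for x
    unfolding e_def by (simp add: inner_simps divide_simps)
  have "e \<bullet> (x - c) \<le> 1" if "x \<in> \<Omega>" for x
    unfolding eq using ab(2)[of x] that closure_subset[of \<Omega>] cb by (auto simp: less_imp_le)
  then have "e \<in> polar_at c \<Omega>" unfolding polar_at_def by simp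
  then have "e \<bullet> (z - c) \<le> 1" using gauge_at_upper[of e z] assms by simp
  then show False unfolding eq using ab cb by (simp add: divide_simps)
qed

lemma gauge_at_less_1_iff: "z \<in> \<Omega> \<longleftrightarrow> gauge_at c \<Omega> z < 1"
proof
  assume g: "gauge_at c \<Omega> z < 1"
  \<comment> \<open>A dilation factor above 1 that keeps the gauge at most 1; it is finite also
    where the gauge is 0.\<close>
  define r where "r = 2 / (1 + gauge_at c \<Omega> z)"
  have r: "r > 1" "r * gauge_at c \<Omega> z \<le> 1" using g gauge_at_nonneg[of z] unfolding r_def by (auto simp: field_simps)
  define w where "w = c + r *\<^sub>R (z - c)"
  have "gauge_at c \<Omega> w \<le> 1" using gauge_at_scale[of r "z - c"] r unfolding w_def by simp
  then have w: "w \<in> closure \<Omega>" by (rule closure_of_gauge_at)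
  have "z = w - (1 - 1 / r) *\<^sub>R (w - c)" unfolding w_def using r by (simp add: algebra_simps)
  moreover have "w - (1 - 1 / r) *\<^sub>R (w - c) \<in> interior \<Omega>"
    using w c r \<Omega> by (intro mem_interior_closure_convex_shrink) (auto simp: interior_open)
  ultimately show "z \<in> \<Omega>" using \<Omega> by (simp add: interior_open)
qed (rule gauge_at_less_1)

lemma gauge_at_convex:
  assumes "0 \<le> s" "s \<le> 1"
  shows "gauge_at c \<Omega> ((1 - s) *\<^sub>R x + s *\<^sub>R y) \<le> (1 - s) * gauge_at c \<Omega> x + s * gauge_at c \<Omega> y"
proof -
  let ?w = "(1 - s) *\<^sub>R x + s *\<^sub>R y"
  obtain a where a: "a \<in> polar_at c \<Omega>" "gauge_at c \<Omega> ?w = a \<bullet> (?w - c)"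
    using gauge_at_attained by blast
  have "a \<bullet> (?w - c) = (1 - s) * (a \<bullet> (x - c)) + s * (a \<bullet> (y - c))" by (simp add: inner_simps algebra_simps)
  also have "\<dots> \<le> (1 - s) * gauge_at c \<Omega> x + s * gauge_at c \<Omega> y"
    using gauge_at_upper[OF a(1)] assms by (intro add_mono mult_left_mono) auto
  finally show ?thesis using a by simp
qed

lemma continuous_on_gauge_at: "continuous_on UNIV (gauge_at c \<Omega>)"
proof -
  obtain B where B: "\<And>a. a \<in> polar_at c \<Omega> \<Longrightarrow> norm a \<le> B"
    using compact_imp_bounded[OF compact_polar_at] by (auto simp: bounded_iff)
  have B0: "0 \<le> B" using B[OF zero_in_polar_at] by simp
  have le: "gauge_at c \<Omega> x \<le> gauge_at c \<Omega> y + B * dist x y" for x y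
  proof -
    obtain a where a: "a \<in> polar_at c \<Omega>" "gauge_at c \<Omega> x = a \<bullet> (x - c)"
      using gauge_at_attained by blast
    have "a \<bullet> (x - c) = a \<bullet> (y - c) + a \<bullet> (x - y)" by (simp add: inner_simps)
    also have "a \<bullet> (x - y) \<le> norm a * norm (x - y)" by (rule norm_cauchy_schwarz)
    also have "\<dots> \<le> B * dist x y" using B[OF a(1)] by (simp add: dist_norm mult_right_mono)
    finally show ?thesis using a gauge_at_upper[OF a(1), of y] by simp
  qed
  have "B-lipschitz_on UNIV (gauge_at c \<Omega>)"
    using le B0 by (intro lipschitz_onI) (smt (verit, best) dist_commute dist_real_def)+
  then show ?thesis by (rule lipschitz_on_continuous_on)
qed

lemma gauge_at_segment_less:
  assumes "c + w + u \<in> \<Omega>" "c + w - u \<in> \<Omega>" "\<bar>t\<bar> \<le> 1"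
  shows "gauge_at c \<Omega> (c + w + t *\<^sub>R u) < 1"
proof -
  have "c + w + t *\<^sub>R u = (1 - (1 + t) / 2) *\<^sub>R (c + w - u) + ((1 + t) / 2) *\<^sub>R (c + w + u)"
    by (simp add: algebra_simps flip: scaleR_add_left) (simp add: field_simps flip: scaleR_add_left)
  moreover have "\<dots> \<in> \<Omega>" using assms \<Omega>(3) by (intro convexD) auto
  ultimately show ?thesis using gauge_at_less_1 by simp
qed

text \<open>In a \<open>\<delta>\<close>-hyperbolic Hilbert geometry the boundary cannot be almost flat over many scales of
  depth: otherwise the four points \<open>P y t\<close> below, with \<open>y\<close> and the distance to the
  lateral boundary each taking two values of ratio \<open>R\<close>, span a large piece of a normed plane.\<close>

lemma hilbert_flat_bound:
  assumes hyp: "\<And>x y z w. x \<in> \<Omega> \<Longrightarrow> y \<in> \<Omega> \<Longrightarrow> z \<in> \<Omega> \<Longrightarrow> w \<in> \<Omega> \<Longrightarrow>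
      gromov_product (hilbert_dist \<Omega>) w x z \<ge>
        min (gromov_product (hilbert_dist \<Omega>) w x y) (gromov_product (hilbert_dist \<Omega>) w y z) - \<delta>"
    and R: "R \<ge> 4" and u: "c + v + u \<in> \<Omega>" "c + v - u \<in> \<Omega>"
    and eps: "\<epsilon> = 1 - gauge_at c \<Omega> (c + v)"
    and Y: "2 * \<epsilon> \<le> Ya" "Yb = 2 * R * Ya" "Yb \<le> 1/2"
    and W: "1 \<le> W" "W \<le> 2" "W \<le> W'" "W' \<le> 2" "W' - W \<le> 1 / R"
    and b: "(1 - Ya) * gauge_at c \<Omega> (c + v + W *\<^sub>R u) = 1" "(1 - Yb) * gauge_at c \<Omega> (c + v + W' *\<^sub>R u) = 1"
  shows "R \<le> 10368 * exp (4 * \<delta>)"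
proof -
  define H where "H = hilbert_dist \<Omega>"
  \<comment> \<open>y is a radial depth and t the lateral position in units of u. By the hypotheses
    on W and W', level Ya meets the boundary at t = W and level Yb at t = W'.\<close>
  define P where "P y t = c + (1 - y) *\<^sub>R (v + t *\<^sub>R u)" for y t
  define X where "X = 1 / R"
  \<comment> \<open>The shallower pair of points lies at level Ys and not at Ya: points of level Ya
    may be on the boundary, and the factor 2 keeps a definite distance from it.\<close>
  define Ys where "Ys = 2 * Ya"
  have vin: "gauge_at c \<Omega> (c + v) < 1" using gauge_at_segment_less[OF u, of 0] by simp
  have eps0: "\<epsilon> > 0" using vin eps by simp
  have X: "0 < X" "X \<le> 1/4" using R unfolding X_def by (auto simp: field_simps)
  have WX: "W' - W \<le> X" using W unfolding X_def by simp
  have Yb_Ys: "Yb = R * Ys" unfolding Ys_def using Y by simp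
  have Y0: "0 < Ya" "0 < Ys" "Ya < Ys" using eps0 Y unfolding Ys_def by auto
  have "4 * Ys \<le> Yb" unfolding Yb_Ys using Y0 R by (intro mult_right_mono) auto
  then have Yord: "Ys < Yb" "Ys \<le> 1/8" "4 * Ys \<le> Yb" using Y0 Y(1,3) by auto
  have gP: "gauge_at c \<Omega> (P y t) = (1 - y) * gauge_at c \<Omega> (c + v + t *\<^sub>R u)" if "y \<le> 1" for y t
    unfolding P_def using gauge_at_scale[of "1 - y" "v + t *\<^sub>R u"] that by (simp add: add.assoc)
  have gW: "gauge_at c \<Omega> (c + v + t *\<^sub>R u) \<le> 1 / (1 - Ya)" if "-1 \<le> t" "t \<le> W" for t
  proof (cases "t \<le> 1")
    case True
    then have "gauge_at c \<Omega> (c + v + t *\<^sub>R u) < 1" using gauge_at_segment_less[OF u, of t] that by auto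
    also have "1 \<le> 1 / (1 - Ya)" using Y0 Yord by (simp add: field_simps)
    finally show ?thesis by simp
  next
    case False
    define s where "s = t / W"
    have s: "0 \<le> s" "s \<le> 1" "s * W = t" using False that W unfolding s_def by auto
    have eq: "c + v + t *\<^sub>R u = (1 - s) *\<^sub>R (c + v) + s *\<^sub>R (c + v + W *\<^sub>R u)"
      using s(3) by (simp add: algebra_simps)
    have "gauge_at c \<Omega> (c + v + t *\<^sub>R u) \<le> (1 - s) * gauge_at c \<Omega> (c + v) + s * gauge_at c \<Omega> (c + v + W *\<^sub>R u)"
      unfolding eq by (rule gauge_at_convex[OF s(1,2)])
    also have "gauge_at c \<Omega> (c + v + W *\<^sub>R u) = 1 / (1 - Ya)" using b Y0 Yord by (simp add: field_simps)
    also have "(1 - s) * gauge_at c \<Omega> (c + v) \<le> (1 - s) * (1 / (1 - Ya))"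
    proof (intro mult_left_mono)
      have "gauge_at c \<Omega> (c + v) \<le> 1" "1 \<le> 1 / (1 - Ya)" using vin Y0 Yord by (auto simp: field_simps)
      then show "gauge_at c \<Omega> (c + v) \<le> 1 / (1 - Ya)" by linarith
    qed (use s in auto)
    finally show ?thesis by (simp add: algebra_simps flip: add_divide_distrib diff_divide_distrib)
  qed
  have clP: "P y t \<in> closure \<Omega>" if "Ya \<le> y" "y \<le> 1" "-1 \<le> t" "t \<le> W" for y t
  proof (rule closure_of_gauge_at)
    have "(1 - y) * gauge_at c \<Omega> (c + v + t *\<^sub>R u) \<le> (1 - Ya) * (1 / (1 - Ya))"
      using that gW[of t] gauge_at_nonneg by (intro mult_mono) auto
    then show "gauge_at c \<Omega> (P y t) \<le> 1" using gP[of y t] that Y0 Yord by simp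
  qed
  have inP: "P y t \<in> \<Omega>" if "Ya < y" "y \<le> 1" "-1 \<le> t" "t \<le> W" for y t
  proof -
    have "(1 - y) * gauge_at c \<Omega> (c + v + t *\<^sub>R u) \<le> (1 - y) * (1 / (1 - Ya))"
      using that gW[of t] by (intro mult_left_mono) auto
    also have "\<dots> < 1" using that Y0 Yord by (simp add: field_simps)
    finally show ?thesis using gP[of y t] that gauge_at_less_1_iff by simp
  qed
  have Pin: "P Ys 0 \<in> \<Omega>" "P Yb 0 \<in> \<Omega>" "P Ys (W - X) \<in> \<Omega>" "P Yb (W - X) \<in> \<Omega>"
    using Y(3) Y0 Yord W X by (auto intro!: inP)
  \<comment> \<open>Beyond the two points the radial line meets the closure at level Ya on one side
    and at c, which is level 1, on the other.\<close>
  have vert: "H (P Ys t) (P Yb t) \<le> 1/2 * ln (4 * R)" if "-1 \<le> t" "t \<le> W" for t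
  proof -
    define \<sigma> where "\<sigma> = (Ys - Ya) / (Yb - Ys)"
    define \<tau> where "\<tau> = (1 - Yb) / (Yb - Ys)"
    have pos: "\<sigma> > 0" "\<tau> > 0" unfolding \<sigma>_def \<tau>_def using Y0 Yord Y(1,3) by auto
    have e: "\<sigma> * (Yb - Ys) = Ys - Ya" "\<tau> * (Yb - Ys) = 1 - Yb" unfolding \<sigma>_def \<tau>_def using Yord by auto
    have diff: "P Yb t - P Ys t = - (Yb - Ys) *\<^sub>R (v + t *\<^sub>R u)" unfolding P_def by (simp add: algebra_simps)
    have 1: "P Ys t - \<sigma> *\<^sub>R (P Yb t - P Ys t) = P Ya t"
    proof -
      have "\<sigma> *\<^sub>R (P Yb t - P Ys t) = - (Ys - Ya) *\<^sub>R (v + t *\<^sub>R u)" unfolding diff scaleR_scaleR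
        using e(1) by (metis mult_minus_right)
      then show ?thesis unfolding P_def by (simp add: algebra_simps)
    qed
    have 2: "P Yb t + \<tau> *\<^sub>R (P Yb t - P Ys t) = c"
    proof -
      have "\<tau> *\<^sub>R (P Yb t - P Ys t) = - (1 - Yb) *\<^sub>R (v + t *\<^sub>R u)" unfolding diff scaleR_scaleR
        using e(2) by (metis mult_minus_right)
      then show ?thesis unfolding P_def by (simp add: algebra_simps)
    qed
    have "H (P Ys t) (P Yb t) \<le> 1/2 * ln ((1 + 1 / \<sigma>) * (1 + 1 / \<tau>))"
      unfolding H_def using pos 1 2 that Y0 Yord Y(1,3) c closure_subset[of \<Omega>]
      by (intro hilbert_dist_upper[OF \<Omega>] inP) (auto intro!: clP)
    also have "\<dots> \<le> 1/2 * ln (4 * R)"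
    proof -
      have "1 + 1 / \<sigma> = (Yb - Ya) / (Ys - Ya)" "1 + 1 / \<tau> = (1 - Ys) / (1 - Yb)"
        unfolding \<sigma>_def \<tau>_def using Y0 Yord Y(1,3) by (simp_all add: field_simps)
      moreover have "(Yb - Ya) / (Ys - Ya) \<le> 2 * R" unfolding Ys_def using Y0 Y by (simp add: field_simps)
      moreover have "(1 - Ys) / (1 - Yb) \<le> 2" using Y(1,3) Y0 by (simp add: field_simps)
      ultimately have "(1 + 1 / \<sigma>) * (1 + 1 / \<tau>) \<le> (2 * R) * 2"
        using Y0 Yord Y(1,3) R by (simp only:, intro mult_mono) auto
      moreover have "0 < (1 + 1 / \<sigma>) * (1 + 1 / \<tau>)" using pos by (intro mult_pos_pos) (auto intro: add_pos_pos)
      ultimately show ?thesis by (simp add: ln_mono)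
    qed
    finally show ?thesis .
  qed
  \<comment> \<open>The lateral line reaches t = -1 on one side and t = W on the other; the second
    point stays X = 1/R short of W, whence the factor R.\<close>
  have horiz: "H (P y 0) (P y (W - X)) \<le> 1/2 * ln (6 * R)" if "Ya < y" "y \<le> 1/2" for y
  proof -
    have WX: "W - X > 0" using W X by auto
    have diff: "P y (W - X) - P y 0 = ((1 - y) * (W - X)) *\<^sub>R u" unfolding P_def by (simp add: algebra_simps)
    have 1: "P y 0 - (1 / (W - X)) *\<^sub>R (P y (W - X) - P y 0) = P y (- 1)"
    proof -
      have "(1 / (W - X)) *\<^sub>R (P y (W - X) - P y 0) = (1 - y) *\<^sub>R u" unfolding diff using WX by simp
      then show ?thesis by (simp only:) (simp add: P_def algebra_simps)
    qed
    have 2: "P y (W - X) + (X / (W - X)) *\<^sub>R (P y (W - X) - P y 0) = P y W"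
    proof -
      have "(X / (W - X)) *\<^sub>R (P y (W - X) - P y 0) = ((1 - y) * X) *\<^sub>R u" unfolding diff using WX by simp
      then show ?thesis by (simp only:) (simp add: P_def algebra_simps)
    qed
    have "H (P y 0) (P y (W - X)) \<le> 1/2 * ln ((1 + 1 / (1 / (W - X))) * (1 + 1 / (X / (W - X))))"
      unfolding H_def
    proof (rule hilbert_dist_upper[OF \<Omega>])
      show "P y 0 - (1 / (W - X)) *\<^sub>R (P y (W - X) - P y 0) \<in> closure \<Omega>"
        unfolding 1 using that W by (intro clP) auto
      show "P y (W - X) + (X / (W - X)) *\<^sub>R (P y (W - X) - P y 0) \<in> closure \<Omega>"
        unfolding 2 using that W by (intro clP) auto
    qed (use that WX W X in \<open>auto intro!: inP\<close>)
    also have "(1 + 1 / (1 / (W - X))) * (1 + 1 / (X / (W - X))) = (1 + W - X) * (W * R)"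
      using WX R unfolding X_def by (simp add: field_simps)
    also have "1/2 * ln ((1 + W - X) * (W * R)) \<le> 1/2 * ln (6 * R)"
    proof -
      have "(1 + W - X) * (W * R) \<le> 3 * (2 * R)" using W X R by (intro mult_mono) auto
      moreover have "0 < (1 + W - X) * (W * R)" using W X R by (intro mult_pos_pos) auto
      ultimately show ?thesis by (simp add: ln_mono)
    qed
    finally show ?thesis .
  qed
  \<comment> \<open>a1 attains the gauge at c + v, and both c + v + u and c + v - u lie in \<Omega>,
    so its slope along u is at most \<epsilon>. Hence f1 is comparable to the level y, whatever the
    lateral position with |t| \<le> 2, as soon as 2 * \<epsilon> \<le> y \<le> 1/2.\<close>
  obtain a1 where a1: "a1 \<in> polar_at c \<Omega>" "a1 \<bullet> v = 1 - \<epsilon>"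
    using gauge_at_attained[of "c + v"] eps by auto
  have a1u: "\<bar>a1 \<bullet> u\<bar> \<le> \<epsilon>"
  proof -
    have "a1 \<bullet> (c + v + u - c) \<le> 1" "a1 \<bullet> (c + v - u - c) \<le> 1" using a1(1) u unfolding polar_at_def by blast+
    then show ?thesis using a1(2) by (simp add: inner_simps abs_le_iff)
  qed
  define f1 where "f1 x = (1 + a1 \<bullet> c) - a1 \<bullet> x" for x
  have f1P: "f1 (P y t) = 1 - (1 - y) * (1 - \<epsilon> + t * (a1 \<bullet> u))" for y t
    unfolding f1_def P_def a1(2)[symmetric] by (simp add: inner_simps algebra_simps)
  have f1b: "y / 2 \<le> f1 (P y t)" "f1 (P y t) \<le> 3 * y"
    if "2 * \<epsilon> \<le> y" "y \<le> 1/2" "\<bar>t\<bar> \<le> 2" for y t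
  proof -
    have "\<bar>t * (a1 \<bullet> u)\<bar> \<le> 2 * \<epsilon>" unfolding abs_mult using that a1u by (intro mult_mono) auto
    then have ta: "t * (a1 \<bullet> u) \<le> 2 * \<epsilon>" "- (2 * \<epsilon>) \<le> t * (a1 \<bullet> u)" by auto
    have "(1 - y) * (1 - \<epsilon> + t * (a1 \<bullet> u)) \<ge> (1 - y) * (1 - 3 * \<epsilon>)"
      using ta that by (intro mult_left_mono) auto
    moreover have "(1 - y) * (1 - 3 * \<epsilon>) = 1 - y - 3 * \<epsilon> + 3 * (y * \<epsilon>)" by (simp add: algebra_simps)
    moreover have "0 \<le> y * \<epsilon>" using that eps0 by auto
    moreover have "1 - Q \<le> 3 * y" if "E \<le> Q" "E = 1 - y - 3 * \<epsilon> + 3 * r" "0 \<le> r" for Q E r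
      using that \<open>2 * \<epsilon> \<le> y\<close> eps0 by simp
    ultimately show "f1 (P y t) \<le> 3 * y" unfolding f1P by blast
    show "y / 2 \<le> f1 (P y t)"
    proof -
      have "(1 - y) * (1 - \<epsilon> + t * (a1 \<bullet> u)) \<le> (1 - y) * (1 + \<epsilon>)"
        using ta that by (intro mult_left_mono) auto
      moreover have "(1 - y) * (1 + \<epsilon>) = 1 - y + \<epsilon> - y * \<epsilon>" by (simp add: algebra_simps)
      moreover have "0 \<le> y * \<epsilon>" using that eps0 by auto
      moreover have "y / 2 \<le> 1 - Q" if "Q \<le> E" "E = 1 - y + \<epsilon> - r" "0 \<le> r" for Q E r
        using that \<open>2 * \<epsilon> \<le> y\<close> by simp
      ultimately show ?thesis unfolding f1P by blast
    qed
  qed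
  have f1nn: "0 \<le> f1 x" if "x \<in> \<Omega>" for x
  proof -
    have "a1 \<bullet> (x - c) \<le> 1" using a1(1) that unfolding polar_at_def by blast
    then show ?thesis unfolding f1_def by (simp add: inner_simps)
  qed
  have f1r: "R / 6 * f1 (P Ys t) \<le> f1 (P Yb t')" "0 < f1 (P Ys t)" "0 < f1 (P Yb t')"
    if "\<bar>t\<bar> \<le> 2" "\<bar>t'\<bar> \<le> 2" for t t'
  proof -
    have "R / 6 * f1 (P Ys t) \<le> R / 6 * (3 * Ys)"
      using R f1b(2)[of Ys t] Y(1,3) Y0 Yord that unfolding Ys_def by (intro mult_left_mono) auto
    also have "\<dots> = Yb / 2" unfolding Yb_Ys by simp
    also have "\<dots> \<le> f1 (P Yb t')" using f1b(1)[of Yb t'] Y(1,3) Y0 Yord that by auto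
    finally show "R / 6 * f1 (P Ys t) \<le> f1 (P Yb t')" .
    show "0 < f1 (P Ys t)" "0 < f1 (P Yb t')"
      using f1b(1)[of Ys t] f1b(1)[of Yb t'] Y(1,3) Y0 Yord that by (auto simp: Ys_def)
  qed
  have low2: "1/2 * ln (R / 6) \<le> H (P Ys (W - X)) (P Yb 0)" "1/2 * ln (R / 6) \<le> H (P Yb 0) (P Ys (W - X))"
  proof -
    note f = f1r[of "W - X" 0]
    have "1/2 * ln (R / 6 * 1) \<le> H (P Ys (W - X)) (P Yb 0)" unfolding H_def
      by (rule hilbert_dist_lower[OF \<Omega> Pin(3,2), of "1 + a1 \<bullet> c" a1 1 0])
        (use f f1nn R W X in \<open>auto simp: f1_def\<close>)
    then show "1/2 * ln (R / 6) \<le> H (P Ys (W - X)) (P Yb 0)" by simp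
    have "1/2 * ln (1 * (R / 6)) \<le> H (P Yb 0) (P Ys (W - X))" unfolding H_def
      by (rule hilbert_dist_lower[OF \<Omega> Pin(2,3), of 1 0 "1 + a1 \<bullet> c" a1])
        (use f f1nn R W X in \<open>auto simp: f1_def\<close>)
    then show "1/2 * ln (R / 6) \<le> H (P Yb 0) (P Ys (W - X))" by simp
  qed
  \<comment> \<open>The second functional supports \<Omega> at the boundary point
    \<open>P Yb W'\<close>; it measures the distance to the lateral boundary.\<close>
  have gb: "gauge_at c \<Omega> (P Yb W') = 1" using gP[of Yb W'] b Y(1,3) by simp
  obtain a2 where a2: "a2 \<in> polar_at c \<Omega>" "a2 \<bullet> (P Yb W' - c) = 1"
    using gauge_at_attained[of "P Yb W'"] gb by auto
  define k where "k = a2 \<bullet> u"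
  define B where "B = 1 / (1 - Yb)"
  have "(1 - Yb) * (a2 \<bullet> v + W' * k) = 1"
    using a2(2) unfolding P_def k_def by (simp add: inner_simps)
  then have a2v: "a2 \<bullet> v = B - W' * k" unfolding B_def using Y(1,3) by (simp add: field_simps)
  have B: "B \<ge> 1" "(1 - Yb) * B = 1" unfolding B_def using Y(1,3) Y0 Yord by (auto simp: field_simps)
  define f2 where "f2 x = (1 + a2 \<bullet> c) - a2 \<bullet> x" for x
  have f2P: "f2 (P y t) = (1 - y) * ((W' - t) * k) - (Yb - y) * B" for y t
  proof -
    have "f2 (P y t) = 1 - (1 - y) * (a2 \<bullet> v + t * k)"
      unfolding f2_def P_def k_def by (simp add: inner_simps algebra_simps)
    also have "\<dots> = 1 - (1 - y) * (B - W' * k + t * k)"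
      unfolding a2v ..
    also have "\<dots> = (1 - y) * ((W' - t) * k) + ((1 - Yb) * B - (1 - y) * B)"
      unfolding B(2) by (simp add: algebra_simps)
    also have "(1 - Yb) * B - (1 - y) * B = - ((Yb - y) * B)" by (simp add: algebra_simps)
    finally show ?thesis by simp
  qed
  have f2nn: "0 \<le> f2 x" if "x \<in> \<Omega>" for x
  proof -
    have "a2 \<bullet> (x - c) \<le> 1" using a2(1) that unfolding polar_at_def by blast
    then show ?thesis unfolding f2_def by (simp add: inner_simps)
  qed
  have f2c: "0 \<le> f2 x" if "x \<in> closure \<Omega>" for x
  proof -
    have "continuous_on (closure \<Omega>) f2" unfolding f2_def by (intro continuous_intros)
    then show ?thesis using continuous_ge_on_closure[OF _ that] f2nn by blast
  qed
  \<comment> \<open>Here the smallness of W' - W enters. Since f2 is still nonnegative at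
    \<open>P Ya W\<close>, its change between the levels is at most (W' - W) * k \<le> k/4, so
    lateral displacement dominates: f2 is of order k at t = 0 and of order k/R at t = W - X.\<close>
  have "0 \<le> f2 (P Ya W)" using Y(1,3) Y0 Yord W by (intro f2c clP) auto
  then have slope: "(Yb - Ya) * B \<le> (1 - Ya) * ((W' - W) * k)" unfolding f2P by simp
  moreover have "0 < (Yb - Ya) * B" using Y0 Yord B by auto
  ultimately have "0 < (1 - Ya) * ((W' - W) * k)" by linarith
  then have k: "k > 0" using W Y0 Yord Y(1,3) by (auto simp: zero_less_mult_iff)
  have "(1 - Ya) * ((W' - W) * k) \<le> 1 * (1/4 * k)"
    using Y0 k W X WX by (intro mult_mono) auto
  moreover have "(Yb - Ys) * B \<le> (Yb - Ya) * B" using Y0 B by (intro mult_right_mono) auto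
  ultimately have slope': "(Yb - Ys) * B \<le> k / 4" using slope by simp
  have f2l: "k / 4 \<le> f2 (P Ys 0)"
  proof -
    have "1/2 * (1 * k) \<le> (1 - Ys) * ((W' - 0) * k)" using k W Yord by (intro mult_mono) auto
    then show ?thesis unfolding f2P using slope' by simp
  qed
  have f2u: "f2 (P Yb (W - X)) \<le> 2 * X * k"
  proof -
    have "(1 - Yb) * ((W' - (W - X)) * k) \<le> 1 * ((2 * X) * k)"
      using Y(1,3) Y0 Yord W k X WX by (intro mult_mono) auto
    then show ?thesis unfolding f2P by simp
  qed
  have f2p: "0 < f2 (P Yb (W - X))"
  proof -
    have "0 < (1 - Yb) * ((W' - (W - X)) * k)" using Y(1,3) W k X by (intro mult_pos_pos) auto
    then show ?thesis unfolding f2P by simp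
  qed
  have f2r: "R / 8 * f2 (P Yb (W - X)) \<le> f2 (P Ys 0)"
  proof -
    have "R / 8 * f2 (P Yb (W - X)) \<le> R / 8 * (2 * X * k)" using f2u R by (intro mult_left_mono) auto
    also have "\<dots> = k / 4" unfolding X_def using R by simp
    finally show ?thesis using f2l by simp
  qed
  \<comment> \<open>On this diagonal f1 grows in one direction and f2 in the other, so each
    contributes a factor of order R. On the other diagonal only f1 is used, together with a constant
    function.\<close>
  have low1: "1/2 * ln (R / 6 * (R / 8)) \<le> H (P Ys 0) (P Yb (W - X))" unfolding H_def
    by (rule hilbert_dist_lower[OF \<Omega> Pin(1,4), of "1 + a1 \<bullet> c" a1 "1 + a2 \<bullet> c" a2])
      (use f1r[of 0 "W - X"] f1nn f2nn f2p f2l f2r k R W X in \<open>auto simp: f1_def f2_def\<close>)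
  note vh = vert[of 0] vert[of "W - X"] horiz[of Ys] horiz[of Yb]
  have vh': "H (P Ys 0) (P Yb 0) \<le> 1/2 * ln (4 * R)" "H (P Ys (W - X)) (P Yb (W - X)) \<le> 1/2 * ln (4 * R)"
    "H (P Ys 0) (P Ys (W - X)) \<le> 1/2 * ln (6 * R)" "H (P Yb 0) (P Yb (W - X)) \<le> 1/2 * ln (6 * R)"
    using vh W X Y(1,3) Y0 Yord by auto
  \<comment> \<open>Four point condition with base point \<open>P Ys (W - X)\<close>: up to
    constants the two diagonals add up to 3/2 ln R and two opposite sides to at most ln R. The
    difference bounds R; the constant 10368 is 48 * 6^3.\<close>
  have "1/2 * ln (R / 6 * (R / 8)) + 1/2 * ln (R / 6) \<le> ln (6 * R) + 2 * \<delta>"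
  proof -
    have l46: "ln (4 * R) \<le> ln (6 * R)" using R by (intro ln_mono) auto
    have "min (gromov_product H (P Ys (W - X)) (P Ys 0) (P Yb 0)) (gromov_product H (P Ys (W - X)) (P Yb 0) (P Yb (W - X))) - \<delta>
       \<le> gromov_product H (P Ys (W - X)) (P Ys 0) (P Yb (W - X))"
      unfolding H_def by (rule hyp) (use Pin in auto)
    then consider "2 * gromov_product H (P Ys (W - X)) (P Ys 0) (P Yb 0) - 2 * \<delta>
        \<le> 2 * gromov_product H (P Ys (W - X)) (P Ys 0) (P Yb (W - X))"
      | "2 * gromov_product H (P Ys (W - X)) (P Yb 0) (P Yb (W - X)) - 2 * \<delta>
        \<le> 2 * gromov_product H (P Ys (W - X)) (P Ys 0) (P Yb (W - X))"
      by linarith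
    then have "ln (R / 6 * (R / 8)) + ln (R / 6) \<le> 2 * ln (6 * R) + 4 * \<delta>"
      unfolding gromov_product_eq
    proof cases
      case 1
      then show ?thesis using low1 low2(1) vh'(1,2) l46 by simp
    next
      case 2
      then show ?thesis using low1 low2(2) vh'(3,4) by simp
    qed
    then show ?thesis by simp
  qed
  also have "ln (R / 6 * (R / 8)) = 2 * ln R - ln 48"
    using R by (simp add: ln_div ln_mult)
  also have "ln (R / 6) = ln R - ln 6" using R by (simp add: ln_div)
  also have "ln (6 * R) = ln 6 + ln R" using R by (simp add: ln_mult)
  finally have "ln R \<le> ln 48 + 3 * ln 6 + 4 * \<delta>" by (simp add: field_simps)
  also have "ln 48 + 3 * ln 6 = ln (10368 :: real)"
  proof -
    have "3 * ln 6 = ln (216 :: real)" using ln_realpow[of "6::real" 3] by simp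
    moreover have "ln (48 * 216 :: real) = ln 48 + ln 216" by (subst ln_mult) auto
    ultimately show ?thesis by simp
  qed
  finally have "exp (ln R) \<le> exp (ln 10368 + 4 * \<delta>)" by simp
  then show ?thesis using R by (simp add: exp_add)
qed

text \<open>Pigeonhole over scales of depth. If the doubled chord leaves \<Omega>, then at each
  level \<open>y k\<close> the half-line in direction u meets the boundary at some
  \<open>W k\<close> in [1, 2]. These numbers increase with k, so one of the K \<ge> R increments is
  at most 1/R, contradicting \<open>hilbert_flat_bound\<close>.\<close>

lemma hilbert_hyperbolic_doubling:
  assumes "gromov_hyperbolic \<Omega> (hilbert_dist \<Omega>)"
  obtains A where "A \<ge> 1" "\<And>v u s. c + v + u \<in> \<Omega> \<Longrightarrow> c + v - u \<in> \<Omega> \<Longrightarrow> 0 \<le> s \<Longrightarrow> s \<le> 1 \<Longrightarrow>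
      A * (1 - gauge_at c \<Omega> (c + v)) \<le> 1 - s \<Longrightarrow> c + s *\<^sub>R (v + 2 *\<^sub>R u) \<in> \<Omega>"
proof -
  obtain \<delta> where \<delta>: "\<delta> \<ge> 0" and hyp: "\<And>x y z w. x \<in> \<Omega> \<Longrightarrow> y \<in> \<Omega> \<Longrightarrow> z \<in> \<Omega> \<Longrightarrow> w \<in> \<Omega> \<Longrightarrow>
      gromov_product (hilbert_dist \<Omega>) w x z \<ge>
        min (gromov_product (hilbert_dist \<Omega>) w x y) (gromov_product (hilbert_dist \<Omega>) w y z) - \<delta>"
    using assms unfolding gromov_hyperbolic_def by blast
  define R where "R = 10369 * exp (4 * \<delta>)"
  have "1 \<le> exp (4 * \<delta>)" using \<delta> by simp
  then have R4: "R \<ge> 4" and Rbig: "R > 10368 * exp (4 * \<delta>)" unfolding R_def by linarith+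
  obtain K :: nat where K: "real K \<ge> R" using real_arch_simple by blast
  have K0: "K > 0" using K R4 by (cases K) auto
  \<comment> \<open>\<open>A * \<epsilon>\<close> is twice the deepest level \<open>y K\<close>, so
    the bound by 1 - s yields both \<open>y K \<le> 1/2\<close> and
    \<open>s \<le> 1 - y K\<close>.\<close>
  define A where "A = 4 * (2 * R) ^ K"
  have "1 \<le> (2 * R) ^ K" using R4 by (intro one_le_power) auto
  then have A1: "A \<ge> 1" unfolding A_def by auto
  show thesis
  proof (rule that[OF A1], rule ccontr)
    fix v u s
    assume u: "c + v + u \<in> \<Omega>" "c + v - u \<in> \<Omega>" and s: "0 \<le> s" "s \<le> 1"
      and sA: "A * (1 - gauge_at c \<Omega> (c + v)) \<le> 1 - s" and out: "c + s *\<^sub>R (v + 2 *\<^sub>R u) \<notin> \<Omega>"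
    define \<epsilon> where "\<epsilon> = 1 - gauge_at c \<Omega> (c + v)"
    have eps: "\<epsilon> > 0" using gauge_at_segment_less[OF u, of 0] unfolding \<epsilon>_def by simp
    define y where "y k = 2 * \<epsilon> * (2 * R) ^ k" for k
    define \<phi> where "\<phi> t = gauge_at c \<Omega> (c + v + t *\<^sub>R u)" for t
    have y2: "y k \<le> 1/2" "s \<le> 1 - y k" "2 * \<epsilon> \<le> y k" if "k \<le> K" for k
    proof -
      have "(2 * R) ^ k \<le> (2 * R) ^ K" using that R4 by (intro power_increasing) auto
      then have "2 * \<epsilon> * (2 * R) ^ k \<le> 2 * \<epsilon> * (2 * R) ^ K" using eps by (intro mult_left_mono) auto
      then have "2 * y k \<le> A * \<epsilon>" unfolding y_def A_def by (simp add: mult_ac)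
      then show "y k \<le> 1/2" "s \<le> 1 - y k" using sA s unfolding \<epsilon>_def[symmetric] by auto
      show "2 * \<epsilon> \<le> y k" unfolding y_def using eps R4 one_le_power[of "2 * R" k] by simp
    qed
    have cont: "continuous_on S \<phi>" for S unfolding \<phi>_def
      by (rule continuous_on_compose2[OF continuous_on_gauge_at]) (auto intro!: continuous_intros)
    have phi1: "\<phi> 1 < 1" "\<phi> 0 < 1"
      using gauge_at_segment_less[OF u, of 1] gauge_at_segment_less[OF u, of 0] unfolding \<phi>_def by auto
    have phi2: "1 \<le> s * \<phi> 2"
      using out gauge_at_less_1_iff gauge_at_scale[OF s(1), of "v + 2 *\<^sub>R u"] unfolding \<phi>_def
      by (auto simp: add.assoc not_less)
    have "\<exists>t\<ge>1. t \<le> 2 \<and> (1 - y k) * \<phi> t = 1" if "k \<le> K" for k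
    proof (rule IVT')
      have "0 \<le> \<phi> 1" unfolding \<phi>_def by (rule gauge_at_nonneg)
      then have "(1 - y k) * \<phi> 1 \<le> 1 * 1" using y2[OF that] phi1 eps by (intro mult_mono) auto
      then show "(1 - y k) * \<phi> 1 \<le> 1" by simp
      have "0 \<le> \<phi> 2" unfolding \<phi>_def by (rule gauge_at_nonneg)
      then have "s * \<phi> 2 \<le> (1 - y k) * \<phi> 2" using y2[OF that] by (intro mult_right_mono) auto
      then show "1 \<le> (1 - y k) * \<phi> 2" using phi2 by simp
    qed (auto intro!: continuous_intros cont)
    then obtain W where W: "\<And>k. k \<le> K \<Longrightarrow> 1 \<le> W k" "\<And>k. k \<le> K \<Longrightarrow> W k \<le> 2"
      "\<And>k. k \<le> K \<Longrightarrow> (1 - y k) * \<phi> (W k) = 1" by metis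
    \<comment> \<open>If W decreased, convexity would make the gauge at \<open>W (Suc k)\<close> at
      most that at \<open>W k\<close>, while the factor 1 - y strictly decreases; the two products
      could not both be 1.\<close>
    have mono: "W k \<le> W (Suc k)" if "Suc k \<le> K" for k
    proof (rule ccontr)
      assume "\<not> W k \<le> W (Suc k)"
      then have lt: "W (Suc k) < W k" by simp
      define r where "r = W (Suc k) / W k"
      have Wk: "W k \<ge> 1" "W (Suc k) \<ge> 1" using W that by auto
      then have r: "0 \<le> r" "r \<le> 1" "r * W k = W (Suc k)" using lt unfolding r_def by auto
      have phik: "\<phi> (W k) \<ge> 1"
      proof -
        have "(1 - y k) * \<phi> (W k) \<le> 1 * \<phi> (W k)"
          using y2[of k] that eps unfolding \<phi>_def by (intro mult_right_mono gauge_at_nonneg) auto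
        then show ?thesis using W(3)[of k] that by simp
      qed
      have eq: "c + v + W (Suc k) *\<^sub>R u = (1 - r) *\<^sub>R (c + v) + r *\<^sub>R (c + v + W k *\<^sub>R u)"
        using r(3) by (simp add: algebra_simps)
      have "\<phi> (W (Suc k)) \<le> (1 - r) * \<phi> 0 + r * \<phi> (W k)"
        unfolding \<phi>_def eq using gauge_at_convex[OF r(1,2), of "c + v" "c + v + W k *\<^sub>R u"] by simp
      also have "\<dots> \<le> (1 - r) * \<phi> (W k) + r * \<phi> (W k)"
        using phi1 phik r by (intro add_right_mono mult_left_mono) auto
      finally have le: "\<phi> (W (Suc k)) \<le> \<phi> (W k)" by (simp add: algebra_simps)
      have "y k < y (Suc k)" unfolding y_def using eps R4 by simp
      then have "(1 - y (Suc k)) * \<phi> (W k) < (1 - y k) * \<phi> (W k)"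
        using phik by (intro mult_strict_right_mono) auto
      moreover have "(1 - y (Suc k)) * \<phi> (W (Suc k)) \<le> (1 - y (Suc k)) * \<phi> (W k)"
        using le y2[of "Suc k"] that by (intro mult_left_mono) auto
      ultimately show False using W(3)[of k] W(3)[of "Suc k"] that by simp
    qed
    have "\<exists>k<K. W (Suc k) - W k \<le> 1 / R"
    proof (rule ccontr)
      assume "\<not> ?thesis"
      then have gt: "\<And>k. k < K \<Longrightarrow> 1 / R < W (Suc k) - W k" by force
      have "(\<Sum>k<K. 1 / R) < (\<Sum>k<K. W (Suc k) - W k)"
        using gt K0 by (intro sum_strict_mono) auto
      also have "\<dots> = W K - W 0" by (rule sum_lessThan_telescope)
      also have "\<dots> \<le> 1" using W(1)[of 0] W(2)[of K] by simp
      finally have "real K / R < 1" by simp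
      then show False using K R4 by (simp add: field_simps)
    qed
    then obtain k where k: "k < K" "W (Suc k) - W k \<le> 1 / R" by blast
    have "R \<le> 10368 * exp (4 * \<delta>)"
    proof (rule hilbert_flat_bound[OF hyp R4 u \<epsilon>_def])
      show "2 * \<epsilon> \<le> y k" "y (Suc k) \<le> 1/2" "1 \<le> W k" "W k \<le> 2" "W k \<le> W (Suc k)" "W (Suc k) \<le> 2"
        using y2 W mono k by auto
      show "y (Suc k) = 2 * R * y k" unfolding y_def by simp
      show "(1 - y k) * gauge_at c \<Omega> (c + v + W k *\<^sub>R u) = 1"
        "(1 - y (Suc k)) * gauge_at c \<Omega> (c + v + W (Suc k) *\<^sub>R u) = 1"
        using W(3) k unfolding \<phi>_def by auto
    qed (use k in auto)
    then show False using Rbig by simp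
  qed
qed

text \<open>Iterated doubling. One doubling moves the centre v to s1 * v with 1 - s1 = A *
  \<epsilon>, which leaves it at depth at most (A + 1) * \<epsilon>.\<close>

lemma hilbert_hyperbolic_expansion:
  assumes "gromov_hyperbolic \<Omega> (hilbert_dist \<Omega>)"
  obtains B where "B > 1" "\<And>k v u s. c + v + u \<in> \<Omega> \<Longrightarrow> c + v - u \<in> \<Omega> \<Longrightarrow> 0 \<le> s \<Longrightarrow> s \<le> 1 \<Longrightarrow>
      B ^ k * (1 - gauge_at c \<Omega> (c + v)) \<le> 1 - s \<Longrightarrow> c + s *\<^sub>R (v + 2 ^ k *\<^sub>R u) \<in> \<Omega>"
proof -
  obtain A where A: "A \<ge> 1" "\<And>v u s. c + v + u \<in> \<Omega> \<Longrightarrow> c + v - u \<in> \<Omega> \<Longrightarrow> 0 \<le> s \<Longrightarrow> s \<le> 1 \<Longrightarrow>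
      A * (1 - gauge_at c \<Omega> (c + v)) \<le> 1 - s \<Longrightarrow> c + s *\<^sub>R (v + 2 *\<^sub>R u) \<in> \<Omega>"
    using hilbert_hyperbolic_doubling[OF assms] by blast
  \<comment> \<open>Chosen so that B^k * (A + 1) + A \<le> B^(k + 1): the remaining k doublings
    start at depth (A + 1) * \<epsilon>, and A * \<epsilon> is spent on the current one.\<close>
  define B where "B = 2 * A + 1"
  have B1: "B > 1" unfolding B_def using A by simp
  have "c + s *\<^sub>R (v + 2 ^ k *\<^sub>R u) \<in> \<Omega>"
    if "c + v + u \<in> \<Omega>" "c + v - u \<in> \<Omega>" "0 \<le> s" "s \<le> 1" "B ^ k * (1 - gauge_at c \<Omega> (c + v)) \<le> 1 - s" for k v u s
    using that
  proof (induction k arbitrary: v u s)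
    case 0
    have "c + s *\<^sub>R (v + u) = (1 - s) *\<^sub>R c + s *\<^sub>R (c + v + u)" by (simp add: algebra_simps)
    also have "\<dots> \<in> \<Omega>" using 0 c \<Omega>(3) by (intro convexD) auto
    finally show ?case by simp
  next
    case (Suc k)
    show ?case
    proof (cases "s = 0")
      case False
      define \<epsilon> where "\<epsilon> = 1 - gauge_at c \<Omega> (c + v)"
      have eps: "\<epsilon> > 0" using gauge_at_segment_less[OF Suc.prems(1,2), of 0] unfolding \<epsilon>_def by simp
      have Bk: "1 \<le> B ^ k" using B1 by simp
      have key: "B ^ k * (A + 1) * \<epsilon> + A * \<epsilon> \<le> 1 - s"
      proof -
        have "A \<le> B ^ k * A" using Bk A by simp
        then have "B ^ k * (A + 1) + A \<le> B ^ k * B" unfolding B_def by (simp add: algebra_simps)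
        then have "(B ^ k * (A + 1) + A) * \<epsilon> \<le> B ^ Suc k * \<epsilon>" using eps by (simp add: mult.commute)
        also have "\<dots> \<le> 1 - s" using Suc.prems(5) unfolding \<epsilon>_def .
        finally show ?thesis by (simp add: algebra_simps)
      qed
      have "0 \<le> B ^ k * (A + 1) * \<epsilon>" using Bk A eps by simp
      then have As: "A * \<epsilon> \<le> 1 - s" using key by linarith
      define s1 where "s1 = 1 - A * \<epsilon>"
      have s1: "s \<le> s1" "s1 \<le> 1" "0 < s1" using As A eps False Suc.prems unfolding s1_def by auto
      define v' u' where "v' = s1 *\<^sub>R v" and "u' = (2 * s1) *\<^sub>R u"
      have "c + s1 *\<^sub>R (v + 2 *\<^sub>R u) \<in> \<Omega>"
        using s1 by (intro A(2)[OF Suc.prems(1,2)]) (auto simp: s1_def \<epsilon>_def)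
      then have in1: "c + v' + u' \<in> \<Omega>" unfolding v'_def u'_def by (simp add: algebra_simps)
      have "c + s1 *\<^sub>R (v + 2 *\<^sub>R (- u)) \<in> \<Omega>"
        using s1 Suc.prems by (intro A(2)) (auto simp: s1_def \<epsilon>_def)
      then have in2: "c + v' - u' \<in> \<Omega>" unfolding v'_def u'_def by (simp add: algebra_simps)
      define s2 where "s2 = s / s1"
      have s2: "0 \<le> s2" "s2 \<le> 1" "s2 * s1 = s" unfolding s2_def using s1 Suc.prems by auto
      have "B ^ k * (1 - gauge_at c \<Omega> (c + v')) \<le> 1 - s2"
      proof -
        have "gauge_at c \<Omega> (c + v') = s1 * (1 - \<epsilon>)"
          unfolding v'_def \<epsilon>_def using gauge_at_scale[of s1 v] s1 by simp
        then have "1 - gauge_at c \<Omega> (c + v') = (A + 1) * \<epsilon> - A * \<epsilon> * \<epsilon>" unfolding s1_def by (simp add: algebra_simps)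
        also have "\<dots> \<le> (A + 1) * \<epsilon>" using A eps by simp
        finally have "B ^ k * (1 - gauge_at c \<Omega> (c + v')) \<le> B ^ k * ((A + 1) * \<epsilon>)"
          using B1 by (intro mult_left_mono) auto
        also have "\<dots> \<le> s1 - s" using key unfolding s1_def by (simp add: mult_ac)
        also have "\<dots> = s1 * (1 - s2)" using s2(3) by (simp add: algebra_simps)
        also have "\<dots> \<le> 1 * (1 - s2)" using s1 s2 by (intro mult_right_mono) auto
        finally show ?thesis by simp
      qed
      then have "c + s2 *\<^sub>R (v' + 2 ^ k *\<^sub>R u') \<in> \<Omega>" using in1 in2 s2 by (intro Suc.IH) auto
      moreover have "s2 *\<^sub>R (v' + 2 ^ k *\<^sub>R u') = (s2 * s1) *\<^sub>R (v + 2 ^ Suc k *\<^sub>R u)"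
        unfolding v'_def u'_def by (simp add: algebra_simps)
      ultimately show ?thesis unfolding s2(3) by simp
    qed (use c in simp)
  qed
  then show thesis using that B1 by blast
qed

end

section \<open>A hyperbolicity criterion for radial contractions\<close>

lemma sum_halves: "(\<Sum>j<k. real (j + 2) / 2 ^ j) = 6 - (2 * real k + 6) / 2 ^ k"
proof (induction k)
  case (Suc k)
  have "real (k + 2) / 2 ^ k - (2 * real k + 6) / 2 ^ k = - ((2 * real (Suc k) + 6) / 2 ^ Suc k)"
    by (simp add: divide_simps)
  then show ?case using Suc by simp
qed simp

text \<open>The three point condition at o0, applied to four triples, gives a four point condition
  for sums of two products. The base point cancels from these sums; the price is the factor
  2.\<close>

lemma gromov_hyperbolic_at_basepoint:
  fixes d :: "'a \<Rightarrow> 'a \<Rightarrow> real"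
  assumes o: "o0 \<in> X" and "\<delta> \<ge> 0"
    and sym: "\<And>x y. x \<in> X \<Longrightarrow> y \<in> X \<Longrightarrow> d x y = d y x"
    and hyp: "\<And>x y z. x \<in> X \<Longrightarrow> y \<in> X \<Longrightarrow> z \<in> X \<Longrightarrow>
      gromov_product d o0 x z \<ge> min (gromov_product d o0 x y) (gromov_product d o0 y z) - \<delta>"
  shows "gromov_hyperbolic X d"
  unfolding gromov_hyperbolic_def
proof (intro exI[of _ "2 * \<delta>"] conjI ballI)
  show "0 \<le> 2 * \<delta>" using assms by simp
  fix x y z w assume X: "x \<in> X" "y \<in> X" "z \<in> X" "w \<in> X"
  let ?p = "\<lambda>x y. gromov_product d o0 x y"
  have psym: "?p a b = ?p b a" if "a \<in> X" "b \<in> X" for a b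
    using sym[of a b] sym[of a o0] sym[of b o0] that o by (simp add: gromov_product_def)
  have d: "d a b = d a o0 + d b o0 - 2 * ?p a b" if "a \<in> X" "b \<in> X" for a b
    using sym[of b o0] that o by (simp add: gromov_product_def field_simps)
  have "?p x z + ?p y w \<ge> min (?p x y + ?p z w) (?p y z + ?p x w) - 2 * \<delta>"
    using hyp[of x y z] hyp[of x w z] hyp[of y x w] hyp[of y z w] X
      psym[of x y] psym[of w z] by linarith
  then show "gromov_product d w x z \<ge> min (gromov_product d w x y) (gromov_product d w y z) - 2 * \<delta>"
    using gromov_product_eq[of d w x z] gromov_product_eq[of d w x y] gromov_product_eq[of d w y z]
      d[of x w] d[of w z] d[of x z] d[of w y] d[of x y] d[of y w] d[of y z] psym[of w z] psym[of w y] X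
    unfolding min_def by (smt (verit, best))
qed

text \<open>The coarse geometry of a hyperbolic cone with apex o0: h is the height, and
  \<open>S T\<close> pushes points radially down to height at most T. Constants appear in every
  axiom because S is not an exact projection, and \<open>chain\<close> provides discrete paths in
  place of geodesics.\<close>

locale radial_contraction =
  fixes X :: "'a set" and d :: "'a \<Rightarrow> 'a \<Rightarrow> real" and S :: "real \<Rightarrow> 'a \<Rightarrow> 'a"
    and h :: "'a \<Rightarrow> real" and o0 :: 'a and C b :: real
  assumes d_nonneg: "\<And>x y. x \<in> X \<Longrightarrow> y \<in> X \<Longrightarrow> 0 \<le> d x y"
    and d_refl: "\<And>x. x \<in> X \<Longrightarrow> d x x = 0"
    and d_sym: "\<And>x y. x \<in> X \<Longrightarrow> y \<in> X \<Longrightarrow> d x y = d y x"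
    and d_tri: "\<And>x y z. x \<in> X \<Longrightarrow> y \<in> X \<Longrightarrow> z \<in> X \<Longrightarrow> d x z \<le> d x y + d y z"
    and C1: "C \<ge> 1" and b0: "b > 0" and o_in: "o0 \<in> X"
    and h_nonneg: "\<And>x. x \<in> X \<Longrightarrow> 0 \<le> h x" and h_o: "h o0 = 0"
    and h_lip: "\<And>x y. x \<in> X \<Longrightarrow> y \<in> X \<Longrightarrow> \<bar>h x - h y\<bar> \<le> C * d x y"
    and S_in: "\<And>T x. 0 \<le> T \<Longrightarrow> x \<in> X \<Longrightarrow> S T x \<in> X"
    and S_zero: "\<And>x. x \<in> X \<Longrightarrow> S 0 x = o0"
    and h_S: "\<And>T x. 0 \<le> T \<Longrightarrow> x \<in> X \<Longrightarrow> h (S T x) \<le> T"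
    and S_near: "\<And>T x. 0 \<le> T \<Longrightarrow> x \<in> X \<Longrightarrow> d x (S T x) \<le> C * (max 0 (h x - T) + 1)"
    and S_comp: "\<And>T T' x. 0 \<le> T \<Longrightarrow> T \<le> T' \<Longrightarrow> x \<in> X \<Longrightarrow> d (S T (S T' x)) (S T x) \<le> C"
    and S_lip: "\<And>T x y. 0 \<le> T \<Longrightarrow> x \<in> X \<Longrightarrow> y \<in> X \<Longrightarrow> d x y \<le> 1 \<Longrightarrow> d (S T x) (S T y) \<le> C * d x y"
    and S_contract: "\<And>T k x y. 0 \<le> T \<Longrightarrow> x \<in> X \<Longrightarrow> y \<in> X \<Longrightarrow> d x y \<le> 1 \<Longrightarrow> T + real k * b \<le> h x \<Longrightarrow>
        d (S T x) (S T y) \<le> C / 2 ^ k * d x y"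
    and chain: "\<And>x y. x \<in> X \<Longrightarrow> y \<in> X \<Longrightarrow> \<exists>N p. p 0 = x \<and> p N = y \<and> (\<forall>i\<le>N. p i \<in> X) \<and>
        (\<forall>i<N. d (p i) (p (Suc i)) \<le> 1) \<and> (\<Sum>i<N. d (p i) (p (Suc i))) \<le> d x y + 1"
begin

section \<open>Discrete near-geodesics and their radial projections\<close>

abbreviation len :: "(nat \<Rightarrow> 'a) \<Rightarrow> nat \<Rightarrow> nat \<Rightarrow> real"
  where "len p i j \<equiv> \<Sum>k=i..<j. d (p k) (p (Suc k))"

text \<open>A discrete substitute for geodesics. The excess of length over distance is bounded for
  every piece, so that prefixes and reversals are of the same kind.\<close>

definition near_geodesic :: "(nat \<Rightarrow> 'a) \<Rightarrow> nat \<Rightarrow> bool" where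
  "near_geodesic p N \<longleftrightarrow> (\<forall>i\<le>N. p i \<in> X) \<and> (\<forall>i<N. d (p i) (p (Suc i)) \<le> 1) \<and>
     (\<forall>i j. i \<le> j \<longrightarrow> j \<le> N \<longrightarrow> len p i j \<le> d (p i) (p j) + 1)"

lemma d_le_sum:
  assumes "i \<le> j" "\<And>k. i \<le> k \<Longrightarrow> k \<le> j \<Longrightarrow> q k \<in> X"
    and "\<And>k. i \<le> k \<Longrightarrow> k < j \<Longrightarrow> d (q k) (q (Suc k)) \<le> f k"
  shows "d (q i) (q j) \<le> (\<Sum>k=i..<j. f k)"
  using assms
proof (induction j rule: dec_induct)
  case base then show ?case by (simp add: d_refl)
next
  case (step n)
  have "d (q i) (q (Suc n)) \<le> d (q i) (q n) + d (q n) (q (Suc n))"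
    using step by (intro d_tri) auto
  also have "d (q i) (q n) \<le> (\<Sum>k=i..<n. f k)" using step by auto
  also have "d (q n) (q (Suc n)) \<le> f n" using step by auto
  finally show ?case using step by simp
qed

lemma len_split: "i \<le> j \<Longrightarrow> j \<le> k \<Longrightarrow> len p i k = len p i j + len p j k"
  by (simp add: sum.atLeastLessThan_concat)

text \<open>By the triangle inequality the excess of a piece is at most the excess of the whole
  chain, so an almost shortest chain qualifies.\<close>

lemma near_geodesic_exists:
  assumes "x \<in> X" "y \<in> X"
  obtains N p where "p 0 = x" "p N = y" "near_geodesic p N" "len p 0 N \<le> d x y + 1"
proof -
  obtain N p where p: "p 0 = x" "p N = y" "\<forall>i\<le>N. p i \<in> X"
        "\<forall>i<N. d (p i) (p (Suc i)) \<le> 1" "(\<Sum>i<N. d (p i) (p (Suc i))) \<le> d x y + 1"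
    using chain[OF assms] by blast
  have L: "len p 0 N \<le> d x y + 1" using p by (simp add: lessThan_atLeast0)
  have "len p i j \<le> d (p i) (p j) + 1" if "i \<le> j" "j \<le> N" for i j
  proof -
    have 1: "d x (p i) \<le> len p 0 i" using d_le_sum[of 0 i p] p that by auto
    have 2: "d (p j) y \<le> len p j N" using d_le_sum[of j N p] p that by auto
    have 3: "d x y \<le> d x (p i) + d (p i) (p j) + d (p j) y"
      using d_tri[of x "p i" y] d_tri[of "p i" "p j" y] assms p that by auto
    show ?thesis using 1 2 3 L that len_split[of 0 i N p] len_split[of i j N p] by auto
  qed
  then have "near_geodesic p N" unfolding near_geodesic_def using p by blast
  then show thesis using that p L by blast
qed

lemma near_geodesic_prefix: "near_geodesic p N \<Longrightarrow> n \<le> N \<Longrightarrow> near_geodesic p n"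
  unfolding near_geodesic_def by auto

lemma len_rev:
  assumes "near_geodesic p N" "i \<le> j" "j \<le> N"
  shows "len (\<lambda>k. p (N - k)) i j = len p (N - j) (N - i)"
proof (rule sum.reindex_bij_witness[of _ "\<lambda>k. N - Suc k" "\<lambda>k. N - Suc k"])
  fix a assume a: "a \<in> {i..<j}"
  then have "Suc (N - Suc a) = N - a" using assms by auto
  moreover have "p (N - Suc a) \<in> X" "p (N - a) \<in> X" using assms unfolding near_geodesic_def by auto
  ultimately show "d (p (N - Suc a)) (p (Suc (N - Suc a))) = d (p (N - a)) (p (N - Suc a))"
    using d_sym by simp
qed (use assms in auto)

lemma near_geodesic_rev:
  assumes "near_geodesic p N"
  shows "near_geodesic (\<lambda>k. p (N - k)) N"
  unfolding near_geodesic_def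
proof (intro conjI allI impI)
  fix i assume "i \<le> N" then show "p (N - i) \<in> X" using assms unfolding near_geodesic_def by auto
next
  fix i assume i: "i < N"
  then have "Suc (N - Suc i) = N - i" by auto
  moreover have "d (p (N - Suc i)) (p (Suc (N - Suc i))) \<le> 1"
    using assms i unfolding near_geodesic_def by auto
  moreover have "p (N - Suc i) \<in> X" "p (N - i) \<in> X" using assms unfolding near_geodesic_def by auto
  ultimately show "d (p (N - i)) (p (N - Suc i)) \<le> 1" using d_sym by metis
next
  fix i j assume ij: "i \<le> j" "j \<le> N"
  have X: "p (N - i) \<in> X" "p (N - j) \<in> X" using assms unfolding near_geodesic_def by auto
  have "len p (N - j) (N - i) \<le> d (p (N - j)) (p (N - i)) + 1"
    using assms ij unfolding near_geodesic_def by auto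
  then show "len (\<lambda>k. p (N - k)) i j \<le> d (p (N - i)) (p (N - j)) + 1"
    using len_rev[OF assms ij] d_sym[OF X] by simp
qed

text \<open>Descending a bounded amount below the level \<open>m\<close> halves the length of a path above it, so a
  near-geodesic with both ends close to the level cannot be long.\<close>

lemma excursion_bound:
  obtains A where "A \<ge> 0"
    "\<And>p N m H i. near_geodesic p N \<Longrightarrow> i \<le> N \<Longrightarrow> (\<And>k. i \<le> k \<Longrightarrow> k \<le> N \<Longrightarrow> m \<le> h (p k)) \<Longrightarrow>
       h (p N) \<le> m \<Longrightarrow> h (p i) \<le> m + H \<Longrightarrow> 0 \<le> H \<Longrightarrow> len p i N \<le> A * (H + 1)"
proof -
  \<comment> \<open>Descending k0 blocks of height b shrinks steps to at most half their
    length.\<close>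
  obtain k0 where "2 * C < 2 ^ k0" using real_arch_pow[of 2 "2*C"] by auto
  then have k0: "C / 2 ^ k0 \<le> 1/2" by (simp add: field_simps)
  define A where "A = 2 * (3 * C + 2 * C * (k0 * b) + 1)"
  show thesis
  proof
    show "A \<ge> 0" unfolding A_def using C1 b0 by simp
    fix p N m H i assume p: "near_geodesic p N" "i \<le> N" and m: "\<And>k. i \<le> k \<Longrightarrow> k \<le> N \<Longrightarrow> m \<le> h (p k)"
      and e: "h (p N) \<le> m" "h (p i) \<le> m + H" and "0 \<le> H"
    have X: "\<And>k. k \<le> N \<Longrightarrow> p k \<in> X" using p unfolding near_geodesic_def by auto
    \<comment> \<open>If the truncation at 0 is active, \<open>S T\<close> is constant and the
      projected ends coincide.\<close>
    define T where "T = max 0 (m - k0 * b)"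
    have m0: "0 \<le> m" using h_nonneg[of "p N"] X e by force
    have T: "0 \<le> T" unfolding T_def by auto
    have mT: "m - T \<le> k0 * b" "T \<le> m" unfolding T_def using m0 b0 by auto
    have half: "d (S T (p i)) (S T (p N)) \<le> len p i N / 2"
    proof (cases "T = 0")
      case True
      have "0 \<le> len p i N" using X by (intro sum_nonneg d_nonneg) auto
      then show ?thesis using True S_zero X p d_refl o_in by auto
    next
      case False
      then have T': "T = m - k0 * b" unfolding T_def by auto
      have "d (S T (p i)) (S T (p N)) \<le> (\<Sum>k=i..<N. 1/2 * d (p k) (p (Suc k)))"
      proof (rule d_le_sum[of i N "\<lambda>k. S T (p k)"])
        fix k assume k: "i \<le> k" "k < N"
        have "d (S T (p k)) (S T (p (Suc k))) \<le> C / 2 ^ k0 * d (p k) (p (Suc k))"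
          using k X p m[of k] T T' unfolding near_geodesic_def by (intro S_contract) auto
        also have "\<dots> \<le> 1/2 * d (p k) (p (Suc k))"
          using k0 k X by (intro mult_right_mono d_nonneg) auto
        finally show "d (S T (p k)) (S T (p (Suc k))) \<le> 1/2 * d (p k) (p (Suc k))" .
      qed (use p X T S_in in auto)
      then show ?thesis by (simp flip: sum_divide_distrib)
    qed
    \<comment> \<open>The length is at most half of itself, plus the two vertical descents at the
      ends, plus 1; solving for it gives the bound.\<close>
    have arith: "L \<le> 2 * (A1 + B1 + 1)"
      if "z \<le> L / 2" "L \<le> y + 1" "y \<le> x + (z + w)" "x \<le> A1" "w \<le> B1" for L x y z w A1 B1 :: real
      using that by simp
    have 1: "len p i N \<le> d (p i) (p N) + 1" using p unfolding near_geodesic_def by auto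
    have 2: "d (p i) (p N) \<le> d (p i) (S T (p i)) + (d (S T (p i)) (S T (p N)) + d (S T (p N)) (p N))"
      using d_tri[of "p i" "S T (p i)" "p N"] d_tri[of "S T (p i)" "S T (p N)" "p N"] X S_in T p by force
    have 3: "d (p i) (S T (p i)) \<le> C * (H + k0 * b + 1)"
    proof -
      have "max 0 (h (p i) - T) + 1 \<le> H + k0 * b + 1" using e mT \<open>0 \<le> H\<close> b0 by auto
      then have "C * (max 0 (h (p i) - T) + 1) \<le> C * (H + k0 * b + 1)" using C1 by (intro mult_left_mono) auto
      then show ?thesis using S_near[OF T, of "p i"] X p by force
    qed
    have 4: "d (S T (p N)) (p N) \<le> C * (k0 * b + 1)"
    proof -
      have "max 0 (h (p N) - T) + 1 \<le> k0 * b + 1" using e mT b0 by auto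
      then have "C * (max 0 (h (p N) - T) + 1) \<le> C * (k0 * b + 1)" using C1 by (intro mult_left_mono) auto
      moreover have "d (S T (p N)) (p N) = d (p N) (S T (p N))" using d_sym X S_in T by auto
      ultimately show ?thesis using S_near[OF T, of "p N"] X by force
    qed
    have "len p i N \<le> 2 * (C * (H + k0 * b + 1) + C * (k0 * b + 1) + 1)"
      using arith[OF half 1 2 3 4] .
    also have "\<dots> \<le> A * (H + 1)"
    proof -
      have "0 \<le> 2 * C + 2 * H + 4 * (C * H) + 4 * (C * (k0 * b) * H)" using C1 \<open>0 \<le> H\<close> b0 by auto
      also have "\<dots> = A * (H + 1) - 2 * (C * (H + k0 * b + 1) + C * (k0 * b + 1) + 1)"
        unfolding A_def by (simp add: algebra_simps)
      finally show ?thesis by simp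
    qed
    finally show "len p i N \<le> A * (H + 1)" .
  qed
qed

text \<open>Let m be the lowest height, reached at the end, and \<open>t k\<close> the first time at
  height at most m + k * b. Between \<open>t (Suc k)\<close> and \<open>t k\<close> the path stays
  above m + k * b, so \<open>S m\<close> contracts it by C / 2^k, while
  \<open>excursion_bound\<close> makes its length at most linear in k. The projected pieces form a
  convergent series, and its sum does not depend on how high the path starts.\<close>

lemma descent_tracks_ray:
  obtains D where "D \<ge> 0"
    "\<And>p N. near_geodesic p N \<Longrightarrow> (\<And>k. k \<le> N \<Longrightarrow> h (p N) \<le> h (p k)) \<Longrightarrow>
       d (p N) (S (h (p N)) (p 0)) \<le> D"
proof -
  obtain A where A: "A \<ge> 0"
    "\<And>p N m H i. near_geodesic p N \<Longrightarrow> i \<le> N \<Longrightarrow> (\<And>k. i \<le> k \<Longrightarrow> k \<le> N \<Longrightarrow> m \<le> h (p k)) \<Longrightarrow>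
       h (p N) \<le> m \<Longrightarrow> h (p i) \<le> m + H \<Longrightarrow> 0 \<le> H \<Longrightarrow> len p i N \<le> A * (H + 1)"
    using excursion_bound by blast
  define D where "D = C + C * A + 6 * (C * A * (b + 1))"
  show thesis
  proof
    show "D \<ge> 0" unfolding D_def using A C1 b0 by simp
    fix p N assume p: "near_geodesic p N" and min: "\<And>k. k \<le> N \<Longrightarrow> h (p N) \<le> h (p k)"
    define m where "m = h (p N)"
    have X: "\<And>k. k \<le> N \<Longrightarrow> p k \<in> X" using p unfolding near_geodesic_def by auto
    have st: "\<And>k. k < N \<Longrightarrow> d (p k) (p (Suc k)) \<le> 1" using p unfolding near_geodesic_def by auto
    have m0: "0 \<le> m" using h_nonneg X unfolding m_def by auto
    define t where "t k = (LEAST i. h (p i) \<le> m + real k * b)" for k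
    have ex: "h (p N) \<le> m + real k * b" for k unfolding m_def using b0 by auto
    have tN: "t k \<le> N" for k unfolding t_def using ex by (rule Least_le)
    have th: "h (p (t k)) \<le> m + real k * b" for k unfolding t_def using ex by (rule LeastI)
    have tl: "m + real k * b < h (p i)" if "i < t k" for i k
      using not_less_Least[of i "\<lambda>i. h (p i) \<le> m + real k * b"] that unfolding t_def by auto
    have tmono: "t (Suc k) \<le> t k" for k
    proof -
      have "h (p (t k)) \<le> m + real (Suc k) * b" using th[of k] b0 by (simp add: algebra_simps)
      then show ?thesis unfolding t_def[of "Suc k"] by (rule Least_le)
    qed
    have lenb: "len p (t k) N \<le> A * (real k * b + 1)" for k
      using A(2)[OF p tN, of k m "real k * b"] th min b0 unfolding m_def by auto
    let ?q = "\<lambda>k. S m (p k)"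
    have qX: "?q k \<in> X" if "k \<le> N" for k using that S_in m0 X by auto
    have base: "d (?q (t 0)) (?q N) \<le> C * A"
    proof -
      have "d (?q (t 0)) (?q N) \<le> (\<Sum>k=t 0..<N. C * d (p k) (p (Suc k)))"
        using tN qX S_lip m0 X st by (intro d_le_sum[of "t 0" N ?q]) auto
      also have "\<dots> = C * len p (t 0) N" by (simp add: sum_distrib_left)
      also have "\<dots> \<le> C * A" using lenb[of 0] C1 by (intro mult_left_mono) auto
      finally show ?thesis .
    qed
    have step: "d (?q (t (Suc k))) (?q (t k)) \<le> C * A * (b + 1) * (real (k + 2) / 2 ^ k)" for k
    proof -
      have "d (?q (t (Suc k))) (?q (t k)) \<le> (\<Sum>j=t (Suc k)..<t k. C / 2 ^ k * d (p j) (p (Suc j)))"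
      proof (rule d_le_sum[of _ _ ?q])
        fix j assume j: "t (Suc k) \<le> j" "j < t k"
        then have "j < N" using tN[of k] by linarith
        then show "d (S m (p j)) (S m (p (Suc j))) \<le> C / 2 ^ k * d (p j) (p (Suc j))"
          using tl[OF j(2)] X st m0 by (intro S_contract) auto
      next
        fix j assume "j \<le> t k" then show "?q j \<in> X" using qX tN[of k] by auto
      qed (use tmono in auto)
      also have "\<dots> = C / 2 ^ k * len p (t (Suc k)) (t k)" by (simp add: sum_distrib_left)
      finally have 1: "d (?q (t (Suc k))) (?q (t k)) \<le> C / 2 ^ k * len p (t (Suc k)) (t k)" .
      have "0 \<le> len p (t k) N" using X by (intro sum_nonneg d_nonneg) auto
      then have "len p (t (Suc k)) (t k) \<le> len p (t (Suc k)) N"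
        using len_split[OF tmono[of k] tN[of k], of p] by linarith
      also have "\<dots> \<le> A * (real (Suc k) * b + 1)" by (rule lenb)
      also have "\<dots> \<le> A * ((b + 1) * real (k + 2))"
        using A(1) b0 by (intro mult_left_mono) (auto simp: algebra_simps)
      finally have "C / 2 ^ k * len p (t (Suc k)) (t k) \<le> C / 2 ^ k * (A * ((b + 1) * real (k + 2)))"
        using C1 by (intro mult_left_mono) auto
      with 1 show ?thesis by (simp add: mult_ac)
    qed
    have ind: "d (?q (t k)) (?q N) \<le> C * A + C * A * (b + 1) * (\<Sum>j<k. real (j + 2) / 2 ^ j)" for k
    proof (induction k)
      case 0 show ?case using base by simp
    next
      case (Suc k)
      have "d (?q (t (Suc k))) (?q N) \<le> d (?q (t (Suc k))) (?q (t k)) + d (?q (t k)) (?q N)"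
        using qX tN by (intro d_tri) auto
      then show ?case using Suc step[of k] by (simp add: algebra_simps)
    qed
    have sums: "(\<Sum>j<k. real (j + 2) / 2 ^ j) \<le> 6" for k unfolding sum_halves by simp
    have bound: "\<And>k. d (?q (t k)) (?q N) \<le> C * A + C * A * (b + 1) * 6"
    proof -
      fix k
      have "C * A * (b + 1) * (\<Sum>j<k. real (j + 2) / 2 ^ j) \<le> C * A * (b + 1) * 6"
        using A(1) C1 b0 sums[of k] by (intro mult_left_mono) auto
      then show "d (?q (t k)) (?q N) \<le> C * A + C * A * (b + 1) * 6" using ind[of k] by linarith
    qed
    obtain k where "h (p 0) - m < real k * b" using reals_Archimedean3[OF b0] by blast
    then have "t k = 0" unfolding t_def by (intro Least_eq_0) auto
    then have "d (?q 0) (?q N) \<le> C * A + C * A * (b + 1) * 6" using bound[of k] by auto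
    moreover have "d (p N) (?q N) \<le> C" using S_near[OF m0, of "p N"] X unfolding m_def by auto
    moreover have "d (p N) (?q 0) \<le> d (p N) (?q N) + d (?q N) (?q 0)" using X qX by (intro d_tri) auto
    moreover have "d (?q N) (?q 0) = d (?q 0) (?q N)" using qX by (intro d_sym) auto
    ultimately show "d (p N) (S (h (p N)) (p 0)) \<le> D" unfolding D_def m_def by auto
  qed
qed

lemma S_coarse_lip:
  assumes "0 \<le> T" "x \<in> X" "y \<in> X"
  shows "d (S T x) (S T y) \<le> C * (d x y + 1)"
proof -
  obtain N p where p: "p 0 = x" "p N = y" "near_geodesic p N" "len p 0 N \<le> d x y + 1"
    using near_geodesic_exists[OF assms(2,3)] .
  have "d (S T (p 0)) (S T (p N)) \<le> (\<Sum>k=0..<N. C * d (p k) (p (Suc k)))"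
    using p(3) S_in S_lip assms unfolding near_geodesic_def by (intro d_le_sum[of 0 N "\<lambda>k. S T (p k)"]) auto
  also have "\<dots> = C * len p 0 N" by (simp add: sum_distrib_left)
  also have "\<dots> \<le> C * (d x y + 1)" using p C1 by (intro mult_left_mono) auto
  finally show ?thesis using p by auto
qed

text \<open>A near-geodesic from x to y is split at its lowest point. Both halves, read towards this
  point, end at their minimum, so the point is close to the projections of x and of y at its own
  height.\<close>

lemma meeting_level:
  obtains D where "D \<ge> 0" "\<And>x y. x \<in> X \<Longrightarrow> y \<in> X \<Longrightarrow> \<exists>m. 0 \<le> m \<and> m \<le> h x \<and> m \<le> h y \<and>
      d (S m x) (S m y) \<le> D \<and> d x (S m x) + d y (S m y) \<le> d x y + D"
proof -
  obtain D where D: "D \<ge> 0"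
    "\<And>p N. near_geodesic p N \<Longrightarrow> (\<And>k. k \<le> N \<Longrightarrow> h (p N) \<le> h (p k)) \<Longrightarrow>
       d (p N) (S (h (p N)) (p 0)) \<le> D" using descent_tracks_ray by blast
  show thesis
  proof (rule that[of "2 * D + 1"])
    show "0 \<le> 2 * D + 1" using D by auto
    fix x y assume xy: "x \<in> X" "y \<in> X"
    obtain N p where p: "p 0 = x" "p N = y" "near_geodesic p N" "len p 0 N \<le> d x y + 1"
      using near_geodesic_exists[OF xy] .
    define n where "n = arg_min_on (h \<circ> p) {..N}"
    have n: "n \<le> N" "\<And>k. k \<le> N \<Longrightarrow> h (p n) \<le> h (p k)"
      using arg_min_if_finite(1)[of "{..N}" "h \<circ> p"] arg_min_least[of "{..N}" _ "h \<circ> p"]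
      unfolding n_def by auto
    define m where "m = h (p n)"
    have X: "\<And>k. k \<le> N \<Longrightarrow> p k \<in> X" using p unfolding near_geodesic_def by auto
    have m0: "0 \<le> m" "m \<le> h x" "m \<le> h y" unfolding m_def using h_nonneg X n p by auto
    have 1: "d (p n) (S m x) \<le> D"
      using D(2)[OF near_geodesic_prefix[OF p(3) n(1)]] n p unfolding m_def by auto
    have 2: "d (p n) (S m y) \<le> D"
      using D(2)[OF near_geodesic_prefix[OF near_geodesic_rev[OF p(3)], of "N - n"]] n p
      unfolding m_def by auto
    have in_: "S m x \<in> X" "S m y \<in> X" "p n \<in> X" using S_in m0 xy X n by auto
    have "d x (p n) + d (p n) y \<le> d x y + 1"
      using d_le_sum[of 0 n p "\<lambda>k. d (p k) (p (Suc k))"] d_le_sum[of n N p "\<lambda>k. d (p k) (p (Suc k))"]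
        X n p len_split[of 0 n N p] by auto
    moreover have "d x (S m x) \<le> d x (p n) + d (p n) (S m x)" "d y (S m y) \<le> d y (p n) + d (p n) (S m y)"
      using d_tri xy in_ by blast+
    moreover have "d (p n) y = d y (p n)" "d (S m x) (p n) = d (p n) (S m x)"
      using d_sym xy in_ by blast+
    moreover have "d (S m x) (S m y) \<le> d (S m x) (p n) + d (p n) (S m y)" using d_tri in_ by blast
    ultimately show "\<exists>m. 0 \<le> m \<and> m \<le> h x \<and> m \<le> h y \<and>
      d (S m x) (S m y) \<le> 2 * D + 1 \<and> d x (S m x) + d y (S m y) \<le> d x y + (2 * D + 1)"
      using m0 1 2 by (intro exI[of _ m]) linarith
  qed
qed

text \<open>Radial segments are coarsely geodesic. A near-geodesic from x to o0 is stopped when its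
  height first drops to T; as h is Lipschitz and steps are at most 1, the height there is within C
  of T, and by \<open>descent_tracks_ray\<close> the point is close to the projection of x.\<close>

lemma ray_additive:
  obtains D where "D \<ge> 0" "\<And>x T. x \<in> X \<Longrightarrow> 0 \<le> T \<Longrightarrow> T \<le> h x \<Longrightarrow>
      d o0 (S T x) + d (S T x) x \<le> d o0 x + D"
proof -
  obtain D where D: "D \<ge> 0"
    "\<And>p N. near_geodesic p N \<Longrightarrow> (\<And>k. k \<le> N \<Longrightarrow> h (p N) \<le> h (p k)) \<Longrightarrow>
       d (p N) (S (h (p N)) (p 0)) \<le> D" using descent_tracks_ray by blast
  define E where "E = D + C + C * (C + 1)"
  show thesis
  proof (rule that[of "2 * E + 1"])
    show "0 \<le> 2 * E + 1" unfolding E_def using D C1 by auto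
    fix x T assume x: "x \<in> X" and T: "0 \<le> T" "T \<le> h x"
    obtain N p where p: "p 0 = x" "p N = o0" "near_geodesic p N" "len p 0 N \<le> d x o0 + 1"
      using near_geodesic_exists[OF x o_in] .
    have X: "\<And>k. k \<le> N \<Longrightarrow> p k \<in> X" using p unfolding near_geodesic_def by auto
    define n where "n = (LEAST i. h (p i) \<le> T)"
    have ex: "h (p N) \<le> T" using p h_o T by auto
    have n: "n \<le> N" "h (p n) \<le> T" "\<And>i. i < n \<Longrightarrow> T < h (p i)"
    proof -
      show "n \<le> N" unfolding n_def using ex by (rule Least_le)
      show "h (p n) \<le> T" unfolding n_def using ex by (rule LeastI)
      show "T < h (p i)" if "i < n" for i
        using not_less_Least[of i "\<lambda>i. h (p i) \<le> T"] that unfolding n_def by simp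
    qed
    define m where "m = h (p n)"
    have m0: "0 \<le> m" unfolding m_def using h_nonneg X n by auto
    have Tm: "T - m \<le> C"
    proof (cases n)
      case 0 then show ?thesis using n p T C1 unfolding m_def by auto
    next
      case (Suc k)
      then have "\<bar>h (p k) - h (p (Suc k))\<bar> \<le> C * d (p k) (p (Suc k))" using h_lip X n by auto
      also have "\<dots> \<le> C * 1" using p(3) Suc n C1 unfolding near_geodesic_def by (intro mult_left_mono) auto
      finally show ?thesis using n(3)[of k] Suc unfolding m_def by auto
    qed
    have mn: "h (p n) \<le> h (p k)" if "k \<le> n" for k
      using n(2) n(3)[of k] that by (cases "k = n") auto
    have 1: "d (p n) (S m x) \<le> D"
      using D(2)[OF near_geodesic_prefix[OF p(3) n(1)]] p mn by (simp add: m_def)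
    have in_: "S m x \<in> X" "S T x \<in> X" "S m (S T x) \<in> X" "p n \<in> X" using S_in T m0 x X n by auto
    have 2: "d (S m (S T x)) (S m x) \<le> C" using S_comp[of m T x] m0 x n unfolding m_def by auto
    have 3: "d (S T x) (S m (S T x)) \<le> C * (C + 1)"
    proof -
      have "d (S T x) (S m (S T x)) \<le> C * (max 0 (h (S T x) - m) + 1)" using S_near m0 in_ by auto
      also have "\<dots> \<le> C * (C + 1)" using h_S[of T x] T x Tm C1 by (intro mult_left_mono) auto
      finally show ?thesis .
    qed
    have "d (S T x) (p n) \<le> E"
      using d_tri[of "S T x" "S m (S T x)" "p n"] d_tri[of "S m (S T x)" "S m x" "p n"]
        d_sym[of "S m x" "p n"] in_ 1 2 3 unfolding E_def by auto
    moreover have "d x (p n) + d (p n) o0 \<le> d x o0 + 1"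
      using d_le_sum[of 0 n p "\<lambda>k. d (p k) (p (Suc k))"] d_le_sum[of n N p "\<lambda>k. d (p k) (p (Suc k))"]
        X n p len_split[of 0 n N p] by auto
    moreover have "d o0 (S T x) \<le> d (p n) o0 + d (S T x) (p n)" "d (S T x) x \<le> d (S T x) (p n) + d x (p n)"
      "d x o0 = d o0 x"
      using d_tri[of o0 "p n" "S T x"] d_tri[of "S T x" "p n" x] d_sym[of x o0] d_sym[of o0 "p n"]
        d_sym[of "S T x" "p n"] d_sym[of "p n" x] x in_ o_in by simp_all
    ultimately show "d o0 (S T x) + d (S T x) x \<le> d o0 x + (2 * E + 1)" by auto
  qed
qed

text \<open>Up to constants, the Gromov product at o0 is the distance from o0 to the projections at
  the meeting level. For three points the lower of the two meeting levels serves both pairs, since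
  projections that are close remain close further down.\<close>

theorem hyperbolic: "gromov_hyperbolic X d"
proof -
  obtain D where D: "D \<ge> 0" "\<And>x y. x \<in> X \<Longrightarrow> y \<in> X \<Longrightarrow> \<exists>m. 0 \<le> m \<and> m \<le> h x \<and> m \<le> h y \<and>
      d (S m x) (S m y) \<le> D \<and> d x (S m x) + d y (S m y) \<le> d x y + D"
    using meeting_level by blast
  obtain E where E: "E \<ge> 0" "\<And>x T. x \<in> X \<Longrightarrow> 0 \<le> T \<Longrightarrow> T \<le> h x \<Longrightarrow>
      d o0 (S T x) + d (S T x) x \<le> d o0 x + E" using ray_additive by blast
  define F where "F = 2 * C + C * (D + 1)"
  have F0: "0 \<le> F" unfolding F_def using C1 D by auto
  have near: "d (S T x) (S T y) \<le> F" if "x \<in> X" "y \<in> X" "0 \<le> T" "T \<le> m" "d (S m x) (S m y) \<le> D" for x y T m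
  proof -
    have in_: "S m x \<in> X" "S m y \<in> X" "S T (S m x) \<in> X" "S T (S m y) \<in> X" "S T x \<in> X" "S T y \<in> X"
      using S_in that by auto
    have "d (S T (S m x)) (S T (S m y)) \<le> C * (d (S m x) (S m y) + 1)"
      using S_coarse_lip that in_ by auto
    also have "\<dots> \<le> C * (D + 1)" using that C1 by (intro mult_left_mono) auto
    finally show ?thesis
      using S_comp[of T m x] S_comp[of T m y] that d_tri[of "S T x" "S T (S m x)" "S T y"]
        d_tri[of "S T (S m x)" "S T (S m y)" "S T y"] d_sym[of "S T x" "S T (S m x)"] in_
      unfolding F_def by auto
  qed
  have lower: "d o0 (S T x) - E - K \<le> gromov_product d o0 x z"
    if "x \<in> X" "z \<in> X" "0 \<le> T" "T \<le> h x" "T \<le> h z" "d (S T x) (S T z) \<le> K" for x z T K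
  proof -
    have in_: "S T x \<in> X" "S T z \<in> X" using S_in that by auto
    show ?thesis using gromov_product_eq[of d o0 x z]
      E(2)[of x T] E(2)[of z T] that in_ d_tri[of x "S T x" z] d_tri[of "S T x" "S T z" z]
        d_tri[of o0 "S T z" "S T x"] d_sym[of x "S T x"] d_sym[of o0 x] d_sym[of "S T x" "S T z"] o_in
      by linarith
  qed
  have upper: "gromov_product d o0 x y \<le> d o0 (S m x) + D" "gromov_product d o0 x y \<le> d o0 (S m y) + D"
    if "x \<in> X" "y \<in> X" "0 \<le> m" "d (S m x) (S m y) \<le> D" "d x (S m x) + d y (S m y) \<le> d x y + D" for x y m
  proof -
    have in_: "S m x \<in> X" "S m y \<in> X" using S_in that by auto
    note f = d_tri[of x "S m x" o0] d_tri[of o0 "S m y" y] d_tri[of o0 "S m x" "S m y"]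
       d_tri[of o0 "S m y" "S m x"] d_sym[of o0 "S m x"] d_sym[of y "S m y"] d_sym[of "S m x" "S m y"]
    show "gromov_product d o0 x y \<le> d o0 (S m x) + D" "gromov_product d o0 x y \<le> d o0 (S m y) + D"
      using gromov_product_eq[of d o0 x y] that in_ f o_in by linarith+
  qed
  show ?thesis
  proof (rule gromov_hyperbolic_at_basepoint[OF o_in, where \<delta> = "D + E + 3 * F"])
    show "0 \<le> D + E + 3 * F" using D E F0 by auto
    fix x y z assume X: "x \<in> X" "y \<in> X" "z \<in> X"
    obtain m where m: "0 \<le> m" "m \<le> h x" "m \<le> h y"
      "d (S m x) (S m y) \<le> D" "d x (S m x) + d y (S m y) \<le> d x y + D" using D X by blast
    obtain n where n: "0 \<le> n" "n \<le> h y" "n \<le> h z"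
      "d (S n y) (S n z) \<le> D" "d y (S n y) + d z (S n z) \<le> d y z + D" using D X by blast
    define T where "T = min m n"
    have T: "0 \<le> T" "T \<le> h x" "T \<le> h z" "T \<le> m" "T \<le> n" unfolding T_def using m n by auto
    have xy: "d (S T x) (S T y) \<le> F" and yz: "d (S T y) (S T z) \<le> F"
      using near X T m n by blast+
    have in_: "S T x \<in> X" "S T y \<in> X" "S T z \<in> X" using S_in X T by auto
    have "d (S T x) (S T z) \<le> 2 * F" using d_tri[of "S T x" "S T y" "S T z"] xy yz in_ by auto
    then have 1: "d o0 (S T x) - E - 2 * F \<le> gromov_product d o0 x z" using lower X T by blast
    have "min (gromov_product d o0 x y) (gromov_product d o0 y z) \<le> d o0 (S T x) + D + F"
    proof (cases "m \<le> n")
      case True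
      then show ?thesis using upper(1)[of x y m] m X F0 unfolding T_def by (auto simp: min_def)
    next
      case False
      then have "gromov_product d o0 y z \<le> d o0 (S T y) + D" using upper(1)[of y z n] n X unfolding T_def by auto
      then show ?thesis using d_tri[of o0 "S T x" "S T y"] xy in_ o_in by auto
    qed
    then show "min (gromov_product d o0 x y) (gromov_product d o0 y z) - (D + E + 3 * F) \<le> gromov_product d o0 x z"
      using 1 by auto
  qed (use d_sym in auto)
qed

end

section \<open>Directional derivatives and smooth functions\<close>

lemma dir_deriv_eqI: "(f has_derivative f') (at z) \<Longrightarrow> dir_deriv f z u = f' u"
  unfolding dir_deriv_def using frechet_derivative_at by metis

lemma has_derivative_dir_deriv: "f differentiable (at z) \<Longrightarrow> (f has_derivative dir_deriv f z) (at z)"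
  unfolding dir_deriv_def using frechet_derivative_works by (metis (no_types, lifting) eta_contract_eq)

lemma dir_deriv_cong_open:
  assumes "open S" "z \<in> S" "\<And>z. z \<in> S \<Longrightarrow> f z = g z" "f differentiable (at z)"
  shows "dir_deriv g z u = dir_deriv f z u" "g differentiable (at z)"
proof -
  have "(g has_derivative dir_deriv f z) (at z)"
    using has_derivative_transform_within_open[OF has_derivative_dir_deriv[OF assms(4)] assms(1,2)] assms(3) by blast
  then show "dir_deriv g z u = dir_deriv f z u" "g differentiable (at z)"
    using dir_deriv_eqI differentiableI by blast+
qed

lemma C_k_on_cong:
  assumes "open S"
  shows "(\<And>z. z \<in> S \<Longrightarrow> f z = g z) \<Longrightarrow> C_k_on k f S \<Longrightarrow> C_k_on k g S"
proof (induction k arbitrary: f g)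
  case 0 then show ?case using continuous_on_cong[of S S f g] by simp
next
  case (Suc k)
  have d: "\<And>z. z \<in> S \<Longrightarrow> f differentiable (at z)" using Suc by simp
  have "C_k_on k (\<lambda>z. dir_deriv g z u) S" for u
    using Suc.IH[of "\<lambda>z. dir_deriv f z u" "\<lambda>z. dir_deriv g z u"] dir_deriv_cong_open(1)[OF assms] Suc.prems by (metis C_k_on.simps(2))
  moreover have "\<forall>z\<in>S. g differentiable (at z)"
    using dir_deriv_cong_open(2)[OF assms, of _ f g] Suc.prems(1) d by blast
  ultimately show ?case by simp
qed

lemma C_k_on_lower: "C_k_on (Suc k) f S \<Longrightarrow> C_k_on k f S"
proof (induction k arbitrary: f)
  case 0 then show ?case
    by (auto intro!: continuous_at_imp_continuous_on differentiable_imp_continuous_within)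
next
  case (Suc k)
  then have "C_k_on k (\<lambda>z. dir_deriv f z u) S" for u
    using Suc.IH[of "\<lambda>z. dir_deriv f z u"] by (metis C_k_on.simps(2))
  then show ?case using Suc.prems by simp
qed

lemma (in bounded_bilinear) dir_deriv_prod:
  assumes "f differentiable (at z)" "g differentiable (at z)"
  shows "dir_deriv (\<lambda>z. prod (f z) (g z)) z u = prod (f z) (dir_deriv g z u) + prod (dir_deriv f z u) (g z)"
    "(\<lambda>z. prod (f z) (g z)) differentiable (at z)"
proof -
  have "((\<lambda>z. prod (f z) (g z)) has_derivative (\<lambda>h. prod (f z) (dir_deriv g z h) + prod (dir_deriv f z h) (g z))) (at z)"
    using assms by (intro FDERIV has_derivative_dir_deriv)
  then show "dir_deriv (\<lambda>z. prod (f z) (g z)) z u = prod (f z) (dir_deriv g z u) + prod (dir_deriv f z u) (g z)"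
    "(\<lambda>z. prod (f z) (g z)) differentiable (at z)"
    using dir_deriv_eqI differentiableI by blast+
qed

lemma dir_deriv_add:
  assumes "f differentiable (at z)" "g differentiable (at z)"
  shows "dir_deriv (\<lambda>z. f z + g z) z u = dir_deriv f z u + dir_deriv g z u"
  by (rule dir_deriv_eqI) (intro has_derivative_add has_derivative_dir_deriv assms)

lemma dir_deriv_const: "dir_deriv (\<lambda>z. c) z u = 0"
  by (rule dir_deriv_eqI) auto

lemma C_k_on_const: "C_k_on k (\<lambda>z. c) S"
  by (induction k arbitrary: c) (auto simp: dir_deriv_const)

lemma C_k_on_add: "open S \<Longrightarrow> C_k_on k f S \<Longrightarrow> C_k_on k g S \<Longrightarrow> C_k_on k (\<lambda>z. f z + g z) S"
proof (induction k arbitrary: f g)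
  case 0 then show ?case by (auto intro: continuous_intros)
next
  case (Suc k)
  have "C_k_on k (\<lambda>z. dir_deriv (\<lambda>z. f z + g z) z u) S" for u
    by (rule C_k_on_cong[OF \<open>open S\<close> _ Suc.IH[of "\<lambda>z. dir_deriv f z u" "\<lambda>z. dir_deriv g z u"]])
      (use Suc.prems in \<open>auto simp: dir_deriv_add\<close>)
  then show ?case using Suc.prems by auto
qed

lemma (in bounded_bilinear) C_k_on_prod:
  "open S \<Longrightarrow> C_k_on k f S \<Longrightarrow> C_k_on k g S \<Longrightarrow> C_k_on k (\<lambda>z. prod (f z) (g z)) S"
proof (induction k arbitrary: f g)
  case 0 then show ?case by (auto intro: continuous_on)
next
  case (Suc k)
  have "C_k_on k (\<lambda>z. dir_deriv (\<lambda>z. prod (f z) (g z)) z u) S" for u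
  proof (rule C_k_on_cong[OF \<open>open S\<close>])
    show "C_k_on k (\<lambda>z. prod (f z) (dir_deriv g z u) + prod (dir_deriv f z u) (g z)) S"
      using Suc.prems C_k_on_lower[OF Suc.prems(2)] C_k_on_lower[OF Suc.prems(3)]
      by (intro C_k_on_add Suc.IH) auto
    show "prod (f z) (dir_deriv g z u) + prod (dir_deriv f z u) (g z) = dir_deriv (\<lambda>z. prod (f z) (g z)) z u"
      if "z \<in> S" for z using dir_deriv_prod(1)[of f z g u] Suc.prems that by simp
  qed
  moreover have "(\<lambda>z. prod (f z) (g z)) differentiable (at z)" if "z \<in> S" for z
    using dir_deriv_prod(2)[of f z g] Suc.prems that by simp
  ultimately show ?case by simp
qed

lemma smooth_on_cong: "open S \<Longrightarrow> (\<And>z. z \<in> S \<Longrightarrow> f z = g z) \<Longrightarrow> smooth_on f S \<Longrightarrow> smooth_on g S"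
  unfolding smooth_on_def using C_k_on_cong by blast

lemma smooth_on_const: "smooth_on (\<lambda>z. c) S"
  unfolding smooth_on_def by (simp add: C_k_on_const)

lemma smooth_on_add: "open S \<Longrightarrow> smooth_on f S \<Longrightarrow> smooth_on g S \<Longrightarrow> smooth_on (\<lambda>z. f z + g z) S"
  unfolding smooth_on_def by (simp add: C_k_on_add)

lemma (in bounded_bilinear) smooth_on_prod:
  "open S \<Longrightarrow> smooth_on f S \<Longrightarrow> smooth_on g S \<Longrightarrow> smooth_on (\<lambda>z. prod (f z) (g z)) S"
  unfolding smooth_on_def by (simp add: C_k_on_prod)

lemmas smooth_on_mult = bounded_bilinear.smooth_on_prod[OF bounded_bilinear_mult]
lemmas smooth_on_scaleR = bounded_bilinear.smooth_on_prod[OF bounded_bilinear_scaleR]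
lemmas smooth_on_inner = bounded_bilinear.smooth_on_prod[OF bounded_bilinear_inner]
lemmas dir_deriv_mult = bounded_bilinear.dir_deriv_prod[OF bounded_bilinear_mult]
lemmas dir_deriv_scaleR = bounded_bilinear.dir_deriv_prod[OF bounded_bilinear_scaleR]
lemmas dir_deriv_inner = bounded_bilinear.dir_deriv_prod[OF bounded_bilinear_inner]

lemma smooth_on_differentiable: "smooth_on f S \<Longrightarrow> z \<in> S \<Longrightarrow> f differentiable (at z)"
  unfolding smooth_on_def by (metis C_k_on.simps(2))

lemma smooth_on_continuous_on: "smooth_on f S \<Longrightarrow> continuous_on S f"
  unfolding smooth_on_def by (metis C_k_on.simps(1))

lemma smooth_on_dir_deriv: "smooth_on f S \<Longrightarrow> smooth_on (\<lambda>z. dir_deriv f z u) S"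
  unfolding smooth_on_def by (metis C_k_on.simps(2))

lemma smooth_on_cmult: "open S \<Longrightarrow> smooth_on f S \<Longrightarrow> smooth_on (\<lambda>z. (c::real) * f z) S"
  by (intro smooth_on_mult smooth_on_const)

lemma smooth_on_uminus: "open S \<Longrightarrow> smooth_on f S \<Longrightarrow> smooth_on (\<lambda>z. - f z :: 'b::real_normed_vector) S"
  using smooth_on_scaleR[OF _ smooth_on_const[of "-1"], of S f] by simp

lemma smooth_on_diff: "open S \<Longrightarrow> smooth_on f S \<Longrightarrow> smooth_on g S \<Longrightarrow> smooth_on (\<lambda>z. f z - g z) S"
  using smooth_on_add[OF _ _ smooth_on_uminus, of S f g] by simp

lemma smooth_on_sum: "open S \<Longrightarrow> (\<And>i. i \<in> A \<Longrightarrow> smooth_on (f i) S) \<Longrightarrow> smooth_on (\<lambda>z. \<Sum>i\<in>A. f i z) S"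
  by (induction A rule: infinite_finite_induct) (auto simp: smooth_on_const smooth_on_add)

lemma smooth_on_prod_real:
  "open S \<Longrightarrow> (\<And>i. i \<in> A \<Longrightarrow> smooth_on (f i) S) \<Longrightarrow> smooth_on (\<lambda>z. \<Prod>i\<in>A. (f i z :: real)) S"
  by (induction A rule: infinite_finite_induct) (auto simp: smooth_on_const smooth_on_mult)

lemma smooth_on_power: "open S \<Longrightarrow> smooth_on f S \<Longrightarrow> smooth_on (\<lambda>z. (f z :: real) ^ n) S"
  by (induction n) (auto simp: smooth_on_const smooth_on_mult)

lemma dir_deriv_bounded_linear:
  assumes "bounded_linear L" "f differentiable (at z)"
  shows "dir_deriv (\<lambda>z. L (f z)) z u = L (dir_deriv f z u)"
  by (rule dir_deriv_eqI) (intro bounded_linear.has_derivative[OF assms(1)] has_derivative_dir_deriv assms)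

lemma C_k_on_id_linear: "bounded_linear L \<Longrightarrow> C_k_on k L S"
proof (cases k)
  case 0 then show "bounded_linear L \<Longrightarrow> C_k_on k L S" by (simp add: linear_continuous_on)
next
  case (Suc j)
  assume L: "bounded_linear L"
  have "dir_deriv L z u = L u" for z u
    by (rule dir_deriv_eqI) (rule bounded_linear_imp_has_derivative[OF L])
  then show ?thesis using Suc L
    by (auto simp: C_k_on_const bounded_linear_imp_differentiable)
qed

lemma smooth_on_linear: "bounded_linear L \<Longrightarrow> smooth_on L S"
  unfolding smooth_on_def by (simp add: C_k_on_id_linear)

lemma dir_deriv_inverse:
  assumes "f differentiable (at z)" "f z \<noteq> (0::real)"
  shows "dir_deriv (\<lambda>z. inverse (f z)) z u = - (dir_deriv f z u * (inverse (f z) * inverse (f z)))"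
    "(\<lambda>z. inverse (f z)) differentiable (at z)"
proof -
  have "((\<lambda>z. inverse (f z)) has_derivative (\<lambda>u. - (inverse (f z) * dir_deriv f z u * inverse (f z)))) (at z)"
    by (rule Deriv.has_derivative_inverse[OF assms(2) has_derivative_dir_deriv[OF assms(1)]])
  then show "dir_deriv (\<lambda>z. inverse (f z)) z u = - (dir_deriv f z u * (inverse (f z) * inverse (f z)))"
    "(\<lambda>z. inverse (f z)) differentiable (at z)"
    using dir_deriv_eqI[of _ _ z u] differentiableI by (auto simp: mult_ac)
qed

text \<open>The derivative of 1/f contains 1/f again, so the induction on k passes from 1/f being
  C^k to its derivative being C^k.\<close>

lemma smooth_on_inverse:
  assumes "open S" "smooth_on f S" "\<And>z. z \<in> S \<Longrightarrow> f z \<noteq> (0::real)"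
  shows "smooth_on (\<lambda>z. inverse (f z)) S"
proof -
  note CM = bounded_bilinear.C_k_on_prod[OF bounded_bilinear_mult]
  have "C_k_on k (\<lambda>z. inverse (f z)) S" for k
  proof (induction k)
    case 0 then show ?case using smooth_on_continuous_on[OF assms(2)] assms(3) by (auto intro!: continuous_intros)
  next
    case (Suc k)
    have "C_k_on k (\<lambda>z. dir_deriv (\<lambda>z. inverse (f z)) z u) S" for u
    proof (rule C_k_on_cong[OF assms(1)])
      have "C_k_on k (\<lambda>z. dir_deriv f z u) S"
        using smooth_on_dir_deriv[OF assms(2)] unfolding smooth_on_def by blast
      then show "C_k_on k (\<lambda>z. (-1) * (dir_deriv f z u * (inverse (f z) * inverse (f z)))) S"
        using Suc assms(1) by (intro CM C_k_on_const) auto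
      show "(-1) * (dir_deriv f z u * (inverse (f z) * inverse (f z))) = dir_deriv (\<lambda>z. inverse (f z)) z u"
        if "z \<in> S" for z
        using dir_deriv_inverse(1)[of f z u] smooth_on_differentiable[OF assms(2)] assms(3) that by simp
    qed
    then show ?case using dir_deriv_inverse(2) smooth_on_differentiable[OF assms(2)] assms(3) by auto
  qed
  then show ?thesis unfolding smooth_on_def by blast
qed

lemma smooth_on_divide:
  assumes "open S" "smooth_on f S" "smooth_on g S" "\<And>z. z \<in> S \<Longrightarrow> g z \<noteq> (0::real)"
  shows "smooth_on (\<lambda>z. f z / g z) S"
  unfolding divide_inverse by (intro smooth_on_mult smooth_on_inverse assms)

lemma dir_deriv_ln:
  assumes "f differentiable (at z)" "f z > (0::real)"
  shows "dir_deriv (\<lambda>z. ln (f z)) z u = dir_deriv f z u * inverse (f z)"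
    "(\<lambda>z. ln (f z)) differentiable (at z)"
proof -
  have "((\<lambda>z. ln (f z)) has_derivative (\<lambda>u. dir_deriv f z u * inverse (f z))) (at z)"
    by (rule has_derivative_ln[OF assms(2) has_derivative_dir_deriv[OF assms(1)]])
  then show "dir_deriv (\<lambda>z. ln (f z)) z u = dir_deriv f z u * inverse (f z)"
    "(\<lambda>z. ln (f z)) differentiable (at z)"
    using dir_deriv_eqI[of _ _ z u] differentiableI by auto
qed

lemma smooth_on_ln:
  assumes "open S" "smooth_on f S" "\<And>z. z \<in> S \<Longrightarrow> f z > (0::real)"
  shows "smooth_on (\<lambda>z. ln (f z)) S"
proof -
  have d: "smooth_on (\<lambda>z. dir_deriv f z u * inverse (f z)) S" for u
    using assms by (intro smooth_on_mult smooth_on_dir_deriv smooth_on_inverse) force+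
  have "smooth_on (\<lambda>z. dir_deriv (\<lambda>z. ln (f z)) z u) S" for u
    by (rule smooth_on_cong[OF assms(1) _ d])
      (use dir_deriv_ln(1)[OF smooth_on_differentiable[OF assms(2)]] assms(3) in auto)
  then have "C_k_on (Suc k) (\<lambda>z. ln (f z)) S" for k
    using dir_deriv_ln(2)[OF smooth_on_differentiable[OF assms(2)]] assms(3) unfolding smooth_on_def by auto
  then show ?thesis unfolding smooth_on_def using C_k_on_lower by blast
qed

section \<open>Derivatives along lines and symmetry of second derivatives\<close>

lemma line_has_vector_derivative:
  assumes "f differentiable (at (p + s *\<^sub>R u))"
  shows "((\<lambda>s. f (p + s *\<^sub>R u)) has_vector_derivative dir_deriv f (p + s *\<^sub>R u) u) (at s)"
proof -
  have "((\<lambda>s. p + s *\<^sub>R u) has_derivative (\<lambda>h. h *\<^sub>R u)) (at s)"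
    by (auto intro!: derivative_eq_intros)
  then have "((\<lambda>s. f (p + s *\<^sub>R u)) has_derivative (\<lambda>h. dir_deriv f (p + s *\<^sub>R u) (h *\<^sub>R u))) (at s)"
    using has_derivative_compose has_derivative_dir_deriv[OF assms] by blast
  moreover have "linear (dir_deriv f (p + s *\<^sub>R u))"
    using has_derivative_dir_deriv[OF assms] has_derivative_linear by blast
  ultimately show ?thesis unfolding has_vector_derivative_def by (simp add: linear_cmul)
qed

lemma line_has_field_derivative:
  fixes f :: "'a::real_normed_vector \<Rightarrow> real"
  assumes "f differentiable (at (p + s *\<^sub>R u))"
  shows "((\<lambda>s. f (p + s *\<^sub>R u)) has_field_derivative dir_deriv f (p + s *\<^sub>R u) u) (at s)"
  using line_has_vector_derivative[OF assms] by (simp add: has_real_derivative_iff_has_vector_derivative)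

lemma mean_value_line:
  fixes f :: "'a::real_normed_vector \<Rightarrow> real"
  assumes "h > 0" "\<And>s. 0 \<le> s \<Longrightarrow> s \<le> h \<Longrightarrow> f differentiable (at (p + s *\<^sub>R u))"
  obtains s where "0 < s" "s < h" "f (p + h *\<^sub>R u) - f p = h * dir_deriv f (p + s *\<^sub>R u) u"
proof -
  have "\<exists>s. 0 < s \<and> s < h \<and> f (p + h *\<^sub>R u) - f (p + 0 *\<^sub>R u) = (h - 0) * dir_deriv f (p + s *\<^sub>R u) u"
    using assms by (intro MVT2 line_has_field_derivative) auto
  then show thesis using that by auto
qed

text \<open>Mean value theorem twice: along u for the increment of f in direction v, then along v
  for the derivative of f in direction u.\<close>

lemma second_difference:
  fixes f :: "'a::real_normed_vector \<Rightarrow> real"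
  assumes "h > 0" and f: "\<And>s t. 0 \<le> s \<Longrightarrow> s \<le> h \<Longrightarrow> 0 \<le> t \<Longrightarrow> t \<le> h \<Longrightarrow> p + s *\<^sub>R u + t *\<^sub>R v \<in> S"
    and S: "C_k_on 2 f S" "open S"
  obtains s t where "0 \<le> s" "s \<le> h" "0 \<le> t" "t \<le> h"
    "f (p + h *\<^sub>R u + h *\<^sub>R v) - f (p + h *\<^sub>R u) - f (p + h *\<^sub>R v) + f p
       = h * h * dir_deriv (\<lambda>z. dir_deriv f z u) (p + s *\<^sub>R u + t *\<^sub>R v) v"
proof -
  have d1: "f differentiable (at z)" if "z \<in> S" for z using S that by (simp add: numeral_2_eq_2)
  have d2: "(\<lambda>z. dir_deriv f z u) differentiable (at z)" if "z \<in> S" for z using S that by (simp add: numeral_2_eq_2)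
  define g where "g z = f (z + h *\<^sub>R v) - f z" for z
  have gd: "g differentiable (at (p + s *\<^sub>R u))"
    and gdd: "dir_deriv g (p + s *\<^sub>R u) u = dir_deriv f (p + s *\<^sub>R u + h *\<^sub>R v) u - dir_deriv f (p + s *\<^sub>R u) u"
    if "0 \<le> s" "s \<le> h" for s
  proof -
    let ?z = "p + s *\<^sub>R u"
    have "((\<lambda>z. z + h *\<^sub>R v) has_derivative (\<lambda>k. k)) (at ?z)" by (auto intro!: derivative_eq_intros)
    moreover have "(f has_derivative dir_deriv f (?z + h *\<^sub>R v)) (at (?z + h *\<^sub>R v))"
      using f[of s h] that assms(1) by (intro has_derivative_dir_deriv d1) auto
    ultimately have 1: "((\<lambda>z. f (z + h *\<^sub>R v)) has_derivative (\<lambda>k. dir_deriv f (?z + h *\<^sub>R v) k)) (at ?z)"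
      using has_derivative_compose by blast
    have 2: "(f has_derivative dir_deriv f ?z) (at ?z)"
      using f[of s 0] that assms(1) by (intro has_derivative_dir_deriv d1) auto
    have "(g has_derivative (\<lambda>k. dir_deriv f (?z + h *\<^sub>R v) k - dir_deriv f ?z k)) (at ?z)"
      unfolding g_def using has_derivative_diff[OF 1 2] .
    then show "g differentiable (at ?z)"
      "dir_deriv g ?z u = dir_deriv f (?z + h *\<^sub>R v) u - dir_deriv f ?z u"
      using differentiableI dir_deriv_eqI by blast+
  qed
  obtain s where s: "0 < s" "s < h" "g (p + h *\<^sub>R u) - g p = h * dir_deriv g (p + s *\<^sub>R u) u"
    using mean_value_line[OF assms(1), of g p u] gd by blast
  obtain t where t: "0 < t" "t < h" "dir_deriv f (p + s *\<^sub>R u + h *\<^sub>R v) u - dir_deriv f (p + s *\<^sub>R u) u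
      = h * dir_deriv (\<lambda>z. dir_deriv f z u) (p + s *\<^sub>R u + t *\<^sub>R v) v"
    using mean_value_line[OF assms(1), of "\<lambda>z. dir_deriv f z u" "p + s *\<^sub>R u" v] d2 f s by (metis less_imp_le)
  have "f (p + h *\<^sub>R u + h *\<^sub>R v) - f (p + h *\<^sub>R u) - f (p + h *\<^sub>R v) + f p = g (p + h *\<^sub>R u) - g p"
    unfolding g_def by simp
  also have "\<dots> = h * h * dir_deriv (\<lambda>z. dir_deriv f z u) (p + s *\<^sub>R u + t *\<^sub>R v) v"
    using s t gdd[of s] by simp
  finally show thesis using that[of s t] s t by auto
qed

text \<open>The second difference is symmetric in u and v and equals h^2 times either mixed
  derivative at points near z; continuity of both excludes different values at z.\<close>

lemma dir_deriv_commute: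
  fixes f :: "'a::real_normed_vector \<Rightarrow> real"
  assumes S: "open S" "C_k_on 2 f S" "z \<in> S"
  shows "dir_deriv (\<lambda>z. dir_deriv f z u) z v = dir_deriv (\<lambda>z. dir_deriv f z v) z u" (is "?A z = ?B z")
proof (rule ccontr)
  assume neq: "?A z \<noteq> ?B z"
  define e where "e = \<bar>?A z - ?B z\<bar> / 2"
  have e: "e > 0" unfolding e_def using neq by simp
  have cont: "continuous_on S ?A" "continuous_on S ?B" using S(2) by (simp_all add: numeral_2_eq_2)
  obtain d1 where d1: "d1 > 0" "\<And>y. y \<in> S \<Longrightarrow> dist y z < d1 \<Longrightarrow> dist (?A y) (?A z) < e"
    using cont(1) S(3) e unfolding continuous_on_iff by blast
  obtain d2 where d2: "d2 > 0" "\<And>y. y \<in> S \<Longrightarrow> dist y z < d2 \<Longrightarrow> dist (?B y) (?B z) < e"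
    using cont(2) S(3) e unfolding continuous_on_iff by blast
  obtain d3 where d3: "d3 > 0" "ball z d3 \<subseteq> S" using S(1,3) open_contains_ball by blast
  \<comment> \<open>Small enough for the parallelogram spanned by h u and h v to stay where both
    mixed derivatives vary by less than e, half of their supposed difference.\<close>
  define h where "h = min d1 (min d2 d3) / (2 * (1 + norm u + norm v))"
  have n: "0 < 1 + norm u + norm v" by (metis add_pos_nonneg norm_ge_zero zero_less_one)
  have h: "h > 0" unfolding h_def using d1 d2 d3 n by auto
  have close: "dist (z + s *\<^sub>R u + t *\<^sub>R v) z < min d1 (min d2 d3)"
    if "0 \<le> s" "s \<le> h" "0 \<le> t" "t \<le> h" for s t
  proof -
    have "dist (z + s *\<^sub>R u + t *\<^sub>R v) z \<le> s * norm u + t * norm v"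
      using that norm_triangle_ineq[of "s *\<^sub>R u" "t *\<^sub>R v"] by (simp add: dist_norm add.assoc)
    also have "\<dots> \<le> h * norm u + h * norm v" using that by (intro add_mono mult_right_mono) auto
    also have "\<dots> \<le> h * (1 + norm u + norm v)" using h by (simp add: algebra_simps)
    also have "\<dots> = min d1 (min d2 d3) / 2" unfolding h_def using n by (simp add: field_simps)
    also have "\<dots> < min d1 (min d2 d3)" using d1 d2 d3 by auto
    finally show ?thesis .
  qed
  have inS: "z + s *\<^sub>R u + t *\<^sub>R v \<in> S" if "0 \<le> s" "s \<le> h" "0 \<le> t" "t \<le> h" for s t
    using close[OF that] d3 by (auto simp: dist_commute subset_iff)
  have inS': "z + s *\<^sub>R v + t *\<^sub>R u \<in> S" if "0 \<le> s" "s \<le> h" "0 \<le> t" "t \<le> h" for s t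
    using inS[of t s] that by (simp add: add_ac)
  obtain s t where st: "0 \<le> s" "s \<le> h" "0 \<le> t" "t \<le> h"
    "f (z + h *\<^sub>R u + h *\<^sub>R v) - f (z + h *\<^sub>R u) - f (z + h *\<^sub>R v) + f z = h * h * ?A (z + s *\<^sub>R u + t *\<^sub>R v)"
    using second_difference[OF h inS S(2,1)] by blast
  obtain s' t' where st': "0 \<le> s'" "s' \<le> h" "0 \<le> t'" "t' \<le> h"
    "f (z + h *\<^sub>R v + h *\<^sub>R u) - f (z + h *\<^sub>R v) - f (z + h *\<^sub>R u) + f z = h * h * ?B (z + s' *\<^sub>R v + t' *\<^sub>R u)"
    using second_difference[OF h inS' S(2,1)] by blast
  have "h * h * ?A (z + s *\<^sub>R u + t *\<^sub>R v) = h * h * ?B (z + t' *\<^sub>R u + s' *\<^sub>R v)"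
  proof -
    have "z + h *\<^sub>R v + h *\<^sub>R u = z + h *\<^sub>R u + h *\<^sub>R v" "z + s' *\<^sub>R v + t' *\<^sub>R u = z + t' *\<^sub>R u + s' *\<^sub>R v"
      by (simp_all add: add_ac)
    then have 1: "z + h *\<^sub>R v + h *\<^sub>R u = z + h *\<^sub>R u + h *\<^sub>R v"
      and 2: "z + s' *\<^sub>R v + t' *\<^sub>R u = z + t' *\<^sub>R u + s' *\<^sub>R v" by blast+
    show ?thesis using st(5) st'(5)[unfolded 1 2] by linarith
  qed
  then have "?A (z + s *\<^sub>R u + t *\<^sub>R v) = ?B (z + t' *\<^sub>R u + s' *\<^sub>R v)" using h by simp
  moreover have "dist (?A (z + s *\<^sub>R u + t *\<^sub>R v)) (?A z) < e" using d1(2) inS close st by auto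
  moreover have "dist (?B (z + t' *\<^sub>R u + s' *\<^sub>R v)) (?B z) < e" using d2(2) inS close st' by auto
  moreover have "\<bar>?A z - ?B z\<bar> = 2 * e" unfolding e_def by simp
  ultimately show False unfolding dist_real_def by linarith
qed

lemma smooth_on_commute:
  fixes f :: "'a::real_normed_vector \<Rightarrow> real"
  assumes "open S" "smooth_on f S" "z \<in> S"
  shows "dir_deriv (\<lambda>z. dir_deriv f z u) z v = dir_deriv (\<lambda>z. dir_deriv f z v) z u"
  using dir_deriv_commute[OF assms(1) _ assms(3)] assms(2) unfolding smooth_on_def by blast

section \<open>Inner products and Gram determinants\<close>

definition inner_form :: "('a::euclidean_space \<Rightarrow> 'a \<Rightarrow> real) \<Rightarrow> bool" where
  "inner_form B \<longleftrightarrow> bilinear B \<and> (\<forall>u v. B u v = B v u) \<and> (\<forall>u. u \<noteq> 0 \<longrightarrow> B u u > 0)"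

text \<open>The vector that is B-dual to the covector represented by a in the Euclidean inner
  product. Pairing each e in \<open>Basis\<close> with \<open>sharp B e\<close> turns sums over
  \<open>Basis\<close> into traces with respect to B.\<close>

definition sharp :: "('a::euclidean_space \<Rightarrow> 'a \<Rightarrow> real) \<Rightarrow> 'a \<Rightarrow> 'a" where
  "sharp B a = (THE c. \<forall>v. B c v = a \<bullet> v)"

lemma bilinear_sum_left: "bilinear B \<Longrightarrow> B (\<Sum>i\<in>A. f i) v = (\<Sum>i\<in>A. B (f i) v)"
  unfolding bilinear_def by (simp add: linear_sum[of "\<lambda>x. B x v"])

lemma bilinear_sum_right: "bilinear B \<Longrightarrow> B v (\<Sum>i\<in>A. f i) = (\<Sum>i\<in>A. B v (f i))"
  unfolding bilinear_def by (simp add: linear_sum[of "\<lambda>x. B v x"])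

context
  fixes B :: "'a::euclidean_space \<Rightarrow> 'a \<Rightarrow> real"
  assumes B: "inner_form B"
begin

lemma B_bil: "bilinear B" and B_sym: "B u v = B v u" and B_pos: "u \<noteq> 0 \<Longrightarrow> B u u > 0"
  using B unfolding inner_form_def by auto

lemmas B_simps = bilinear_ladd[OF B_bil] bilinear_radd[OF B_bil] bilinear_lmul[OF B_bil] bilinear_rmul[OF B_bil]
  bilinear_lneg[OF B_bil] bilinear_rneg[OF B_bil] bilinear_lsub[OF B_bil] bilinear_rsub[OF B_bil]
  bilinear_lzero[OF B_bil] bilinear_rzero[OF B_bil]

lemma B_nonneg: "0 \<le> B u u"
  using B_pos[of u] B_simps by (cases "u = 0") auto

lemma B_eq_0: "B u u = 0 \<longleftrightarrow> u = 0"
  using B_pos[of u] B_simps by (cases "u = 0") auto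

lemma B_eqI: "(\<And>v. B x v = B y v) \<Longrightarrow> x = y"
  using B_eq_0[of "x - y"] by (simp add: B_simps)

lemma B_expand: "B u v = (\<Sum>e\<in>Basis. (v \<bullet> e) * B u e)"
  using euclidean_representation[of v] bilinear_sum_right[OF B_bil, of u "\<lambda>e. (v \<bullet> e) *\<^sub>R e" Basis]
  by (simp add: B_simps)

lemma sharp_unique: "\<exists>!c. \<forall>v. B c v = a \<bullet> v"
proof -
  define T where "T c = (\<Sum>e\<in>Basis. B c e *\<^sub>R e)" for c
  have lin: "linear T" unfolding T_def
    by (intro linearI) (simp_all add: B_simps scaleR_add_left sum.distrib scaleR_sum_right)
  have Te: "T c \<bullet> v = B c v" for c v
    unfolding T_def inner_sum_left B_expand[of c v] by (simp add: mult.commute inner_commute)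
  have "inj T"
  proof (rule injI)
    fix x y assume "T x = T y"
    then show "x = y" using Te B_eqI by metis
  qed
  then have "surj T" using lin linear_injective_imp_surjective by blast
  then obtain c where "T c = a" by (metis surjD)
  then show ?thesis using Te B_eqI by metis
qed

lemma sharp: "B (sharp B a) v = a \<bullet> v"
  unfolding sharp_def using theI'[OF sharp_unique[of a]] by blast

lemma sharp_eqI: "(\<And>v. B c v = a \<bullet> v) \<Longrightarrow> sharp B a = c"
  using B_eqI sharp by metis

lemma linear_sharp: "linear (sharp B)"
  by (intro linearI sharp_eqI) (simp_all add: B_simps sharp inner_simps)

lemma sharp_frame_right: "(\<Sum>e\<in>Basis. B e a *\<^sub>R sharp B e) = a"
proof (rule B_eqI)
  fix v
  show "B (\<Sum>e\<in>Basis. B e a *\<^sub>R sharp B e) v = B a v"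
    by (simp add: bilinear_sum_left[OF B_bil] B_simps sharp B_expand[of a v] B_sym[of _ a] inner_commute mult.commute)
qed

lemma cauchy_schwarz_form: "(B u v)\<^sup>2 \<le> B u u * B v v"
proof (cases "v = 0")
  case False
  have "0 \<le> B (B v v *\<^sub>R u - B u v *\<^sub>R v) (B v v *\<^sub>R u - B u v *\<^sub>R v)" by (rule B_nonneg)
  also have "\<dots> = B v v * (B u u * B v v - (B u v)\<^sup>2)"
    by (simp add: B_simps B_sym[of v u] power2_eq_square algebra_simps)
  finally show ?thesis using B_pos[OF False] by (simp add: zero_le_mult_iff)
qed (simp add: B_simps)

text \<open>Gram-Schmidt along subsets of the standard basis. That \<open>w e\<close> stays in the
  span of the subset is carried along, so that the next basis vector differs from its
  projection.\<close>

lemma orthonormal_subset: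
  assumes "finite A" "A \<subseteq> Basis"
  shows "\<exists>w. (\<forall>e\<in>A. w e \<in> span A) \<and> (\<forall>e\<in>A. \<forall>e'\<in>A. B (w e) (w e') = (if e = e' then 1 else 0))"
  using assms
proof (induction A rule: finite_induct)
  case (insert e A)
  then obtain w where w: "\<And>a. a \<in> A \<Longrightarrow> w a \<in> span A"
    "\<And>a b. a \<in> A \<Longrightarrow> b \<in> A \<Longrightarrow> B (w a) (w b) = (if a = b then 1 else 0)"
    by (metis insert_subset)
  define p where "p = (\<Sum>a\<in>A. B e (w a) *\<^sub>R w a)"
  define v where "v = e - p"
  have p: "p \<in> span A" unfolding p_def using w by (intro span_sum span_scale) auto
  have "e \<notin> span A"
  proof
    assume "e \<in> span A"
    moreover have "A \<subseteq> Basis - {e}" using insert by auto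
    ultimately have "e \<in> span (Basis - {e})" using span_mono by blast
    then show False using independent_Basis insert.prems unfolding dependent_def by blast
  qed
  then have v0: "v \<noteq> 0" unfolding v_def using p by auto
  have vorth: "B v (w a) = 0" if "a \<in> A" for a
  proof -
    have "B p (w a) = (\<Sum>b\<in>A. B e (w b) * B (w b) (w a))"
      unfolding p_def by (simp add: bilinear_sum_left[OF B_bil] B_simps)
    also have "\<dots> = (\<Sum>b\<in>A. if b = a then B e (w b) else 0)" using w that by (intro sum.cong) auto
    also have "\<dots> = B e (w a)" using that insert.hyps(1) by simp
    finally show ?thesis unfolding v_def by (simp add: B_simps)
  qed
  define w' where "w' = w(e := (1 / sqrt (B v v)) *\<^sub>R v)"
  have Bv: "B v v > 0" using B_pos[OF v0] .
  have w'A: "w' a = w a" if "a \<in> A" for a using that insert.hyps(2) unfolding w'_def by auto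
  have 1: "B (w' e) (w' e) = 1"
  proof -
    have "sqrt (B v v) * sqrt (B v v) = B v v" using Bv by simp
    then show ?thesis unfolding w'_def using Bv by (simp add: B_simps field_simps)
  qed
  have 2: "B (w' e) (w' a) = 0" "B (w' a) (w' e) = 0" if "a \<in> A" for a
    using vorth[OF that] w'A[OF that] B_sym[of "w' a" "w' e"] unfolding w'_def by (auto simp: B_simps)
  have "p \<in> span (insert e A)" using p span_mono[of A "insert e A"] by blast
  then have 3: "w' e \<in> span (insert e A)"
    unfolding w'_def v_def fun_upd_same by (intro span_scale span_diff) (auto intro: span_base)
  have 4: "w' a \<in> span (insert e A)" if "a \<in> A" for a
    using w(1)[OF that] w'A[OF that] span_mono[of A "insert e A"] by auto
  show ?case
    using 1 2 3 4 w(2) w'A insert.hyps(2) by (intro exI[of _ w']) auto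
qed auto

lemma orthonormal_frame:
  obtains f :: "'a \<Rightarrow> 'a" where "linear f" "bij f" "\<And>u v. B (f u) (f v) = u \<bullet> v"
proof -
  obtain w :: "'a \<Rightarrow> 'a" where w: "\<And>a b. a \<in> Basis \<Longrightarrow> b \<in> Basis \<Longrightarrow> B (w a) (w b) = (if a = b then 1 else 0)"
  proof -
    have "\<exists>w :: 'a \<Rightarrow> 'a. (\<forall>e\<in>Basis. w e \<in> span Basis) \<and> (\<forall>e\<in>Basis. \<forall>e'\<in>Basis. B (w e) (w e') = (if e = e' then 1 else 0))"
      by (rule orthonormal_subset) auto
    then show thesis using that by blast
  qed
  define f where "f u = (\<Sum>e\<in>Basis. (u \<bullet> e) *\<^sub>R w e)" for u
  have lin: "linear f" unfolding f_def
    by (intro linearI) (simp_all add: inner_simps scaleR_add_left sum.distrib scaleR_sum_right)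
  have iso: "B (f u) (f v) = u \<bullet> v" for u v
  proof -
    have "B (f u) (f v) = (\<Sum>a\<in>Basis. \<Sum>b\<in>Basis. (u \<bullet> a) * ((v \<bullet> b) * B (w a) (w b)))"
      unfolding f_def bilinear_sum_left[OF B_bil]
      by (intro sum.cong refl) (simp add: bilinear_sum_right[OF B_bil] B_simps sum_distrib_left mult_ac)
    also have "\<dots> = (\<Sum>a\<in>Basis. \<Sum>b\<in>Basis. if b = a then (u \<bullet> a) * (v \<bullet> b) else 0)"
      using w by (intro sum.cong) auto
    also have "\<dots> = u \<bullet> v" by (simp add: euclidean_inner[of u v])
    finally show ?thesis .
  qed
  have "inj f"
  proof (rule injI)
    fix x y assume "f x = f y"
    then have "f (x - y) = 0" using lin by (simp add: linear_diff)
    then have "(x - y) \<bullet> (x - y) = 0" using iso[of "x - y" "x - y"] by (simp add: B_simps)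
    then show "x = y" by simp
  qed
  then have "bij f" using lin linear_injective_imp_surjective by (auto simp: bij_def)
  then show thesis using that lin iso by blast
qed

text \<open>Both sides are the trace of P with respect to B, on the left through a dual basis, on
  the right in an orthonormal frame.\<close>

lemma trace_sharp_frame:
  fixes f :: "'a \<Rightarrow> 'a"
  assumes f: "linear f" "bij f" "\<And>u v. B (f u) (f v) = u \<bullet> v" and P: "bilinear P"
  shows "(\<Sum>e\<in>Basis. P e (sharp B e)) = (\<Sum>k\<in>Basis. (P (f k) (f k) :: 'b::real_vector))"
proof -
  have sh: "sharp B e = (\<Sum>k\<in>Basis. (e \<bullet> f k) *\<^sub>R f k)" for e
  proof (rule sharp_eqI)
    fix v
    obtain w where v: "v = f w" using f(2) by (metis bij_pointE)
    have "B (\<Sum>k\<in>Basis. (e \<bullet> f k) *\<^sub>R f k) v = (\<Sum>k\<in>Basis. (e \<bullet> f k) * (k \<bullet> w))"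
      unfolding v by (simp add: bilinear_sum_left[OF B_bil] B_simps f(3))
    also have "\<dots> = e \<bullet> f (\<Sum>k\<in>Basis. (w \<bullet> k) *\<^sub>R k)"
      using f(1) by (simp add: linear_sum linear_cmul inner_sum_right inner_commute mult.commute)
    also have "\<dots> = e \<bullet> v" unfolding v by (simp add: euclidean_representation)
    finally show "B (\<Sum>k\<in>Basis. (e \<bullet> f k) *\<^sub>R f k) v = e \<bullet> v" .
  qed
  have PL: "linear (\<lambda>x. P x y)" "linear (P x)" for x y using P unfolding bilinear_def by auto
  have "(\<Sum>e\<in>Basis. P e (sharp B e)) = (\<Sum>e\<in>Basis. \<Sum>k\<in>Basis. (e \<bullet> f k) *\<^sub>R P e (f k))"
    unfolding sh by (simp add: linear_sum[OF PL(2)] linear_cmul[OF PL(2)])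
  also have "\<dots> = (\<Sum>k\<in>Basis. \<Sum>e\<in>Basis. (f k \<bullet> e) *\<^sub>R P e (f k))"
    by (subst sum.swap) (simp add: inner_commute)
  also have "\<dots> = (\<Sum>k\<in>Basis. P (\<Sum>e\<in>Basis. (f k \<bullet> e) *\<^sub>R e) (f k))"
    by (simp add: linear_sum[OF PL(1)] linear_cmul[OF PL(1)])
  finally show ?thesis by (simp add: euclidean_representation)
qed

text \<open>Divided by sqrt q, the pair is part of an orthonormal frame, and the other diagonal
  entries of P are nonnegative. Instead of completing the pair to a frame, the proof sums P over the
  projections of a frame to the orthogonal complement of the pair.\<close>

lemma trace_sharp_pair:
  assumes P: "bilinear P" "\<And>u v. P u v = P v u" "\<And>u. 0 \<le> P u u"
    and ab: "B \<alpha> \<beta> = 0" "B \<alpha> \<alpha> = q" "B \<beta> \<beta> = q" "q > 0"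
  shows "P \<alpha> \<alpha> + P \<beta> \<beta> \<le> q * (\<Sum>e\<in>Basis. P e (sharp B e) :: real)"
proof -
  obtain f :: "'a \<Rightarrow> 'a" where f: "linear f" "bij f" "\<And>u v. B (f u) (f v) = u \<bullet> v" using orthonormal_frame by blast
  obtain a b where [simp]: "\<alpha> = f a" "\<beta> = f b" using f(2) by (metis bij_pointE)
  have e: "a \<bullet> b = 0" "a \<bullet> a = q" "b \<bullet> b = q" using ab f(3) by auto
  define Q where "Q x y = P (f x) (f y)" for x y
  note Ps = bilinear_ladd[OF P(1)] bilinear_radd[OF P(1)] bilinear_lmul[OF P(1)] bilinear_rmul[OF P(1)]
  have Qb: "bilinear Q" unfolding Q_def bilinear_def
    by (auto intro!: linearI simp: linear_add[OF f(1)] linear_cmul[OF f(1)] Ps)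
  note Qs = bilinear_ladd[OF Qb] bilinear_radd[OF Qb] bilinear_lmul[OF Qb] bilinear_rmul[OF Qb]
    bilinear_lsub[OF Qb] bilinear_rsub[OF Qb]
  have Qsym: "Q x y = Q y x" for x y unfolding Q_def using P(2) .
  have con: "(\<Sum>k\<in>Basis. (k \<bullet> x) * Q k y) = Q x y" for x y
  proof -
    have "Q x y = Q (\<Sum>k\<in>Basis. (x \<bullet> k) *\<^sub>R k) y" by (simp add: euclidean_representation)
    then show ?thesis by (simp add: bilinear_sum_left[OF Qb] Qs inner_commute)
  qed
  have con2: "(\<Sum>k\<in>Basis. (k \<bullet> x) * (k \<bullet> y)) = x \<bullet> y" for x y :: 'a
    by (simp add: euclidean_inner[of x y] inner_commute)
  \<comment> \<open>The projection to the orthogonal complement of a and b, multiplied by q to avoid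
    divisions.\<close>
  define proj where "proj x = q *\<^sub>R x - (x \<bullet> a) *\<^sub>R a - (x \<bullet> b) *\<^sub>R b" for x
  have "0 \<le> (\<Sum>k\<in>Basis. Q (proj k) (proj k))" unfolding Q_def by (intro sum_nonneg P(3))
  also have "\<dots> = (\<Sum>k\<in>Basis. q\<^sup>2 * Q k k - 2 * q * ((k \<bullet> a) * Q k a) - 2 * q * ((k \<bullet> b) * Q k b)
      + Q a a * ((k \<bullet> a) * (k \<bullet> a)) + Q b b * ((k \<bullet> b) * (k \<bullet> b)) + 2 * Q a b * ((k \<bullet> a) * (k \<bullet> b)))"
  proof (intro sum.cong refl)
    fix k
    have s: "Q a k = Q k a" "Q b k = Q k b" "Q b a = Q a b" using Qsym by blast+
    show "Q (proj k) (proj k) = q\<^sup>2 * Q k k - 2 * q * ((k \<bullet> a) * Q k a) - 2 * q * ((k \<bullet> b) * Q k b)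
      + Q a a * ((k \<bullet> a) * (k \<bullet> a)) + Q b b * ((k \<bullet> b) * (k \<bullet> b)) + 2 * Q a b * ((k \<bullet> a) * (k \<bullet> b))"
      unfolding proj_def by (simp add: Qs s power2_eq_square algebra_simps)
  qed
  also have "\<dots> = q\<^sup>2 * (\<Sum>k\<in>Basis. Q k k) - q * Q a a - q * Q b b"
    by (simp only: sum.distrib sum_subtractf sum_distrib_left[symmetric] con con2 e) (simp add: algebra_simps)
  finally have "q * (Q a a + Q b b) \<le> q * (q * (\<Sum>k\<in>Basis. Q k k))"
    by (simp add: power2_eq_square algebra_simps)
  then have "Q a a + Q b b \<le> q * (\<Sum>k\<in>Basis. Q k k)" using ab(4) by simp
  then show ?thesis unfolding trace_sharp_frame[OF f P(1)] Q_def by simp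
qed

end

section \<open>Gram matrices in real coordinates of complex space\<close>

definition EB :: "'n::finite \<times> bool \<Rightarrow> complex ^ 'n" where
  "EB p = axis (fst p) (if snd p then \<i> else 1)"

lemma EB_bij: "bij_betw (EB :: 'n::finite \<times> bool \<Rightarrow> complex ^ 'n) UNIV Basis"
proof (rule bij_betw_imageI)
  show "inj (EB :: 'n \<times> bool \<Rightarrow> complex ^ 'n)"
    unfolding EB_def by (auto intro!: injI simp: axis_eq_axis split: if_splits)
  show "range (EB :: 'n \<times> bool \<Rightarrow> complex ^ 'n) = Basis"
  proof (intro equalityI subsetI)
    fix x :: "complex ^ 'n" assume "x \<in> Basis"
    then obtain i where "x = axis i 1 \<or> x = axis i \<i>" by (auto simp: Basis_vec_def Basis_complex_def)
    then have "x = EB (i, False) \<or> x = EB (i, True)" unfolding EB_def by auto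
    then show "x \<in> range EB" by blast
  qed (auto simp: EB_def Basis_vec_def Basis_complex_def)
qed

lemma sum_EB: "(\<Sum>p\<in>UNIV. F (EB p)) = (\<Sum>e\<in>Basis. F e)"
  using sum.reindex_bij_betw[OF EB_bij] .

lemma EB_inner: "EB p \<bullet> EB q = (if p = q then 1 else 0)"
proof -
  have "EB p \<in> Basis" "EB q \<in> Basis" using EB_bij unfolding bij_betw_def by auto
  moreover have "EB p = EB q \<longleftrightarrow> p = q" using EB_bij unfolding bij_betw_def by (metis UNIV_I inj_onD)
  ultimately show ?thesis by (simp add: inner_Basis)
qed

definition emat :: "(complex ^ 'n \<Rightarrow> complex ^ 'n) \<Rightarrow> real ^ ('n::finite \<times> bool) ^ ('n \<times> bool)" where
  "emat f = (\<chi> i j. EB i \<bullet> f (EB j))"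

text \<open>Its determinant is the squared volume density of B. The rows and columns are indexed by
  the finite type \<open>'n \<times> bool\<close> of real coordinates, so that \<open>det\<close>
  applies.\<close>

definition gram :: "(complex ^ 'n \<Rightarrow> complex ^ 'n \<Rightarrow> real) \<Rightarrow> real ^ ('n::finite \<times> bool) ^ ('n \<times> bool)" where
  "gram B = (\<chi> i j. B (EB i) (EB j))"

lemma emat_comp:
  assumes "linear f" shows "emat (\<lambda>x. f (g x)) = emat f ** emat g"
proof -
  have "EB i \<bullet> f (g (EB j)) = (\<Sum>k\<in>UNIV. (EB i \<bullet> f (EB k)) * (EB k \<bullet> g (EB j)))" for i j
  proof -
    have "f (g (EB j)) = f (\<Sum>e\<in>Basis. (g (EB j) \<bullet> e) *\<^sub>R e)" by (simp add: euclidean_representation)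
    also have "\<dots> = (\<Sum>e\<in>Basis. (g (EB j) \<bullet> e) *\<^sub>R f e)" using assms by (simp add: linear_sum linear_cmul)
    also have "\<dots> = (\<Sum>k\<in>UNIV. (g (EB j) \<bullet> EB k) *\<^sub>R f (EB k))" by (rule sum_EB[symmetric])
    finally show ?thesis by (simp add: inner_sum_right inner_commute mult.commute)
  qed
  then show ?thesis unfolding emat_def matrix_matrix_mult_def by (simp add: vec_eq_iff)
qed

lemma emat_id: "emat (\<lambda>x. x) = mat 1"
  unfolding emat_def mat_def by (simp add: vec_eq_iff EB_inner)

lemma gram_pullback: "gram (\<lambda>u v. A u \<bullet> A v) = transpose (emat A) ** emat A"
proof -
  have "A u \<bullet> A v = (\<Sum>k\<in>UNIV. (EB k \<bullet> A u) * (EB k \<bullet> A v))" for u v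
    unfolding sum_EB[of "\<lambda>e. (e \<bullet> A u) * (e \<bullet> A v)"] by (subst euclidean_inner) (simp add: inner_commute)
  then show ?thesis unfolding gram_def emat_def matrix_matrix_mult_def transpose_def by (simp add: vec_eq_iff)
qed

lemma gram_comp:
  assumes "linear f" "bilinear B" shows "gram (\<lambda>u v. B (f u) (f v)) = transpose (emat f) ** gram B ** emat f"
proof -
  have f: "f u = (\<Sum>k\<in>UNIV. (EB k \<bullet> f u) *\<^sub>R EB k)" for u
    unfolding sum_EB[of "\<lambda>e. (e \<bullet> f u) *\<^sub>R e"] by (simp add: inner_commute[of _ "f u"] euclidean_representation)
  have r: "B x (f v) = (\<Sum>l\<in>UNIV. B x (EB l) * (EB l \<bullet> f v))" for x v
    by (subst f[of v]) (simp add: bilinear_sum_right[OF assms(2)] bilinear_rmul[OF assms(2)] mult.commute)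
  have l: "B (f u) x = (\<Sum>k\<in>UNIV. (EB k \<bullet> f u) * B (EB k) x)" for x u
    by (subst f[of u]) (simp add: bilinear_sum_left[OF assms(2)] bilinear_lmul[OF assms(2)])
  have "B (f u) (f v) = (\<Sum>l\<in>UNIV. (\<Sum>k\<in>UNIV. (EB k \<bullet> f u) * B (EB k) (EB l)) * (EB l \<bullet> f v))" for u v
    unfolding r[of "f u" v] l[symmetric] ..
  then show ?thesis unfolding gram_def emat_def matrix_matrix_mult_def transpose_def by (simp add: vec_eq_iff)
qed

lemma inner_form_frame_inverse:
  fixes B :: "'a::euclidean_space \<Rightarrow> 'a \<Rightarrow> real"
  assumes "inner_form B"
  obtains f A :: "'a \<Rightarrow> 'a" where "linear f" "linear A" "\<And>u v. B (f u) (f v) = u \<bullet> v" "\<And>u v. B u v = A u \<bullet> A v"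
    "\<And>u. A (f u) = u" "\<And>u. f (A u) = u"
proof -
  obtain f :: "'a \<Rightarrow> 'a" where f: "linear f" "bij f" "\<And>u v. B (f u) (f v) = u \<bullet> v" using orthonormal_frame[OF assms] by blast
  define A where "A = inv f"
  have inv: "A (f u) = u" "f (A u) = u" for u
    unfolding A_def using f(2) by (auto simp: bij_def surj_f_inv_f)
  have "linear A"
  proof (rule linearI)
    show "A (x + y) = A x + A y" for x y using inv linear_add[OF f(1)] by metis
    show "A (r *\<^sub>R x) = r *\<^sub>R A x" for r x using inv linear_cmul[OF f(1)] by metis
  qed
  moreover have "B u v = A u \<bullet> A v" for u v using f(3)[of "A u" "A v"] inv by simp
  ultimately show thesis using that f inv by blast
qed

lemma det_gram_frame:
  assumes "linear f" "linear A" "\<And>u. f (A u) = u" "\<And>u. A (f u) = u" "\<And>u v. B u v = A u \<bullet> A v"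
  shows "det (gram B) = (det (emat A))\<^sup>2" "det (emat A) * det (emat f) = 1"
proof -
  have "B = (\<lambda>u v. A u \<bullet> A v)" using assms by blast
  then show "det (gram B) = (det (emat A))\<^sup>2"
    using gram_pullback[of A] by (simp add: det_mul det_transpose power2_eq_square)
  have "emat A ** emat f = mat 1" unfolding emat_comp[OF assms(2), of f, symmetric] assms(4) by (rule emat_id)
  then show "det (emat A) * det (emat f) = 1" by (metis det_I det_mul)
qed

lemma det_gram_pos:
  fixes B :: "complex ^ 'n \<Rightarrow> complex ^ 'n \<Rightarrow> real"
  assumes "inner_form B" shows "det (gram B) > 0"
proof -
  obtain f A :: "complex ^ 'n \<Rightarrow> complex ^ 'n" where f: "linear f" "linear A" "\<And>u v. B u v = A u \<bullet> A v" "\<And>u. A (f u) = u" "\<And>u. f (A u) = u"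
    using inner_form_frame_inverse[OF assms] by metis
  have "det (emat A) \<noteq> 0" using det_gram_frame(2)[OF f(1,2,5,4,3)] by force
  then show ?thesis using det_gram_frame(1)[OF f(1,2,5,4,3)] by simp
qed

text \<open>The entries of all powers of a contraction are bounded by 1, hence so are, up to a constant, the
  powers of its determinant.\<close>

lemma det_contraction:
  fixes M :: "real ^ 'm ^ 'm"
  assumes M: "\<And>x. norm (M *v x) \<le> norm x"
  shows "\<bar>det M\<bar> \<le> 1"
proof (rule ccontr)
  assume "\<not> \<bar>det M\<bar> \<le> 1"
  define P where "P k = ((\<lambda>N. M ** N) ^^ k) (mat 1)" for k
  have P: "norm (P k *v x) \<le> norm x" for k x
  proof (induction k)
    case 0 then show ?case by (simp add: P_def)
  next
    case (Suc k)
    have "P (Suc k) *v x = M *v (P k *v x)" by (simp add: P_def matrix_vector_mul_assoc)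
    then show ?case using M[of "P k *v x"] Suc by simp
  qed
  have dP: "det (P k) = det M ^ k" for k
    by (induction k) (simp_all add: P_def det_mul)
  have entry: "\<bar>P k $ i $ j\<bar> \<le> 1" for k i j
  proof -
    have "(P k *v axis j 1) $ i = P k $ i $ j"
      by (simp add: matrix_vector_mul_component inner_axis)
    then have "\<bar>P k $ i $ j\<bar> \<le> norm (P k *v axis j 1)" using component_le_norm_cart[of "P k *v axis j 1" i] by simp
    also have "\<dots> \<le> 1" using P[of k "axis j 1"] by (simp add: norm_axis_1)
    finally show ?thesis .
  qed
  have "\<bar>det (P k)\<bar> \<le> fact (CARD('m))" for k
  proof -
    have "\<bar>det (P k)\<bar> \<le> (\<Sum>p | p permutes (UNIV :: 'm set). \<bar>of_int (sign p) * (\<Prod>i\<in>UNIV. P k $ i $ p i)\<bar>)"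
      unfolding det_def by (rule sum_abs)
    also have "\<dots> \<le> (\<Sum>p | p permutes (UNIV :: 'm set). 1)"
    proof (rule sum_mono)
      fix p :: "'m \<Rightarrow> 'm"
      have "\<bar>of_int (sign p) * (\<Prod>i\<in>UNIV. P k $ i $ p i)\<bar> = (\<Prod>i\<in>UNIV. \<bar>P k $ i $ p i\<bar>)"
        by (simp add: abs_mult abs_prod sign_def)
      also have "\<dots> \<le> 1" by (intro prod_le_1) (use entry in auto)
      finally show "\<bar>of_int (sign p) * (\<Prod>i\<in>UNIV. P k $ i $ p i)\<bar> \<le> 1" .
    qed
    also have "\<dots> = fact (CARD('m))" using card_permutations[of "UNIV :: 'm set" "CARD('m)"] by simp
    finally show ?thesis .
  qed
  then have "\<bar>det M\<bar> ^ k \<le> fact (CARD('m))" for k unfolding dP by (simp add: power_abs)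
  moreover obtain k where "fact (CARD('m)) < \<bar>det M\<bar> ^ k" using real_arch_pow[of "\<bar>det M\<bar>"] \<open>\<not> \<bar>det M\<bar> \<le> 1\<close> by auto
  ultimately show False by (meson not_le)
qed

lemma emat_vector_norm:
  assumes C: "linear C" and le: "\<And>u. norm (C u) \<le> norm (u :: complex ^ 'n)"
  shows "norm (emat C *v x) \<le> norm x"
proof -
  define \<phi> where "\<phi> x = (\<Sum>p\<in>UNIV. (x $ p) *\<^sub>R EB p)" for x :: "real ^ ('n \<times> bool)"
  have \<phi>_EB: "\<phi> x \<bullet> EB p = x $ p" for x p
    unfolding \<phi>_def by (simp add: inner_sum_left EB_inner if_distrib cong: if_cong)
  have norm\<phi>: "norm (\<phi> x) = norm x" for x
  proof -
    have "\<phi> x \<bullet> \<phi> x = (\<Sum>p\<in>UNIV. (\<phi> x \<bullet> EB p) * (\<phi> x \<bullet> EB p))"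
      unfolding sum_EB[of "\<lambda>e. (\<phi> x \<bullet> e) * (\<phi> x \<bullet> e)"] by (rule euclidean_inner)
    also have "\<dots> = x \<bullet> x" unfolding \<phi>_EB by (simp add: inner_vec_def)
    finally show ?thesis by (simp add: norm_eq_sqrt_inner)
  qed
  have "\<phi> (emat C *v x) = C (\<phi> x)"
  proof -
    have "(emat C *v x) $ q = C (\<phi> x) \<bullet> EB q" for q
      unfolding \<phi>_def emat_def matrix_vector_mult_def using C
      by (simp add: linear_sum linear_cmul inner_sum_left inner_commute[of "EB q"] mult.commute)
    then have "\<phi> (emat C *v x) = (\<Sum>q\<in>UNIV. (C (\<phi> x) \<bullet> EB q) *\<^sub>R EB q)" unfolding \<phi>_def[of "emat C *v x"] by simp
    then show ?thesis unfolding sum_EB[of "\<lambda>e. (C (\<phi> x) \<bullet> e) *\<^sub>R e"] by (simp add: euclidean_representation)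
  qed
  then show ?thesis using le[of "\<phi> x"] norm\<phi> by metis
qed

text \<open>In orthonormal frames of the two forms the hypothesis says that the change of frame is a
  contraction, and \<open>det_contraction\<close> bounds its determinant.\<close>

lemma det_gram_mono:
  fixes B :: "complex ^ 'n \<Rightarrow> complex ^ 'n \<Rightarrow> real"
  assumes B: "inner_form B" and B': "inner_form B'" and le: "\<And>u. B u u \<le> B' u u"
  shows "det (gram B) \<le> det (gram B')"
proof -
  obtain f A :: "complex ^ 'n \<Rightarrow> complex ^ 'n" where f: "linear f" "linear A" "\<And>u v. B (f u) (f v) = u \<bullet> v" "\<And>u v. B u v = A u \<bullet> A v"
    "\<And>u. A (f u) = u" "\<And>u. f (A u) = u" by (rule inner_form_frame_inverse[OF B]) blast
  obtain k C :: "complex ^ 'n \<Rightarrow> complex ^ 'n" where k: "linear k" "linear C" "\<And>u v. B' (k u) (k v) = u \<bullet> v" "\<And>u v. B' u v = C u \<bullet> C v"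
    "\<And>u. C (k u) = u" "\<And>u. k (C u) = u" by (rule inner_form_frame_inverse[OF B']) blast
  have nm: "norm (A (k u)) \<le> norm u" for u
    using le[of "k u"] unfolding f(4) k(4) k(5) by (simp add: norm_le)
  have lin: "linear (\<lambda>u. A (k u))" using linear_compose[OF k(1) f(2)] unfolding o_def .
  have "\<bar>det (emat (\<lambda>u. A (k u)))\<bar> \<le> 1"
    by (rule det_contraction[OF emat_vector_norm[OF lin nm]])
  then have "\<bar>det (emat A) * det (emat k)\<bar> \<le> 1" unfolding emat_comp[OF f(2), of k] det_mul .
  then have 1: "(det (emat A) * det (emat k))\<^sup>2 \<le> 1" by (rule iffD2[OF abs_square_le_1])
  have 2: "det (emat C) * det (emat k) = 1" by (rule det_gram_frame(2)[OF k(1,2,6,5,4)])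
  have "(det (emat A))\<^sup>2 = (det (emat A))\<^sup>2 * (det (emat C) * det (emat k))\<^sup>2" unfolding 2 by simp
  also have "\<dots> = (det (emat A) * det (emat k))\<^sup>2 * (det (emat C))\<^sup>2" by (simp add: power_mult_distrib)
  also have "\<dots> \<le> 1 * (det (emat C))\<^sup>2" using 1 by (intro mult_right_mono) auto
  finally show ?thesis
    using det_gram_frame(1)[OF f(1,2,6,5,4)] det_gram_frame(1)[OF k(1,2,6,5,4)] by simp
qed

lemma det_gram_scale: "det (gram (\<lambda>u v. c * B u v)) = c ^ DIM(complex ^ 'n) * det (gram (B :: complex ^ 'n \<Rightarrow> complex ^ 'n \<Rightarrow> real))"
proof -
  have "gram (\<lambda>u v. c * B u v) = mat c ** gram B"
    unfolding gram_def mat_def matrix_matrix_mult_def by (simp add: vec_eq_iff if_distrib[of "\<lambda>x. x * _"] cong: if_cong)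
  moreover have "det (mat c :: real ^ ('n \<times> bool) ^ ('n \<times> bool)) = c ^ DIM(complex ^ 'n)"
    by (subst det_diagonal) (simp_all add: mat_def mult.commute)
  ultimately show ?thesis by (simp add: det_mul)
qed

lemma reflection_exchanges:
  fixes x y :: "'a::real_inner"
  assumes "norm x = norm y"
  obtains R :: "'a \<Rightarrow> 'a" where "linear R" "\<And>u v. R u \<bullet> R v = u \<bullet> v" "\<And>u. R (R u) = u" "R x = y"
proof -
  define a where "a = x - y"
  \<comment> \<open>Householder reflection along x - y; if x = y the quotient has denominator 0 and
    R is the identity.\<close>
  define R where "R u = u - (2 * (u \<bullet> a) / (a \<bullet> a)) *\<^sub>R a" for u
  have 1: "linear R" unfolding R_def by (intro linearI) (simp_all add: inner_simps add_divide_distrib algebra_simps)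
  have 2: "R u \<bullet> R v = u \<bullet> v" for u v
    unfolding R_def by (cases "a = 0") (simp_all add: inner_simps inner_commute field_simps)
  have 3: "R (R u) = u" for u
  proof (cases "a = 0")
    case False
    then have "R u \<bullet> a = - (u \<bullet> a)" unfolding R_def by (simp add: inner_simps)
    then show ?thesis unfolding R_def[of "R u"] by (simp add: R_def)
  qed (simp add: R_def)
  have 4: "R x = y"
  proof (cases "a = 0")
    case False
    have "x \<bullet> x = y \<bullet> y" using assms by (simp add: norm_eq)
    then have "2 * (x \<bullet> a) = a \<bullet> a" unfolding a_def by (simp add: inner_simps inner_commute)
    then show ?thesis unfolding R_def using False by (simp add: a_def)
  qed (simp add: R_def a_def)
  show thesis using that[OF 1 2 3 4] .
qed

text \<open>In a frame orthonormal for B with one axis along v, the perturbed form is diagonal, with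
  entry s on this axis and r on all others.\<close>

lemma det_gram_rank_one:
  fixes B :: "complex ^ 'n \<Rightarrow> complex ^ 'n \<Rightarrow> real"
  assumes B: "inner_form B" and t: "B v v = t" "t > 0"
  shows "det (gram (\<lambda>u w. r * B u w - (r - s) / t * (B u v * B w v))) = s * r ^ (DIM(complex ^ 'n) - 1) * det (gram B)"
proof -
  let ?C = "\<lambda>u w. r * B u w - (r - s) / t * (B u v * B w v)"
  obtain f A :: "complex ^ 'n \<Rightarrow> complex ^ 'n" where f: "linear f" "linear A" "\<And>u v. B (f u) (f v) = u \<bullet> v" "\<And>u v. B u v = A u \<bullet> A v"
    "\<And>u. A (f u) = u" "\<And>u. f (A u) = u" by (rule inner_form_frame_inverse[OF B]) blast
  define q :: "'n \<times> bool" where "q = undefined"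
  have "norm (EB q :: complex ^ 'n) = 1" using EB_inner[of q q] by (simp add: norm_eq_sqrt_inner)
  then have "norm (sqrt t *\<^sub>R (EB q :: complex ^ 'n)) = norm (A v)" using t f(4)[of v v] by (simp add: norm_eq_sqrt_inner)
  \<comment> \<open>The reflection turns one coordinate axis into the direction of v, so that k
    below is a frame adapted to v.\<close>
  then obtain R :: "complex ^ 'n \<Rightarrow> complex ^ 'n" where R: "linear R" "\<And>u v. R u \<bullet> R v = u \<bullet> v" "\<And>u. R (R u) = u" "R (sqrt t *\<^sub>R EB q) = A v"
    using reflection_exchanges by blast
  define k where "k u = f (R u)" for u
  have k: "linear k" unfolding k_def using linear_compose[OF R(1) f(1)] unfolding o_def .
  have Bk: "B (k u) (k w) = u \<bullet> w" for u w unfolding k_def f(3) R(2) ..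
  have Bv: "B (k u) v = sqrt t * (u \<bullet> EB q)" for u
  proof -
    have "v = k (sqrt t *\<^sub>R EB q)" unfolding k_def R(4) f(6) ..
    then show ?thesis using Bk[of u "sqrt t *\<^sub>R EB q"] by simp
  qed
  have bil: "bilinear B" using B_bil[OF B] .
  have bilC: "bilinear ?C"
    unfolding bilinear_def by (auto intro!: linearI simp: bilinear_ladd[OF bil] bilinear_radd[OF bil] bilinear_lmul[OF bil] bilinear_rmul[OF bil] algebra_simps add_divide_distrib diff_divide_distrib)
  have g: "gram (\<lambda>u w. ?C (k u) (k w)) = (\<chi> i j. if i = j then (if i = q then s else r) else 0)"
  proof -
    have "r * (EB i \<bullet> EB j) - (r - s) / t * (sqrt t * (EB i \<bullet> EB q) * (sqrt t * (EB j \<bullet> EB q)))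
        = (if i = j then (if i = q then s else r) else 0)" for i j :: "'n \<times> bool"
      unfolding EB_inner using t by (cases "i = q"; cases "j = q") auto
    then show ?thesis unfolding gram_def Bk Bv by (simp only: vec_eq_iff vec_lambda_beta) simp
  qed
  have "det (gram (\<lambda>u w. ?C (k u) (k w))) = (\<Prod>i\<in>UNIV. if i = q then s else r)"
    unfolding g by (subst det_diagonal) simp_all
  also have "\<dots> = s * (\<Prod>i\<in>UNIV - {q}. r)"
    by (subst prod.remove[of _ q]) (auto intro!: prod.cong)
  also have "\<dots> = s * r ^ (DIM(complex ^ 'n) - 1)" by (simp add: card_Diff_singleton mult.commute)
  finally have 1: "det (gram ?C) * (det (emat k))\<^sup>2 = s * r ^ (DIM(complex ^ 'n) - 1)"
    unfolding gram_comp[OF k bilC] by (simp add: det_mul det_transpose power2_eq_square mult_ac)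
  have "det (gram (\<lambda>u w. B (k u) (k w))) = 1"
    unfolding Bk gram_def using det_I by (simp add: EB_inner mat_def[symmetric])
  then have 2: "det (gram B) * (det (emat k))\<^sup>2 = 1"
    unfolding gram_comp[OF k bil] by (simp add: det_mul det_transpose power2_eq_square mult_ac)
  have "det (gram ?C) = det (gram ?C) * (det (emat k))\<^sup>2 * det (gram B)" using 2 by (simp add: mult_ac)
  then show ?thesis unfolding 1 .
qed

section \<open>Kaehler-Einstein metrics\<close>

abbreviation DD :: "'a::real_normed_vector \<Rightarrow> ('a \<Rightarrow> 'b::real_normed_vector) \<Rightarrow> 'a \<Rightarrow> 'b" where
  "DD w f z \<equiv> dir_deriv f z w"

lemma linear_dir_deriv: "f differentiable (at z) \<Longrightarrow> linear (\<lambda>w. DD w f z)"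
  using has_derivative_linear[OF has_derivative_dir_deriv] by blast

lemma dir_deriv_sum:
  assumes "\<And>i. i \<in> A \<Longrightarrow> f i differentiable (at z)"
  shows "dir_deriv (\<lambda>z. \<Sum>i\<in>A. f i z) z u = (\<Sum>i\<in>A. dir_deriv (f i) z u)"
  by (rule dir_deriv_eqI[OF has_derivative_sum]) (intro has_derivative_dir_deriv assms)

text \<open>A product rule for functions of y that enter both as parameter and as argument.
  Linearity in the argument reduces it to finitely many coordinate products, so F is differentiated
  only at fixed arguments.\<close>

lemma dir_deriv_family:
  fixes F :: "'a::real_normed_vector \<Rightarrow> 'b::euclidean_space \<Rightarrow> 'c::real_normed_vector"
  assumes S: "open S" "z \<in> S" and lin: "\<And>y. y \<in> S \<Longrightarrow> linear (F y)"
    and F: "\<And>x. (\<lambda>y. F y x) differentiable (at z)" and X: "X differentiable (at z)"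
  shows "DD w (\<lambda>y. F y (X y)) z = DD w (\<lambda>y. F y (X z)) z + F z (DD w X z)"
    "(\<lambda>y. F y (X y)) differentiable (at z)"
proof -
  have rep: "F y x = (\<Sum>e\<in>Basis. (x \<bullet> e) *\<^sub>R F y e)" if "y \<in> S" for y x
  proof -
    have "F y x = F y (\<Sum>e\<in>Basis. (x \<bullet> e) *\<^sub>R e)" by (simp add: euclidean_representation)
    then show ?thesis using lin[OF that] by (simp add: linear_sum linear_cmul)
  qed
  have Xd: "(\<lambda>y. X y \<bullet> e) differentiable (at z)" "DD w (\<lambda>y. X y \<bullet> e) z = DD w X z \<bullet> e" for e
    using dir_deriv_inner(1)[OF X, of "\<lambda>_. e" w] dir_deriv_inner(2)[OF X, of "\<lambda>_. e"] by (auto simp: dir_deriv_const)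
  have td: "(\<lambda>y. (X y \<bullet> e) *\<^sub>R F y e) differentiable (at z)"
    "DD w (\<lambda>y. (X y \<bullet> e) *\<^sub>R F y e) z = (X z \<bullet> e) *\<^sub>R DD w (\<lambda>y. F y e) z + (DD w X z \<bullet> e) *\<^sub>R F z e" for e
    using dir_deriv_scaleR(1)[OF Xd(1)[of e] F[of e], of w] dir_deriv_scaleR(2)[OF Xd(1)[of e] F[of e]] Xd(2)[of e] by auto
  let ?G = "\<lambda>y. \<Sum>e\<in>Basis. (X y \<bullet> e) *\<^sub>R F y e"
  have Gd: "?G differentiable (at z)" using td by (intro differentiable_sum) auto
  have G: "DD w ?G z = (\<Sum>e\<in>Basis. (X z \<bullet> e) *\<^sub>R DD w (\<lambda>y. F y e) z) + (\<Sum>e\<in>Basis. (DD w X z \<bullet> e) *\<^sub>R F z e)"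
    using dir_deriv_sum[of Basis "\<lambda>e y. (X y \<bullet> e) *\<^sub>R F y e"] td by (simp add: sum.distrib)
  let ?H = "\<lambda>y. \<Sum>e\<in>Basis. (X z \<bullet> e) *\<^sub>R F y e"
  have Hd: "?H differentiable (at z)" using F by (intro differentiable_sum ballI differentiable_scaleR) auto
  have H: "DD w ?H z = (\<Sum>e\<in>Basis. (X z \<bullet> e) *\<^sub>R DD w (\<lambda>y. F y e) z)"
  proof -
    have "DD w (\<lambda>y. (X z \<bullet> e) *\<^sub>R F y e) z = (X z \<bullet> e) *\<^sub>R DD w (\<lambda>y. F y e) z"
      "(\<lambda>y. (X z \<bullet> e) *\<^sub>R F y e) differentiable (at z)" for e
      using dir_deriv_scaleR(1)[OF differentiable_const[of "X z \<bullet> e"] F[of e], of w]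
        dir_deriv_scaleR(2)[OF differentiable_const[of "X z \<bullet> e"] F[of e]] by (auto simp: dir_deriv_const)
    then show ?thesis using dir_deriv_sum[of Basis "\<lambda>e y. (X z \<bullet> e) *\<^sub>R F y e"] by simp
  qed
  have 1: "DD w (\<lambda>y. F y (X y)) z = DD w ?G z" "(\<lambda>y. F y (X y)) differentiable (at z)"
    using dir_deriv_cong_open[OF S, of ?G "\<lambda>y. F y (X y)"] Gd rep by auto
  have 2: "DD w (\<lambda>y. F y (X z)) z = DD w ?H z"
    using dir_deriv_cong_open[OF S, of ?H "\<lambda>y. F y (X z)"] Hd rep by auto
  show "(\<lambda>y. F y (X y)) differentiable (at z)" by (rule 1)
  show "DD w (\<lambda>y. F y (X y)) z = DD w (\<lambda>y. F y (X z)) z + F z (DD w X z)"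
    unfolding 1(1) 2 G H rep[OF S(2), of "DD w X z"] by simp
qed

lemma smooth_on_family:
  fixes F :: "'a::real_normed_vector \<Rightarrow> 'b::euclidean_space \<Rightarrow> 'c::real_normed_vector"
  assumes S: "open S" and lin: "\<And>y. y \<in> S \<Longrightarrow> linear (F y)"
    and F: "\<And>x. smooth_on (\<lambda>y. F y x) S" and X: "smooth_on X S"
  shows "smooth_on (\<lambda>y. F y (X y)) S"
proof (rule smooth_on_cong[OF S])
  show "smooth_on (\<lambda>y. \<Sum>e\<in>Basis. (X y \<bullet> e) *\<^sub>R F y e) S"
    using S F X by (intro smooth_on_sum smooth_on_scaleR smooth_on_inner smooth_on_const)
  fix y assume "y \<in> S"
  have "F y (X y) = F y (\<Sum>e\<in>Basis. (X y \<bullet> e) *\<^sub>R e)" by (simp add: euclidean_representation)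
  then show "(\<Sum>e\<in>Basis. (X y \<bullet> e) *\<^sub>R F y e) = F y (X y)"
    using lin[OF \<open>y \<in> S\<close>] by (simp add: linear_sum linear_cmul)
qed

lemma smooth_on_det:
  fixes M :: "'a::real_normed_vector \<Rightarrow> real ^ 'm ^ 'm"
  assumes "open S" "\<And>i j. smooth_on (\<lambda>z. M z $ i $ j) S"
  shows "smooth_on (\<lambda>z. det (M z)) S"
  unfolding det_def by (intro smooth_on_sum smooth_on_mult smooth_on_const smooth_on_prod_real assms)

definition det_deriv :: "real ^ 'm ^ 'm \<Rightarrow> real ^ 'm ^ 'm \<Rightarrow> real" where
  "det_deriv A A' = (\<Sum>p\<in>{p. p permutes (UNIV :: 'm::finite set)}. of_int (sign p) *
     (\<Sum>i\<in>UNIV. A' $ i $ p i * (\<Prod>j\<in>UNIV - {i}. A $ j $ p j)))"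

lemma det_has_derivative:
  fixes A :: "real \<Rightarrow> real ^ 'm ^ 'm"
  assumes "\<And>i j. ((\<lambda>t. A t $ i $ j) has_field_derivative A' $ i $ j) (at t0)"
  shows "((\<lambda>t. det (A t)) has_field_derivative det_deriv (A t0) A') (at t0)"
  unfolding det_def det_deriv_def
proof (rule DERIV_sum)
  fix p
  have "((\<lambda>t. \<Prod>i\<in>UNIV. A t $ i $ p i) has_field_derivative
     (\<Sum>i\<in>UNIV. A' $ i $ p i * (\<Prod>j\<in>UNIV - {i}. A t0 $ j $ p j))) (at t0)"
    by (rule has_field_derivative_prod) (rule assms)
  then show "((\<lambda>t. of_int (sign p) * (\<Prod>i\<in>UNIV. A t $ i $ p i)) has_field_derivative
     of_int (sign p) * (\<Sum>i\<in>UNIV. A' $ i $ p i * (\<Prod>j\<in>UNIV - {i}. A t0 $ j $ p j))) (at t0)"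
    by (rule DERIV_cmult)
qed

text \<open>A permutation other than the identity moves at least two indices, so even after one
  factor is left out an off-diagonal entry of the identity matrix remains. Only the trace
  survives.\<close>

lemma det_deriv_mat_1: "det_deriv (mat 1) (C :: real ^ 'm ^ 'm) = (\<Sum>i\<in>UNIV. C $ i $ i)"
proof -
  have "(\<Prod>j\<in>UNIV - {i}. (mat 1 :: real ^ 'm ^ 'm) $ j $ p j) = (if p = id then 1 else 0)"
    if p: "p permutes UNIV" for p i
  proof (cases "p = id")
    case False
    have "\<exists>j. j \<noteq> i \<and> p j \<noteq> j"
    proof (rule ccontr)
      assume "\<not> ?thesis"
      then have fix_: "\<And>j. j \<noteq> i \<Longrightarrow> p j = j" by blast
      have "p i = i"
      proof (rule ccontr)
        assume "p i \<noteq> i"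
        then have "p (p i) = p i" by (rule fix_)
        then show False using permutes_inj[OF p] \<open>p i \<noteq> i\<close> by (meson injD)
      qed
      then have "p = id" using fix_ by (metis eq_id_iff)
      then show False using False by blast
    qed
    then obtain j where "j \<noteq> i" "p j \<noteq> j" by blast
    then have "\<exists>j\<in>UNIV - {i}. (mat 1 :: real ^ 'm ^ 'm) $ j $ p j = 0"
      by (intro bexI[of _ j]) (auto simp: mat_def)
    then show ?thesis using False by simp
  qed (simp add: mat_def)
  then have "det_deriv (mat 1) C = (\<Sum>p\<in>{p. p permutes (UNIV :: 'm set)}. if p = id then (\<Sum>i\<in>UNIV. C $ i $ i) else 0)"
    unfolding det_deriv_def by (intro sum.cong) (auto simp: sign_id)
  also have "\<dots> = (\<Sum>i\<in>UNIV. C $ i $ i)" by (simp add: permutes_id)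
  finally show ?thesis .
qed

lemma det_id_plus_has_derivative:
  "((\<lambda>t. det (mat 1 + t *\<^sub>R C)) has_field_derivative (\<Sum>i\<in>UNIV. C $ i $ i)) (at 0)"
proof -
  have "((\<lambda>t. det (mat 1 + t *\<^sub>R C)) has_field_derivative det_deriv (mat 1 + 0 *\<^sub>R C) C) (at 0)"
    by (rule det_has_derivative) (auto intro!: derivative_eq_intros)
  then show ?thesis by (simp add: det_deriv_mat_1)
qed

section \<open>The complex structure on complex space\<close>

definition J :: "complex ^ 'n \<Rightarrow> complex ^ 'n" where "J v = \<i> *s v"

lemma linear_J: "linear J"
  unfolding J_def by (intro linearI) (simp_all add: vec_eq_iff scaleR_conv_of_real algebra_simps)

lemma bounded_linear_J: "bounded_linear J"
  using linear_J by (rule linear_conv_bounded_linear[THEN iffD1])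

lemma J_J [simp]: "J (J v) = - v"
  unfolding J_def by (simp add: vec_eq_iff)

lemmas J_simps = linear_add[OF linear_J] linear_diff[OF linear_J] linear_neg[OF linear_J] linear_cmul[OF linear_J]
  linear_0[OF linear_J]

lemma J_inner: "J u \<bullet> v = - (u \<bullet> J v)"
  unfolding J_def inner_vec_def by (simp add: inner_complex_def sum_negf[symmetric])

lemma norm_J [simp]: "norm (J v) = norm v"
  by (simp add: norm_eq_sqrt_inner J_inner)

section \<open>The Levi-Civita connection in coordinates\<close>

locale riemannian_open =
  fixes \<Omega> :: "(complex ^ 'n) set" and g :: "complex ^ 'n \<Rightarrow> complex ^ 'n \<Rightarrow> complex ^ 'n \<Rightarrow> real"
  assumes open_\<Omega>: "open \<Omega>" and riem: "riemannian_metric_on \<Omega> g"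
begin

abbreviation "\<Gamma> \<equiv> levi_civita g"
abbreviation "dg z w u v \<equiv> DD w (\<lambda>y. g y u v) z"

lemma form: "z \<in> \<Omega> \<Longrightarrow> inner_form (g z)"
  using riem unfolding riemannian_metric_on_def inner_form_def by blast

lemma smooth_g: "smooth_on (\<lambda>z. g z u v) \<Omega>"
  using riem unfolding riemannian_metric_on_def by blast

lemma g_diff: "z \<in> \<Omega> \<Longrightarrow> (\<lambda>y. g y u v) differentiable (at z)"
  using smooth_on_differentiable smooth_g by blast

lemma bil: "z \<in> \<Omega> \<Longrightarrow> bilinear (g z)"
  using form unfolding inner_form_def by blast

lemma gsym: "z \<in> \<Omega> \<Longrightarrow> g z u v = g z v u"
  using form unfolding inner_form_def by blast

lemma g_lin: "z \<in> \<Omega> \<Longrightarrow> linear (g z u)" "z \<in> \<Omega> \<Longrightarrow> linear (\<lambda>u. g z u v)"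
  using bil unfolding bilinear_def by auto

lemma dg_sym: assumes "z \<in> \<Omega>" shows "dg z w u v = dg z w v u"
  by (rule dir_deriv_cong_open(1)[OF open_\<Omega> assms _ g_diff[OF assms]]) (rule gsym)

lemma linear_dg1: "z \<in> \<Omega> \<Longrightarrow> linear (\<lambda>w. dg z w u v)"
  using linear_dir_deriv[OF g_diff] .

lemma linear_dg2: assumes z: "z \<in> \<Omega>" shows "linear (\<lambda>u. dg z w u v)"
proof (rule linearI)
  fix x y
  have "dg z w (x + y) v = DD w (\<lambda>z. g z x v + g z y v) z"
    using g_diff[OF z]
    by (intro dir_deriv_cong_open(1)[OF open_\<Omega> z]) (auto simp: bilinear_ladd[OF bil])
  then show "dg z w (x + y) v = dg z w x v + dg z w y v"
    using dir_deriv_add[OF g_diff[OF z] g_diff[OF z]] by simp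
next
  fix r x
  have "dg z w (r *\<^sub>R x) v = DD w (\<lambda>z. r *\<^sub>R g z x v) z"
    using g_diff[OF z]
    by (intro dir_deriv_cong_open(1)[OF open_\<Omega> z]) (auto simp: bilinear_lmul[OF bil])
  also have "\<dots> = r *\<^sub>R dg z w x v"
    using dir_deriv_bounded_linear[OF bounded_linear_scaleR_right g_diff[OF z]] .
  finally show "dg z w (r *\<^sub>R x) v = r *\<^sub>R dg z w x v" .
qed

lemma linear_dg3: assumes z: "z \<in> \<Omega>" shows "linear (\<lambda>v. dg z w u v)"
proof -
  have "(\<lambda>v. dg z w u v) = (\<lambda>v. dg z w v u)" using dg_sym[OF z] by blast
  then show ?thesis using linear_dg2[OF z] by metis
qed

text \<open>Cramer's rule writes the coordinates of the dual vector as quotients of determinants in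
  the entries of g.\<close>

lemma smooth_sharp: "smooth_on (\<lambda>z. sharp (g z) a) \<Omega>"
proof (rule smooth_on_cong[OF open_\<Omega>])
  let ?x = "\<lambda>z k. det (\<chi> i j. if j = k then a \<bullet> EB i else gram (g z) $ i $ j) / det (gram (g z))"
  have gr: "smooth_on (\<lambda>z. gram (g z) $ i $ j) \<Omega>" for i j
    unfolding gram_def using smooth_g by simp
  have "smooth_on (\<lambda>z. ?x z k) \<Omega>" for k
  proof (intro smooth_on_divide smooth_on_det open_\<Omega> gr)
    show "smooth_on (\<lambda>z. (\<chi> i j. if j = k then a \<bullet> EB i else gram (g z) $ i $ j) $ i $ j) \<Omega>" for i j
      using gr smooth_on_const by (cases "j = k") auto
    show "det (gram (g z)) \<noteq> 0" if "z \<in> \<Omega>" for z using det_gram_pos[OF form[OF that]] by simp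
  qed
  then show "smooth_on (\<lambda>z. \<Sum>k\<in>UNIV. ?x z k *\<^sub>R EB k) \<Omega>"
    by (intro smooth_on_sum smooth_on_scaleR smooth_on_const open_\<Omega>)
  fix z assume z: "z \<in> \<Omega>"
  let ?s = "sharp (g z) a"
  let ?y = "\<chi> k. ?s \<bullet> EB k"
  have s: "?s = (\<Sum>k\<in>UNIV. (?s \<bullet> EB k) *\<^sub>R EB k)"
    unfolding sum_EB[of "\<lambda>e. (?s \<bullet> e) *\<^sub>R e"] by (simp add: euclidean_representation)
  have "gram (g z) *v ?y = (\<chi> i. a \<bullet> EB i)"
  proof -
    have "(\<Sum>j\<in>UNIV. g z (EB i) (EB j) * (?s \<bullet> EB j)) = a \<bullet> EB i" for i
    proof -
      have "a \<bullet> EB i = g z (EB i) ?s" using sharp[OF form[OF z], of a "EB i"] gsym[OF z] by simp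
      also have "\<dots> = (\<Sum>j\<in>UNIV. (?s \<bullet> EB j) * g z (EB i) (EB j))"
        by (subst (1) s) (simp add: linear_sum[OF g_lin(1)[OF z]] linear_cmul[OF g_lin(1)[OF z]])
      finally show ?thesis by (simp add: mult.commute)
    qed
    then show ?thesis unfolding matrix_vector_mult_def gram_def by (simp add: vec_eq_iff)
  qed
  then have "?y = (\<chi> k. det (\<chi> i j. if j = k then (\<chi> i. a \<bullet> EB i) $ i else gram (g z) $ i $ j) / det (gram (g z)))"
    using cramer[of "gram (g z)" ?y "\<chi> i. a \<bullet> EB i"] det_gram_pos[OF form[OF z]] by simp
  then have "?y $ k = ?x z k" for k by (simp only: vec_lambda_beta)
  then have "?s \<bullet> EB k = ?x z k" for k by (simp only: vec_lambda_beta)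
  then show "(\<Sum>k\<in>UNIV. ?x z k *\<^sub>R EB k) = ?s" using s by simp
qed

lemma sharp_diff: "z \<in> \<Omega> \<Longrightarrow> (\<lambda>y. sharp (g y) a) differentiable (at z)"
  using smooth_on_differentiable smooth_sharp by blast

text \<open>Resolves the definite description in \<open>levi_civita\<close>: the right-hand side of
  the Koszul formula is linear in the test vector, hence a covector, and its dual vector depends
  smoothly on z.\<close>

lemma levi_civita_eq_sharp:
  assumes z: "z \<in> \<Omega>"
  shows "\<Gamma> z u v = sharp (g z) (\<Sum>e\<in>Basis. (1/2 * (dg z u v e + dg z v u e - dg z e u v)) *\<^sub>R e)"
proof -
  let ?R = "\<lambda>w. 1/2 * (dg z u v w + dg z v u w - dg z w u v)"
  have lin: "linear ?R"
  proof (rule linearI)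
    show "?R (x + y) = ?R x + ?R y" for x y
      by (simp add: linear_add[OF linear_dg3[OF z]] linear_add[OF linear_dg1[OF z]] field_simps)
    show "?R (r *\<^sub>R x) = r *\<^sub>R ?R x" for r x
      by (simp add: linear_cmul[OF linear_dg3[OF z]] linear_cmul[OF linear_dg1[OF z]] algebra_simps)
  qed
  define K where "K = (\<Sum>e\<in>Basis. ?R e *\<^sub>R e)"
  have R: "?R w = K \<bullet> w" for w
  proof -
    have "?R w = ?R (\<Sum>e\<in>Basis. (w \<bullet> e) *\<^sub>R e)" by (simp only: euclidean_representation)
    also have "\<dots> = (\<Sum>e\<in>Basis. (w \<bullet> e) *\<^sub>R ?R e)" by (simp only: linear_sum[OF lin] linear_cmul[OF lin])
    finally show ?thesis unfolding K_def inner_sum_left inner_scaleR_left by (simp add: inner_commute mult.commute)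
  qed
  have "\<Gamma> z u v = sharp (g z) K" unfolding levi_civita_def sharp_def R ..
  then show ?thesis unfolding K_def .
qed

lemma koszul:
  assumes z: "z \<in> \<Omega>"
  shows "2 * g z (\<Gamma> z u v) w = dg z u v w + dg z v u w - dg z w u v"
proof -
  let ?R = "\<lambda>w. 1/2 * (dg z u v w + dg z v u w - dg z w u v)"
  have lin: "linear ?R"
  proof (rule linearI)
    show "?R (x + y) = ?R x + ?R y" for x y
      by (simp add: linear_add[OF linear_dg3[OF z]] linear_add[OF linear_dg1[OF z]] field_simps)
    show "?R (r *\<^sub>R x) = r *\<^sub>R ?R x" for r x
      by (simp add: linear_cmul[OF linear_dg3[OF z]] linear_cmul[OF linear_dg1[OF z]] algebra_simps)
  qed
  have "?R w = ?R (\<Sum>e\<in>Basis. (w \<bullet> e) *\<^sub>R e)" by (simp only: euclidean_representation)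
  also have "\<dots> = (\<Sum>e\<in>Basis. (w \<bullet> e) *\<^sub>R ?R e)" by (simp only: linear_sum[OF lin] linear_cmul[OF lin])
  also have "\<dots> = (\<Sum>e\<in>Basis. ?R e *\<^sub>R e) \<bullet> w"
    unfolding inner_sum_left inner_scaleR_left by (simp add: inner_commute mult.commute)
  also have "\<dots> = g z (\<Gamma> z u v) w" unfolding levi_civita_eq_sharp[OF z] by (rule sharp[OF form[OF z], symmetric])
  finally show ?thesis by simp
qed

lemma \<Gamma>_sym: assumes z: "z \<in> \<Omega>" shows "\<Gamma> z u v = \<Gamma> z v u"
proof (rule B_eqI[OF form[OF z]])
  show "g z (\<Gamma> z u v) w = g z (\<Gamma> z v u) w" for w
    using koszul[OF z, of u v w] koszul[OF z, of v u w] dg_sym[OF z, of u v w] by simp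
qed

lemma \<Gamma>_lin: assumes z: "z \<in> \<Omega>" shows "linear (\<Gamma> z u)"
proof (rule linearI)
  note l = linear_dg1[OF z] linear_dg2[OF z] linear_dg3[OF z]
  note gl = g_lin(2)[OF z]
  fix x y
  show "\<Gamma> z u (x + y) = \<Gamma> z u x + \<Gamma> z u y"
  proof (rule B_eqI[OF form[OF z]])
    fix w
    have "2 * g z (\<Gamma> z u (x + y)) w = 2 * g z (\<Gamma> z u x) w + 2 * g z (\<Gamma> z u y) w"
      unfolding koszul[OF z] by (simp add: linear_add[OF l(1)] linear_add[OF l(2)] linear_add[OF l(3)])
    then show "g z (\<Gamma> z u (x + y)) w = g z (\<Gamma> z u x + \<Gamma> z u y) w" by (simp add: linear_add[OF gl])
  qed
next
  note l = linear_dg1[OF z] linear_dg2[OF z] linear_dg3[OF z]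
  note gl = g_lin(2)[OF z]
  fix r x
  show "\<Gamma> z u (r *\<^sub>R x) = r *\<^sub>R \<Gamma> z u x"
  proof (rule B_eqI[OF form[OF z]])
    fix w
    have "2 * g z (\<Gamma> z u (r *\<^sub>R x)) w = r * (2 * g z (\<Gamma> z u x) w)"
      unfolding koszul[OF z] by (simp add: linear_cmul[OF l(1)] linear_cmul[OF l(2)] linear_cmul[OF l(3)] algebra_simps)
    then show "g z (\<Gamma> z u (r *\<^sub>R x)) w = g z (r *\<^sub>R \<Gamma> z u x) w" by (simp add: linear_cmul[OF gl])
  qed
qed

lemma \<Gamma>_lin_left: assumes z: "z \<in> \<Omega>" shows "linear (\<lambda>u. \<Gamma> z u v)"
proof -
  have "(\<lambda>u. \<Gamma> z u v) = \<Gamma> z v" using \<Gamma>_sym[OF z] by blast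
  then show ?thesis using \<Gamma>_lin[OF z] by simp
qed

lemma metric_compat:
  assumes z: "z \<in> \<Omega>"
  shows "dg z w u v = g z (\<Gamma> z w u) v + g z u (\<Gamma> z w v)"
proof -
  have "2 * dg z w u v = 2 * g z (\<Gamma> z w u) v + 2 * g z (\<Gamma> z w v) u"
    unfolding koszul[OF z] using dg_sym[OF z, of w u v] dg_sym[OF z, of v w u] dg_sym[OF z, of u v w]
      dg_sym[OF z, of w v u] by simp
  then show ?thesis using gsym[OF z, of u] by simp
qed

lemma smooth_dg: "smooth_on (\<lambda>z. dg z w u v) \<Omega>"
  using smooth_g smooth_on_dir_deriv by blast

lemma smooth_\<Gamma>: "smooth_on (\<lambda>z. \<Gamma> z u v) \<Omega>"
proof (rule smooth_on_cong[OF open_\<Omega>])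
  show "smooth_on (\<lambda>z. sharp (g z) (\<Sum>e\<in>Basis. (1/2 * (dg z u v e + dg z v u e - dg z e u v)) *\<^sub>R e)) \<Omega>"
  proof (rule smooth_on_family[OF open_\<Omega>, of "\<lambda>z. sharp (g z)"])
    show "smooth_on (\<lambda>z. \<Sum>e\<in>Basis. (1/2 * (dg z u v e + dg z v u e - dg z e u v)) *\<^sub>R e) \<Omega>"
    proof (rule smooth_on_sum[OF open_\<Omega>])
      fix e :: "complex ^ 'n"
      have "smooth_on (\<lambda>z. dg z u v e + dg z v u e - dg z e u v) \<Omega>"
        by (rule smooth_on_diff[OF open_\<Omega> smooth_on_add[OF open_\<Omega> smooth_dg smooth_dg] smooth_dg])
      from smooth_on_scaleR[OF open_\<Omega> smooth_on_cmult[OF open_\<Omega> this] smooth_on_const]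
      show "smooth_on (\<lambda>z. (1/2 * (dg z u v e + dg z v u e - dg z e u v)) *\<^sub>R e) \<Omega>" .
    qed
  qed (auto simp: linear_sharp form smooth_sharp)
qed (simp add: levi_civita_eq_sharp)

lemma \<Gamma>_diff: "z \<in> \<Omega> \<Longrightarrow> (\<lambda>y. \<Gamma> y u v) differentiable (at z)"
  using smooth_on_differentiable smooth_\<Gamma> by blast

lemma DD_g:
  assumes z: "z \<in> \<Omega>" and X: "X differentiable (at z)" "Y differentiable (at z)"
  shows "DD w (\<lambda>y. g y (X y) (Y y)) z = dg z w (X z) (Y z) + g z (DD w X z) (Y z) + g z (X z) (DD w Y z)"
    "(\<lambda>y. g y (X y) (Y y)) differentiable (at z)"
proof -
  have f1: "DD w (\<lambda>y. g y (X y) v) z = dg z w (X z) v + g z (DD w X z) v"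
    "(\<lambda>y. g y (X y) v) differentiable (at z)" for v
    using dir_deriv_family(1)[OF open_\<Omega> z, of "\<lambda>y u. g y u v" X w, OF g_lin(2) g_diff[OF z] X(1)]
      dir_deriv_family(2)[OF open_\<Omega> z, of "\<lambda>y u. g y u v" X, OF g_lin(2) g_diff[OF z] X(1)] by auto
  show "DD w (\<lambda>y. g y (X y) (Y y)) z = dg z w (X z) (Y z) + g z (DD w X z) (Y z) + g z (X z) (DD w Y z)"
    "(\<lambda>y. g y (X y) (Y y)) differentiable (at z)"
    using f1(1)[of "Y z"] dir_deriv_family(1)[OF open_\<Omega> z, of "\<lambda>y v. g y (X y) v" Y w, OF g_lin(1) f1(2) X(2)]
      dir_deriv_family(2)[OF open_\<Omega> z, of "\<lambda>y v. g y (X y) v" Y, OF g_lin(1) f1(2) X(2)] by auto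
qed

lemma DD_\<Gamma>:
  assumes z: "z \<in> \<Omega>" and X: "X differentiable (at z)"
  shows "DD w (\<lambda>y. \<Gamma> y u (X y)) z = DD w (\<lambda>y. \<Gamma> y u (X z)) z + \<Gamma> z u (DD w X z)"
    "(\<lambda>y. \<Gamma> y u (X y)) differentiable (at z)"
  using dir_deriv_family(1)[OF open_\<Omega> z, of "\<lambda>y v. \<Gamma> y u v" X w, OF \<Gamma>_lin \<Gamma>_diff[OF z] X]
    dir_deriv_family(2)[OF open_\<Omega> z, of "\<lambda>y v. \<Gamma> y u v" X, OF \<Gamma>_lin \<Gamma>_diff[OF z] X] by auto

definition \<psi> :: "complex ^ 'n \<Rightarrow> real" where "\<psi> z = ln (det (gram (g z)))"

lemma smooth_\<psi>: "smooth_on \<psi> \<Omega>"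
  unfolding \<psi>_def
proof (intro smooth_on_ln smooth_on_det open_\<Omega>)
  show "smooth_on (\<lambda>z. gram (g z) $ i $ j) \<Omega>" for i j unfolding gram_def using smooth_g by simp
qed (use det_gram_pos form in auto)

text \<open>By metric compatibility the Gram matrix of g along z + t w has the same first derivative
  at t = 0 as that of g z pulled back by id + t * \<open>\<Gamma> z w\<close>. The pullback has
  determinant det (1 + t C)^2 times that of g z, whose logarithmic derivative is twice the trace of
  C.\<close>

lemma DD_\<psi>:
  assumes z: "z \<in> \<Omega>"
  shows "DD w \<psi> z = 2 * (\<Sum>e\<in>Basis. \<Gamma> z w e \<bullet> e)"
proof -
  let ?M = "\<lambda>y. gram (g y)"
  define C where "C = emat (\<Gamma> z w)"
  define M' where "M' = (\<chi> i j. dg z w (EB i) (EB j))"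
  have tr: "(\<Sum>i\<in>UNIV. C $ i $ i) = (\<Sum>e\<in>Basis. \<Gamma> z w e \<bullet> e)"
    unfolding C_def emat_def using sum_EB[of "\<lambda>e. \<Gamma> z w e \<bullet> e"] by (simp add: inner_commute)
  have "((\<lambda>t. det (?M (z + t *\<^sub>R w))) has_field_derivative det_deriv (?M (z + 0 *\<^sub>R w)) M') (at 0)"
  proof (rule det_has_derivative)
    fix i j
    have "((\<lambda>t. g (z + t *\<^sub>R w) (EB i) (EB j)) has_field_derivative dg (z + 0 *\<^sub>R w) w (EB i) (EB j)) (at 0)"
      using g_diff[OF z] by (intro line_has_field_derivative) auto
    then show "((\<lambda>t. ?M (z + t *\<^sub>R w) $ i $ j) has_field_derivative M' $ i $ j) (at 0)"
      unfolding gram_def M'_def by simp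
  qed
  then have 1: "((\<lambda>t. det (?M (z + t *\<^sub>R w))) has_field_derivative det_deriv (?M z) M') (at 0)" by simp
  define f where "f t u = u + t *\<^sub>R \<Gamma> z w u" for t u
  have lf: "linear (f t)" for t unfolding f_def
    by (intro linearI) (simp_all add: linear_add[OF \<Gamma>_lin[OF z]] linear_cmul[OF \<Gamma>_lin[OF z]] algebra_simps)
  have emf: "emat (f t) = mat 1 + t *\<^sub>R C" for t
    unfolding f_def emat_def C_def mat_def by (simp add: vec_eq_iff inner_simps EB_inner)
  define N where "N t = gram (\<lambda>u v. g z (f t u) (f t v))" for t
  have "((\<lambda>t. det (N t)) has_field_derivative det_deriv (N 0) M') (at 0)"
  proof (rule det_has_derivative)
    fix i j
    note gb = linear_add[OF g_lin(1)[OF z]] linear_add[OF g_lin(2)[OF z]] linear_cmul[OF g_lin(1)[OF z]] linear_cmul[OF g_lin(2)[OF z]]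
    let ?c = "g z (\<Gamma> z w (EB i)) (\<Gamma> z w (EB j))"
    have "N t $ i $ j = g z (EB i) (EB j) + t * M' $ i $ j + t * t * ?c" for t
      unfolding N_def gram_def f_def M'_def using metric_compat[OF z]
      by (simp add: gb algebra_simps)
    moreover have "((\<lambda>t. g z (EB i) (EB j) + t * M' $ i $ j + t * t * ?c) has_field_derivative M' $ i $ j) (at 0)"
      by (auto intro!: derivative_eq_intros)
    ultimately show "((\<lambda>t. N t $ i $ j) has_field_derivative M' $ i $ j) (at 0)" by simp
  qed
  moreover have "N 0 = ?M z" unfolding N_def f_def by simp
  moreover have "det (N t) = (det (mat 1 + t *\<^sub>R C))\<^sup>2 * det (?M z)" for t
    unfolding N_def gram_comp[OF lf bil[OF z]] emf by (simp add: det_mul det_transpose power2_eq_square)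
  moreover have "((\<lambda>t. (det (mat 1 + t *\<^sub>R C))\<^sup>2 * det (?M z)) has_field_derivative
      2 * (\<Sum>i\<in>UNIV. C $ i $ i) * det (?M z)) (at 0)"
    by (auto intro!: derivative_eq_intros det_id_plus_has_derivative simp: det_I)
  ultimately have "det_deriv (?M z) M' = 2 * (\<Sum>i\<in>UNIV. C $ i $ i) * det (?M z)"
    by (simp only: DERIV_unique)
  then have 2: "((\<lambda>t. det (?M (z + t *\<^sub>R w))) has_field_derivative 2 * (\<Sum>e\<in>Basis. \<Gamma> z w e \<bullet> e) * det (?M z)) (at 0)"
    using 1 tr by simp
  have pos: "det (?M z) > 0" using det_gram_pos form[OF z] by blast
  have "((\<lambda>t. \<psi> (z + t *\<^sub>R w)) has_field_derivative 2 * (\<Sum>e\<in>Basis. \<Gamma> z w e \<bullet> e)) (at 0)"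
    unfolding \<psi>_def using pos by (auto intro!: derivative_eq_intros 2)
  moreover have "((\<lambda>t. \<psi> (z + t *\<^sub>R w)) has_field_derivative DD w \<psi> (z + 0 *\<^sub>R w)) (at 0)"
    using smooth_on_differentiable[OF smooth_\<psi> z] by (intro line_has_field_derivative) auto
  ultimately show ?thesis using DERIV_unique by fastforce
qed

lemma trace_DD_\<Gamma>:
  assumes z: "z \<in> \<Omega>"
  shows "(\<Sum>e\<in>Basis. DD v (\<lambda>y. \<Gamma> y e w) z \<bullet> e) = 1/2 * DD v (DD w \<psi>) z"
proof -
  have d: "(\<lambda>y. \<Gamma> y e w \<bullet> e) differentiable (at z)" "DD v (\<lambda>y. \<Gamma> y e w \<bullet> e) z = DD v (\<lambda>y. \<Gamma> y e w) z \<bullet> e" for e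
    using dir_deriv_inner(1)[OF \<Gamma>_diff[OF z, of e w] differentiable_const[of e], of v]
      dir_deriv_inner(2)[OF \<Gamma>_diff[OF z, of e w] differentiable_const[of e]] by (auto simp: dir_deriv_const)
  have "(\<Sum>e\<in>Basis. DD v (\<lambda>y. \<Gamma> y e w) z \<bullet> e) = DD v (\<lambda>y. \<Sum>e\<in>Basis. \<Gamma> y e w \<bullet> e) z"
    using dir_deriv_sum[of Basis "\<lambda>e y. \<Gamma> y e w \<bullet> e" z v] d by simp
  also have "\<dots> = DD v (\<lambda>y. 1/2 * DD w \<psi> y) z"
  proof (rule dir_deriv_cong_open(1)[OF open_\<Omega> z, symmetric])
    show "(\<Sum>e\<in>Basis. \<Gamma> y e w \<bullet> e) = 1/2 * DD w \<psi> y" if "y \<in> \<Omega>" for y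
      unfolding DD_\<psi>[OF that] using \<Gamma>_sym[OF that] by simp
  qed (use d in \<open>auto intro!: differentiable_sum\<close>)
  also have "\<dots> = 1/2 * DD v (DD w \<psi>) z"
    using dir_deriv_bounded_linear[OF bounded_linear_mult_right]
      smooth_on_differentiable[OF smooth_on_dir_deriv[OF smooth_\<psi>] z] by blast
  finally show ?thesis .
qed

end

section \<open>Christoffel symbols of Kaehler metrics\<close>

locale kaehler_open = riemannian_open \<Omega> g for \<Omega> :: "(complex ^ 'n) set" and g +
  assumes kaehler: "kaehler_metric_on \<Omega> g"
begin

lemma g_J: "z \<in> \<Omega> \<Longrightarrow> g z (J u) (J v) = g z u v"
  using kaehler unfolding kaehler_metric_on_def J_def by blast

lemma g_J_skew: "z \<in> \<Omega> \<Longrightarrow> g z (J u) v = - g z u (J v)"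
  using g_J[of z u "J v"] linear_neg[OF g_lin(1), of z "J u" v] by simp

lemma dg_J: assumes z: "z \<in> \<Omega>" shows "dg z w (J u) (J v) = dg z w u v"
  by (rule dir_deriv_cong_open(1)[OF open_\<Omega> z _ g_diff[OF z]]) (simp add: g_J)

lemma dg_J_skew: assumes z: "z \<in> \<Omega>" shows "dg z w (J u) v = - dg z w u (J v)"
  using dg_J[OF z, of u "J v" w] linear_neg[OF linear_dg3[OF z], of "J u" v w] by simp

lemma closed: "z \<in> \<Omega> \<Longrightarrow> dg z u (J v) w + dg z v (J w) u + dg z w (J u) v = 0"
  using kaehler unfolding kaehler_metric_on_def fundamental_form_def J_def by blast

text \<open>In coordinates this says that J is parallel. Closedness of the fundamental form is used
  at (x, v, w) and at (v, J w, J x); inserted into the Koszul formula, the two identities together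
  cancel every derivative of g.\<close>

lemma \<Gamma>_J: assumes z: "z \<in> \<Omega>" shows "\<Gamma> z v (J w) = J (\<Gamma> z v w)"
proof (rule B_eqI[OF form[OF z]])
  fix x
  note neg = linear_neg[OF linear_dg1[OF z]] linear_neg[OF linear_dg2[OF z]] linear_neg[OF linear_dg3[OF z]]
  have c1: "dg z x (J v) w + dg z v (J w) x + dg z w (J x) v = 0" by (rule closed[OF z])
  have c2: "dg z v (J (J w)) (J x) + dg z (J w) (J (J x)) v + dg z (J x) (J v) (J w) = 0" by (rule closed[OF z])
  have c3: "dg z v (J (J w)) (J x) = dg z v (J w) x" by (rule dg_J[OF z])
  have c4: "dg z (J w) (J (J x)) v = - dg z (J w) v x" using dg_sym[OF z, of v x "J w"] by (simp add: neg)
  have c5: "dg z (J x) (J v) (J w) = dg z (J x) v w" by (rule dg_J[OF z])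
  have "2 * g z (\<Gamma> z v (J w)) x + 2 * g z (\<Gamma> z v w) (J x) = 0"
    unfolding koszul[OF z]
    using c1 c2 c3 c4 c5 dg_J_skew[OF z, of w x v] dg_J_skew[OF z, of v w x] dg_sym[OF z, of v "J x" w]
    by simp
  then show "g z (\<Gamma> z v (J w)) x = g z (J (\<Gamma> z v w)) x" using g_J_skew[OF z, of "\<Gamma> z v w" x] by simp
qed

lemma \<Gamma>_J_left: assumes z: "z \<in> \<Omega>" shows "\<Gamma> z (J v) w = J (\<Gamma> z v w)"
  using \<Gamma>_J[OF z, of w v] \<Gamma>_sym[OF z] by simp

lemma \<Gamma>_J_J: assumes z: "z \<in> \<Omega>" shows "\<Gamma> z (J v) (J w) = - \<Gamma> z v w"
  using \<Gamma>_J[OF z, of "J v" w] \<Gamma>_J_left[OF z, of v w] by simp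

end

section \<open>The Einstein equation as an equation for \<psi>\<close>

locale kaehler_einstein_open = kaehler_open \<Omega> g for \<Omega> :: "(complex ^ 'n) set" and g +
  assumes einstein: "z \<in> \<Omega> \<Longrightarrow> ricci_curvature g z v w = - g z v w"
begin

lemma ricci_eq:
  assumes z: "z \<in> \<Omega>"
  shows "ricci_curvature g z v w = (\<Sum>e\<in>Basis. DD e (\<lambda>y. \<Gamma> y v w) z \<bullet> e) + 1/2 * DD (\<Gamma> z v w) \<psi> z
    - 1/2 * DD v (DD w \<psi>) z - (\<Sum>e\<in>Basis. \<Gamma> z v (\<Gamma> z e w) \<bullet> e)"
proof -
  have 1: "(\<Sum>e\<in>Basis. \<Gamma> z e (\<Gamma> z v w) \<bullet> e) = 1/2 * DD (\<Gamma> z v w) \<psi> z"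
    unfolding DD_\<psi>[OF z] using \<Gamma>_sym[OF z] by simp
  have 2: "(\<Sum>e\<in>Basis. DD v (\<lambda>y. \<Gamma> y e w) z \<bullet> e) = 1/2 * DD v (DD w \<psi>) z"
    by (rule trace_DD_\<Gamma>[OF z])
  show ?thesis
    unfolding ricci_curvature_def riemann_curvature_def 1[symmetric] 2[symmetric]
    by (simp add: inner_simps sum.distrib sum_subtractf)
qed

text \<open>\<Gamma> is complex linear in both slots, so rotating both arguments by J changes the
  sign of every term of the Ricci tensor except the Hessian of \<psi>. Adding the rotated tensor
  leaves the J-invariant part of this Hessian, the classical potential of the Ricci form.\<close>

lemma hessian_\<psi>:
  assumes z: "z \<in> \<Omega>"
  shows "DD v (DD w \<psi>) z + DD (J v) (DD (J w) \<psi>) z = 4 * g z v w"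
proof -
  have d\<psi>: "\<psi> differentiable (at z)" using smooth_on_differentiable[OF smooth_\<psi> z] .
  have 1: "DD e (\<lambda>y. \<Gamma> y (J v) (J w)) z = - DD e (\<lambda>y. \<Gamma> y v w) z" for e
  proof -
    have "DD e (\<lambda>y. \<Gamma> y (J v) (J w)) z = DD e (\<lambda>y. - \<Gamma> y v w) z"
      using \<Gamma>_J_J \<Gamma>_diff[OF z] by (intro dir_deriv_cong_open(1)[OF open_\<Omega> z]) auto
    also have "\<dots> = - DD e (\<lambda>y. \<Gamma> y v w) z"
      using dir_deriv_bounded_linear[OF bounded_linear_minus[OF bounded_linear_ident] \<Gamma>_diff[OF z]] .
    finally show ?thesis .
  qed
  have 2: "DD (\<Gamma> z (J v) (J w)) \<psi> z = - DD (\<Gamma> z v w) \<psi> z"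
    unfolding \<Gamma>_J_J[OF z] using linear_neg[OF linear_dir_deriv[OF d\<psi>]] .
  have 3: "\<Gamma> z (J v) (\<Gamma> z e (J w)) = - \<Gamma> z v (\<Gamma> z e w)" for e
    using \<Gamma>_J[OF z, of e w] \<Gamma>_J_J[OF z] by simp
  have "ricci_curvature g z v w + ricci_curvature g z (J v) (J w) = - 1/2 * (DD v (DD w \<psi>) z + DD (J v) (DD (J w) \<psi>) z)"
    unfolding ricci_eq[OF z] 1 2 3 by (simp add: sum_negf algebra_simps)
  then show ?thesis using einstein[OF z] g_J[OF z] by simp
qed

end

section \<open>Bochner's inequality\<close>

lemma sum_inner_expand:
  assumes "linear (F :: 'a::euclidean_space \<Rightarrow> 'b::real_vector)" shows "(\<Sum>b\<in>Basis. (x \<bullet> b) *\<^sub>R F b) = F x"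
proof -
  have "F x = F (\<Sum>b\<in>Basis. (x \<bullet> b) *\<^sub>R b)" by (simp add: euclidean_representation)
  then show ?thesis using assms by (simp add: linear_sum linear_cmul)
qed

context riemannian_open
begin

abbreviation "\<sigma> z e \<equiv> sharp (g z) e"

text \<open>The second order part of the Laplace-Beltrami operator. The first order part is a trace
  of \<Gamma>, which vanishes for Kaehler metrics by \<open>trace_\<Gamma>\<close>; there this is
  the full operator.\<close>

definition Lap :: "(complex ^ 'n \<Rightarrow> real) \<Rightarrow> complex ^ 'n \<Rightarrow> real" where
  "Lap f z = (\<Sum>e\<in>Basis. DD (\<sigma> z e) (DD e f) z)"

text \<open>The inner product of the two differentials in the metric dual to g.\<close>

definition dpair :: "(complex ^ 'n \<Rightarrow> real) \<Rightarrow> (complex ^ 'n \<Rightarrow> real) \<Rightarrow> complex ^ 'n \<Rightarrow> real" where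
  "dpair f k z = (\<Sum>e\<in>Basis. DD e f z * DD (\<sigma> z e) k z)"

lemma g_\<sigma>: "z \<in> \<Omega> \<Longrightarrow> g z (\<sigma> z a) v = a \<bullet> v" "z \<in> \<Omega> \<Longrightarrow> g z v (\<sigma> z a) = a \<bullet> v"
  using sharp[OF form] gsym by auto

lemma bilinear_hessian:
  assumes f: "smooth_on f \<Omega>" and z: "z \<in> \<Omega>"
  shows "bilinear (\<lambda>v w. DD v (DD w f) z)"
proof -
  have d: "f differentiable (at y)" if "y \<in> \<Omega>" for y using smooth_on_differentiable[OF f that] .
  have d2: "(DD w f) differentiable (at z)" for w
    using smooth_on_differentiable[OF smooth_on_dir_deriv[OF f] z] .
  have "linear (\<lambda>w. DD v (DD w f) z)" for v
  proof (rule linearI)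
    fix x y
    have "DD v (DD (x + y) f) z = DD v (\<lambda>z. DD x f z + DD y f z) z"
      using d2 d by (intro dir_deriv_cong_open(1)[OF open_\<Omega> z]) (auto simp: linear_add[OF linear_dir_deriv])
    then show "DD v (DD (x + y) f) z = DD v (DD x f) z + DD v (DD y f) z"
      using dir_deriv_add[OF d2 d2] by simp
  next
    fix r x
    have "DD v (DD (r *\<^sub>R x) f) z = DD v (\<lambda>z. r *\<^sub>R DD x f z) z"
      using d2 d by (intro dir_deriv_cong_open(1)[OF open_\<Omega> z]) (auto simp: linear_cmul[OF linear_dir_deriv])
    then show "DD v (DD (r *\<^sub>R x) f) z = r *\<^sub>R DD v (DD x f) z"
      using dir_deriv_bounded_linear[OF bounded_linear_scaleR_right d2] by simp
  qed
  then show ?thesis unfolding bilinear_def using linear_dir_deriv[OF d2] by auto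
qed

lemma Lap_add:
  assumes f: "smooth_on f \<Omega>" "smooth_on k \<Omega>" and z: "z \<in> \<Omega>"
  shows "Lap (\<lambda>y. c * f y + r * k y) z = c * Lap f z + r * Lap k z"
proof -
  have d: "f differentiable (at y)" "k differentiable (at y)" if "y \<in> \<Omega>" for y
    using smooth_on_differentiable f that by blast+
  have d2: "(DD w f) differentiable (at z)" "(DD w k) differentiable (at z)" for w
    using smooth_on_differentiable smooth_on_dir_deriv f z by blast+
  have lin: "DD v (\<lambda>y. c * F y + r * K y) y = c * DD v F y + r * DD v K y"
    if "F differentiable (at y)" "K differentiable (at y)" for F K :: "_ \<Rightarrow> real" and v y
    by (rule dir_deriv_eqI) (auto intro!: derivative_eq_intros has_derivative_dir_deriv that)
  have "DD v (DD w (\<lambda>y. c * f y + r * k y)) z = c * DD v (DD w f) z + r * DD v (DD w k) z" for v w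
  proof -
    have "DD v (DD w (\<lambda>y. c * f y + r * k y)) z = DD v (\<lambda>y. c * DD w f y + r * DD w k y) z"
    proof (rule dir_deriv_cong_open(1)[OF open_\<Omega> z])
      show "c * DD w f y + r * DD w k y = DD w (\<lambda>y. c * f y + r * k y) y" if "y \<in> \<Omega>" for y
        using lin[OF d[OF that]] by simp
    qed (use d2 in auto)
    then show ?thesis using lin[OF d2(1)[of w] d2(2)[of w], of v] by simp
  qed
  then show ?thesis unfolding Lap_def by (simp add: sum.distrib sum_distrib_left)
qed

lemma Lap_ln:
  assumes f: "smooth_on f \<Omega>" and pos: "\<And>y. y \<in> \<Omega> \<Longrightarrow> f y > 0" and z: "z \<in> \<Omega>"
  shows "Lap (\<lambda>y. ln (f y)) z = Lap f z / f z - dpair f f z / (f z)\<^sup>2"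
proof -
  have d: "f differentiable (at y)" if "y \<in> \<Omega>" for y
    using smooth_on_differentiable f that by blast+
  have d2: "(DD w f) differentiable (at z)" for w
    using smooth_on_differentiable smooth_on_dir_deriv f z by blast+
  have "DD v (DD w (\<lambda>y. ln (f y))) z = DD v (DD w f) z / f z - DD w f z * DD v f z / (f z)\<^sup>2" for v w
  proof -
    have fz: "f z > 0" using pos z by blast
    note inv = dir_deriv_inverse(1)[OF d[OF z], of v]
    have "(\<lambda>y. DD w f y * inverse (f y)) differentiable (at z)"
      "DD v (\<lambda>y. DD w f y * inverse (f y)) z = DD w f z * DD v (\<lambda>y. inverse (f y)) z + DD v (DD w f) z * inverse (f z)"
      using dir_deriv_mult(1)[OF d2[of w] dir_deriv_inverse(2)[OF d[OF z]], of v]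
        dir_deriv_mult(2)[OF d2[of w] dir_deriv_inverse(2)[OF d[OF z]]] fz by auto
    moreover have "DD v (DD w (\<lambda>y. ln (f y))) z = DD v (\<lambda>y. DD w f y * inverse (f y)) z"
      using calculation(1) dir_deriv_ln(1)[OF d pos]
      by (intro dir_deriv_cong_open(1)[OF open_\<Omega> z]) auto
    ultimately show ?thesis using inv fz by (simp add: divide_inverse power2_eq_square)
  qed
  then show ?thesis unfolding Lap_def dpair_def
    by (simp add: sum_subtractf sum_divide_distrib)
qed

definition grad :: "(complex ^ 'n \<Rightarrow> real) \<Rightarrow> complex ^ 'n \<Rightarrow> complex ^ 'n" where
  "grad f z = (\<Sum>e\<in>Basis. DD e f z *\<^sub>R \<sigma> z e)"

lemma smooth_grad: "smooth_on f \<Omega> \<Longrightarrow> smooth_on (grad f) \<Omega>"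
  unfolding grad_def
  by (intro smooth_on_sum smooth_on_scaleR smooth_on_dir_deriv smooth_sharp open_\<Omega>)

lemma DD_grad:
  assumes "k differentiable (at z)"
  shows "DD (grad f z) k z = dpair f k z"
  unfolding grad_def dpair_def using linear_dir_deriv[OF assms] by (simp add: linear_sum linear_cmul)

lemma g_grad: "z \<in> \<Omega> \<Longrightarrow> f differentiable (at z) \<Longrightarrow> g z (grad f z) v = DD v f z"
  unfolding grad_def using sum_inner_expand[OF linear_dir_deriv, of f z v]
  by (simp add: bilinear_sum_left[OF bil] bilinear_lmul[OF bil] g_\<sigma> inner_commute mult.commute)

end

context kaehler_open
begin

lemma bij_J: "bij (J :: complex ^ 'n \<Rightarrow> complex ^ 'n)"
  by (rule o_bij[of "\<lambda>x. - J x"]) (auto simp: J_simps)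

text \<open>J is an isometry of g z, so it carries orthonormal frames to orthonormal frames.\<close>

lemma trace_J:
  fixes P :: "complex ^ 'n \<Rightarrow> complex ^ 'n \<Rightarrow> 'b::real_vector"
  assumes z: "z \<in> \<Omega>" and P: "bilinear P"
  shows "(\<Sum>e\<in>Basis. P (J e) (J (\<sigma> z e))) = (\<Sum>e\<in>Basis. P e (\<sigma> z e))"
proof -
  obtain f :: "complex ^ 'n \<Rightarrow> complex ^ 'n" where f: "linear f" "bij f" "\<And>u v. g z (f u) (f v) = u \<bullet> v"
    using orthonormal_frame[OF form[OF z]] by blast
  have lin: "linear (\<lambda>x. J (f x))" using linear_compose[OF f(1) linear_J] by (simp add: o_def)
  have bij: "bij (\<lambda>x. J (f x))" using bij_comp[OF f(2) bij_J] by (simp add: o_def)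
  have P': "bilinear (\<lambda>x y. P (J x) (J y))"
    using P linear_compose[OF linear_J] unfolding bilinear_def by (auto simp: o_def)
  show ?thesis
    using trace_sharp_frame[OF form[OF z] lin bij _ P] trace_sharp_frame[OF form[OF z] f P'] f(3) g_J[OF z] by simp
qed

lemma trace_\<Gamma>: assumes z: "z \<in> \<Omega>" shows "(\<Sum>e\<in>Basis. \<Gamma> z e (\<sigma> z e)) = 0"
proof -
  have "bilinear (\<Gamma> z)" unfolding bilinear_def using \<Gamma>_lin[OF z] \<Gamma>_lin_left[OF z] by auto
  from trace_J[OF z this] have "- (\<Sum>e\<in>Basis. \<Gamma> z e (\<sigma> z e)) = (\<Sum>e\<in>Basis. \<Gamma> z e (\<sigma> z e))"
    unfolding \<Gamma>_J_J[OF z] by (simp add: sum_negf)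
  then have "(\<Sum>e\<in>Basis. \<Gamma> z e (\<sigma> z e)) + (\<Sum>e\<in>Basis. \<Gamma> z e (\<sigma> z e)) = 0"
    by (metis add.left_inverse)
  then have "2 *\<^sub>R (\<Sum>e\<in>Basis. \<Gamma> z e (\<sigma> z e)) = 0" by (simp only: scaleR_2)
  then show ?thesis by simp
qed

lemma DD_sharp:
  assumes z: "z \<in> \<Omega>"
  shows "g z (DD w (\<lambda>y. \<sigma> y a) z) v = - g z (\<Gamma> z w (\<sigma> z a)) v - g z (\<sigma> z a) (\<Gamma> z w v)"
proof -
  have "DD w (\<lambda>y. g y (\<sigma> y a) v) z = DD w (\<lambda>y. a \<bullet> v) z"
    using g_\<sigma> by (intro dir_deriv_cong_open(1)[OF open_\<Omega> z]) auto
  then have "dg z w (\<sigma> z a) v + g z (DD w (\<lambda>y. \<sigma> y a) z) v = 0"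
    using DD_g(1)[OF z sharp_diff[OF z, of a] differentiable_const[of v], of w]
    by (simp add: dir_deriv_const bilinear_rzero[OF bil[OF z]])
  then show ?thesis using metric_compat[OF z, of "\<sigma> z a" v w] by simp
qed

text \<open>The divergence on the left is Euclidean. The Riemannian volume is exp (\<psi> / 2) times
  Lebesgue measure, which accounts for the term in \<psi>.\<close>

lemma divergence_grad:
  assumes f: "smooth_on f \<Omega>" and z: "z \<in> \<Omega>"
  shows "(\<Sum>b\<in>Basis. DD b (grad f) z \<bullet> b) = Lap f z - 1/2 * dpair f \<psi> z"
proof -
  have d: "(DD e f) differentiable (at z)" for e
    using smooth_on_differentiable[OF smooth_on_dir_deriv[OF f] z] .
  have td: "(\<lambda>y. DD e f y *\<^sub>R \<sigma> y e) differentiable (at z)"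
    "DD b (\<lambda>y. DD e f y *\<^sub>R \<sigma> y e) z = DD e f z *\<^sub>R DD b (\<lambda>y. \<sigma> y e) z + DD b (DD e f) z *\<^sub>R \<sigma> z e" for e b
    using dir_deriv_scaleR(1)[OF d sharp_diff[OF z]] dir_deriv_scaleR(2)[OF d sharp_diff[OF z]] by auto
  have G: "DD b (grad f) z = (\<Sum>e\<in>Basis. DD e f z *\<^sub>R DD b (\<lambda>y. \<sigma> y e) z + DD b (DD e f) z *\<^sub>R \<sigma> z e)" for b
    unfolding grad_def[abs_def] using dir_deriv_sum[of Basis "\<lambda>e y. DD e f y *\<^sub>R \<sigma> y e" z b] td by simp
  have ds: "(\<Sum>b\<in>Basis. DD b (\<lambda>y. \<sigma> y e) z \<bullet> b) = - (1/2 * DD (\<sigma> z e) \<psi> z)" for e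
  proof -
    have "DD b (\<lambda>y. \<sigma> y e) z \<bullet> b = - (\<Gamma> z (\<sigma> z e) b \<bullet> b) - g z (\<sigma> z e) (\<Gamma> z b (\<sigma> z b))" for b
    proof -
      have "DD b (\<lambda>y. \<sigma> y e) z \<bullet> b = g z (DD b (\<lambda>y. \<sigma> y e) z) (\<sigma> z b)"
        using g_\<sigma>(2)[OF z] by (simp add: inner_commute)
      also have "\<dots> = - g z (\<Gamma> z b (\<sigma> z e)) (\<sigma> z b) - g z (\<sigma> z e) (\<Gamma> z b (\<sigma> z b))" by (rule DD_sharp[OF z])
      also have "g z (\<Gamma> z b (\<sigma> z e)) (\<sigma> z b) = \<Gamma> z (\<sigma> z e) b \<bullet> b"
        using g_\<sigma>(2)[OF z] \<Gamma>_sym[OF z] by (simp add: inner_commute)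
      finally show ?thesis .
    qed
    then have "(\<Sum>b\<in>Basis. DD b (\<lambda>y. \<sigma> y e) z \<bullet> b)
      = - (\<Sum>b\<in>Basis. \<Gamma> z (\<sigma> z e) b \<bullet> b) - g z (\<sigma> z e) (\<Sum>b\<in>Basis. \<Gamma> z b (\<sigma> z b))"
      by (simp add: sum_subtractf sum_negf bilinear_sum_right[OF bil[OF z]])
    then show ?thesis unfolding trace_\<Gamma>[OF z] DD_\<psi>[OF z] by (simp add: bilinear_rzero[OF bil[OF z]])
  qed
  have "(\<Sum>b\<in>Basis. DD b (grad f) z \<bullet> b)
    = (\<Sum>e\<in>Basis. DD e f z * (\<Sum>b\<in>Basis. DD b (\<lambda>y. \<sigma> y e) z \<bullet> b)) + (\<Sum>e\<in>Basis. \<Sum>b\<in>Basis. (\<sigma> z e \<bullet> b) *\<^sub>R DD b (DD e f) z)"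
    unfolding G inner_sum_left sum_distrib_left
    by (subst sum.swap) (simp add: inner_add_left sum.distrib mult.commute)
  also have "(\<Sum>e\<in>Basis. \<Sum>b\<in>Basis. (\<sigma> z e \<bullet> b) *\<^sub>R DD b (DD e f) z) = Lap f z"
    unfolding Lap_def using sum_inner_expand[OF linear_dir_deriv[OF d]] by simp
  also have "(\<Sum>e\<in>Basis. DD e f z * (\<Sum>b\<in>Basis. DD b (\<lambda>y. \<sigma> y e) z \<bullet> b)) = - 1/2 * dpair f \<psi> z"
    unfolding ds dpair_def by (simp add: sum_distrib_left sum_negf algebra_simps)
  finally show ?thesis by simp
qed

text \<open>The combination \<open>DD x \<Gamma> + J (DD (J x) \<Gamma>)\<close> below is twice the antiholomorphic derivative of the
  Christoffel symbols, that is, the curvature tensor with all its Kaehler symmetries.\<close>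

abbreviation "N z x w u \<equiv> DD x (\<lambda>y. \<Gamma> y w u) z"

lemma N_sym: assumes z: "z \<in> \<Omega>" shows "N z x w u = N z x u w"
  by (rule dir_deriv_cong_open(1)[OF open_\<Omega> z _ \<Gamma>_diff[OF z]]) (rule \<Gamma>_sym)

lemma N_J: assumes z: "z \<in> \<Omega>" shows "N z x (J w) u = J (N z x w u)"
proof -
  have "N z x (J w) u = DD x (\<lambda>y. J (\<Gamma> y w u)) z"
    by (rule dir_deriv_cong_open(1)[OF open_\<Omega> z])
      (auto simp: \<Gamma>_J_left intro!: differentiableI[OF bounded_linear.has_derivative[OF bounded_linear_J has_derivative_dir_deriv[OF \<Gamma>_diff[OF z]]]])
  then show ?thesis using dir_deriv_bounded_linear[OF bounded_linear_J \<Gamma>_diff[OF z]] by simp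
qed

lemma N_lin1: "z \<in> \<Omega> \<Longrightarrow> linear (\<lambda>x. N z x w u)"
  using linear_dir_deriv[OF \<Gamma>_diff] .

lemma N_lin3: assumes z: "z \<in> \<Omega>" shows "linear (N z x w)"
proof (rule linearI)
  fix a b
  have "N z x w (a + b) = DD x (\<lambda>y. \<Gamma> y w a + \<Gamma> y w b) z"
    using \<Gamma>_diff[OF z] by (intro dir_deriv_cong_open(1)[OF open_\<Omega> z]) (auto simp: linear_add[OF \<Gamma>_lin])
  then show "N z x w (a + b) = N z x w a + N z x w b" using dir_deriv_add[OF \<Gamma>_diff[OF z] \<Gamma>_diff[OF z]] by simp
next
  fix r a
  have "N z x w (r *\<^sub>R a) = DD x (\<lambda>y. r *\<^sub>R \<Gamma> y w a) z"
    using \<Gamma>_diff[OF z] by (intro dir_deriv_cong_open(1)[OF open_\<Omega> z]) (auto simp: linear_cmul[OF \<Gamma>_lin])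
  then show "N z x w (r *\<^sub>R a) = r *\<^sub>R N z x w a"
    using dir_deriv_bounded_linear[OF bounded_linear_scaleR_right \<Gamma>_diff[OF z]] by simp
qed

lemma N_lin2: assumes z: "z \<in> \<Omega>" shows "linear (\<lambda>w. N z x w u)"
proof -
  have "(\<lambda>w. N z x w u) = N z x u" using N_sym[OF z] by blast
  then show ?thesis using N_lin3[OF z] by simp
qed

definition Kt where "Kt z x w u v = g z (N z x w u) v + g z (J (N z (J x) w u)) v"

text \<open>A curvature symmetry. \<open>A v\<close> is the holomorphic derivative of g along w; in
  the combination of its derivatives that occurs in Kt, second derivatives are commuted until w acts
  last, on B1 and B2. These are symmetric in x and v because the connection is torsion free.\<close>

lemma Kt_swap:
  assumes z: "z \<in> \<Omega>"
  shows "Kt z x w u v = Kt z v w u x"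
proof -
  define A where "A v y = g y (\<Gamma> y w u) v" for v y
  define B1 where "B1 x v y = dg y x u v - dg y (J x) u (J v)" for x v y
  define B2 where "B2 x v y = dg y x u (J v) + dg y (J x) u v" for x v y
  have Ad: "A v differentiable (at z)" and DA: "DD x (A v) z = g z (\<Gamma> z x (\<Gamma> z w u)) v + g z (\<Gamma> z w u) (\<Gamma> z x v) + g z (N z x w u) v" for x v
    unfolding A_def using DD_g(1)[OF z \<Gamma>_diff[OF z] differentiable_const[of v], of w u x]
      DD_g(2)[OF z \<Gamma>_diff[OF z] differentiable_const[of v], of w u]
    by (auto simp: dir_deriv_const bilinear_rzero[OF bil[OF z]] metric_compat[OF z])
  have dd: "(\<lambda>y. dg y x u v) differentiable (at z)" for x u v
    using smooth_on_differentiable[OF smooth_dg z] .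
  have A2: "2 * A v y = dg y w u v + dg y (J w) u (J v)" if "y \<in> \<Omega>" for v y
    unfolding A_def metric_compat[OF that] \<Gamma>_J_left[OF that] \<Gamma>_J[OF that] using g_J[OF that, of "\<Gamma> y w u" v]
    by (simp add: bilinear_rneg[OF bil[OF that]])
  have DA2: "2 * DD x (A v) z = DD x (DD w (\<lambda>y. g y u v)) z + DD x (DD (J w) (\<lambda>y. g y u (J v))) z" for x v
  proof -
    have "2 * DD x (A v) z = DD x (\<lambda>y. 2 * A v y) z"
      using dir_deriv_bounded_linear[OF bounded_linear_mult_right Ad, of 2] by simp
    also have "\<dots> = DD x (\<lambda>y. dg y w u v + dg y (J w) u (J v)) z"
      using A2 dd by (intro dir_deriv_cong_open(1)[OF open_\<Omega> z]) (auto intro!: differentiable_add)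
    also have "\<dots> = DD x (DD w (\<lambda>y. g y u v)) z + DD x (DD (J w) (\<lambda>y. g y u (J v))) z"
      by (rule dir_deriv_add[OF dd dd])
    finally show ?thesis .
  qed
  have sw: "DD x (DD w (\<lambda>y. g y u v)) z = DD w (DD x (\<lambda>y. g y u v)) z" for x w v
    using smooth_on_commute[OF open_\<Omega> smooth_g z] .
  have E: "2 * (DD x (A v) z - DD (J x) (A (J v)) z) = DD w (B1 x v) z + DD (J w) (B2 x v) z" for x v
  proof -
    have neg: "DD a (DD b (\<lambda>y. g y u (- v))) z = - DD a (DD b (\<lambda>y. g y u v)) z" for a b
    proof -
      have "DD a (DD b (\<lambda>y. g y u (- v))) z = DD a (\<lambda>y. - DD b (\<lambda>y. g y u v) y) z"
        using linear_neg[OF linear_dg3, of _ u v b] dd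
        by (intro dir_deriv_cong_open(1)[OF open_\<Omega> z]) auto
      then show ?thesis using dir_deriv_bounded_linear[OF bounded_linear_minus[OF bounded_linear_ident] dd] by simp
    qed
    have "2 * (DD x (A v) z - DD (J x) (A (J v)) z) =
      DD w (DD x (\<lambda>y. g y u v)) z + DD (J w) (DD x (\<lambda>y. g y u (J v))) z
      - DD w (DD (J x) (\<lambda>y. g y u (J v))) z + DD (J w) (DD (J x) (\<lambda>y. g y u v)) z"
      using DA2[of v x] DA2[of "J v" "J x"] neg[of "J w" "J x"]
        sw[of v w x] sw[of "J v" "J w" x] sw[of "J v" w "J x"] sw[of v "J w" "J x"] by simp
    moreover have "DD w (B1 x v) z = DD w (DD x (\<lambda>y. g y u v)) z - DD w (DD (J x) (\<lambda>y. g y u (J v))) z"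
      unfolding B1_def by (rule dir_deriv_eqI[OF has_derivative_diff]) (rule has_derivative_dir_deriv[OF dd])+
    moreover have "DD (J w) (B2 x v) z = DD (J w) (DD x (\<lambda>y. g y u (J v))) z + DD (J w) (DD (J x) (\<lambda>y. g y u v)) z"
      unfolding B2_def by (rule dir_deriv_add[OF dd dd])
    ultimately show ?thesis by simp
  qed
  have B1s: "B1 x v y = B1 v x y" and B2s: "B2 x v y = B2 v x y" if "y \<in> \<Omega>" for x v y
  proof -
    have "B1 x v y = 2 * g y u (\<Gamma> y x v)" for x v
      unfolding B1_def metric_compat[OF that] \<Gamma>_J_left[OF that] \<Gamma>_J[OF that] using g_J[OF that, of "\<Gamma> y x u" v]
      by (simp add: bilinear_rneg[OF bil[OF that]])
    moreover have "B2 x v y = 2 * g y u (J (\<Gamma> y x v))" for x v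
      unfolding B2_def metric_compat[OF that] \<Gamma>_J[OF that] \<Gamma>_J_left[OF that] using g_J_skew[OF that, of "\<Gamma> y x u" v]
      by simp
    ultimately show "B1 x v y = B1 v x y" "B2 x v y = B2 v x y" using \<Gamma>_sym[OF that] by simp_all
  qed
  have "DD a (B1 x v) z = DD a (B1 v x) z" "DD a (B2 x v) z = DD a (B2 v x) z" for a x v
    using B1s B2s dd unfolding B1_def B2_def
    by (intro dir_deriv_cong_open(1)[OF open_\<Omega> z]; auto intro!: differentiable_add differentiable_diff)+
  then have Esym: "DD x (A v) z - DD (J x) (A (J v)) z = DD v (A x) z - DD (J v) (A (J x)) z"
    using E[of x v] E[of v x] by simp
  have Kt: "DD x (A v) z - DD (J x) (A (J v)) z = Kt z x w u v + 2 * g z (\<Gamma> z w u) (\<Gamma> z x v)" for x v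
    unfolding DA Kt_def \<Gamma>_J_left[OF z] \<Gamma>_J[OF z]
    using g_J[OF z, of "\<Gamma> z x (\<Gamma> z w u)" v] g_J_skew[OF z, of "N z (J x) w u" v]
    by (simp add: bilinear_rneg[OF bil[OF z]])
  show ?thesis using Kt[of x v] Kt[of v x] Esym \<Gamma>_sym[OF z, of x v] by simp
qed

end

context kaehler_einstein_open
begin

text \<open>The Ricci curvature as a trace over another pair of slots than in its definition.
  \<open>Kt_swap\<close> and the symmetry of N move the traced pair to the place where
  \<open>trace_DD_\<Gamma>\<close> and the Einstein equation apply.\<close>

lemma trace_N:
  assumes z: "z \<in> \<Omega>"
  shows "(\<Sum>e\<in>Basis. g z (N z (\<sigma> z e) e x) y) = g z x y"
proof -
  define P where "P a b = g z (N z b a x) y" for a b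
  have P: "bilinear P" unfolding P_def bilinear_def
    using linear_compose[OF N_lin1[OF z] g_lin(2)[OF z]] linear_compose[OF N_lin2[OF z] g_lin(2)[OF z]]
    by (auto simp: o_def)
  have "P (J a) (J b) = g z (J (N z (J b) a x)) y" for a b unfolding P_def N_J[OF z] ..
  then have "2 * (\<Sum>e\<in>Basis. P e (\<sigma> z e)) = (\<Sum>e\<in>Basis. Kt z (\<sigma> z e) e x y)"
    using trace_J[OF z P] unfolding Kt_def P_def by (simp add: sum.distrib)
  also have "\<dots> = (\<Sum>e\<in>Basis. Kt z y x e (\<sigma> z e))"
  proof (intro sum.cong refl)
    fix e
    have "Kt z (\<sigma> z e) e x y = Kt z y e x (\<sigma> z e)" by (rule Kt_swap[OF z])
    then show "Kt z (\<sigma> z e) e x y = Kt z y x e (\<sigma> z e)" unfolding Kt_def using N_sym[OF z] by simp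
  qed
  also have "\<dots> = (\<Sum>e\<in>Basis. N z y e x \<bullet> e) + (\<Sum>e\<in>Basis. N z (J y) e (J x) \<bullet> e)"
  proof -
    have "N z (J y) e (J x) = J (N z (J y) x e)" for e using N_J[OF z] N_sym[OF z] by simp
    then show ?thesis unfolding Kt_def sum.distrib g_\<sigma>(2)[OF z] using N_sym[OF z, of x _ y] by (simp add: inner_commute)
  qed
  also have "\<dots> = 1/2 * DD y (DD x \<psi>) z + 1/2 * DD (J y) (DD (J x) \<psi>) z"
    unfolding trace_DD_\<Gamma>[OF z] ..
  also have "\<dots> = 2 * g z x y" using hessian_\<psi>[OF z, of x y] gsym[OF z] by simp
  finally show ?thesis unfolding P_def by simp
qed

lemma Lap_\<psi>: assumes z: "z \<in> \<Omega>" shows "Lap \<psi> z = 2 * DIM(complex ^ 'n)"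
proof -
  have b: "bilinear (\<lambda>v w. DD w (DD v \<psi>) z)"
    using bilinear_hessian[OF smooth_\<psi> z] unfolding bilinear_def by auto
  have "2 * Lap \<psi> z = (\<Sum>e\<in>Basis. DD (\<sigma> z e) (DD e \<psi>) z + DD (J (\<sigma> z e)) (DD (J e) \<psi>) z)"
    using trace_J[OF z b] unfolding Lap_def by (simp add: sum.distrib)
  also have "\<dots> = (\<Sum>e\<in>Basis. 4 * (e \<bullet> (e :: complex ^ 'n)))"
    unfolding hessian_\<psi>[OF z] g_\<sigma>[OF z] ..
  finally show ?thesis by simp
qed

section \<open>Bochner's formula for a constant covector\<close>

context
  fixes a :: "complex ^ 'n"
begin

definition "\<alpha> y = \<sigma> y a"
definition "q y = a \<bullet> \<sigma> y a"

lemma smooth_q: "smooth_on q \<Omega>"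
  unfolding q_def by (intro smooth_on_inner smooth_on_const smooth_sharp open_\<Omega>)

lemma q_eq: "z \<in> \<Omega> \<Longrightarrow> q z = g z (\<alpha> z) (\<alpha> z)"
  unfolding q_def \<alpha>_def by (simp add: g_\<sigma>)

lemma q_pos: assumes "z \<in> \<Omega>" "a \<noteq> 0" shows "q z > 0"
proof -
  have "\<alpha> z \<noteq> 0"
  proof
    assume "\<alpha> z = 0"
    then have "a \<bullet> a = 0" using g_\<sigma>(1)[OF assms(1), of a a] unfolding \<alpha>_def by (simp add: bilinear_lzero[OF bil[OF assms(1)]])
    then show False using assms by simp
  qed
  then show ?thesis using B_pos[OF form[OF assms(1)]] q_eq[OF assms(1)] by simp
qed

lemma \<alpha>_diff: "z \<in> \<Omega> \<Longrightarrow> \<alpha> differentiable (at z)"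
  unfolding \<alpha>_def[abs_def] by (rule sharp_diff)

text \<open>\<open>- T z\<close> is the covariant Hessian, as an endomorphism, of the linear
  function y |-> a \<bullet> y; \<alpha> is the gradient of this function and q the squared length
  of the gradient.\<close>

definition T where "T z w = \<sigma> z (\<Sum>b\<in>Basis. g z (\<alpha> z) (\<Gamma> z w b) *\<^sub>R b)"

lemma g_T: assumes z: "z \<in> \<Omega>" shows "g z (T z w) v = g z (\<alpha> z) (\<Gamma> z w v)"
proof -
  have lin: "linear (\<lambda>v. g z (\<alpha> z) (\<Gamma> z w v))"
    using linear_compose[OF \<Gamma>_lin[OF z] g_lin(1)[OF z]] by (simp add: o_def)
  have "g z (T z w) v = (\<Sum>b\<in>Basis. (v \<bullet> b) *\<^sub>R g z (\<alpha> z) (\<Gamma> z w b))"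
    unfolding T_def g_\<sigma>(1)[OF z] inner_sum_left inner_scaleR_left by (simp add: inner_commute mult.commute)
  then show ?thesis using sum_inner_expand[OF lin] by simp
qed

lemma T_lin: assumes z: "z \<in> \<Omega>" shows "linear (T z)"
proof (rule linearI)
  show "T z (x + y) = T z x + T z y" for x y
    by (rule B_eqI[OF form[OF z]])
      (simp add: g_T[OF z] bilinear_ladd[OF bil[OF z]] bilinear_radd[OF bil[OF z]] linear_add[OF \<Gamma>_lin_left[OF z]])
  show "T z (r *\<^sub>R x) = r *\<^sub>R T z x" for r x
    by (rule B_eqI[OF form[OF z]])
      (simp add: g_T[OF z] bilinear_lmul[OF bil[OF z]] bilinear_rmul[OF bil[OF z]] linear_cmul[OF \<Gamma>_lin_left[OF z]])
qed

text \<open>The linear function is the real part of a holomorphic one, so its Hessian is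
  anti-invariant under J.\<close>

lemma T_J: assumes z: "z \<in> \<Omega>" shows "T z (J w) = - J (T z w)"
  by (rule B_eqI[OF form[OF z]])
    (simp add: g_T[OF z] g_J_skew[OF z] bilinear_lneg[OF bil[OF z]] \<Gamma>_J_left[OF z] \<Gamma>_J[OF z])

lemma DD_\<alpha>: assumes z: "z \<in> \<Omega>" shows "DD w \<alpha> z = - \<Gamma> z w (\<alpha> z) - T z w"
  by (rule B_eqI[OF form[OF z]])
    (simp add: DD_sharp[OF z] \<alpha>_def[abs_def] g_T[OF z, unfolded \<alpha>_def] bilinear_lsub[OF bil[OF z]] bilinear_lneg[OF bil[OF z]])

lemma DD_q: assumes z: "z \<in> \<Omega>" shows "DD w q z = - 2 * (a \<bullet> \<Gamma> z w (\<alpha> z))"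
proof -
  have "DD w q z = a \<bullet> DD w \<alpha> z"
    unfolding q_def[abs_def] \<alpha>_def[abs_def]
    using dir_deriv_bounded_linear[OF bounded_linear_inner_right sharp_diff[OF z]] .
  also have "\<dots> = g z (\<alpha> z) (- \<Gamma> z w (\<alpha> z) - T z w)" unfolding DD_\<alpha>[OF z] \<alpha>_def g_\<sigma>(1)[OF z] ..
  also have "\<dots> = - g z (\<alpha> z) (\<Gamma> z w (\<alpha> z)) - g z (T z w) (\<alpha> z)"
    using gsym[OF z] by (simp add: bilinear_rsub[OF bil[OF z]] bilinear_rneg[OF bil[OF z]])
  also have "\<dots> = - 2 * g z (\<alpha> z) (\<Gamma> z w (\<alpha> z))" unfolding g_T[OF z] by simp
  finally show ?thesis unfolding \<alpha>_def g_\<sigma>(1)[OF z] .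
qed

lemma DD_q_T: assumes z: "z \<in> \<Omega>" shows "DD w q z = - 2 * g z (T z (\<alpha> z)) w"
  unfolding DD_q[OF z] g_T[OF z] using \<Gamma>_sym[OF z, of w] g_\<sigma>(1)[OF z, of a] unfolding \<alpha>_def by simp

text \<open>Bochner's formula: twice the squared norm of the Hessian plus twice the Ricci curvature
  of the gradient, which the Einstein equation turns into - 2 q through \<open>trace_N\<close>. The
  terms quadratic in \<Gamma> that remain have a trace that changes sign under J, hence
  vanish.\<close>

lemma Lap_q:
  assumes z: "z \<in> \<Omega>"
  shows "Lap q z = 2 * (\<Sum>e\<in>Basis. g z (T z e) (T z (\<sigma> z e))) - 2 * q z"
proof -
  have ax: "a \<bullet> x = g z (\<alpha> z) x" for x unfolding \<alpha>_def g_\<sigma>(1)[OF z] ..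
  have H: "DD v (DD w q) z = - 2 * g z (\<alpha> z) (N z v w (\<alpha> z)) + 2 * g z (\<alpha> z) (\<Gamma> z w (\<Gamma> z v (\<alpha> z))) + 2 * g z (T z w) (T z v)" for v w
  proof -
    have d: "(\<lambda>y. \<Gamma> y w (\<alpha> y)) differentiable (at z)" using DD_\<Gamma>(2)[OF z \<alpha>_diff[OF z]] .
    have "DD v (DD w q) z = DD v (\<lambda>y. (- 2) * (a \<bullet> \<Gamma> y w (\<alpha> y))) z"
      using DD_q d by (intro dir_deriv_cong_open(1)[OF open_\<Omega> z]) auto
    also have "\<dots> = (- 2) * (a \<bullet> DD v (\<lambda>y. \<Gamma> y w (\<alpha> y)) z)"
      by (rule dir_deriv_bounded_linear[OF _ d, of "\<lambda>x. (- 2) * (a \<bullet> x)"])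
        (intro bounded_linear_const_mult bounded_linear_inner_right)
    also have "DD v (\<lambda>y. \<Gamma> y w (\<alpha> y)) z = N z v w (\<alpha> z) + \<Gamma> z w (- \<Gamma> z v (\<alpha> z) - T z v)"
      unfolding DD_\<Gamma>(1)[OF z \<alpha>_diff[OF z]] DD_\<alpha>[OF z] ..
    also have "\<Gamma> z w (- \<Gamma> z v (\<alpha> z) - T z v) = - \<Gamma> z w (\<Gamma> z v (\<alpha> z)) - \<Gamma> z w (T z v)"
      by (simp add: linear_diff[OF \<Gamma>_lin[OF z]] linear_neg[OF \<Gamma>_lin[OF z]])
    finally show ?thesis unfolding ax g_T[OF z]
      by (simp add: bilinear_radd[OF bil[OF z]] bilinear_rsub[OF bil[OF z]] bilinear_rneg[OF bil[OF z]])
  qed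
  have 0: "(\<Sum>e\<in>Basis. g z (\<alpha> z) (\<Gamma> z e (\<Gamma> z (\<sigma> z e) (\<alpha> z)))) = 0"
  proof -
    define P where "P x y = g z (\<alpha> z) (\<Gamma> z x (\<Gamma> z y (\<alpha> z)))" for x y
    have "bilinear P" unfolding P_def bilinear_def
      using linear_compose[OF \<Gamma>_lin_left[OF z] g_lin(1)[OF z]]
        linear_compose[OF linear_compose[OF \<Gamma>_lin_left[OF z] \<Gamma>_lin[OF z]] g_lin(1)[OF z]] by (auto simp: o_def)
    from trace_J[OF z this] show ?thesis
      unfolding P_def \<Gamma>_J_left[OF z] \<Gamma>_J[OF z] J_J by (simp add: bilinear_rneg[OF bil[OF z]] sum_negf)
  qed
  have 1: "(\<Sum>e\<in>Basis. g z (\<alpha> z) (N z (\<sigma> z e) e (\<alpha> z))) = q z"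
    using trace_N[OF z, of "\<alpha> z" "\<alpha> z"] gsym[OF z] q_eq[OF z] by simp
  show ?thesis unfolding Lap_def H sum.distrib sum_distrib_left[symmetric] 0 1 by simp
qed

text \<open>The refined Kato inequality behind this bound: \<open>T\<close> anticommutes with \<open>J\<close>, so \<open>T \<alpha>\<close> and
  \<open>T (J \<alpha>)\<close> contribute equally to the norm of \<open>T\<close>.\<close>

lemma Lap_ln_q:
  assumes z: "z \<in> \<Omega>" and "a \<noteq> 0"
  shows "Lap (\<lambda>y. ln (q y)) z \<ge> - 2"
proof -
  define P where "P u v = g z (T z u) (T z v)" for u v
  let ?tr = "\<Sum>e\<in>Basis. P e (\<sigma> z e)"
  have P: "bilinear P" "\<And>u v. P u v = P v u" "\<And>u. 0 \<le> P u u"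
    unfolding P_def bilinear_def
    using linear_compose[OF T_lin[OF z] g_lin(1)[OF z]] linear_compose[OF T_lin[OF z] g_lin(2)[OF z]]
      gsym[OF z] B_nonneg[OF form[OF z]] by (auto simp: o_def)
  have qz: "q z > 0" using q_pos assms by blast
  have ort: "g z (\<alpha> z) (J (\<alpha> z)) = 0"
    using g_J_skew[OF z, of "\<alpha> z" "\<alpha> z"] gsym[OF z, of "\<alpha> z" "J (\<alpha> z)"] by simp
  have "P (\<alpha> z) (\<alpha> z) + P (J (\<alpha> z)) (J (\<alpha> z)) \<le> q z * ?tr"
    by (rule trace_sharp_pair[OF form[OF z] P ort]) (use q_eq[OF z] g_J[OF z] qz in auto)
  moreover have "P (J (\<alpha> z)) (J (\<alpha> z)) = P (\<alpha> z) (\<alpha> z)"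
    unfolding P_def T_J[OF z] by (simp add: bilinear_lneg[OF bil[OF z]] bilinear_rneg[OF bil[OF z]] g_J[OF z])
  ultimately have kato: "2 * P (\<alpha> z) (\<alpha> z) \<le> q z * ?tr" by simp
  have "dpair q q z = 4 * (\<Sum>e\<in>Basis. g z (T z (\<alpha> z)) e * g z (T z (\<alpha> z)) (\<sigma> z e))"
    unfolding dpair_def DD_q_T[OF z] by (simp add: sum_distrib_left)
  also have "(\<Sum>e\<in>Basis. g z (T z (\<alpha> z)) e * g z (T z (\<alpha> z)) (\<sigma> z e)) = g z (T z (\<alpha> z)) (\<Sum>e\<in>Basis. g z e (T z (\<alpha> z)) *\<^sub>R \<sigma> z e)"
    by (simp add: bilinear_sum_right[OF bil[OF z]] bilinear_rmul[OF bil[OF z]] gsym[OF z, of "T z (\<alpha> z)"])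
  also have "\<dots> = P (\<alpha> z) (\<alpha> z)" unfolding sharp_frame_right[OF form[OF z]] P_def ..
  finally have "dpair q q z \<le> 2 * (q z * ?tr)" using kato by simp
  then have "dpair q q z / (q z)\<^sup>2 \<le> 2 * (q z * ?tr) / (q z)\<^sup>2" by (intro divide_right_mono) auto
  also have "\<dots> = 2 * ?tr / q z" using qz by (simp add: power2_eq_square)
  finally have "dpair q q z / (q z)\<^sup>2 \<le> 2 * ?tr / q z" .
  moreover have "Lap q z / q z = 2 * ?tr / q z - 2"
    unfolding Lap_q[OF z] P_def using qz by (simp add: diff_divide_distrib)
  ultimately show ?thesis
    using Lap_ln[OF smooth_q _ z] q_pos assms by simp
qed

lemma schwarz_form: assumes z: "z \<in> \<Omega>" shows "(a \<bullet> v)\<^sup>2 \<le> q z * g z v v"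
  using cauchy_schwarz_form[OF form[OF z], of "\<alpha> z" v] unfolding q_eq[OF z]
  by (simp add: \<alpha>_def g_\<sigma>[OF z])

section \<open>The function |dh|^2 / h^2 and its test vector fields\<close>

context
  fixes c :: real
  assumes h_pos: "\<And>z. z \<in> \<Omega> \<Longrightarrow> 0 < a \<bullet> z + c" and a0: "a \<noteq> 0"
begin

definition "fq y = q y / (a \<bullet> y + c)\<^sup>2"
text \<open>The logarithm of \<open>fq\<close>, with explicit coefficients so that it has the shape
  of \<open>Lap_add\<close>.\<close>

definition "F y = 1 * ln (q y) + (- 2) * ln (a \<bullet> y + c)"

lemma smooth_h: "smooth_on (\<lambda>y. a \<bullet> y + c) \<Omega>"
  by (rule smooth_on_add[OF open_\<Omega> smooth_on_linear[OF bounded_linear_inner_right] smooth_on_const])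

lemma smooth_fq: "smooth_on fq \<Omega>"
  unfolding fq_def
  by (rule smooth_on_divide[OF open_\<Omega> smooth_q smooth_on_power[OF open_\<Omega> smooth_h]]) (use h_pos in force)

lemma fq_pos: "z \<in> \<Omega> \<Longrightarrow> 0 < fq z"
  unfolding fq_def using h_pos[of z] q_pos[of z] a0 by simp

lemma smooth_F: "smooth_on F \<Omega>"
  unfolding F_def
  by (rule smooth_on_add[OF open_\<Omega> smooth_on_cmult[OF open_\<Omega> smooth_on_ln[OF open_\<Omega> smooth_q]]
        smooth_on_cmult[OF open_\<Omega> smooth_on_ln[OF open_\<Omega> smooth_h]]]) (use h_pos q_pos[OF _ a0] in auto)

lemma DD_h: "DD w (\<lambda>y. a \<bullet> y + c) z = a \<bullet> w"
  by (rule dir_deriv_eqI) (auto intro!: derivative_eq_intros)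

lemma Lap_ln_h: assumes z: "z \<in> \<Omega>" shows "Lap (\<lambda>y. ln (a \<bullet> y + c)) z = - fq z"
proof -
  have "Lap (\<lambda>y. a \<bullet> y + c) z = 0" unfolding Lap_def DD_h by (simp add: dir_deriv_const)
  moreover have "dpair (\<lambda>y. a \<bullet> y + c) (\<lambda>y. a \<bullet> y + c) z = q z"
  proof -
    have "(\<Sum>e\<in>Basis. (a \<bullet> e) *\<^sub>R (a \<bullet> \<sigma> z e)) = a \<bullet> \<sigma> z a"
      by (rule sum_inner_expand) (use linear_compose[OF linear_sharp[OF form[OF z]] bounded_linear.linear[OF bounded_linear_inner_right[of a]]] in \<open>simp add: o_def\<close>)
    then show ?thesis unfolding dpair_def DD_h q_def by simp
  qed
  ultimately show ?thesis using Lap_ln[OF smooth_h h_pos z] unfolding fq_def by simp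
qed

lemma Lap_F: assumes z: "z \<in> \<Omega>" shows "Lap F z \<ge> 2 * fq z - 2"
proof -
  have "smooth_on (\<lambda>y. ln (q y)) \<Omega>" "smooth_on (\<lambda>y. ln (a \<bullet> y + c)) \<Omega>"
    using smooth_on_ln[OF open_\<Omega> smooth_q q_pos[OF _ a0]] smooth_on_ln[OF open_\<Omega> smooth_h h_pos] by auto
  from Lap_add[OF this z, of 1 "- 2"]
  have "Lap F z = Lap (\<lambda>y. ln (q y)) z + 2 * fq z" unfolding F_def Lap_ln_h[OF z] by simp
  then show ?thesis using Lap_ln_q[OF z a0] by simp
qed

lemma DD_fq_power: assumes z: "z \<in> \<Omega>"
  shows "DD v (\<lambda>y. fq y ^ p) z = fq z ^ p * (real p * DD v F z)" "(\<lambda>y. fq y ^ p) differentiable (at z)"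
proof -
  have d: "fq differentiable (at z)" using smooth_on_differentiable[OF smooth_fq z] .
  have "DD v F z = DD v (\<lambda>y. ln (fq y)) z"
  proof (rule dir_deriv_cong_open(1)[OF open_\<Omega> z _ dir_deriv_ln(2)[OF d fq_pos[OF z]]])
    show "ln (fq y) = F y" if "y \<in> \<Omega>" for y
      unfolding F_def fq_def using h_pos[OF that] q_pos[OF that a0] by (simp add: ln_div ln_realpow)
  qed
  then have "DD v fq z = fq z * DD v F z" using dir_deriv_ln(1)[OF d fq_pos[OF z]] fq_pos[OF z] by simp
  moreover have "DD v fq z * (of_nat p * fq z ^ (p - 1)) = fq z ^ p * (real p * DD v F z)" if "DD v fq z = fq z * DD v F z"
    unfolding that by (cases p) auto
  moreover have D: "((\<lambda>y. fq y ^ p) has_derivative (\<lambda>v. DD v fq z * (of_nat p * fq z ^ (p - 1)))) (at z)"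
    using has_derivative_power[OF has_derivative_dir_deriv[OF d], of p] by (simp add: mult_ac)
  ultimately show "DD v (\<lambda>y. fq y ^ p) z = fq z ^ p * (real p * DD v F z)"
    using dir_deriv_eqI[OF D, of v] by simp
  show "(\<lambda>y. fq y ^ p) differentiable (at z)" using D differentiableI by blast
qed

text \<open>Subtracting \<open>\<psi> / 2\<close> turns the Riemannian volume into Lebesgue measure in the integrals of the
  vector field \<open>fq ^ p *\<^sub>R grad (\<Lambda> p)\<close>.\<close>

definition "\<Lambda> p y = real p * F y + (- 1/2) * \<psi> y"

lemma smooth_\<Lambda>: "smooth_on (\<Lambda> p) \<Omega>"
  unfolding \<Lambda>_def
  by (rule smooth_on_add[OF open_\<Omega> smooth_on_cmult[OF open_\<Omega> smooth_F] smooth_on_cmult[OF open_\<Omega> smooth_\<psi>]])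

lemma smooth_X: "smooth_on (\<lambda>y. fq y ^ p *\<^sub>R grad (\<Lambda> p) y) \<Omega>"
  by (rule smooth_on_scaleR[OF open_\<Omega> smooth_on_power[OF open_\<Omega> smooth_fq] smooth_grad[OF smooth_\<Lambda>]])

text \<open>Differentiating the power of fq contributes p times the pairing of \<Lambda> with F, and
  \<open>divergence_grad\<close> contributes - 1/2 times its pairing with \<psi>. By the choice of
  \<Lambda> they add up to the square \<open>dpair (\<Lambda> p) (\<Lambda> p)\<close>, which later
  absorbs the derivative of the cutoff.\<close>

lemma divergence_X:
  assumes z: "z \<in> \<Omega>"
  shows "(\<Sum>b\<in>Basis. DD b (\<lambda>y. fq y ^ p *\<^sub>R grad (\<Lambda> p) y) z \<bullet> b)
    \<ge> fq z ^ p * (2 * real p * fq z - 2 * real p - DIM(complex ^ 'n) + dpair (\<Lambda> p) (\<Lambda> p) z)"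
proof -
  have dF: "F differentiable (at z)" "\<psi> differentiable (at z)" "grad (\<Lambda> p) differentiable (at z)"
    using smooth_on_differentiable[OF _ z] smooth_F smooth_\<psi> smooth_grad[OF smooth_\<Lambda>] by blast+
  have D\<Lambda>: "DD v (\<Lambda> p) z = real p * DD v F z + (- 1/2) * DD v \<psi> z" for v
    unfolding \<Lambda>_def by (rule dir_deriv_eqI) (auto intro!: derivative_eq_intros has_derivative_dir_deriv dF)
  have pair: "dpair (\<Lambda> p) (\<Lambda> p) z = real p * dpair (\<Lambda> p) F z - 1/2 * dpair (\<Lambda> p) \<psi> z"
  proof -
    have "dpair (\<Lambda> p) (\<Lambda> p) z = DD (grad (\<Lambda> p) z) (\<Lambda> p) z"
      using DD_grad smooth_on_differentiable[OF smooth_\<Lambda> z] by metis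
    then show ?thesis unfolding D\<Lambda> DD_grad[OF dF(1)] DD_grad[OF dF(2)] by simp
  qed
  have "DD b (\<lambda>y. fq y ^ p *\<^sub>R grad (\<Lambda> p) y) z \<bullet> b
      = fq z ^ p * (DD b (grad (\<Lambda> p)) z \<bullet> b) + (grad (\<Lambda> p) z \<bullet> b) *\<^sub>R DD b (\<lambda>y. fq y ^ p) z" for b
    using dir_deriv_scaleR(1)[OF DD_fq_power(2)[OF z] dF(3)] by (simp add: inner_simps)
  then have "(\<Sum>b\<in>Basis. DD b (\<lambda>y. fq y ^ p *\<^sub>R grad (\<Lambda> p) y) z \<bullet> b)
      = fq z ^ p * (\<Sum>b\<in>Basis. DD b (grad (\<Lambda> p)) z \<bullet> b) + (\<Sum>b\<in>Basis. (grad (\<Lambda> p) z \<bullet> b) *\<^sub>R DD b (\<lambda>y. fq y ^ p) z)"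
    by (simp add: sum.distrib sum_distrib_left)
  also have "(\<Sum>b\<in>Basis. (grad (\<Lambda> p) z \<bullet> b) *\<^sub>R DD b (\<lambda>y. fq y ^ p) z) = DD (grad (\<Lambda> p) z) (\<lambda>y. fq y ^ p) z"
    by (rule sum_inner_expand[OF linear_dir_deriv[OF DD_fq_power(2)[OF z]]])
  also have "\<dots> = fq z ^ p * (real p * dpair (\<Lambda> p) F z)"
    unfolding DD_fq_power(1)[OF z] DD_grad[OF dF(1)] ..
  also have "(\<Sum>b\<in>Basis. DD b (grad (\<Lambda> p)) z \<bullet> b) = Lap (\<Lambda> p) z - 1/2 * dpair (\<Lambda> p) \<psi> z"
    by (rule divergence_grad[OF smooth_\<Lambda> z])
  finally have eq: "(\<Sum>b\<in>Basis. DD b (\<lambda>y. fq y ^ p *\<^sub>R grad (\<Lambda> p) y) z \<bullet> b)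
      = fq z ^ p * (Lap (\<Lambda> p) z + dpair (\<Lambda> p) (\<Lambda> p) z)"
    unfolding pair by (simp add: algebra_simps)
  have "Lap (\<Lambda> p) z = real p * Lap F z - DIM(complex ^ 'n)"
    unfolding \<Lambda>_def using Lap_add[OF smooth_F smooth_\<psi> z, of "real p" "- 1/2"] Lap_\<psi>[OF z] by simp
  moreover have "real p * (2 * fq z - 2) \<le> real p * Lap F z" using Lap_F[OF z] by (intro mult_left_mono) auto
  ultimately have "2 * real p * fq z - 2 * real p - DIM(complex ^ 'n) + dpair (\<Lambda> p) (\<Lambda> p) z \<le> Lap (\<Lambda> p) z + dpair (\<Lambda> p) (\<Lambda> p) z"
    by (simp add: algebra_simps)
  then show ?thesis unfolding eq using fq_pos[OF z] by (intro mult_left_mono) auto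
qed

lemma g_X:
  assumes z: "z \<in> \<Omega>"
  shows "g z (fq z ^ p *\<^sub>R grad (\<Lambda> p) z) (fq z ^ p *\<^sub>R grad (\<Lambda> p) z) = (fq z ^ p)\<^sup>2 * dpair (\<Lambda> p) (\<Lambda> p) z"
    "0 \<le> dpair (\<Lambda> p) (\<Lambda> p) z"
proof -
  have d: "\<Lambda> p differentiable (at z)" using smooth_on_differentiable[OF smooth_\<Lambda> z] .
  have "g z (grad (\<Lambda> p) z) (grad (\<Lambda> p) z) = dpair (\<Lambda> p) (\<Lambda> p) z"
    unfolding g_grad[OF z d] DD_grad[OF d] ..
  then show "g z (fq z ^ p *\<^sub>R grad (\<Lambda> p) z) (fq z ^ p *\<^sub>R grad (\<Lambda> p) z) = (fq z ^ p)\<^sup>2 * dpair (\<Lambda> p) (\<Lambda> p) z"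
    "0 \<le> dpair (\<Lambda> p) (\<Lambda> p) z"
    using B_nonneg[OF form[OF z], of "grad (\<Lambda> p) z"]
    by (auto simp: bilinear_lmul[OF bil[OF z]] bilinear_rmul[OF bil[OF z]] power2_eq_square)
qed

end

end

end

section \<open>The Riemannian distance\<close>

lemma vector_derivative_affine:
  fixes \<gamma> :: "real \<Rightarrow> 'a::real_normed_vector"
  assumes "\<gamma> differentiable (at (m * t + c))"
  shows "vector_derivative (\<lambda>t. \<gamma> (m * t + c)) (at t) = m *\<^sub>R vector_derivative \<gamma> (at (m * t + c))"
proof -
  have "((\<lambda>t. m * t + c) has_vector_derivative m) (at t)" by (auto intro!: derivative_eq_intros)
  moreover have "(\<gamma> has_vector_derivative vector_derivative \<gamma> (at (m * t + c))) (at (m * t + c))"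
    using assms vector_derivative_works by blast
  ultimately have "((\<gamma> \<circ> (\<lambda>t. m * t + c)) has_vector_derivative m *\<^sub>R vector_derivative \<gamma> (at (m * t + c))) (at t)"
    by (rule vector_diff_chain_at)
  then show ?thesis by (simp add: o_def vector_derivative_at)
qed

lemma vector_derivative_cong_open:
  assumes "open U" "t \<in> U" "\<And>x. x \<in> U \<Longrightarrow> f x = k x"
  shows "vector_derivative f (at t) = vector_derivative k (at t)"
proof -
  have "(f has_vector_derivative D) (at t) \<longleftrightarrow> (k has_vector_derivative D) (at t)" for D
    using has_vector_derivative_transform_within_open[OF _ assms(1,2), of f D k]
      has_vector_derivative_transform_within_open[OF _ assms(1,2), of k D f] assms(3) by auto
  then show ?thesis unfolding vector_derivative_def by simp
qed

lemma valid_path_pieces: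
  assumes "valid_path \<gamma>"
  obtains S where "finite S" "\<And>t. t \<in> {0..1} - S \<Longrightarrow> \<gamma> differentiable (at t)"
    "continuous_on ({0..1} - S) (\<lambda>t. vector_derivative \<gamma> (at t))" "continuous_on {0..1} \<gamma>"
proof -
  obtain S where "continuous_on {0..1} \<gamma>" "finite S" "\<gamma> C1_differentiable_on ({0..1} - S)"
    using assms unfolding valid_path_def piecewise_C1_differentiable_on_def by blast
  then show thesis using that[of S] unfolding C1_differentiable_on_eq by blast
qed

context riemannian_open
begin

definition speed :: "(real \<Rightarrow> complex ^ 'n) \<Rightarrow> real \<Rightarrow> real" where
  "speed \<gamma> t = sqrt (g (\<gamma> t) (vector_derivative \<gamma> (at t)) (vector_derivative \<gamma> (at t)))"

lemma lengths_iff: "L \<in> riemannian_lengths \<Omega> g x y \<longleftrightarrow>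
    (\<exists>\<gamma>. valid_path \<gamma> \<and> path_image \<gamma> \<subseteq> \<Omega> \<and> pathstart \<gamma> = x \<and> pathfinish \<gamma> = y \<and> (speed \<gamma> has_integral L) {0..1})"
  unfolding riemannian_lengths_def speed_def[abs_def] by blast

lemma lengthsI: "valid_path \<gamma> \<Longrightarrow> path_image \<gamma> \<subseteq> \<Omega> \<Longrightarrow> (speed \<gamma> has_integral L) {0..1} \<Longrightarrow>
    L \<in> riemannian_lengths \<Omega> g (\<gamma> 0) (\<gamma> 1)"
  unfolding lengths_iff pathstart_def pathfinish_def by blast

abbreviation "lengths \<equiv> riemannian_lengths \<Omega> g"
abbreviation "d \<equiv> riemannian_dist \<Omega> g"

lemma g_expand:
  assumes z: "z \<in> \<Omega>"
  shows "g z u v = (\<Sum>e\<in>Basis. \<Sum>b\<in>Basis. (u \<bullet> e) * ((v \<bullet> b) * g z e b))"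
proof -
  have "g z (\<Sum>e\<in>Basis. (u \<bullet> e) *\<^sub>R e) (\<Sum>b\<in>Basis. (v \<bullet> b) *\<^sub>R b) = (\<Sum>e\<in>Basis. \<Sum>b\<in>Basis. (u \<bullet> e) * ((v \<bullet> b) * g z e b))"
    unfolding bilinear_sum_left[OF bil[OF z]] unfolding bilinear_sum_right[OF bil[OF z]]
    by (simp add: bilinear_lmul[OF bil[OF z]] bilinear_rmul[OF bil[OF z]] mult_ac)
  then show ?thesis by (simp add: euclidean_representation)
qed

lemma g_continuous:
  assumes "continuous_on S \<gamma>" "continuous_on S u" "continuous_on S v" "\<gamma> ` S \<subseteq> \<Omega>"
  shows "continuous_on S (\<lambda>t. g (\<gamma> t) (u t) (v t))"
proof -
  have "continuous_on S (\<lambda>t. g (\<gamma> t) e b)" for e b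
    using continuous_on_compose2[OF smooth_on_continuous_on[OF smooth_g] assms(1,4)] .
  then have "continuous_on S (\<lambda>t. \<Sum>e\<in>Basis. \<Sum>b\<in>Basis. (u t \<bullet> e) * ((v t \<bullet> b) * g (\<gamma> t) e b))"
    by (intro continuous_intros assms)
  moreover have "(\<Sum>e\<in>Basis. \<Sum>b\<in>Basis. (u t \<bullet> e) * ((v t \<bullet> b) * g (\<gamma> t) e b)) = g (\<gamma> t) (u t) (v t)" if "t \<in> S" for t
    using g_expand assms(4) that by (simp add: image_subset_iff)
  ultimately show ?thesis by (simp cong: continuous_on_cong)
qed

lemma g_nonneg: "z \<in> \<Omega> \<Longrightarrow> 0 \<le> g z v v"
  using B_nonneg[OF form] .

lemma g_scale:
  assumes "z \<in> \<Omega>" shows "sqrt (g z (m *\<^sub>R v) (m *\<^sub>R v)) = \<bar>m\<bar> * sqrt (g z v v)"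
proof -
  have "g z (m *\<^sub>R v) (m *\<^sub>R v) = m\<^sup>2 * g z v v"
    by (simp add: bilinear_lmul[OF bil[OF assms]] bilinear_rmul[OF bil[OF assms]] power2_eq_square)
  then show ?thesis by (simp add: real_sqrt_mult)
qed

lemma speed_nonneg: "\<gamma> t \<in> \<Omega> \<Longrightarrow> 0 \<le> speed \<gamma> t"
  unfolding speed_def using g_nonneg by simp

lemma lengths_nonneg: assumes "L \<in> lengths x y" shows "0 \<le> L"
proof -
  obtain \<gamma> where "path_image \<gamma> \<subseteq> \<Omega>" and h: "(speed \<gamma> has_integral L) {0..1}"
    using assms unfolding lengths_iff by blast
  then have "0 \<le> speed \<gamma> t" if "t \<in> {0..1}" for t
    using speed_nonneg that unfolding path_image_def by blast
  then show ?thesis using has_integral_nonneg[OF h] by blast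
qed

lemma lengths_in: "L \<in> lengths x y \<Longrightarrow> x \<in> \<Omega> \<and> y \<in> \<Omega>"
  unfolding lengths_iff using pathfinish_in_path_image pathstart_in_path_image by blast

lemma bdd_lengths: "bdd_below (lengths x y)"
  using lengths_nonneg by (intro bdd_belowI) auto

lemma d_le_length: "L \<in> lengths x y \<Longrightarrow> d x y \<le> L"
  unfolding riemannian_dist_def using lengths_in cInf_lower[OF _ bdd_lengths] by auto

lemma lengths_C1:
  assumes "\<And>t. t \<in> {0..1} \<Longrightarrow> (\<gamma> has_vector_derivative \<gamma>' t) (at t)" "continuous_on {0..1} \<gamma>'" "\<gamma> ` {0..1} \<subseteq> \<Omega>"
  shows "integral {0..1} (\<lambda>t. sqrt (g (\<gamma> t) (\<gamma>' t) (\<gamma>' t))) \<in> lengths (\<gamma> 0) (\<gamma> 1)"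
proof (rule lengthsI)
  have vd: "vector_derivative \<gamma> (at t) = \<gamma>' t" if "t \<in> {0..1}" for t
    using vector_derivative_at[OF assms(1)[OF that]] .
  have "\<gamma> C1_differentiable_on {0..1}"
    unfolding C1_differentiable_on_eq
    using differentiableI_vector[OF assms(1)] continuous_on_eq[OF assms(2), of "\<lambda>t. vector_derivative \<gamma> (at t)"] vd
    by simp
  then show "valid_path \<gamma>" unfolding valid_path_def by (rule C1_differentiable_imp_piecewise)
  show "path_image \<gamma> \<subseteq> \<Omega>" using assms(3) unfolding path_image_def .
  have cont: "continuous_on {0..1} \<gamma>"
    by (intro continuous_at_imp_continuous_on ballI has_vector_derivative_continuous[OF assms(1)])
  have "(\<lambda>t. sqrt (g (\<gamma> t) (\<gamma>' t) (\<gamma>' t))) integrable_on {0..1}"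
    by (intro integrable_continuous_real continuous_on_real_sqrt g_continuous cont assms)
  then have "((\<lambda>t. sqrt (g (\<gamma> t) (\<gamma>' t) (\<gamma>' t))) has_integral integral {0..1} (\<lambda>t. sqrt (g (\<gamma> t) (\<gamma>' t) (\<gamma>' t)))) {0..1}"
    by (rule integrable_integral)
  then show "(speed \<gamma> has_integral integral {0..1} (\<lambda>t. sqrt (g (\<gamma> t) (\<gamma>' t) (\<gamma>' t)))) {0..1}"
    using vd unfolding speed_def[abs_def] by (subst has_integral_cong) auto
qed

lemma lengths_reverse: assumes "L \<in> lengths x y" shows "L \<in> lengths y x"
proof -
  obtain \<gamma> where \<gamma>: "valid_path \<gamma>" "path_image \<gamma> \<subseteq> \<Omega>" "\<gamma> 0 = x" "\<gamma> 1 = y" "(speed \<gamma> has_integral L) {0..1}"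
    using assms unfolding lengths_iff pathstart_def pathfinish_def by blast
  obtain S where S: "finite S" "\<And>t. t \<in> {0..1} - S \<Longrightarrow> \<gamma> differentiable (at t)" using valid_path_pieces[OF \<gamma>(1)] by metis
  have "((\<lambda>t. speed \<gamma> (- t)) has_integral L) {-1..-0}" using \<gamma>(5) unfolding has_integral_reflect_real .
  then have "((\<lambda>t. speed \<gamma> (- (1 *\<^sub>R t + (- 1)))) has_integral (L /\<^sub>R 1 ^ DIM(real))) (cbox ((-1 - (-1)) /\<^sub>R 1) ((0 - (-1)) /\<^sub>R 1))"
    by (intro has_integral_affinity') auto
  then have "((\<lambda>t. speed \<gamma> (1 - t)) has_integral L) {0..1}" by simp
  moreover have "speed (reversepath \<gamma>) t = speed \<gamma> (1 - t)" if "t \<in> {0..1} - (\<lambda>t. 1 - t) ` S" for t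
  proof -
    have "1 - t \<notin> S" using that by (metis DiffD2 diff_diff_eq2 add_diff_cancel_left' image_eqI)
    then have "\<gamma> differentiable (at (-1 * t + 1))" using S(2)[of "1 - t"] that by simp
    from vector_derivative_affine[OF this]
    have "vector_derivative (reversepath \<gamma>) (at t) = (- 1) *\<^sub>R vector_derivative \<gamma> (at (1 - t))"
      unfolding reversepath_def by simp
    moreover have "\<gamma> (1 - t) \<in> \<Omega>" using \<gamma>(2) that unfolding path_image_def by force
    ultimately show ?thesis unfolding speed_def using g_scale[of "\<gamma> (1 - t)" "- 1"] by (simp add: reversepath_def)
  qed
  ultimately have "(speed (reversepath \<gamma>) has_integral L) {0..1}"
    using S(1) by (intro has_integral_spike_finite[of "(\<lambda>t. 1 - t) ` S" _ "speed (reversepath \<gamma>)" "\<lambda>t. speed \<gamma> (1 - t)"]) auto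
  then have "L \<in> lengths (reversepath \<gamma> 0) (reversepath \<gamma> 1)"
    using \<gamma> by (intro lengthsI) auto
  then show ?thesis using \<gamma> by (simp add: reversepath_def)
qed

lemma speed_affine:
  assumes "\<gamma> differentiable (at (m * t + c))" "\<gamma> (m * t + c) \<in> \<Omega>"
  shows "speed (\<lambda>t. \<gamma> (m * t + c)) t = \<bar>m\<bar> * speed \<gamma> (m * t + c)"
  unfolding speed_def vector_derivative_affine[OF assms(1)] using g_scale[OF assms(2)] .

text \<open>The computation shared by joined paths and subpaths. The endpoints a and b join the
  exceptional set because k is prescribed only in the open interval.\<close>

lemma speed_affine_piece:
  assumes S: "finite S" "\<And>t. t \<in> {0..1} - S \<Longrightarrow> \<gamma> differentiable (at t)" and im: "path_image \<gamma> \<subseteq> \<Omega>"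
    and uv: "0 \<le> u" "u \<le> v" "v \<le> 1" and m: "m > 0" "m * a + c = u" "m * b + c = v"
    and K: "(speed \<gamma> has_integral K) {u..v}"
    and k: "\<And>t. t \<in> {a<..<b} \<Longrightarrow> k t = \<gamma> (m * t + c)"
  shows "(speed k has_integral K) {a..b}"
proof -
  have ab: "a = (u - c) / m" "b = (v - c) / m" using m by auto
  have "((\<lambda>t. speed \<gamma> (m *\<^sub>R t + c)) has_integral (K /\<^sub>R m ^ DIM(real))) (cbox ((u - c) /\<^sub>R m) ((v - c) /\<^sub>R m))"
    using K m by (intro has_integral_affinity') auto
  then have "((\<lambda>t. speed \<gamma> (m * t + c)) has_integral (K / m)) {a..b}"
    unfolding ab by (simp add: divide_inverse mult.commute)
  from has_integral_mult_right[OF this, of m]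
  have 1: "((\<lambda>t. m * speed \<gamma> (m * t + c)) has_integral K) {a..b}" using m by simp
  define S' where "S' = (\<lambda>t. (t - c) / m) ` S \<union> {a, b}"
  have "speed k t = m * speed \<gamma> (m * t + c)" if "t \<in> {a..b} - S'" for t
  proof -
    have t: "t \<in> {a<..<b}" using that unfolding S'_def by auto
    have "m * a < m * t" "m * t < m * b" using t m by auto
    then have "u < m * t + c" "m * t + c < v" using m(2,3) by linarith+
    then have in01: "m * t + c \<in> {0..1}" using uv by auto
    have "m * t + c \<notin> S"
    proof
      assume "m * t + c \<in> S"
      moreover have "t = (m * t + c - c) / m" using m by simp
      ultimately have "t \<in> S'" unfolding S'_def by blast
      then show False using that by blast
    qed
    then have df: "\<gamma> differentiable (at (m * t + c))" using S(2) in01 by blast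
    have "vector_derivative k (at t) = vector_derivative (\<lambda>t. \<gamma> (m * t + c)) (at t)"
      by (rule vector_derivative_cong_open[of "{a<..<b}"]) (use t k in auto)
    then have "speed k t = speed (\<lambda>t. \<gamma> (m * t + c)) t" unfolding speed_def using k[OF t] by simp
    also have "\<dots> = m * speed \<gamma> (m * t + c)"
    proof -
      have "\<gamma> (m * t + c) \<in> \<Omega>" using im in01 unfolding path_image_def by blast
      then show ?thesis using speed_affine[OF df] m by simp
    qed
    finally show ?thesis .
  qed
  then show ?thesis using S(1) by (intro has_integral_spike_finite[OF _ _ 1, of S']) (auto simp: S'_def)
qed

lemma lengths_join:
  assumes "L \<in> lengths x y" "K \<in> lengths y z" shows "L + K \<in> lengths x z"
proof -
  obtain \<gamma> where \<gamma>: "valid_path \<gamma>" "path_image \<gamma> \<subseteq> \<Omega>" "pathstart \<gamma> = x" "pathfinish \<gamma> = y" "(speed \<gamma> has_integral L) {0..1}"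
    using assms(1) unfolding lengths_iff by blast
  obtain \<eta> where \<eta>: "valid_path \<eta>" "path_image \<eta> \<subseteq> \<Omega>" "pathstart \<eta> = y" "pathfinish \<eta> = z" "(speed \<eta> has_integral K) {0..1}"
    using assms(2) unfolding lengths_iff by blast
  obtain S where S: "finite S" "\<And>t. t \<in> {0..1} - S \<Longrightarrow> \<gamma> differentiable (at t)" using valid_path_pieces[OF \<gamma>(1)] by metis
  obtain R where R: "finite R" "\<And>t. t \<in> {0..1} - R \<Longrightarrow> \<eta> differentiable (at t)" using valid_path_pieces[OF \<eta>(1)] by metis
  let ?j = "\<gamma> +++ \<eta>"
  have 1: "(speed ?j has_integral L) {0..1/2}"
    by (rule speed_affine_piece[OF S \<gamma>(2), of 0 1 2 0 0]) (use \<gamma>(5) in \<open>auto simp: joinpaths_def\<close>)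
  have 2: "(speed ?j has_integral K) {1/2..1}"
    by (rule speed_affine_piece[OF R \<eta>(2), of 0 1 2 "1/2" "-1"]) (use \<eta>(5) in \<open>auto simp: joinpaths_def\<close>)
  have "(speed ?j has_integral (L + K)) {0..1}" by (rule has_integral_combine[OF _ _ 1 2]) auto
  moreover have "valid_path ?j" "path_image ?j \<subseteq> \<Omega>" "pathstart ?j = x" "pathfinish ?j = z"
    using \<gamma> \<eta> path_image_join_subset[of \<gamma> \<eta>] by (auto intro!: valid_path_join)
  ultimately show ?thesis unfolding lengths_iff by blast
qed

lemma lengths_subpath:
  assumes \<gamma>: "valid_path \<gamma>" "path_image \<gamma> \<subseteq> \<Omega>" "(speed \<gamma> has_integral L) {0..1}"
    and uv: "0 \<le> u" "u < v" "v \<le> 1"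
  shows "integral {u..v} (speed \<gamma>) \<in> lengths (\<gamma> u) (\<gamma> v)"
proof -
  obtain S where S: "finite S" "\<And>t. t \<in> {0..1} - S \<Longrightarrow> \<gamma> differentiable (at t)" using valid_path_pieces[OF \<gamma>(1)] by metis
  have "speed \<gamma> integrable_on {u..v}"
    by (rule integrable_on_subinterval[OF has_integral_integrable[OF \<gamma>(3)]]) (use uv in auto)
  then have "(speed \<gamma> has_integral integral {u..v} (speed \<gamma>)) {u..v}" by (rule integrable_integral)
  then have "(speed (subpath u v \<gamma>) has_integral integral {u..v} (speed \<gamma>)) {0..1}"
    using uv by (intro speed_affine_piece[OF S \<gamma>(2), of u v "v - u" 0 u 1]) (auto simp: subpath_def)
  moreover have "valid_path (subpath u v \<gamma>)" using \<gamma>(1) uv by (intro valid_path_subpath) auto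
  moreover have "path_image (subpath u v \<gamma>) \<subseteq> \<Omega>" using \<gamma>(2) uv path_image_subpath_subset[of u v \<gamma>] by auto
  ultimately have "integral {u..v} (speed \<gamma>) \<in> lengths (subpath u v \<gamma> 0) (subpath u v \<gamma> 1)" by (intro lengthsI)
  then show ?thesis by (simp add: subpath_def)
qed

lemma path_lipschitz:
  fixes \<phi> :: "complex ^ 'n \<Rightarrow> real"
  assumes diff: "\<And>z. z \<in> \<Omega> \<Longrightarrow> \<phi> differentiable (at z)"
    and le: "\<And>z v. z \<in> \<Omega> \<Longrightarrow> \<bar>DD v \<phi> z\<bar> \<le> \<kappa> * sqrt (g z v v)"
    and L: "L \<in> lengths x y"
  shows "\<bar>\<phi> y - \<phi> x\<bar> \<le> \<kappa> * L"
proof -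
  obtain \<gamma> where \<gamma>: "valid_path \<gamma>" "path_image \<gamma> \<subseteq> \<Omega>" "\<gamma> 0 = x" "\<gamma> 1 = y" "(speed \<gamma> has_integral L) {0..1}"
    using L unfolding lengths_iff pathstart_def pathfinish_def by blast
  obtain S where S: "finite S" "\<And>t. t \<in> {0..1} - S \<Longrightarrow> \<gamma> differentiable (at t)" "continuous_on {0..1} \<gamma>"
    using valid_path_pieces[OF \<gamma>(1)] by metis
  have in\<Omega>: "\<gamma> t \<in> \<Omega>" if "t \<in> {0..1}" for t using \<gamma>(2) that unfolding path_image_def by blast
  \<comment> \<open>At the exceptional points the vector derivative carries no information; the
    value 0 there does not affect the integral.\<close>
  define D where "D t = (if t \<in> S then 0 else DD (vector_derivative \<gamma> (at t)) \<phi> (\<gamma> t))" for t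
  have D_int: "(D has_integral (\<phi> (\<gamma> 1) - \<phi> (\<gamma> 0))) {0..1}"
  proof (rule fundamental_theorem_of_calculus_interior_strong[OF S(1), of _ _ "\<lambda>t. \<phi> (\<gamma> t)"])
    have c\<phi>: "continuous_on \<Omega> \<phi>" using diff by (intro continuous_at_imp_continuous_on) (auto intro: differentiable_imp_continuous_within)
    show "continuous_on {0..1} (\<lambda>t. \<phi> (\<gamma> t))"
      by (rule continuous_on_compose2[OF c\<phi> S(3)]) (use in\<Omega> in blast)
    fix t assume t: "t \<in> {0<..<1} - S"
    then have "(\<gamma> has_derivative (\<lambda>h. h *\<^sub>R vector_derivative \<gamma> (at t))) (at t)"
      using S(2)[of t] vector_derivative_works[of \<gamma> "at t"] unfolding has_vector_derivative_def by auto
    moreover have "(\<phi> has_derivative dir_deriv \<phi> (\<gamma> t)) (at (\<gamma> t))"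
      using t by (intro has_derivative_dir_deriv diff in\<Omega>) auto
    ultimately have "((\<lambda>t. \<phi> (\<gamma> t)) has_derivative (\<lambda>h. dir_deriv \<phi> (\<gamma> t) (h *\<^sub>R vector_derivative \<gamma> (at t)))) (at t)"
      using has_derivative_compose by blast
    moreover have "linear (dir_deriv \<phi> (\<gamma> t))"
      using t by (intro has_derivative_linear[OF has_derivative_dir_deriv] diff in\<Omega>) auto
    ultimately show "((\<lambda>t. \<phi> (\<gamma> t)) has_vector_derivative D t) (at t)"
      unfolding has_vector_derivative_def D_def using t by (simp add: linear_cmul)
  qed auto
  moreover have "norm (D t) \<le> \<kappa> * speed \<gamma> t" if "t \<in> {0..1} - S" for t
    using le[of "\<gamma> t"] in\<Omega>[of t] that unfolding D_def speed_def by auto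
  then have "norm (D t) \<le> (if t \<in> S then 0 else \<kappa> * speed \<gamma> t)" if "t \<in> {0..1}" for t
    using that unfolding D_def by auto
  moreover have int: "((\<lambda>t. if t \<in> S then 0 else \<kappa> * speed \<gamma> t) has_integral (\<kappa> * L)) {0..1}"
    by (rule has_integral_spike_finite[OF S(1) _ has_integral_mult_right[OF \<gamma>(5), of \<kappa>]]) auto
  ultimately have "norm (integral {0..1} D) \<le> integral {0..1} (\<lambda>t. if t \<in> S then 0 else \<kappa> * speed \<gamma> t)"
    by (intro integral_norm_bound_integral) (auto simp: has_integral_integrable)
  then have "norm (\<phi> (\<gamma> 1) - \<phi> (\<gamma> 0)) \<le> \<kappa> * L"
    using integral_unique[OF D_int] integral_unique[OF int] by simp
  then show ?thesis using \<gamma> by simp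
qed

text \<open>\<open>riemannian_lengths\<close> collects integrals that exist, so the image speed must
  be shown integrable: it is continuous off a finite set, hence measurable, and dominated by
  \<kappa> times the integrable speed of \<gamma>.\<close>

lemma lengths_image:
  assumes c: "c \<in> \<Omega>" and s: "0 \<le> s" "s \<le> 1"
    and im: "\<And>t. t \<in> {0..1} \<Longrightarrow> c + s *\<^sub>R (\<gamma> t - c) \<in> \<Omega>"
    and le: "\<And>t v. t \<in> {0..1} \<Longrightarrow> sqrt (g (c + s *\<^sub>R (\<gamma> t - c)) (s *\<^sub>R v) (s *\<^sub>R v)) \<le> \<kappa> * sqrt (g (\<gamma> t) v v)"
    and \<gamma>: "valid_path \<gamma>" "path_image \<gamma> \<subseteq> \<Omega>" "(speed \<gamma> has_integral L) {0..1}"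
  shows "\<exists>K\<in>lengths (c + s *\<^sub>R (\<gamma> 0 - c)) (c + s *\<^sub>R (\<gamma> 1 - c)). K \<le> \<kappa> * L"
proof -
  obtain S where S: "finite S" "\<And>t. t \<in> {0..1} - S \<Longrightarrow> \<gamma> differentiable (at t)"
    "continuous_on ({0..1} - S) (\<lambda>t. vector_derivative \<gamma> (at t))" "continuous_on {0..1} \<gamma>"
    using valid_path_pieces[OF \<gamma>(1)] by metis
  define k where "k t = c + s *\<^sub>R (\<gamma> t - c)" for t
  have vd: "(k has_vector_derivative s *\<^sub>R vector_derivative \<gamma> (at t)) (at t)" if "t \<in> {0..1} - S" for t
  proof -
    have "(\<gamma> has_vector_derivative vector_derivative \<gamma> (at t)) (at t)" using S(2)[OF that] vector_derivative_works by blast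
    then show ?thesis unfolding k_def by (auto intro!: derivative_eq_intros)
  qed
  have kd: "vector_derivative k (at t) = s *\<^sub>R vector_derivative \<gamma> (at t)" if "t \<in> {0..1} - S" for t
    using vector_derivative_at[OF vd[OF that]] .
  have kcont: "continuous_on {0..1} k" unfolding k_def by (intro continuous_intros S)
  have "k C1_differentiable_on ({0..1} - S)"
    unfolding C1_differentiable_on_eq using differentiableI_vector[OF vd] kd
      continuous_on_eq[OF continuous_on_scaleR[OF continuous_on_const[of _ s] S(3)], of "\<lambda>t. vector_derivative k (at t)"]
    by simp
  then have vk: "valid_path k" unfolding valid_path_def piecewise_C1_differentiable_on_def using kcont S(1) by blast
  have pk: "path_image k \<subseteq> \<Omega>" unfolding path_image_def k_def using im by blast
  define f where "f t = (if t \<in> S then 0 else speed k t)" for t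
  have f_le: "norm (f t) \<le> (if t \<in> S then 0 else \<kappa> * speed \<gamma> t)" if "t \<in> {0..1}" for t
    using le[OF that, of "vector_derivative \<gamma> (at t)"] im[OF that] kd[of t] that g_nonneg
    unfolding f_def speed_def k_def[symmetric] by auto
  have int: "((\<lambda>t. if t \<in> S then 0 else \<kappa> * speed \<gamma> t) has_integral (\<kappa> * L)) {0..1}"
    by (rule has_integral_spike_finite[OF S(1) _ has_integral_mult_right[OF \<gamma>(3)]]) auto
  have "continuous_on ({0..1} - S) (\<lambda>t. g (k t) (s *\<^sub>R vector_derivative \<gamma> (at t)) (s *\<^sub>R vector_derivative \<gamma> (at t)))"
    by (intro g_continuous continuous_intros S(3) continuous_on_subset[OF kcont]) (use im in \<open>auto simp: k_def\<close>)
  then have "continuous_on ({0..1} - S) (speed k)"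
    unfolding speed_def[abs_def]
    by (intro continuous_on_real_sqrt) (rule continuous_on_eq, use kd in auto)
  moreover have lS: "{0..1} - S \<in> sets lebesgue"
    by (intro sets.Diff negligible_imp_sets[OF negligible_finite[OF S(1)]]) auto
  ultimately have "speed k \<in> borel_measurable (lebesgue_on ({0..1} - S))"
    by (intro continuous_imp_measurable_on_sets_lebesgue)
  then have "(\<lambda>t. if t \<in> {0..1} - S then speed k t else 0) \<in> borel_measurable lebesgue"
    by (rule borel_measurable_if_I[OF _ lS])
  then have "(\<lambda>t. if t \<in> {0..1} - S then speed k t else 0) \<in> borel_measurable (lebesgue_on {0..1})"
    using measurable_restrict_space1 by blast
  moreover have "f t = (if t \<in> {0..1} - S then speed k t else 0)" if "t \<in> {0..1}" for t
    unfolding f_def using that by auto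
  ultimately have "f \<in> borel_measurable (lebesgue_on {0..1})"
    by (subst measurable_cong[where g = "\<lambda>t. if t \<in> {0..1} - S then speed k t else 0"]) auto
  then have "f integrable_on {0..1}"
    using f_le int by (intro measurable_bounded_by_integrable_imp_integrable[of f "{0..1}" "\<lambda>t. if t \<in> S then 0 else \<kappa> * speed \<gamma> t"]) (auto simp: has_integral_integrable)
  then have fi: "(f has_integral integral {0..1} f) {0..1}" by (rule integrable_integral)
  have "(speed k has_integral integral {0..1} f) {0..1}"
    by (rule has_integral_spike_finite[OF S(1) _ fi]) (auto simp: f_def)
  from lengthsI[OF vk pk this]
  have "integral {0..1} f \<in> lengths (c + s *\<^sub>R (\<gamma> 0 - c)) (c + s *\<^sub>R (\<gamma> 1 - c))" unfolding k_def .
  moreover have "integral {0..1} f \<le> \<kappa> * L"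
    using f_le by (intro has_integral_le[OF fi int]) fastforce
  ultimately show ?thesis by blast
qed

end

section \<open>A continuously differentiable bump function\<close>

lemma max_square_has_derivative: "((\<lambda>t::real. (max 0 t)\<^sup>2) has_real_derivative 2 * max 0 t) (at t)"
proof (cases "t = 0")
  case True
  have "((\<lambda>h. (max 0 h)\<^sup>2 / h) \<longlongrightarrow> 0) (at (0::real))"
  proof (rule Lim_null_comparison)
    show "\<forall>\<^sub>F h in at 0. norm ((max 0 h)\<^sup>2 / h) \<le> norm (h::real)"
      by (rule always_eventually) (auto simp: max_def power2_eq_square)
    show "((\<lambda>h::real. norm h) \<longlongrightarrow> 0) (at 0)" by (rule tendsto_norm_zero) (rule tendsto_ident_at)
  qed
  then show ?thesis using True by (simp add: DERIV_def)
next
  case False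
  show ?thesis
  proof (cases "t > 0")
    case True
    have "((\<lambda>t. t\<^sup>2) has_real_derivative 2 * max 0 t) (at t)" using True by (auto intro!: derivative_eq_intros)
    then show ?thesis by (rule has_field_derivative_transform_within_open[of _ _ _ "{0<..}"]) (use True in auto)
  next
    case t: False
    have "((\<lambda>t::real. 0) has_real_derivative 2 * max 0 t) (at t)" using t by (auto simp: max_def)
    then show ?thesis by (rule has_field_derivative_transform_within_open[of _ _ _ "{..<0}"]) (use t False in auto)
  qed
qed

text \<open>Squaring the positive part makes the function C1. It serves as a test function for lower
  bounds of the distance and as a mollifier.\<close>

definition bump :: "real \<Rightarrow> 'a::real_inner \<Rightarrow> real" where "bump r x = (max 0 (r\<^sup>2 - x \<bullet> x))\<^sup>2"

lemma bump_has_derivative: "(bump r has_derivative (\<lambda>v. - 4 * max 0 (r\<^sup>2 - x \<bullet> x) * (x \<bullet> v))) (at x)"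
proof -
  have 1: "((\<lambda>x. r\<^sup>2 - x \<bullet> x) has_derivative (\<lambda>v. - (2 * (x \<bullet> v)))) (at x)"
    by (auto intro!: derivative_eq_intros simp: inner_commute)
  have "((\<lambda>t::real. (max 0 t)\<^sup>2) has_derivative (\<lambda>u. 2 * max 0 (r\<^sup>2 - x \<bullet> x) * u)) (at (r\<^sup>2 - x \<bullet> x))"
    using max_square_has_derivative unfolding has_field_derivative_def by simp
  from has_derivative_compose[OF 1 this] show ?thesis unfolding bump_def[abs_def] by (simp add: mult_ac)
qed

lemma bump_bounds:
  fixes x :: "'a::real_inner"
  assumes "r > 0"
  shows "0 \<le> bump r x" "bump r x \<le> r ^ 4" "bump r (0::'a) = r ^ 4" "norm x \<ge> r \<Longrightarrow> bump r x = 0"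
    "bump r x = r ^ 4 \<Longrightarrow> x = 0" "norm x < r \<Longrightarrow> bump r x > 0"
proof -
  show "0 \<le> bump r x" unfolding bump_def by simp
  have m: "0 \<le> max 0 (r\<^sup>2 - x \<bullet> x)" "max 0 (r\<^sup>2 - x \<bullet> x) \<le> r\<^sup>2" by auto
  have r4: "r ^ 4 = (r\<^sup>2)\<^sup>2" by simp
  show "bump r x \<le> r ^ 4" unfolding bump_def r4 using m by (intro power_mono) auto
  show "bump r (0::'a) = r ^ 4" unfolding bump_def by simp
  show "bump r x = 0" if "norm x \<ge> r"
  proof -
    have "r\<^sup>2 \<le> (norm x)\<^sup>2" using that assms by (intro power_mono) auto
    then show ?thesis unfolding bump_def by (simp add: power2_norm_eq_inner)
  qed
  show "x = 0" if "bump r x = r ^ 4"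
  proof -
    have "max 0 (r\<^sup>2 - x \<bullet> x) = r\<^sup>2"
      by (rule power2_eq_imp_eq) (use that m in \<open>simp_all add: bump_def\<close>)
    then show ?thesis using assms by (simp add: max_def split: if_splits)
  qed
  show "bump r x > 0" if "norm x < r"
  proof -
    have "(norm x)\<^sup>2 < r\<^sup>2" using that assms by (intro power_strict_mono) auto
    then show ?thesis unfolding bump_def by (simp add: power2_norm_eq_inner)
  qed
qed

context riemannian_open
begin

lemma compact_bounds:
  assumes K: "compact K" "K \<subseteq> \<Omega>"
  obtains c C where "c > 0" "C > 0" "\<And>z v. z \<in> K \<Longrightarrow> c * norm v \<le> sqrt (g z v v)"
    "\<And>z v. z \<in> K \<Longrightarrow> sqrt (g z v v) \<le> C * norm v"
proof (cases "K = {}")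
  case False
  let ?S = "K \<times> sphere (0 :: complex ^ 'n) 1"
  have "axis undefined 1 \<in> sphere (0 :: complex ^ 'n) 1" by (simp add: norm_axis_1)
  then have ne: "?S \<noteq> {}" using False by blast
  have cp: "compact ?S" using K by (intro compact_Times) auto
  have cont: "continuous_on ?S (\<lambda>x. g (fst x) (snd x) (snd x))"
    by (intro g_continuous continuous_intros) (use K in auto)
  obtain x where x: "x \<in> ?S" "\<And>y. y \<in> ?S \<Longrightarrow> g (fst x) (snd x) (snd x) \<le> g (fst y) (snd y) (snd y)"
    using continuous_attains_inf[OF cp ne cont] by blast
  obtain y where y: "y \<in> ?S" "\<And>x. x \<in> ?S \<Longrightarrow> g (fst x) (snd x) (snd x) \<le> g (fst y) (snd y) (snd y)"
    using continuous_attains_sup[OF cp ne cont] by blast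
  have pos: "g (fst a) (snd a) (snd a) > 0" if "a \<in> ?S" for a
  proof -
    have "fst a \<in> \<Omega>" "snd a \<noteq> 0" using that K by auto
    then show ?thesis using B_pos[OF form] by blast
  qed
  let ?c = "sqrt (g (fst x) (snd x) (snd x))" and ?C = "sqrt (g (fst y) (snd y) (snd y))"
  have both: "?c * norm v \<le> sqrt (g z v v) \<and> sqrt (g z v v) \<le> ?C * norm v" if z: "z \<in> K" for z v
  proof (cases "v = 0")
    case True then show ?thesis using z K by (auto simp: bilinear_lzero[OF bil])
  next
    case False
    define u where "u = (1 / norm v) *\<^sub>R v"
    have u: "(z, u) \<in> ?S" using z False unfolding u_def by simp
    have v: "v = norm v *\<^sub>R u" unfolding u_def using False by simp
    have "sqrt (g z v v) = norm v * sqrt (g z u u)"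
      using g_scale[of z "norm v" u] v z K by auto
    then show ?thesis using x(2)[OF u] y(2)[OF u] by (simp add: mult.commute mult_left_mono)
  qed
  show thesis
    by (rule that[of ?c ?C]) (use pos[OF x(1)] pos[OF y(1)] both in auto)
qed (use that[of 1 1] in auto)

end

section \<open>The Riemannian distance as a metric\<close>

locale riemannian_convex = riemannian_open \<Omega> g for \<Omega> :: "(complex ^ 'n) set" and g +
  assumes convex_\<Omega>: "convex \<Omega>"
begin

lemma segment_in: "x \<in> \<Omega> \<Longrightarrow> y \<in> \<Omega> \<Longrightarrow> 0 \<le> t \<Longrightarrow> t \<le> 1 \<Longrightarrow> x + t *\<^sub>R (y - x) \<in> \<Omega>"
proof -
  assume *: "x \<in> \<Omega>" "y \<in> \<Omega>" "0 \<le> t" "t \<le> 1"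
  have "(1 - t) *\<^sub>R x + t *\<^sub>R y \<in> \<Omega>" by (rule convexD[OF convex_\<Omega>]) (use * in auto)
  moreover have "(1 - t) *\<^sub>R x + t *\<^sub>R y = x + t *\<^sub>R (y - x)"
    by (simp add: scaleR_left_diff_distrib scaleR_right_diff_distrib)
  ultimately show ?thesis by simp
qed

lemma lengths_segment:
  assumes "x \<in> \<Omega>" "y \<in> \<Omega>"
  shows "integral {0..1} (\<lambda>t. sqrt (g (x + t *\<^sub>R (y - x)) (y - x) (y - x))) \<in> lengths x y"
proof -
  have "integral {0..1} (\<lambda>t. sqrt (g (x + t *\<^sub>R (y - x)) (y - x) (y - x)))
      \<in> lengths (x + 0 *\<^sub>R (y - x)) (x + 1 *\<^sub>R (y - x))"
    by (rule lengths_C1) (use assms segment_in in \<open>auto intro!: derivative_eq_intros\<close>)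
  then show ?thesis by simp
qed

lemma d_segment_le:
  assumes xy: "x \<in> \<Omega>" "y \<in> \<Omega>" and M: "\<And>t. 0 \<le> t \<Longrightarrow> t \<le> 1 \<Longrightarrow> sqrt (g (x + t *\<^sub>R (y - x)) (y - x) (y - x)) \<le> M"
  shows "d x y \<le> M"
proof -
  have c: "(\<lambda>t. sqrt (g (x + t *\<^sub>R (y - x)) (y - x) (y - x))) integrable_on {0..1}"
    by (intro integrable_continuous_real continuous_on_real_sqrt g_continuous continuous_intros)
      (use segment_in[OF xy] in auto)
  have "d x y \<le> integral {0..1} (\<lambda>t. sqrt (g (x + t *\<^sub>R (y - x)) (y - x) (y - x)))"
    by (rule d_le_length[OF lengths_segment[OF xy]])
  also have "\<dots> \<le> integral {0..1} (\<lambda>t::real. M)" by (rule Henstock_Kurzweil_Integration.integral_le) (use c M in auto)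
  finally show ?thesis by simp
qed

lemma d_nonneg: "0 \<le> d x y"
proof (cases "x \<in> \<Omega> \<and> y \<in> \<Omega>")
  case True
  then have "lengths x y \<noteq> {}" using lengths_segment by blast
  then show ?thesis unfolding riemannian_dist_def using True lengths_nonneg by (auto intro!: cInf_greatest)
qed (auto simp: riemannian_dist_def)

lemma d_approx:
  assumes "x \<in> \<Omega>" "y \<in> \<Omega>" "\<epsilon> > 0"
  obtains L where "L \<in> lengths x y" "L < d x y + \<epsilon>"
proof -
  have "lengths x y \<noteq> {}" using lengths_segment assms by blast
  moreover have "Inf (lengths x y) < d x y + \<epsilon>" unfolding riemannian_dist_def using assms by simp
  ultimately show thesis using cInf_lessD that by blast
qed

lemma d_self: assumes x: "x \<in> \<Omega>" shows "d x x = 0"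
proof -
  have "d x x \<le> 0" by (rule d_segment_le[OF x x]) (simp add: bilinear_lzero[OF bil[OF x]])
  then show ?thesis using d_nonneg[of x x] by simp
qed

lemma d_sym: "d x y = d y x"
proof -
  have "lengths x y = lengths y x" using lengths_reverse by blast
  then show ?thesis unfolding riemannian_dist_def by auto
qed

lemma d_tri:
  assumes "x \<in> \<Omega>" "y \<in> \<Omega>" "z \<in> \<Omega>" shows "d x z \<le> d x y + d y z"
proof (rule field_le_epsilon)
  fix e :: real assume e: "e > 0"
  obtain L where L: "L \<in> lengths x y" "L < d x y + e / 2" using d_approx[of x y "e / 2"] assms e by auto
  obtain K where K: "K \<in> lengths y z" "K < d y z + e / 2" using d_approx[of y z "e / 2"] assms e by auto
  have "d x z \<le> L + K" by (rule d_le_length[OF lengths_join[OF L(1) K(1)]])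
  then show "d x z \<le> d x y + d y z + e" using L K by (simp add: field_simps)
qed

lemma d_lipschitz:
  fixes \<phi> :: "complex ^ 'n \<Rightarrow> real"
  assumes diff: "\<And>z. z \<in> \<Omega> \<Longrightarrow> \<phi> differentiable (at z)"
    and le: "\<And>z v. z \<in> \<Omega> \<Longrightarrow> \<bar>DD v \<phi> z\<bar> \<le> \<kappa> * sqrt (g z v v)"
    and xy: "x \<in> \<Omega>" "y \<in> \<Omega>" and \<kappa>: "\<kappa> \<ge> 0"
  shows "\<bar>\<phi> y - \<phi> x\<bar> \<le> \<kappa> * d x y"
proof (rule field_le_epsilon)
  fix e :: real assume e: "e > 0"
  obtain L where L: "L \<in> lengths x y" "L < d x y + e / (\<kappa> + 1)" using d_approx[of x y "e / (\<kappa> + 1)"] xy e \<kappa> by auto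
  have "\<bar>\<phi> y - \<phi> x\<bar> \<le> \<kappa> * L" by (rule path_lipschitz[OF diff le L(1)])
  also have "\<dots> \<le> \<kappa> * (d x y + e / (\<kappa> + 1))" using L \<kappa> by (intro mult_left_mono) auto
  also have "\<dots> = \<kappa> * d x y + e * (\<kappa> / (\<kappa> + 1))" by (simp add: algebra_simps)
  also have "e * (\<kappa> / (\<kappa> + 1)) \<le> e * 1" using e \<kappa> by (intro mult_left_mono) auto
  finally show "\<bar>\<phi> y - \<phi> x\<bar> \<le> \<kappa> * d x y + e" by simp
qed

text \<open>The bump function is Lipschitz for d, because its derivative lives in the ball where g
  dominates the Euclidean metric. This yields lower bounds for d without following a path to its
  first exit from the ball.\<close>

lemma d_bump_lower:
  assumes r: "r > 0" "cball z0 r \<subseteq> \<Omega>" and c: "c > 0" "\<And>z v. z \<in> cball z0 r \<Longrightarrow> c * norm v \<le> sqrt (g z v v)"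
    and y: "y \<in> \<Omega>"
  shows "r ^ 4 - bump r (y - z0) \<le> 4 * r ^ 3 / c * d z0 y"
proof -
  let ?\<phi> = "\<lambda>z. bump r (z - z0)"
  have D: "(?\<phi> has_derivative (\<lambda>v. - 4 * max 0 (r\<^sup>2 - (z - z0) \<bullet> (z - z0)) * ((z - z0) \<bullet> v))) (at z)" for z
  proof -
    have "((\<lambda>z. z - z0) has_derivative (\<lambda>v. v)) (at z)" by (auto intro!: derivative_eq_intros)
    from has_derivative_compose[OF this bump_has_derivative] show ?thesis .
  qed
  have z0: "z0 \<in> \<Omega>" using r by auto
  have "\<bar>?\<phi> y - ?\<phi> z0\<bar> \<le> 4 * r ^ 3 / c * d z0 y"
  proof (rule d_lipschitz[OF _ _ z0 y])
    show "?\<phi> differentiable (at z)" for z using D differentiableI by blast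
    show "0 \<le> 4 * r ^ 3 / c" using r c by simp
    fix z v assume z: "z \<in> \<Omega>"
    let ?m = "max 0 (r\<^sup>2 - (z - z0) \<bullet> (z - z0))"
    have DD: "DD v ?\<phi> z = - 4 * ?m * ((z - z0) \<bullet> v)" using dir_deriv_eqI[OF D] .
    show "\<bar>DD v ?\<phi> z\<bar> \<le> 4 * r ^ 3 / c * sqrt (g z v v)"
    proof (cases "norm (z - z0) \<le> r")
      case True
      have "\<bar>DD v ?\<phi> z\<bar> = 4 * (?m * \<bar>(z - z0) \<bullet> v\<bar>)" unfolding DD by (simp add: abs_mult)
      also have "\<dots> \<le> 4 * (r\<^sup>2 * (r * norm v))"
      proof (intro mult_left_mono mult_mono)
        have "\<bar>(z - z0) \<bullet> v\<bar> \<le> norm (z - z0) * norm v" by (rule Cauchy_Schwarz_ineq2)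
        also have "\<dots> \<le> r * norm v" using True by (intro mult_right_mono) auto
        finally show "\<bar>(z - z0) \<bullet> v\<bar> \<le> r * norm v" .
      qed auto
      also have "\<dots> = 4 * r ^ 3 / c * (c * norm v)" using c by (simp add: power3_eq_cube power2_eq_square)
      also have "\<dots> \<le> 4 * r ^ 3 / c * sqrt (g z v v)"
        using c(1) c(2)[of z v] True r by (intro mult_left_mono) (auto simp: dist_norm norm_minus_commute)
      finally show ?thesis .
    next
      case False
      then have "r\<^sup>2 \<le> (norm (z - z0))\<^sup>2" using r by (intro power_mono) auto
      then have "?m = 0" by (simp add: power2_norm_eq_inner)
      then have "DD v ?\<phi> z = 0" unfolding DD by simp
      moreover have "0 \<le> 4 * r ^ 3 / c * sqrt (g z v v)" using r c g_nonneg[OF z] by simp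
      ultimately show ?thesis by simp
    qed
  qed
  then have "\<bar>bump r (y - z0) - r ^ 4\<bar> \<le> 4 * r ^ 3 / c * d z0 y" using bump_bounds(3)[where 'a = "complex ^ 'n", OF r(1)] by simp
  then show ?thesis by linarith
qed

lemma d_lower_far:
  assumes r: "r > 0" "cball z0 r \<subseteq> \<Omega>" and c: "c > 0" "\<And>z v. z \<in> cball z0 r \<Longrightarrow> c * norm v \<le> sqrt (g z v v)"
    and y: "y \<in> \<Omega>" "norm (y - z0) \<ge> r"
  shows "c * r \<le> 4 * d z0 y"
proof -
  have "r ^ 4 \<le> 4 * r ^ 3 / c * d z0 y"
    using d_bump_lower[OF r c y(1)] bump_bounds(4)[OF r(1) y(2)] by simp
  then have "r ^ 3 * (c * r) \<le> r ^ 3 * (4 * d z0 y)" using c by (simp add: field_simps power_numeral_reduce)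
  then show ?thesis using r by simp
qed

lemma cball_bounds:
  assumes "z0 \<in> \<Omega>"
  obtains r c C where "r > 0" "cball z0 r \<subseteq> \<Omega>" "c > 0" "C > 0" "\<And>z v. z \<in> cball z0 r \<Longrightarrow> c * norm v \<le> sqrt (g z v v)"
    "\<And>z v. z \<in> cball z0 r \<Longrightarrow> sqrt (g z v v) \<le> C * norm v"
proof -
  obtain r where r: "r > 0" "cball z0 r \<subseteq> \<Omega>" using open_\<Omega> assms open_contains_cball by blast
  show thesis using compact_bounds[OF compact_cball r(2)] that r by metis
qed

lemma d_zero: assumes "x \<in> \<Omega>" "y \<in> \<Omega>" "d x y = 0" shows "x = y"
proof -
  obtain r c C where rc: "r > 0" "cball x r \<subseteq> \<Omega>" "c > 0" "\<And>z v. z \<in> cball x r \<Longrightarrow> c * norm v \<le> sqrt (g z v v)"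
    using cball_bounds[OF assms(1)] by metis
  have "r ^ 4 \<le> bump r (y - x)" using d_bump_lower[OF rc assms(2)] assms(3) by simp
  then have "bump r (y - x) = r ^ 4" using bump_bounds(2)[OF rc(1), of "y - x"] by simp
  then show ?thesis using bump_bounds(5)[OF rc(1)] by fastforce
qed

sublocale M: Metric_space \<Omega> d
proof
  show "d x y = 0 \<longleftrightarrow> x = y" if "x \<in> \<Omega>" "y \<in> \<Omega>" for x y
    using d_zero[OF that] d_self[OF that(1)] by blast
qed (use d_nonneg d_sym d_tri in blast)+

lemma d_local_upper:
  assumes "x \<in> \<Omega>"
  obtains r C where "r > 0" "C > 0" "cball x r \<subseteq> \<Omega>" "\<And>y. y \<in> cball x r \<Longrightarrow> d x y \<le> C * dist x y"
proof -
  obtain r c C where rc: "r > 0" "cball x r \<subseteq> \<Omega>" "C > 0" "\<And>z v. z \<in> cball x r \<Longrightarrow> sqrt (g z v v) \<le> C * norm v"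
    using cball_bounds[OF assms(1)] by metis
  have "d x y \<le> C * dist x y" if y: "y \<in> cball x r" for y
  proof (rule d_segment_le)
    fix t :: real assume t: "0 \<le> t" "t \<le> 1"
    have "norm (t *\<^sub>R (y - x)) \<le> 1 * norm (y - x)" unfolding norm_scaleR using t by (intro mult_right_mono) auto
    then have "x + t *\<^sub>R (y - x) \<in> cball x r" using y by (simp add: dist_norm norm_minus_commute)
    from rc(4)[OF this, of "y - x"]
    show "sqrt (g (x + t *\<^sub>R (y - x)) (y - x) (y - x)) \<le> C * dist x y"
      by (simp add: dist_norm norm_minus_commute)
  qed (use y rc assms in auto)
  then show thesis by (rule that[OF rc(1) rc(3) rc(2)])
qed

lemma d_continuous: assumes "o0 \<in> \<Omega>" shows "continuous_on \<Omega> (d o0)"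
  unfolding continuous_on_iff
proof (intro ballI allI impI)
  fix x and e :: real assume x: "x \<in> \<Omega>" and e: "e > 0"
  obtain r C where rC: "r > 0" "C > 0" "cball x r \<subseteq> \<Omega>" "\<And>y. y \<in> cball x r \<Longrightarrow> d x y \<le> C * dist x y"
    using d_local_upper[OF x] by blast
  have "dist (d o0 y) (d o0 x) < e" if y: "y \<in> \<Omega>" "dist y x < min r (e / C)" for y
  proof -
    have "d x y \<le> C * dist x y" using rC(4)[of y] y by (simp add: dist_commute)
    also have "\<dots> < C * (e / C)" using y rC by (intro mult_strict_left_mono) (auto simp: dist_commute)
    also have "\<dots> = e" using rC by simp
    finally have "d x y < e" .
    moreover have "d o0 y \<le> d o0 x + d x y" "d o0 x \<le> d o0 y + d x y"
      using d_tri[of o0 x y] d_tri[of o0 y x] d_sym[of y x] assms x y by auto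
    ultimately show ?thesis by (simp add: dist_real_def abs_less_iff)
  qed
  then show "\<exists>s>0. \<forall>y\<in>\<Omega>. dist y x < s \<longrightarrow> dist (d o0 y) (d o0 x) < e"
    using rC e by (intro exI[of _ "min r (e / C)"]) auto
qed

lemma limitin_imp_tendsto:
  assumes "limitin M.mtopology f l sequentially"
  shows "f \<longlonglongrightarrow> l"
proof (rule LIMSEQ_I)
  fix e :: real assume e: "e > 0"
  have l: "l \<in> \<Omega>" and f: "\<And>\<epsilon>. \<epsilon> > 0 \<Longrightarrow> \<exists>N. \<forall>n\<ge>N. f n \<in> \<Omega> \<and> d (f n) l < \<epsilon>"
    using assms unfolding M.limit_metric_sequentially by auto
  obtain r c C where rc: "r > 0" "cball l r \<subseteq> \<Omega>" "c > 0" "\<And>z v. z \<in> cball l r \<Longrightarrow> c * norm v \<le> sqrt (g z v v)"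
    using cball_bounds[OF l] by metis
  define s where "s = min r e"
  have s: "s > 0" "cball l s \<subseteq> \<Omega>" "\<And>z v. z \<in> cball l s \<Longrightarrow> c * norm v \<le> sqrt (g z v v)"
    using rc e unfolding s_def by (auto simp: subset_iff)
  obtain N where N: "\<forall>n\<ge>N. f n \<in> \<Omega> \<and> d (f n) l < c * s / 4" using f[of "c * s / 4"] s rc by auto
  have "norm (f n - l) < e" if "n \<ge> N" for n
  proof (rule ccontr)
    assume "\<not> norm (f n - l) < e"
    then have "s \<le> norm (f n - l)" unfolding s_def by auto
    then have "c * s \<le> 4 * d l (f n)" using d_lower_far[OF s(1,2) rc(3) s(3)] N that by auto
    then show False using N that d_sym[of l "f n"] by force
  qed
  then show "\<exists>N. \<forall>n\<ge>N. norm (f n - l) < e" by blast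
qed

text \<open>Arc length is an indefinite integral, hence uniformly continuous in the parameter even
  if the speed is unbounded; an equidistant subdivision therefore has short pieces.\<close>

lemma chain_exists:
  assumes xy: "x \<in> \<Omega>" "y \<in> \<Omega>" and e: "\<epsilon> > 0"
  shows "\<exists>N p. p 0 = x \<and> p N = y \<and> (\<forall>i\<le>N. p i \<in> \<Omega>) \<and>
        (\<forall>i<N. d (p i) (p (Suc i)) \<le> \<epsilon>) \<and> (\<Sum>i<N. d (p i) (p (Suc i))) \<le> d x y + \<epsilon>"
proof -
  obtain L where L: "L \<in> lengths x y" "L < d x y + \<epsilon>" using d_approx[OF xy e] by blast
  obtain \<gamma> where \<gamma>: "valid_path \<gamma>" "path_image \<gamma> \<subseteq> \<Omega>" "\<gamma> 0 = x" "\<gamma> 1 = y" "(speed \<gamma> has_integral L) {0..1}"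
    using L(1) unfolding lengths_iff pathstart_def pathfinish_def by blast
  have int: "speed \<gamma> integrable_on {0..1}" using \<gamma>(5) by blast
  define s where "s t = integral {0..t} (speed \<gamma>)" for t
  have "uniformly_continuous_on {0..1} s"
    unfolding s_def by (intro compact_uniformly_continuous indefinite_integral_continuous_1 int) auto
  then obtain \<delta> where \<delta>: "\<delta> > 0" "\<And>a b. a \<in> {0..1} \<Longrightarrow> b \<in> {0..1} \<Longrightarrow> dist b a < \<delta> \<Longrightarrow> dist (s b) (s a) < \<epsilon>"
    unfolding uniformly_continuous_on_def using e by metis
  obtain N :: nat where "N > 0" "1 / real N < \<delta>"
    using \<delta>(1) by (metis reals_Archimedean inverse_eq_divide zero_less_Suc)
  then have N: "N > 0" "1 / real N < \<delta>" by auto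
  define p where "p i = \<gamma> (real i / real N)" for i
  have t: "real i / real N \<in> {0..1}" if "i \<le> N" for i using that N by auto
  have st: "d (p i) (p (Suc i)) \<le> s (real (Suc i) / real N) - s (real i / real N)" if "i < N" for i
  proof -
    let ?a = "real i / real N" and ?b = "real (Suc i) / real N"
    have ab: "0 \<le> ?a" "?a < ?b" "?b \<le> 1" using that N by (auto simp: divide_strict_right_mono)
    have "d (p i) (p (Suc i)) \<le> integral {?a..?b} (speed \<gamma>)"
      unfolding p_def by (rule d_le_length[OF lengths_subpath[OF \<gamma>(1,2,5) ab]])
    also have "\<dots> = s ?b - s ?a"
    proof -
      have "speed \<gamma> integrable_on {0..?b}" by (rule integrable_on_subinterval[OF int]) (use ab in auto)
      from Henstock_Kurzweil_Integration.integral_combine[OF ab(1) less_imp_le[OF ab(2)] this]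
      show ?thesis unfolding s_def by simp
    qed
    finally show ?thesis .
  qed
  have 1: "d (p i) (p (Suc i)) \<le> \<epsilon>" if "i < N" for i
  proof -
    have "dist (real (Suc i) / real N) (real i / real N) = 1 / real N"
      using N by (simp add: dist_real_def add_divide_distrib)
    then have "dist (s (real (Suc i) / real N)) (s (real i / real N)) < \<epsilon>" using \<delta>(2) t N that by auto
    then show ?thesis using st[OF that] by (simp add: dist_real_def)
  qed
  have "(\<Sum>i<N. d (p i) (p (Suc i))) \<le> (\<Sum>i<N. s (real (Suc i) / real N) - s (real i / real N))"
    using st by (intro sum_mono) auto
  also have "\<dots> = s 1 - s 0" using sum_lessThan_telescope[of "\<lambda>i. s (real i / real N)" N] N by simp
  also have "\<dots> = L" unfolding s_def using integral_unique[OF \<gamma>(5)] by simp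
  finally have 2: "(\<Sum>i<N. d (p i) (p (Suc i))) \<le> d x y + \<epsilon>" using L(2) by simp
  have "p 0 = x" "p N = y" "\<forall>i\<le>N. p i \<in> \<Omega>"
    unfolding p_def using \<gamma> N t by (auto simp: path_image_def)
  then show ?thesis using 1 2 by blast
qed

lemma d_le_chain:
  assumes "i \<le> j" "\<And>k. i \<le> k \<Longrightarrow> k \<le> j \<Longrightarrow> q k \<in> \<Omega>"
  shows "d (q i) (q j) \<le> (\<Sum>k=i..<j. d (q k) (q (Suc k)))"
  using assms
proof (induction j rule: dec_induct)
  case base then show ?case by (simp add: d_self)
next
  case (step n)
  have "d (q i) (q (Suc n)) \<le> d (q i) (q n) + d (q n) (q (Suc n))"
    using step by (intro d_tri) auto
  then show ?case using step by (simp add: sum.atLeastLessThan_Suc)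
qed

text \<open>A chain from o0 to z is cut just before it first leaves the ball of radius R. The cut
  point is farther than R - r from o0 and the chain has length at most R + 2 * r, whence 3 *
  r.\<close>

lemma near_ball:
  assumes o0: "o0 \<in> \<Omega>" and z: "z \<in> \<Omega>" "d o0 z \<le> R + r" and r: "r > 0" and R: "R \<ge> 0"
  obtains y where "y \<in> \<Omega>" "d o0 y \<le> R" "d y z \<le> 3 * r"
proof (cases "d o0 z \<le> R")
  case True then show thesis using that[of z] z r by (simp add: d_self)
next
  case False
  obtain N p where p: "p 0 = o0" "p N = z" "\<forall>i\<le>N. p i \<in> \<Omega>" "\<forall>i<N. d (p i) (p (Suc i)) \<le> r"
    "(\<Sum>i<N. d (p i) (p (Suc i))) \<le> d o0 z + r" using chain_exists[OF o0 z(1) r] by blast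
  define P where "P i \<longleftrightarrow> R < d o0 (p i)" for i
  have "P N" unfolding P_def using False p by simp
  define n where "n = (LEAST i. P i)"
  have Pn: "P n" unfolding n_def by (rule LeastI) (rule \<open>P N\<close>)
  have n: "R < d o0 (p n)" "n \<le> N" "\<And>i. i < n \<Longrightarrow> d o0 (p i) \<le> R"
  proof -
    show "R < d o0 (p n)" using Pn unfolding P_def .
    show "n \<le> N" unfolding n_def by (rule Least_le) (rule \<open>P N\<close>)
    fix i assume "i < n"
    then have "\<not> P i" unfolding n_def by (rule not_less_Least)
    then show "d o0 (p i) \<le> R" unfolding P_def by simp
  qed
  have "n \<noteq> 0" using n(1) p(1) R o0 by (metis d_self not_less)
  then obtain m where m: "n = Suc m" by (cases n) auto
  have pm: "p m \<in> \<Omega>" "p n \<in> \<Omega>" "d o0 (p m) \<le> R" using p n m by auto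
  have "d o0 (p n) \<le> d o0 (p m) + r"
  proof -
    have "d (p m) (p n) \<le> r" using p(4) n(2) m by auto
    then show ?thesis using d_tri[OF o0 pm(1,2)] by simp
  qed
  moreover have "d o0 (p m) \<le> (\<Sum>k=0..<m. d (p k) (p (Suc k)))" "d (p m) z \<le> (\<Sum>k=m..<N. d (p k) (p (Suc k)))"
  proof -
    have mN: "m \<le> N" using n m by simp
    show "d o0 (p m) \<le> (\<Sum>k=0..<m. d (p k) (p (Suc k)))" using d_le_chain[of 0 m p] p(1,3) mN by simp
    show "d (p m) z \<le> (\<Sum>k=m..<N. d (p k) (p (Suc k)))" using d_le_chain[of m N p] p(2,3) mN by simp
  qed
  moreover have "(\<Sum>k=0..<m. d (p k) (p (Suc k))) + (\<Sum>k=m..<N. d (p k) (p (Suc k))) = (\<Sum>k<N. d (p k) (p (Suc k)))"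
    using sum.atLeastLessThan_concat[of 0 m N "\<lambda>k. d (p k) (p (Suc k))"] n m by (simp add: lessThan_atLeast0)
  ultimately have "d (p m) z \<le> 3 * r" using n(1) p(5) z(2) by linarith
  then show thesis using that pm by blast
qed

end

section \<open>Mollification\<close>

definition compactly_supported :: "('a::euclidean_space \<Rightarrow> real) \<Rightarrow> bool" where
  "compactly_supported f \<longleftrightarrow> continuous_on UNIV f \<and> (\<exists>K. compact K \<and> (\<forall>x. x \<notin> K \<longrightarrow> f x = 0))"

lemma compactly_supported_box:
  assumes "compactly_supported f"
  obtains r where "r > 0" "\<And>x. r < norm x \<Longrightarrow> f x = 0"
proof -
  obtain K where K: "compact K" "\<And>x. x \<notin> K \<Longrightarrow> f x = 0" using assms unfolding compactly_supported_def by blast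
  obtain b where "b > 0" "\<And>x. x \<in> K \<Longrightarrow> norm x \<le> b" using compact_imp_bounded[OF K(1)] bounded_pos by metis
  then show thesis using that[of b] K(2) by fastforce
qed

lemma norm_ball_in_box: obtains a :: "'a::euclidean_space" where "\<And>x. norm x \<le> r \<Longrightarrow> x \<in> cbox (- a) a"
proof -
  obtain a :: 'a where "cball 0 r \<subseteq> cbox (- a) a" using bounded_subset_cbox_symmetric[OF bounded_cball] by blast
  then show thesis using that[of a] by (auto simp: subset_iff)
qed

lemma compactly_supported_cbox:
  assumes "compactly_supported f"
  obtains a where "\<And>x. x \<notin> cbox (- a) a \<Longrightarrow> f x = 0"
proof -
  obtain r where r: "\<And>x. r < norm x \<Longrightarrow> f x = 0" using compactly_supported_box[OF assms] by blast
  obtain a :: 'a where a: "\<And>x. norm x \<le> r \<Longrightarrow> x \<in> cbox (- a) a" using norm_ball_in_box by blast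
  show thesis by (rule that[of a], rule r) (use a not_le in blast)
qed

lemma has_integral_UNIV_box:
  fixes f :: "'a::euclidean_space \<Rightarrow> real"
  assumes "continuous_on UNIV f" "\<And>x. x \<notin> cbox a b \<Longrightarrow> f x = 0"
  shows "(f has_integral integral (cbox a b) f) UNIV" "integral UNIV f = integral (cbox a b) f"
proof -
  have "f integrable_on cbox a b"
    by (rule integrable_continuous, rule continuous_on_subset[OF assms(1)]) simp
  then have "(f has_integral integral (cbox a b) f) (cbox a b)" by (rule integrable_integral)
  then show "(f has_integral integral (cbox a b) f) UNIV"
    by (rule has_integral_on_superset) (use assms(2) in auto)
  then show "integral UNIV f = integral (cbox a b) f" by (rule integral_unique)
qed

lemma compactly_supported_has_integral:
  assumes "compactly_supported f"
  shows "(f has_integral integral UNIV f) UNIV" "f integrable_on UNIV"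
proof -
  obtain a where a: "\<And>x. x \<notin> cbox (- a) a \<Longrightarrow> f x = 0" using compactly_supported_cbox[OF assms] by blast
  have "(f has_integral integral (cbox (- a) a) f) UNIV"
    by (rule has_integral_UNIV_box(1)) (use assms a in \<open>auto simp: compactly_supported_def\<close>)
  then show "f integrable_on UNIV" by blast
  then show "(f has_integral integral UNIV f) UNIV" by (rule integrable_integral)
qed

lemma compactly_supported_translate:
  assumes "compactly_supported f"
  shows "integral UNIV (\<lambda>x. f (x + c)) = integral UNIV f"
proof -
  obtain a where out: "\<And>x. x \<notin> cbox (- a) a \<Longrightarrow> f x = 0" using compactly_supported_cbox[OF assms] by blast
  have c: "continuous_on UNIV f" using assms unfolding compactly_supported_def by blast
  have "f integrable_on cbox (- a) a"
    by (rule integrable_continuous, rule continuous_on_subset[OF c]) simp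
  then have "(f has_integral integral (cbox (- a) a) f) (cbox (- a) a)" by (rule integrable_integral)
  from has_integral_affinity'[OF this, of 1 c]
  have "((\<lambda>x. f (x + c)) has_integral integral (cbox (- a) a) f) (cbox (- a - c) (a - c))" by simp
  then have "((\<lambda>x. f (x + c)) has_integral integral (cbox (- a) a) f) UNIV"
  proof (rule has_integral_on_superset)
    fix x assume "x \<notin> cbox (- a - c) (a - c)"
    then have "x + c \<notin> cbox (- a) a" by (auto simp: mem_box algebra_simps)
    then show "f (x + c) = 0" using out by blast
  qed simp
  then show ?thesis using has_integral_UNIV_box(2)[OF c out] integral_unique by metis
qed

lemma dir_deriv_zero_open:
  assumes "open S" "z \<in> S" "\<And>x. x \<in> S \<Longrightarrow> f x = 0" shows "dir_deriv f z v = 0"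
  using dir_deriv_cong_open(1)[OF assms(1,2), of "\<lambda>x. 0" f v] assms(3) by (simp add: dir_deriv_const)

lemma compactly_supported_dir_deriv:
  assumes "compactly_supported f" "continuous_on UNIV (\<lambda>z. dir_deriv f z v)"
  shows "compactly_supported (\<lambda>z. dir_deriv f z v)"
proof -
  obtain K where K: "compact K" "\<And>x. x \<notin> K \<Longrightarrow> f x = 0" using assms unfolding compactly_supported_def by blast
  have "dir_deriv f z v = 0" if "z \<notin> K" for z
    by (rule dir_deriv_zero_open[of "- K"]) (use K that in \<open>auto simp: compact_imp_closed open_Compl\<close>)
  then show ?thesis using K assms unfolding compactly_supported_def by blast
qed

text \<open>The integral of f (x + t v) does not depend on t, and its derivative at t = 0 can be
  taken under the integral. The box is enlarged by norm v so that it contains the supports of all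
  translates with |t| \<le> 1.\<close>

lemma integral_dir_deriv_zero:
  fixes f :: "'a::euclidean_space \<Rightarrow> real"
  assumes cs: "compactly_supported f" and df: "\<And>z. f differentiable (at z)"
    and cont: "continuous_on UNIV (\<lambda>z. dir_deriv f z v)"
  shows "integral UNIV (\<lambda>z. dir_deriv f z v) = 0"
proof -
  obtain r where r: "\<And>x. r < norm x \<Longrightarrow> f x = 0" using compactly_supported_box[OF cs] by blast
  obtain a where a: "\<And>x. norm x \<le> r + norm v \<Longrightarrow> x \<in> cbox (- a) (a :: 'a)" using norm_ball_in_box by blast
  have c: "continuous_on UNIV f" using cs unfolding compactly_supported_def by blast
  have far: "r < norm (x + t *\<^sub>R v)" if "x \<notin> cbox (- a) a" "\<bar>t\<bar> \<le> 1" for x t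
  proof -
    have "\<not> norm x \<le> r + norm v" using a that by blast
    moreover have "norm (t *\<^sub>R v) \<le> norm v" using that(2) by (simp add: mult_left_le_one_le)
    moreover have "norm x \<le> norm (x + t *\<^sub>R v) + norm (t *\<^sub>R v)"
      using norm_triangle_ineq4[of "x + t *\<^sub>R v" "t *\<^sub>R v"] by simp
    ultimately show ?thesis by linarith
  qed
  define I where "I t = integral (cbox (- a) a) (\<lambda>x. f (x + t *\<^sub>R v))" for t :: real
  have cl: "continuous_on S (\<lambda>x. f (x + t *\<^sub>R v))" for S t
    by (rule continuous_on_compose2[OF c]) (auto intro!: continuous_intros)
  have I_const: "I t = integral UNIV f" if "\<bar>t\<bar> \<le> 1" for t
  proof -
    have "integral UNIV (\<lambda>x. f (x + t *\<^sub>R v)) = I t"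
      unfolding I_def by (rule has_integral_UNIV_box(2)[OF cl]) (use far that r in blast)
    then show ?thesis using compactly_supported_translate[OF cs] by simp
  qed
  have "((\<lambda>t. integral (cbox (- a) a) (\<lambda>x. f (x + t *\<^sub>R v))) has_field_derivative
      integral (cbox (- a) a) (\<lambda>x. dir_deriv f (x + 0 *\<^sub>R v) v)) (at 0 within UNIV)"
  proof (rule leibniz_rule_field_derivative)
    show "((\<lambda>t. f (x + t *\<^sub>R v)) has_field_derivative dir_deriv f (x + t *\<^sub>R v) v) (at t within UNIV)" for x t
      by (rule has_field_derivative_at_within, rule line_has_field_derivative, rule df)
    show "(\<lambda>x. f (x + t *\<^sub>R v)) integrable_on cbox (- a) a" for t
      by (rule integrable_continuous[OF cl])
    show "continuous_on (UNIV \<times> cbox (- a) a) (\<lambda>(t, x). dir_deriv f (x + t *\<^sub>R v) v)"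
      unfolding case_prod_beta by (rule continuous_on_compose2[OF cont]) (auto intro!: continuous_intros)
  qed auto
  then have 1: "(I has_field_derivative integral (cbox (- a) a) (\<lambda>x. dir_deriv f x v)) (at 0)"
    unfolding I_def[abs_def] by simp
  have 2: "(I has_field_derivative 0) (at 0)"
    by (rule has_field_derivative_transform_within_open[of "\<lambda>t. integral UNIV f" _ _ "{-1<..<1}"])
      (use I_const in auto)
  have "integral UNIV (\<lambda>z. dir_deriv f z v) = integral (cbox (- a) a) (\<lambda>x. dir_deriv f x v)"
  proof (rule has_integral_UNIV_box(2)[OF cont])
    fix x assume x: "x \<notin> cbox (- a) a"
    show "dir_deriv f x v = 0"
      by (rule dir_deriv_zero_open[of "- cball 0 r"]) (use far[OF x, of 0] r in auto)
  qed
  then show ?thesis using DERIV_unique[OF 1 2] by simp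
qed

lemma continuous_on_bump: "continuous_on S (bump r)"
  unfolding bump_def[abs_def] by (intro continuous_intros)

lemma compactly_supported_bump: "r > 0 \<Longrightarrow> compactly_supported (bump r)"
  unfolding compactly_supported_def
  by (intro conjI exI[of _ "cball 0 r"]) (auto simp: continuous_on_bump bump_bounds(4))

definition bump_kernel :: "real \<Rightarrow> 'a::euclidean_space \<Rightarrow> real" where
  "bump_kernel r w = bump r w / integral UNIV (bump r :: 'a \<Rightarrow> real)"

lemma kernel_facts:
  assumes r: "r > 0"
  shows "0 \<le> bump_kernel r (w::'a::euclidean_space)" "r \<le> norm w \<Longrightarrow> bump_kernel r w = 0"
    "integral UNIV (bump_kernel r :: 'a \<Rightarrow> real) = 1" "continuous_on (S :: 'a set) (bump_kernel r)"
    "integral UNIV (bump r :: 'a \<Rightarrow> real) > 0"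
proof -
  let ?b = "bump r :: 'a \<Rightarrow> real"
  have cs: "compactly_supported ?b" by (rule compactly_supported_bump[OF r])
  have "0 \<le> integral UNIV ?b"
    by (rule Henstock_Kurzweil_Integration.integral_nonneg[OF compactly_supported_has_integral(2)[OF cs]])
      (use bump_bounds(1)[OF r] in auto)
  moreover have "integral UNIV ?b \<noteq> 0"
  proof
    assume 0: "integral UNIV ?b = 0"
    obtain a :: 'a where a: "\<And>x. norm x \<le> r \<Longrightarrow> x \<in> cbox (- a) a" using norm_ball_in_box by blast
    have ab: "0 \<in> box (- a) a"
    proof -
      have "(r *\<^sub>R b) \<in> cbox (- a) a" if "b \<in> Basis" for b using a[of "r *\<^sub>R b"] that r by simp
      then have "r \<le> a \<bullet> b" if "b \<in> Basis" for b using that by (fastforce simp: mem_box inner_Basis)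
      then show ?thesis using r by (force simp: mem_box)
    qed
    have z: "?b x = 0" if "x \<notin> cbox (- a) a" for x using bump_bounds(4)[OF r] a that by (meson linear)
    have hi: "(?b has_integral 0) (cbox (- a) a)"
      using has_integral_UNIV_box[OF continuous_on_bump z] 0 integrable_integral[OF integrable_continuous[OF continuous_on_bump[of "cbox (- a) a" r]]]
      by simp
    have "?b 0 = 0"
      by (rule has_integral_0_cbox_imp_0[of "- a" a ?b, OF continuous_on_bump _ hi])
        (use bump_bounds(1)[OF r] ab box_subset_cbox in auto)
    then show False using bump_bounds(6)[OF r, of "0::'a"] r by simp
  qed
  ultimately show I: "integral UNIV ?b > 0" by simp
  show "0 \<le> bump_kernel r w" unfolding bump_kernel_def using bump_bounds(1)[OF r, of w] I by simp
  show "bump_kernel r w = 0" if "r \<le> norm w" unfolding bump_kernel_def using bump_bounds(4)[OF r that] by simp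
  have "((bump_kernel r :: 'a \<Rightarrow> real) has_integral integral UNIV ?b / integral UNIV ?b) UNIV"
    unfolding bump_kernel_def[abs_def] by (rule has_integral_divide[OF compactly_supported_has_integral(1)[OF cs]])
  from integral_unique[OF this] show "integral UNIV (bump_kernel r :: 'a \<Rightarrow> real) = 1" using I by simp
  show "continuous_on S (bump_kernel r)" unfolding bump_kernel_def[abs_def]
    by (rule continuous_on_divide[OF continuous_on_bump continuous_on_const]) (use I in force)
qed

lemma compactly_supported_kernel_mult:
  assumes "r > 0" "continuous_on UNIV f"
  shows "compactly_supported (\<lambda>w. bump_kernel r w * f w)"
  unfolding compactly_supported_def
  by (intro conjI exI[of _ "cball 0 r"] continuous_on_mult kernel_facts(4) assms)
    (auto simp: kernel_facts(2)[OF assms(1)])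

lemma kernel_mean_le:
  fixes f :: "'a::euclidean_space \<Rightarrow> real"
  assumes r: "r > 0" and f: "continuous_on UNIV f" and le: "\<And>w. norm w \<le> r \<Longrightarrow> f w \<le> M"
  shows "integral UNIV (\<lambda>w. bump_kernel r w * f w) \<le> M"
proof -
  have "integral UNIV (\<lambda>w. bump_kernel r w * f w) \<le> integral UNIV (\<lambda>w::'a. bump_kernel r w * M)"
  proof (rule Henstock_Kurzweil_Integration.integral_le)
    show "(\<lambda>w. bump_kernel r w * f w) integrable_on UNIV" "(\<lambda>w::'a. bump_kernel r w * M) integrable_on UNIV"
      by (rule compactly_supported_has_integral(2)[OF compactly_supported_kernel_mult[OF r]], rule f continuous_on_const)+
    show "bump_kernel r w * f w \<le> bump_kernel r w * M" for w
      using le[of w] kernel_facts(1,2)[OF r, of w] by (cases "norm w \<le> r") (auto intro: mult_left_mono)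
  qed
  also have "\<dots> = M" using kernel_facts(3)[OF r, where 'a = 'a] by simp
  finally show ?thesis .
qed

lemma kernel_mean_ge:
  assumes r: "r > 0" and f: "continuous_on UNIV f" and le: "\<And>w. norm w \<le> r \<Longrightarrow> M \<le> f w"
  shows "M \<le> integral UNIV (\<lambda>w. bump_kernel r w * f w)"
proof -
  have "integral UNIV (\<lambda>w. bump_kernel r w * - f w) \<le> - M"
    by (rule kernel_mean_le[OF r continuous_on_minus[OF f]]) (use le in auto)
  then show ?thesis by simp
qed

text \<open>The variable z sits in the kernel, so derivatives in z fall on the kernel and f is not
  differentiated. For estimates \<open>mollify_translate\<close> moves z into f.\<close>

definition mollify :: "real \<Rightarrow> ('a::euclidean_space \<Rightarrow> real) \<Rightarrow> 'a \<Rightarrow> real" where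
  "mollify r f z = integral UNIV (\<lambda>u. bump_kernel r (u - z) * f u)"

lemma mollify_translate:
  assumes r: "r > 0" and f: "compactly_supported f"
  shows "mollify r f z = integral UNIV (\<lambda>w. bump_kernel r w * f (w + z))"
proof -
  obtain K where K: "compact K" "\<forall>x. x \<notin> K \<longrightarrow> f x = 0" "continuous_on UNIV f"
    using f unfolding compactly_supported_def by blast
  have "compactly_supported (\<lambda>u. bump_kernel r (u - z) * f u)"
    unfolding compactly_supported_def
    using K by (auto intro!: exI[of _ K] continuous_on_mult continuous_on_compose2[OF kernel_facts(4)[OF r, of UNIV]] continuous_intros)
  from compactly_supported_translate[OF this, of z] show ?thesis unfolding mollify_def by simp
qed

lemma mollify_le:
  assumes r: "r > 0" and f: "compactly_supported f" and le: "\<And>w. norm w \<le> r \<Longrightarrow> f (w + z) \<le> M"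
  shows "mollify r f z \<le> M"
proof -
  have "continuous_on UNIV f" using f unfolding compactly_supported_def by blast
  then have "continuous_on UNIV (\<lambda>w. f (w + z))" by (rule continuous_on_compose2) (auto intro!: continuous_intros)
  from kernel_mean_le[OF r this le] show ?thesis unfolding mollify_translate[OF r f] .
qed

lemma mollify_ge:
  assumes r: "r > 0" and f: "compactly_supported f" and le: "\<And>w. norm w \<le> r \<Longrightarrow> M \<le> f (w + z)"
  shows "M \<le> mollify r f z"
proof -
  have "continuous_on UNIV f" using f unfolding compactly_supported_def by blast
  then have "continuous_on UNIV (\<lambda>w. f (w + z))" by (rule continuous_on_compose2) (auto intro!: continuous_intros)
  from kernel_mean_ge[OF r this le] show ?thesis unfolding mollify_translate[OF r f] .
qed

lemma mollify_diff_le: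
  assumes r: "r > 0" and f: "compactly_supported f" and le: "\<And>w. norm w \<le> r \<Longrightarrow> f (w + z) - f (w + y) \<le> M"
  shows "mollify r f z - mollify r f y \<le> M"
proof -
  have c: "continuous_on UNIV (\<lambda>w. f (w + z))" for z
    by (rule continuous_on_compose2[of UNIV f]) (use f in \<open>auto simp: compactly_supported_def intro!: continuous_intros\<close>)
  have i: "(\<lambda>w. bump_kernel r w * f (w + z)) integrable_on UNIV" for z
    by (rule compactly_supported_has_integral(2)[OF compactly_supported_kernel_mult[OF r c]])
  have "mollify r f z - mollify r f y = integral UNIV (\<lambda>w. bump_kernel r w * f (w + z) - bump_kernel r w * f (w + y))"
    unfolding mollify_translate[OF r f] by (rule Henstock_Kurzweil_Integration.integral_diff[OF i i, symmetric])
  also have "\<dots> = integral UNIV (\<lambda>w. bump_kernel r w * (f (w + z) - f (w + y)))" by (simp add: right_diff_distrib)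
  also have "\<dots> \<le> M" by (rule kernel_mean_le[OF r]) (use le c in \<open>auto intro!: continuous_on_diff\<close>)
  finally show ?thesis .
qed

lemma mollify_C1:
  assumes r: "r > 0" and f: "compactly_supported f"
  shows "mollify r f differentiable (at z)" "continuous_on UNIV (\<lambda>z. dir_deriv (mollify r f) z v)"
proof -
  obtain a where a: "\<And>x. x \<notin> cbox (- a) a \<Longrightarrow> f x = 0" using compactly_supported_cbox[OF f] by blast
  have c: "continuous_on UNIV f" using f unfolding compactly_supported_def by blast
  let ?c = "integral UNIV (bump r :: 'a \<Rightarrow> real)"
  define D where "D z u = (4 * max 0 (r\<^sup>2 - (u - z) \<bullet> (u - z)) * f u / ?c) *\<^sub>R blinfun_inner_right (u - z)" for z u
  have D: "blinfun_apply (D z u) v = 4 * max 0 (r\<^sup>2 - (u - z) \<bullet> (u - z)) * f u / ?c * ((u - z) \<bullet> v)" for z u v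
    unfolding D_def by (simp add: blinfun.scaleR_left)
  have ck: "continuous_on S (\<lambda>u. bump_kernel r (u - z) * f u)" for S z
    by (intro continuous_on_mult continuous_on_compose2[OF kernel_facts(4)[OF r, of UNIV]] continuous_on_subset[OF c])
      (auto intro!: continuous_intros)
  have eq: "mollify r f z = integral (cbox (- a) a) (\<lambda>u. bump_kernel r (u - z) * f u)" for z
    unfolding mollify_def by (rule has_integral_UNIV_box(2)[OF ck]) (simp add: a)
  have Dcont: "continuous_on (UNIV \<times> cbox (- a) a) (\<lambda>(z, u). D z u)"
    unfolding D_def case_prod_beta using kernel_facts(5)[OF r, where 'a = 'a]
    by (intro continuous_intros continuous_on_compose2[OF c] bounded_linear.continuous_on[OF bounded_linear_blinfun_inner_right]) auto
  have der: "(mollify r f has_derivative integral (cbox (- a) a) (D z)) (at z within UNIV)" for z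
    unfolding eq[abs_def]
  proof (rule leibniz_rule)
    show "((\<lambda>z. bump_kernel r (u - z) * f u) has_derivative blinfun_apply (D z u)) (at z within UNIV)" for z u
    proof -
      have "((\<lambda>z. u - z) has_derivative (\<lambda>v. - v)) (at z)" by (auto intro!: derivative_eq_intros)
      from has_derivative_compose[OF this bump_has_derivative[of r "u - z"]]
      have 1: "((\<lambda>z. bump r (u - z)) has_derivative (\<lambda>v. - 4 * max 0 (r\<^sup>2 - (u - z) \<bullet> (u - z)) * ((u - z) \<bullet> (- v)))) (at z)" .
      note 2 = has_derivative_mult_left[OF 1, of "f u / ?c"]
      have 3: "(\<lambda>z. bump_kernel r (u - z) * f u) = (\<lambda>x. bump r (u - x) * (f u / ?c))"
        unfolding bump_kernel_def by auto
      have 4: "blinfun_apply (D z u) = (\<lambda>x. - 4 * max 0 (r\<^sup>2 - (u - z) \<bullet> (u - z)) * ((u - z) \<bullet> - x) * (f u / ?c))"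
        unfolding fun_eq_iff D by simp
      show ?thesis unfolding 3 4 by (rule 2)
    qed
    show "(\<lambda>u. bump_kernel r (u - z) * f u) integrable_on cbox (- a) a" for z by (rule integrable_continuous[OF ck])
  qed (use Dcont in auto)
  then show "mollify r f differentiable (at z)" unfolding differentiable_def by auto
  have "dir_deriv (mollify r f) z v = blinfun_apply (integral (cbox (- a) a) (D z)) v" for z
    by (rule dir_deriv_eqI[OF der])
  moreover have "continuous_on UNIV (\<lambda>z. integral (cbox (- a) a) (D z))"
    by (rule integral_continuous_on_param[OF Dcont])
  ultimately show "continuous_on UNIV (\<lambda>z. dir_deriv (mollify r f) z v)"
    using blinfun.continuous_on[OF _ continuous_on_const] by simp
qed

lemma continuous_on_extend_zero:
  assumes "open \<Omega>" "continuous_on \<Omega> f" "closed K" "K \<subseteq> \<Omega>" "\<And>x. x \<notin> K \<Longrightarrow> f x = 0"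
  shows "continuous_on UNIV f"
proof -
  have "continuous_on (\<Omega> \<union> - K) f"
  proof (rule continuous_on_open_Un)
    show "continuous_on (- K) f"
      using continuous_on_cong[of "- K" "- K" f "\<lambda>x. 0"] assms(5) by simp
  qed (use assms in auto)
  moreover have "\<Omega> \<union> - K = UNIV" using assms(4) by blast
  ultimately show ?thesis by simp
qed

section \<open>Completeness and cutoff functions\<close>

lemma compact_neighbourhood:
  fixes K :: "'a::euclidean_space set"
  assumes "compact K" "open \<Omega>" "K \<subseteq> \<Omega>"
  obtains e K' where "e > 0" "compact K'" "K \<subseteq> K'" "K' \<subseteq> \<Omega>" "\<And>x w. x \<in> K \<Longrightarrow> norm w \<le> e \<Longrightarrow> x + w \<in> K'"
proof -
  obtain e where e: "e > 0" "(\<Union>x\<in>K. cball x e) \<subseteq> \<Omega>"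
    using compact_subset_open_imp_cball_epsilon_subset[OF assms] by blast
  let ?K = "{x + y |x y. x \<in> K \<and> y \<in> cball 0 e}"
  have "compact ?K" using compact_sums[OF assms(1) compact_cball[of 0 e]] .
  moreover have "x + w \<in> ?K" if "x \<in> K" "norm w \<le> e" for x w using that by auto
  moreover have "K \<subseteq> ?K"
  proof
    fix x assume "x \<in> K"
    then have "x = x + 0 \<and> x \<in> K \<and> 0 \<in> cball (0::'a) e" using e(1) by simp
    then show "x \<in> ?K" by blast
  qed
  moreover have "?K \<subseteq> \<Omega>"
  proof
    fix z assume "z \<in> ?K"
    then obtain x y where "z = x + y" "x \<in> K" "norm y \<le> e" by auto
    then have "z \<in> (\<Union>x\<in>K. cball x e)" by (auto simp: dist_norm intro!: bexI[of _ x])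
    then show "z \<in> \<Omega>" using e(2) by blast
  qed
  ultimately show thesis using that e(1) by blast
qed

lemma dir_deriv_le_quotient:
  fixes f :: "'a::real_normed_vector \<Rightarrow> real"
  assumes "f differentiable (at z)" "\<delta> > 0" "\<And>t. 0 < t \<Longrightarrow> t < \<delta> \<Longrightarrow> f (z + t *\<^sub>R v) - f z \<le> t * M"
  shows "dir_deriv f z v \<le> M"
proof -
  have "((\<lambda>t. f (z + t *\<^sub>R v)) has_field_derivative dir_deriv f z v) (at 0)"
    using line_has_field_derivative[of f z 0 v] assms(1) by simp
  then have "((\<lambda>h. (f (z + h *\<^sub>R v) - f z) / h) \<longlongrightarrow> dir_deriv f z v) (at 0)"
    unfolding DERIV_def by simp
  then have 1: "((\<lambda>h. (f (z + h *\<^sub>R v) - f z) / h) \<longlongrightarrow> dir_deriv f z v) (at_right 0)"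
    by (rule tendsto_mono[rotated]) (simp add: at_le)
  have 2: "\<forall>\<^sub>F h in at_right 0. (f (z + h *\<^sub>R v) - f z) / h \<le> M"
    unfolding eventually_at_right_field using assms(2,3)
    by (intro exI[of _ \<delta>]) (auto simp: pos_divide_le_eq mult.commute)
  show ?thesis using tendsto_upperbound[OF 1 2] by simp
qed

context riemannian_open
begin

lemma compact_lower_bound:
  assumes K: "compact K" "K \<subseteq> \<Omega>"
  shows "\<exists>c>0. \<forall>z\<in>K. \<forall>v. c * norm v \<le> sqrt (g z v v)"
proof (rule compact_bounds[OF K])
  fix c C :: real assume "c > 0" "\<And>z v. z \<in> K \<Longrightarrow> c * norm v \<le> sqrt (g z v v)"
  then show ?thesis by (intro exI[of _ c] conjI ballI allI)
qed

text \<open>Uniform continuity of g on unit vectors over a compact set. Since g is at least c^2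
  there, an error below 3 * c^2 gives the factor 4, which is 2 for norms.\<close>

lemma g_comparison:
  assumes K: "compact K" "K \<subseteq> \<Omega>"
  obtains e where "e > 0" "\<And>z w. z \<in> K \<Longrightarrow> norm w \<le> e \<Longrightarrow> z + w \<in> \<Omega>"
    "\<And>z w v. z \<in> K \<Longrightarrow> norm w \<le> e \<Longrightarrow> g (z + w) v v \<le> 4 * g z v v"
proof -
  obtain e0 K' where K': "e0 > 0" "compact K'" "K \<subseteq> K'" "K' \<subseteq> \<Omega>" "\<And>x w. x \<in> K \<Longrightarrow> norm w \<le> e0 \<Longrightarrow> x + w \<in> K'"
    using compact_neighbourhood[OF K(1) open_\<Omega> K(2)] by blast
  obtain c where c: "c > 0" "\<And>z v. z \<in> K' \<Longrightarrow> c * norm v \<le> sqrt (g z v v)"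
    using compact_lower_bound[OF K'(2,4)] by blast
  let ?S = "K' \<times> sphere (0 :: complex ^ 'n) 1"
  have "continuous_on ?S (\<lambda>x. g (fst x) (snd x) (snd x))"
    by (intro g_continuous continuous_intros) (use K' in auto)
  then have uc: "uniformly_continuous_on ?S (\<lambda>x. g (fst x) (snd x) (snd x))"
    by (rule compact_uniformly_continuous) (use K' in \<open>auto intro: compact_Times\<close>)
  have "3 * c\<^sup>2 > 0" using c by simp
  then obtain e1 where e1: "e1 > 0" "\<And>x y. x \<in> ?S \<Longrightarrow> y \<in> ?S \<Longrightarrow> dist y x < e1 \<Longrightarrow>
      dist (g (fst y) (snd y) (snd y)) (g (fst x) (snd x) (snd x)) < 3 * c\<^sup>2"
    using uc[unfolded uniformly_continuous_on_def, rule_format, of "3 * c\<^sup>2"] by blast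
  define e where "e = min e0 (e1 / 2)"
  have e: "e > 0" "e \<le> e0" "e < e1" using K'(1) e1(1) unfolding e_def by auto
  have in\<Omega>: "z + w \<in> \<Omega>" if "z \<in> K" "norm w \<le> e" for z w using K'(4,5) that e by force
  have "g (z + w) v v \<le> 4 * g z v v" if zw: "z \<in> K" "norm w \<le> e" for z w v
  proof (cases "v = 0")
    case True
    show ?thesis using bilinear_lzero[OF bil[OF in\<Omega>[OF zw]]] bilinear_lzero[OF bil[of z]] zw K unfolding True by auto
  next
    case False
    define u where "u = (1 / norm v) *\<^sub>R v"
    have v: "v = norm v *\<^sub>R u" and u: "norm u = 1" unfolding u_def using False by auto
    have in': "z + w \<in> K'" "z \<in> K'" using K'(3,5) zw e by force+
    have "dist (g (z + w) u u) (g z u u) < 3 * c\<^sup>2"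
    proof -
      have "dist (z + w, u) (z, u) < e1" using zw e by (simp add: dist_Pair_Pair dist_norm)
      then show ?thesis using e1(2)[of "(z, u)" "(z + w, u)"] in' u by simp
    qed
    moreover have "c\<^sup>2 \<le> g z u u"
    proof -
      have "c \<le> sqrt (g z u u)" using c(2)[OF in'(2), of u] u by simp
      then have "c\<^sup>2 \<le> (sqrt (g z u u))\<^sup>2" using c by (intro power_mono) auto
      then show ?thesis using g_nonneg[of z u] zw K by auto
    qed
    ultimately have 1: "g (z + w) u u \<le> 4 * g z u u" by (simp add: dist_real_def abs_less_iff)
    have sc: "g y v v = (norm v)\<^sup>2 * g y u u" if "y \<in> \<Omega>" for y
    proof -
      have "g y (norm v *\<^sub>R u) (norm v *\<^sub>R u) = (norm v)\<^sup>2 * g y u u"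
        unfolding bilinear_lmul[OF bil[OF that]] bilinear_rmul[OF bil[OF that]] by (simp add: power2_eq_square)
      then show ?thesis unfolding v[symmetric] .
    qed
    show ?thesis unfolding sc[OF in\<Omega>[OF zw]] sc[OF subsetD[OF K(2) zw(1)]]
      using mult_left_mono[OF 1, of "(norm v)\<^sup>2"] by simp
  qed
  then show thesis using that e in\<Omega> by blast
qed

end

section \<open>Compactness of closed balls and construction of cutoff functions\<close>

locale riemannian_complete = riemannian_convex \<Omega> g for \<Omega> :: "(complex ^ 'n) set" and g +
  assumes complete: "Metric_space.mcomplete \<Omega> (riemannian_dist \<Omega> g)"
begin

context
  fixes o0 :: "complex ^ 'n"
  assumes o0: "o0 \<in> \<Omega>"
begin

definition "cb R = {z \<in> \<Omega>. d o0 z \<le> R}"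

lemma compact_cb_subset:
  assumes K: "compact K" "K \<subseteq> \<Omega>" "cb R \<subseteq> K" shows "compact (cb R)"
proof -
  have "closed (K \<inter> d o0 -` {..R})"
    using continuous_closed_preimage[OF continuous_on_subset[OF d_continuous[OF o0] K(2)] compact_imp_closed[OF K(1)] closed_atMost] .
  then have "compact (K \<inter> (K \<inter> d o0 -` {..R}))" by (rule compact_Int_closed[OF K(1)])
  moreover have "K \<inter> (K \<inter> d o0 -` {..R}) = cb R" using K unfolding cb_def by auto
  ultimately show ?thesis by simp
qed

lemma cb_mono: "R \<le> R' \<Longrightarrow> cb R \<subseteq> cb R'"
  unfolding cb_def by auto

lemma cb_subset: "cb R \<subseteq> \<Omega>" unfolding cb_def by auto

lemma compact_cb_mono: "R \<le> R' \<Longrightarrow> compact (cb R') \<Longrightarrow> compact (cb R)"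
  by (rule compact_cb_subset[OF _ cb_subset cb_mono])

lemma compact_cb_extend:
  assumes R: "R \<ge> 0" "compact (cb R)"
  obtains r where "r > 0" "compact (cb (R + r))"
proof -
  obtain e K where K: "e > 0" "compact K" "cb R \<subseteq> K" "K \<subseteq> \<Omega>" "\<And>x w. x \<in> cb R \<Longrightarrow> norm w \<le> e \<Longrightarrow> x + w \<in> K"
    using compact_neighbourhood[OF R(2) open_\<Omega> cb_subset] by blast
  obtain c where c: "c > 0" "\<And>z v. z \<in> K \<Longrightarrow> c * norm v \<le> sqrt (g z v v)"
    using compact_lower_bound[OF K(2,4)] by blast
  \<comment> \<open>\<open>near_ball\<close> provides y in the ball with d y z \<le> 3 * r, whereas
    leaving the Euclidean ball of radius e about y costs at least c * e / 4 = 4 * r.\<close>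
  define r where "r = c * e / 16"
  have r: "r > 0" unfolding r_def using c K by simp
  have "cb (R + r) \<subseteq> K"
  proof
    fix z assume "z \<in> cb (R + r)"
    then have z: "z \<in> \<Omega>" "d o0 z \<le> R + r" unfolding cb_def by auto
    obtain y where y: "y \<in> \<Omega>" "d o0 y \<le> R" "d y z \<le> 3 * r" using near_ball[OF o0 z r R(1)] .
    have ycb: "y \<in> cb R" using y unfolding cb_def by auto
    have cbK: "x \<in> K" if "x \<in> cball y e" for x
      using K(5)[OF ycb, of "x - y"] that by (simp add: dist_norm norm_minus_commute)
    have "norm (z - y) \<le> e"
    proof (rule ccontr)
      assume "\<not> norm (z - y) \<le> e"
      then have far: "norm (z - y) \<ge> e" by simp
      have sub: "cball y e \<subseteq> \<Omega>" using cbK K(4) by blast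
      have "c * e \<le> 4 * d y z"
        by (rule d_lower_far[OF K(1) sub c(1) _ z(1) far]) (use cbK c(2) in blast)
      then show False using y(3) r unfolding r_def by simp
    qed
    then show "z \<in> K" using K(5)[OF ycb, of "z - y"] by simp
  qed
  then show thesis using that r compact_cb_subset[OF K(2,4)] by blast
qed

text \<open>By \<open>near_ball\<close>, a finite r-net of the compact ball of radius R - r is a net
  of mesh 4 * r for the ball of radius R, which is thus totally bounded. Completeness gives limits,
  and convergence in d implies Euclidean convergence.\<close>

lemma compact_cb_limit:
  assumes R: "R > 0" and small: "\<And>R'. 0 \<le> R' \<Longrightarrow> R' < R \<Longrightarrow> compact (cb R')"
  shows "compact (cb R)"
proof -
  have "M.mtotally_bounded (cb R)"
    unfolding M.mtotally_bounded_def
  proof (intro allI impI)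
    fix \<epsilon> :: real assume \<epsilon>: "\<epsilon> > 0"
    define r where "r = min R (\<epsilon> / 4)"
    have r: "r > 0" "r \<le> R" "4 * r \<le> \<epsilon>" using R \<epsilon> unfolding r_def by auto
    have cp: "compact (cb (R - r))" by (rule small) (use r in auto)
    have op: "open (\<Omega> \<inter> d x -` {..<r})" if "x \<in> cb (R - r)" for x
      using that cb_subset by (intro continuous_open_preimage[OF d_continuous open_\<Omega> open_lessThan]) auto
    have cov: "cb (R - r) \<subseteq> (\<Union>x\<in>cb (R - r). \<Omega> \<inter> d x -` {..<r})"
      using r d_self cb_subset by fastforce
    obtain K where K: "K \<subseteq> cb (R - r)" "finite K" "cb (R - r) \<subseteq> (\<Union>x\<in>K. \<Omega> \<inter> d x -` {..<r})"
      using compactE_image[OF cp op cov] by blast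
    have "z \<in> (\<Union>x\<in>K. M.mball x \<epsilon>)" if z: "z \<in> cb R" for z
    proof -
      have z': "z \<in> \<Omega>" "d o0 z \<le> (R - r) + r" using z unfolding cb_def by auto
      have Rr: "R - r \<ge> 0" using r by simp
      obtain y where y: "y \<in> \<Omega>" "d o0 y \<le> R - r" "d y z \<le> 3 * r" using near_ball[OF o0 z' r(1) Rr] .
      then have "y \<in> cb (R - r)" unfolding cb_def by auto
      then obtain x where x: "x \<in> K" "d x y < r" using K(3) by auto
      have x\<Omega>: "x \<in> \<Omega>" using x K(1) cb_subset by blast
      have "d x z < \<epsilon>" using d_tri[OF x\<Omega> y(1) z'(1)] x y r by linarith
      then show ?thesis using x x\<Omega> z' by auto
    qed
    moreover have "K \<subseteq> cb R" using K(1) cb_mono[of "R - r" R] r by auto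
    ultimately show "\<exists>K. finite K \<and> K \<subseteq> cb R \<and> cb R \<subseteq> (\<Union>x\<in>K. M.mball x \<epsilon>)" using K(2) by blast
  qed
  from iffD1[OF M.mtotally_bounded_sequentially this]
  have tb: "\<exists>r. strict_mono r \<and> M.MCauchy (\<sigma> \<circ> r)" if "range \<sigma> \<subseteq> cb R" for \<sigma> :: "nat \<Rightarrow> complex ^ 'n"
    using that by (elim conjE allE impE)
  show ?thesis
    unfolding compact_def
  proof (intro allI impI)
    fix \<sigma> :: "nat \<Rightarrow> complex ^ 'n" assume "\<forall>n. \<sigma> n \<in> cb R"
    then have \<sigma>: "\<And>n. \<sigma> n \<in> cb R" by blast
    then have "range \<sigma> \<subseteq> cb R" by auto
    from tb[OF this] obtain r where r: "strict_mono r" "M.MCauchy (\<sigma> \<circ> r)" by (elim exE conjE)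
    then obtain l where l: "limitin M.mtopology (\<sigma> \<circ> r) l sequentially" using complete unfolding M.mcomplete_def by blast
    have l\<Omega>: "l \<in> \<Omega>" using l unfolding M.limit_metric_sequentially by blast
    have lim: "(\<sigma> \<circ> r) \<longlonglongrightarrow> l" by (rule limitin_imp_tendsto[OF l])
    have "(\<lambda>n. d o0 ((\<sigma> \<circ> r) n)) \<longlonglongrightarrow> d o0 l"
      by (rule continuous_on_tendsto_compose[OF d_continuous[OF o0] lim l\<Omega>])
        (use \<sigma> cb_subset in \<open>auto intro!: always_eventually\<close>)
    then have "d o0 l \<le> R"
      by (rule tendsto_upperbound) (use \<sigma> in \<open>auto simp: cb_def intro!: always_eventually\<close>)
    then show "\<exists>l\<in>cb R. \<exists>r. strict_mono r \<and> (\<sigma> \<circ> r) \<longlonglongrightarrow> l" using l\<Omega> r(1) lim unfolding cb_def by blast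
  qed
qed

text \<open>Hopf--Rinow, by real induction on the radius.\<close>

lemma compact_cb: assumes "R \<ge> 0" shows "compact (cb R)"
proof (rule ccontr)
  assume no: "\<not> compact (cb R)"
  define A where "A = {R. 0 \<le> R \<and> compact (cb R)}"
  have bd: "x \<le> R" if "x \<in> A" for x
    using that no compact_cb_mono[of R x] unfolding A_def by force
  have cb0: "cb 0 = {o0}"
    using d_zero[OF o0] d_self[OF o0] d_nonneg o0 unfolding cb_def by (auto simp: antisym_conv)
  then have A0: "0 \<in> A" unfolding A_def by simp
  have bdd: "bdd_above A" by (rule bdd_aboveI) (rule bd)
  define s where "s = Sup A"
  have s0: "0 \<le> s" unfolding s_def by (rule cSup_upper[OF A0 bdd])
  have "compact (cb s)"
  proof (cases "s = 0")
    case False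
    show ?thesis
    proof (rule compact_cb_limit)
      show "s > 0" using False s0 by simp
      fix R' assume R': "0 \<le> R'" "R' < s"
      then obtain x where "x \<in> A" "R' < x" unfolding s_def using less_cSup_iff[OF _ bdd] A0 by blast
      then show "compact (cb R')" using compact_cb_mono[of R' x] unfolding A_def by auto
    qed
  qed (simp add: cb0)
  then obtain r where r: "r > 0" "compact (cb (s + r))" using compact_cb_extend[OF s0] by blast
  then have "s + r \<in> A" unfolding A_def using s0 by auto
  then have "s + r \<le> s" unfolding s_def by (rule cSup_upper[OF _ bdd])
  then show False using r by simp
qed

end

text \<open>The distance to o0, truncated between radii R and 2 * R and divided by R, is
  (1/R)-Lipschitz for d, and its support is compact by \<open>compact_cb\<close>. It is then
  mollified at a scale on which norms of g change by a factor of at most 2, so the gradient bound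
  becomes 2/R \<le> \<kappa>.\<close>

lemma cutoff_exists:
  assumes K0: "compact K0" "K0 \<subseteq> \<Omega>" "K0 \<noteq> {}" and \<kappa>: "\<kappa> > 0"
  obtains \<eta> :: "complex ^ 'n \<Rightarrow> real" and K where "compact K" "K \<subseteq> \<Omega>" "\<And>z. z \<notin> K \<Longrightarrow> \<eta> z = 0" "\<And>z. 0 \<le> \<eta> z" "\<And>z. \<eta> z \<le> 1"
    "\<And>z. z \<in> K0 \<Longrightarrow> \<eta> z = 1" "\<And>z. \<eta> differentiable (at z)" "\<And>v. continuous_on UNIV (\<lambda>z. DD v \<eta> z)"
    "\<And>z v. z \<in> \<Omega> \<Longrightarrow> \<bar>DD v \<eta> z\<bar> \<le> \<kappa> * sqrt (g z v v)"
proof -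
  obtain o0 where o0: "o0 \<in> \<Omega>" using K0 by blast
  obtain s K1 where K1: "s > 0" "compact K1" "K0 \<subseteq> K1" "K1 \<subseteq> \<Omega>" "\<And>x w. x \<in> K0 \<Longrightarrow> norm w \<le> s \<Longrightarrow> x + w \<in> K1"
    using compact_neighbourhood[OF K0(1) open_\<Omega> K0(2)] by blast
  have "K1 \<noteq> {}" using K0 K1 by blast
  then obtain x1 where x1: "\<And>y. y \<in> K1 \<Longrightarrow> d o0 y \<le> d o0 x1"
    using continuous_attains_sup[OF K1(2) _ continuous_on_subset[OF d_continuous[OF o0] K1(4)]] by blast
  define R where "R = max (d o0 x1) (2 / \<kappa>)"
  have R: "R > 0" "\<And>y. y \<in> K1 \<Longrightarrow> d o0 y \<le> R" "2 / R \<le> \<kappa>"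
  proof -
    have "2 / \<kappa> > 0" "2 / \<kappa> \<le> R" unfolding R_def using \<kappa> by auto
    then show "R > 0" by linarith
    show "d o0 y \<le> R" if "y \<in> K1" for y using x1[OF that] unfolding R_def by auto
    show "2 / R \<le> \<kappa>" using \<open>2 / \<kappa> \<le> R\<close> \<open>R > 0\<close> \<kappa> by (simp add: field_simps)
  qed
  define K2 where "K2 = cb o0 (2 * R)"
  have K2: "compact K2" "K2 \<subseteq> \<Omega>" unfolding K2_def using compact_cb[OF o0] cb_subset[OF o0] R by auto
  obtain e1 K3 where K3: "e1 > 0" "compact K3" "K2 \<subseteq> K3" "K3 \<subseteq> \<Omega>" "\<And>x w. x \<in> K2 \<Longrightarrow> norm w \<le> e1 \<Longrightarrow> x + w \<in> K3"
    using compact_neighbourhood[OF K2(1) open_\<Omega> K2(2)] by blast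
  obtain e3 where e3: "e3 > 0" "\<And>z w. z \<in> K3 \<Longrightarrow> norm w \<le> e3 \<Longrightarrow> z + w \<in> \<Omega>"
    "\<And>z w v. z \<in> K3 \<Longrightarrow> norm w \<le> e3 \<Longrightarrow> g (z + w) v v \<le> 4 * g z v v"
    using g_comparison[OF K3(2,4)] by blast
  define \<Phi> where "\<Phi> z = (if z \<in> \<Omega> then max 0 (min 1 (2 - d o0 z / R)) else 0)" for z
  have \<Phi>01: "0 \<le> \<Phi> z" "\<Phi> z \<le> 1" for z unfolding \<Phi>_def by auto
  have \<Phi>0: "\<Phi> z = 0" if "z \<notin> K2" for z
    using that R(1) unfolding \<Phi>_def K2_def cb_def[OF o0] by (auto simp: field_simps not_le)
  have \<Phi>1: "\<Phi> z = 1" if "z \<in> K1" for z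
    using that R K1(4) unfolding \<Phi>_def by (auto simp: field_simps)
  have cont: "continuous_on \<Omega> \<Phi>"
  proof -
    have "continuous_on \<Omega> (\<lambda>z. max 0 (min 1 (2 - d o0 z / R)))"
      using R(1) by (intro continuous_intros d_continuous o0) auto
    then show ?thesis using continuous_on_cong[of \<Omega> \<Omega> \<Phi> "\<lambda>z. max 0 (min 1 (2 - d o0 z / R))"] unfolding \<Phi>_def by simp
  qed
  have cs: "compactly_supported \<Phi>"
    unfolding compactly_supported_def
    using continuous_on_extend_zero[OF open_\<Omega> cont compact_imp_closed[OF K2(1)] K2(2) \<Phi>0] K2 \<Phi>0 by blast
  have lip: "\<Phi> x - \<Phi> y \<le> d x y / R" if "x \<in> \<Omega>" "y \<in> \<Omega>" for x y
  proof -
    have "d o0 y \<le> d o0 x + d x y" using d_tri[OF o0 that] .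
    then have "d o0 y / R \<le> (d o0 x + d x y) / R" using R(1) by (intro divide_right_mono) auto
    then have "d o0 y / R \<le> d o0 x / R + d x y / R" by (simp add: add_divide_distrib)
    moreover have "0 \<le> d x y / R" using d_nonneg R(1) by auto
    ultimately show ?thesis unfolding \<Phi>_def using that by (auto simp: max_def min_def)
  qed
  \<comment> \<open>e \<le> s preserves the value 1 on K0 and e \<le> e1 keeps the support in K3; 2
    * e \<le> e3 because points are displaced by w and by t v at once.\<close>
  define e where "e = min (min s e1) (e3 / 2)"
  have e: "e > 0" "e \<le> s" "e \<le> e1" "2 * e \<le> e3" unfolding e_def using K1(1) K3(1) e3(1) by auto
  define \<eta> where "\<eta> = mollify e \<Phi>"
  have \<eta>0: "\<eta> z = 0" if z: "z \<notin> K3" for z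
  proof -
    have "\<Phi> (w + z) = 0" if w: "norm w \<le> e" for w
    proof (rule \<Phi>0)
      show "w + z \<notin> K2"
        using K3(5)[of "w + z" "- w"] w e z by auto
    qed
    then have "\<eta> z \<le> 0" "0 \<le> \<eta> z" unfolding \<eta>_def using mollify_le[OF e(1) cs] mollify_ge[OF e(1) cs] by force+
    then show ?thesis by simp
  qed
  have \<eta>1: "\<eta> z = 1" if z: "z \<in> K0" for z
  proof -
    have "\<Phi> (w + z) = 1" if w: "norm w \<le> e" for w
      using \<Phi>1 K1(5)[OF z, of w] w e by (simp add: add.commute)
    then have "\<eta> z \<le> 1" "1 \<le> \<eta> z" unfolding \<eta>_def using mollify_le[OF e(1) cs] mollify_ge[OF e(1) cs] by force+
    then show ?thesis by simp
  qed
  have \<eta>01: "0 \<le> \<eta> z" "\<eta> z \<le> 1" for z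
    unfolding \<eta>_def using mollify_le[OF e(1) cs] mollify_ge[OF e(1) cs] \<Phi>01 by blast+
  have d\<eta>: "\<eta> differentiable (at z)" for z unfolding \<eta>_def by (rule mollify_C1[OF e(1) cs])
  have up: "DD v \<eta> z \<le> \<kappa> * sqrt (g z v v)" if z: "z \<in> K3" for z v
  proof (rule dir_deriv_le_quotient[OF d\<eta>])
    define \<delta> where "\<delta> = e / (norm v + 1)"
    show "\<delta> > 0" unfolding \<delta>_def using e by (simp add: add_nonneg_pos)
    fix t :: real assume t: "0 < t" "t < \<delta>"
    have tv: "t * norm v \<le> e"
    proof -
      have "t * norm v \<le> t * (norm v + 1)" using t by simp
      also have "\<dots> \<le> \<delta> * (norm v + 1)" using t by (intro mult_right_mono) auto
      also have "\<dots> = e" unfolding \<delta>_def using norm_ge_zero[of v] by (simp add: add_nonneg_eq_0_iff)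
      finally show ?thesis .
    qed
    have "\<eta> (z + t *\<^sub>R v) - \<eta> z \<le> t * (2 / R * sqrt (g z v v))"
      unfolding \<eta>_def
    proof (rule mollify_diff_le[OF e(1) cs])
      fix w :: "complex ^ 'n" assume w: "norm w \<le> e"
      have n: "norm (w + (r * t) *\<^sub>R v) \<le> e3" if r: "0 \<le> r" "r \<le> 1" for r
      proof -
        have "norm (w + (r * t) *\<^sub>R v) \<le> norm w + \<bar>r * t\<bar> * norm v" using norm_triangle_ineq[of w "(r * t) *\<^sub>R v"] by simp
        also have "\<bar>r * t\<bar> * norm v = r * (t * norm v)" using t r by simp
        also have "\<dots> \<le> 1 * e" using tv t r by (intro mult_mono) auto
        finally show ?thesis using w e by simp
      qed
      have a: "w + z \<in> \<Omega>" "w + (z + t *\<^sub>R v) \<in> \<Omega>"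
        using e3(2)[OF z n[of 0]] e3(2)[OF z n[of 1]] by (simp_all add: add_ac)
      have "d (w + z) (w + (z + t *\<^sub>R v)) \<le> 2 * (t * sqrt (g z v v))"
      proof (rule d_segment_le[OF a])
        fix r :: real assume r: "0 \<le> r" "r \<le> 1"
        have eq: "w + z + r *\<^sub>R (w + (z + t *\<^sub>R v) - (w + z)) = z + (w + (r * t) *\<^sub>R v)"
          "w + (z + t *\<^sub>R v) - (w + z) = t *\<^sub>R v" by simp_all
        have in\<Omega>: "z + (w + (r * t) *\<^sub>R v) \<in> \<Omega>" by (rule e3(2)[OF z n[OF r]])
        have "sqrt (g (z + (w + (r * t) *\<^sub>R v)) v v) \<le> sqrt (4 * g z v v)"
          using e3(3)[OF z n[OF r]] by simp
        then have "t * sqrt (g (z + (w + (r * t) *\<^sub>R v)) v v) \<le> t * sqrt (4 * g z v v)" using t by simp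
        then show "sqrt (g (w + z + r *\<^sub>R (w + (z + t *\<^sub>R v) - (w + z))) (w + (z + t *\<^sub>R v) - (w + z)) (w + (z + t *\<^sub>R v) - (w + z)))
          \<le> 2 * (t * sqrt (g z v v))"
          unfolding eq(1) unfolding eq(2) g_scale[OF in\<Omega>] using t by (simp only: real_sqrt_mult) simp
      qed
      then have "d (w + (z + t *\<^sub>R v)) (w + z) / R \<le> 2 * (t * sqrt (g z v v)) / R"
        unfolding d_sym[of "w + (z + t *\<^sub>R v)"] using R(1) by (intro divide_right_mono) auto
      then show "\<Phi> (w + (z + t *\<^sub>R v)) - \<Phi> (w + z) \<le> t * (2 / R * sqrt (g z v v))"
        using lip[OF a(2,1)] by (simp add: mult_ac)
    qed
    also have "\<dots> \<le> t * (\<kappa> * sqrt (g z v v))"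
    proof -
      have "0 \<le> sqrt (g z v v)" using g_nonneg[of z v] z K3(4) by auto
      then show ?thesis using R(3) t by (intro mult_left_mono mult_right_mono) auto
    qed
    finally show "\<eta> (z + t *\<^sub>R v) - \<eta> z \<le> t * (\<kappa> * sqrt (g z v v))" .
  qed
  have le: "\<bar>DD v \<eta> z\<bar> \<le> \<kappa> * sqrt (g z v v)" if z: "z \<in> \<Omega>" for z v
  proof (cases "z \<in> K3")
    case True
    have "DD (- v) \<eta> z = - DD v \<eta> z" using linear_neg[OF linear_dir_deriv[OF d\<eta>]] .
    moreover have "sqrt (g z (- v) (- v)) = sqrt (g z v v)" using g_scale[OF z, of "- 1" v] by simp
    ultimately show ?thesis using up[OF True, of v] up[OF True, of "- v"] by (simp add: abs_le_iff)
  next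
    case False
    have "DD v \<eta> z = 0"
      by (rule dir_deriv_zero_open[of "- K3"]) (use False \<eta>0 K3(2) in \<open>auto simp: compact_imp_closed open_Compl\<close>)
    then show ?thesis using g_nonneg[OF z] \<kappa> by simp
  qed
  show thesis
    by (rule that[OF K3(2,4) \<eta>0 \<eta>01 \<eta>1 d\<eta> _ le]) (auto simp: \<eta>_def intro: mollify_C1[OF e(1) cs])
qed

end

section \<open>Integral estimates and the supremum bound\<close>

context riemannian_complete
begin

lemma integral_extend_zero:
  fixes w :: "complex ^ 'n \<Rightarrow> real"
  assumes w: "continuous_on \<Omega> w" and K: "compact K" "K \<subseteq> \<Omega>" "\<And>z. z \<notin> K \<Longrightarrow> w z = 0"
  shows "compactly_supported (\<lambda>z. if z \<in> \<Omega> then w z else 0)"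
  unfolding compactly_supported_def
proof (intro conjI exI[of _ K] allI impI)
  have "continuous_on \<Omega> (\<lambda>z. if z \<in> \<Omega> then w z else 0)"
    using continuous_on_cong[of \<Omega> \<Omega> "\<lambda>z. if z \<in> \<Omega> then w z else 0" w] w by simp
  then show "continuous_on UNIV (\<lambda>z. if z \<in> \<Omega> then w z else 0)"
    by (rule continuous_on_extend_zero[OF open_\<Omega> _ compact_imp_closed[OF K(1)] K(2)]) (use K in auto)
qed (use K in auto)

text \<open>The divergence theorem for \<zeta> Y extended by 0: every coordinate contributes the
  integral of a derivative of a compactly supported function.\<close>

lemma divergence_compactly_supported:
  fixes Y :: "complex ^ 'n \<Rightarrow> complex ^ 'n" and \<zeta> :: "complex ^ 'n \<Rightarrow> real"
  assumes Y: "smooth_on Y \<Omega>" and K: "compact K" "K \<subseteq> \<Omega>" "\<And>z. z \<notin> K \<Longrightarrow> \<zeta> z = 0"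
    and \<zeta>: "\<And>z. \<zeta> differentiable (at z)" "\<And>v. continuous_on UNIV (\<lambda>z. DD v \<zeta> z)"
  defines "\<Psi> \<equiv> \<lambda>z. if z \<in> \<Omega> then \<zeta> z * (\<Sum>b\<in>Basis. DD b Y z \<bullet> b) + DD (Y z) \<zeta> z else 0"
  shows "compactly_supported \<Psi>" "integral UNIV \<Psi> = 0"
proof -
  define G where "G b z = (if z \<in> \<Omega> then \<zeta> z * (Y z \<bullet> b) else 0)" for b z
  have opK: "open (- K)" using K by (simp add: compact_imp_closed open_Compl)
  have c\<zeta>: "continuous_on S \<zeta>" for S
    using \<zeta>(1) differentiable_imp_continuous_within differentiable_at_withinI
    by (metis continuous_on_eq_continuous_within)
  have D\<zeta>0: "DD v \<zeta> z = 0" if "z \<notin> K" for v z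
    by (rule dir_deriv_zero_open[OF opK]) (use that K in auto)
  have DG: "DD v (G b) z = \<zeta> z * (DD v Y z \<bullet> b) + DD v \<zeta> z * (Y z \<bullet> b)" "G b differentiable (at z)"
    if z: "z \<in> \<Omega>" for b z v
  proof -
    have "((\<lambda>z. \<zeta> z * (Y z \<bullet> b)) has_derivative (\<lambda>v. \<zeta> z * (DD v Y z \<bullet> b) + DD v \<zeta> z * (Y z \<bullet> b))) (at z)"
      by (intro has_derivative_mult has_derivative_inner_left has_derivative_dir_deriv \<zeta> smooth_on_differentiable[OF Y z])
    then have D: "(G b has_derivative (\<lambda>v. \<zeta> z * (DD v Y z \<bullet> b) + DD v \<zeta> z * (Y z \<bullet> b))) (at z)"
      by (rule has_derivative_transform_within_open[OF _ open_\<Omega> z]) (simp add: G_def)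
    show "DD v (G b) z = \<zeta> z * (DD v Y z \<bullet> b) + DD v \<zeta> z * (Y z \<bullet> b)" using dir_deriv_eqI[OF D] .
    show "G b differentiable (at z)" using D differentiableI by blast
  qed
  have DG0: "DD v (G b) z = 0" "G b differentiable (at z)" if z: "z \<notin> K" for b z v
  proof -
    have "((\<lambda>z. 0::real) has_derivative (\<lambda>v. 0)) (at z)" by simp
    then have D: "(G b has_derivative (\<lambda>v. 0)) (at z)"
      by (rule has_derivative_transform_within_open[OF _ opK]) (use z K in \<open>auto simp: G_def\<close>)
    show "DD v (G b) z = 0" using dir_deriv_eqI[OF D] .
    show "G b differentiable (at z)" using D differentiableI by blast
  qed
  have dG: "G b differentiable (at z)" for b z using DG(2) DG0(2) K(2) by blast
  have cY: "continuous_on \<Omega> Y" "\<And>b. continuous_on \<Omega> (\<lambda>z. DD b Y z)"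
    using smooth_on_continuous_on[OF Y] smooth_on_continuous_on[OF smooth_on_dir_deriv[OF Y]] by auto
  have csG: "compactly_supported (G b)" for b
    unfolding G_def[abs_def] by (rule integral_extend_zero[OF _ K(1,2)]) (use K cY c\<zeta> in \<open>auto intro!: continuous_intros\<close>)
  have cDG: "continuous_on UNIV (\<lambda>z. DD v (G b) z)" for v b
  proof (rule continuous_on_extend_zero[OF open_\<Omega> _ compact_imp_closed[OF K(1)] K(2) DG0(1)])
    have "continuous_on \<Omega> (\<lambda>z. \<zeta> z * (DD v Y z \<bullet> b) + DD v \<zeta> z * (Y z \<bullet> b))"
      by (intro continuous_intros cY c\<zeta> continuous_on_subset[OF \<zeta>(2)]) auto
    then show "continuous_on \<Omega> (\<lambda>z. DD v (G b) z)"
      using continuous_on_cong[of \<Omega> \<Omega> "\<lambda>z. DD v (G b) z" "\<lambda>z. \<zeta> z * (DD v Y z \<bullet> b) + DD v \<zeta> z * (Y z \<bullet> b)"] DG(1) by simp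
  qed
  have csDG: "compactly_supported (\<lambda>z. DD v (G b) z)" for v b
    by (rule compactly_supported_dir_deriv[OF csG cDG])
  have eq: "\<Psi> z = (\<Sum>b\<in>Basis. DD b (G b) z)" for z
  proof (cases "z \<in> \<Omega>")
    case True
    have "(\<Sum>b\<in>Basis. (Y z \<bullet> b) *\<^sub>R DD b \<zeta> z) = DD (Y z) \<zeta> z"
      by (rule sum_inner_expand[OF linear_dir_deriv[OF \<zeta>(1)]])
    then show ?thesis unfolding \<Psi>_def using True
      by (simp add: DG(1) sum.distrib sum_distrib_left mult.commute)
  next
    case False
    then have "z \<notin> K" using K by blast
    then show ?thesis unfolding \<Psi>_def using False DG0(1) by simp
  qed
  have "(\<Psi> has_integral (\<Sum>b\<in>Basis. integral UNIV (\<lambda>z. DD b (G b) z))) UNIV"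
    unfolding eq[abs_def] by (intro has_integral_sum compactly_supported_has_integral(1) csDG) auto
  moreover have "integral UNIV (\<lambda>z. DD b (G b) z) = 0" for b
    by (rule integral_dir_deriv_zero[OF csG dG cDG])
  ultimately have "(\<Psi> has_integral 0) UNIV" by simp
  then show "integral UNIV \<Psi> = 0" by (rule integral_unique)
  have "continuous_on UNIV \<Psi>" unfolding eq[abs_def] by (intro continuous_on_sum cDG)
  moreover have "\<Psi> z = 0" if "z \<notin> K" for z unfolding eq using DG0(1)[OF that] by simp
  ultimately show "compactly_supported \<Psi>" unfolding compactly_supported_def using K(1) by blast
qed

context
  fixes f :: "complex ^ 'n \<Rightarrow> real" and Y :: "nat \<Rightarrow> complex ^ 'n \<Rightarrow> complex ^ 'n" and s :: "nat \<Rightarrow> complex ^ 'n \<Rightarrow> real" and m :: nat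
  assumes f: "continuous_on \<Omega> f" "\<And>z. z \<in> \<Omega> \<Longrightarrow> 0 < f z" and Y: "\<And>p. smooth_on (Y p) \<Omega>"
    and div: "\<And>p z. z \<in> \<Omega> \<Longrightarrow> (\<Sum>b\<in>Basis. DD b (Y p) z \<bullet> b) \<ge> f z ^ p * (2 * real p * f z - 2 * real p - real m + (s p z)\<^sup>2)"
    and nrm: "\<And>p z. z \<in> \<Omega> \<Longrightarrow> sqrt (g z (Y p z) (Y p z)) \<le> f z ^ p * s p z"
begin

text \<open>The field Y p is tested with \<eta>^(2 p + 2). Differentiating this power brings the
  factor 2 p + 2, which the gradient bound 1 / (p + 1) reduces to 2, uniformly in p. The cross term
  2 e u is then absorbed by e^2 u^2 at the price of adding 1.\<close>

lemma energy_estimate: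
  assumes K: "compact K" "K \<subseteq> \<Omega>" "\<And>z. z \<notin> K \<Longrightarrow> \<eta> z = 0" and \<eta>: "\<And>z. 0 \<le> \<eta> z" "\<And>z. \<eta> z \<le> 1"
    "\<And>z. \<eta> differentiable (at z)" "\<And>v. continuous_on UNIV (\<lambda>z. DD v \<eta> z)"
    "\<And>z v. z \<in> \<Omega> \<Longrightarrow> \<bar>DD v \<eta> z\<bar> \<le> 1 / (real p + 1) * sqrt (g z v v)"
    and p: "p \<ge> 1"
  defines "H \<equiv> \<lambda>k z. if z \<in> \<Omega> then ((\<eta> z)\<^sup>2 * f z) ^ k else 0"
  shows "\<And>k. k \<ge> 1 \<Longrightarrow> compactly_supported (H k)"
    "2 * real p * integral UNIV (H (p + 1)) \<le> (2 * real p + real m + 1) * integral UNIV (H p)"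
proof -
  have c\<eta>: "continuous_on S \<eta>" for S
    using \<eta>(3) differentiable_imp_continuous_within differentiable_at_withinI
    by (metis continuous_on_eq_continuous_within)
  show cs: "compactly_supported (H k)" if "k \<ge> 1" for k
    unfolding H_def by (rule integral_extend_zero[OF _ K(1,2)])
      (use f(1) K(3) c\<eta> that in \<open>auto intro!: continuous_intros\<close>)
  define \<zeta> where "\<zeta> z = \<eta> z ^ (2 * p + 2)" for z
  have D\<zeta>: "(\<zeta> has_derivative (\<lambda>v. real (2 * p + 2) * \<eta> z ^ (2 * p + 1) * DD v \<eta> z)) (at z)" for z
    using has_derivative_power[OF has_derivative_dir_deriv[OF \<eta>(3)], of "2 * p + 2" z] unfolding \<zeta>_def
    by (simp add: mult_ac)
  have DD\<zeta>: "DD v \<zeta> z = real (2 * p + 2) * \<eta> z ^ (2 * p + 1) * DD v \<eta> z" for v z using dir_deriv_eqI[OF D\<zeta>] .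
  have \<zeta>: "\<zeta> differentiable (at z)" for z using D\<zeta> differentiableI by blast
  have c\<zeta>: "continuous_on UNIV (\<lambda>z. DD v \<zeta> z)" for v unfolding DD\<zeta> by (intro continuous_intros c\<eta> \<eta>)
  define \<Psi> where "\<Psi> z = (if z \<in> \<Omega> then \<zeta> z * (\<Sum>b\<in>Basis. DD b (Y p) z \<bullet> b) + DD (Y p z) \<zeta> z else 0)" for z
  have \<zeta>0: "\<zeta> z = 0" if "z \<notin> K" for z unfolding \<zeta>_def using K(3)[OF that] by simp
  have \<Psi>: "compactly_supported \<Psi>" "integral UNIV \<Psi> = 0"
    using divergence_compactly_supported[OF Y K(1,2) \<zeta>0 \<zeta> c\<zeta>, of p] unfolding \<Psi>_def[abs_def] by auto
  have pt: "2 * real p * H (p + 1) z \<le> \<Psi> z + (2 * real p + real m + 1) * H p z" for z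
  proof (cases "z \<in> \<Omega>")
    case z: True
    define e t u where "e = \<eta> z" and "t = f z" and "u = s p z"
    have e: "0 \<le> e" "e \<le> 1" and t: "0 < t" unfolding e_def t_def using \<eta> f(2)[OF z] by auto
    have A: "\<zeta> z * (\<Sum>b\<in>Basis. DD b (Y p) z \<bullet> b) \<ge> e ^ (2 * p + 2) * (t ^ p * (2 * real p * t - 2 * real p - real m + u\<^sup>2))"
      unfolding \<zeta>_def e_def t_def u_def using \<eta>(1) by (intro mult_left_mono div[OF z]) auto
    have "\<bar>DD (Y p z) \<eta> z\<bar> \<le> 1 / (real p + 1) * (t ^ p * u)"
      unfolding t_def u_def using \<eta>(5)[OF z, of "Y p z"] mult_left_mono[OF nrm[OF z, of p], of "1 / (real p + 1)"] by simp
    then have "- (1 / (real p + 1) * (t ^ p * u)) \<le> DD (Y p z) \<eta> z" by (simp add: abs_le_iff)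
    then have "real (2 * p + 2) * e ^ (2 * p + 1) * (- (1 / (real p + 1) * (t ^ p * u))) \<le> DD (Y p z) \<zeta> z"
      unfolding DD\<zeta> e_def using \<eta>(1) by (intro mult_left_mono) auto
    moreover have "real (2 * p + 2) * e ^ (2 * p + 1) * (- (1 / (real p + 1) * (t ^ p * u))) = - 2 * e ^ (2 * p + 1) * (t ^ p * u)"
      by (simp add: field_simps)
    ultimately have B: "- 2 * e ^ (2 * p + 1) * (t ^ p * u) \<le> DD (Y p z) \<zeta> z" by simp
    have "e ^ (2 * p) * t ^ p * (2 * real p * (e\<^sup>2 * t) - (2 * real p + real m + 1)) \<le>
        e ^ (2 * p) * t ^ p * (e\<^sup>2 * (2 * real p * t - 2 * real p - real m + u\<^sup>2) - 2 * e * u)"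
    proof (rule mult_left_mono)
      have "e\<^sup>2 * (2 * real p + real m) \<le> 1 * (2 * real p + real m)"
        using e by (intro mult_right_mono) (auto simp: power_le_one)
      moreover have "0 \<le> (e * u - 1)\<^sup>2" by simp
      ultimately show "2 * real p * (e\<^sup>2 * t) - (2 * real p + real m + 1)
          \<le> e\<^sup>2 * (2 * real p * t - 2 * real p - real m + u\<^sup>2) - 2 * e * u"
        by (simp add: power2_eq_square algebra_simps)
    qed (use e t in auto)
    also have "\<dots> = e ^ (2 * p + 2) * (t ^ p * (2 * real p * t - 2 * real p - real m + u\<^sup>2)) + (- 2 * e ^ (2 * p + 1) * (t ^ p * u))"
      by (simp add: power_add power2_eq_square algebra_simps)
    also have "\<dots> \<le> \<Psi> z" unfolding \<Psi>_def using A B z by simp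
    finally have "e ^ (2 * p) * t ^ p * (2 * real p * (e\<^sup>2 * t)) - e ^ (2 * p) * t ^ p * (2 * real p + real m + 1) \<le> \<Psi> z"
      by (simp only: right_diff_distrib)
    moreover have "H p z = e ^ (2 * p) * t ^ p" "H (p + 1) z = e ^ (2 * p) * t ^ p * (e\<^sup>2 * t)"
      unfolding H_def e_def t_def using z by (simp_all add: power_mult_distrib power_mult)
    ultimately show ?thesis by (simp add: mult_ac)
  qed (simp add: H_def \<Psi>_def)
  have i: "(H k has_integral integral UNIV (H k)) UNIV" if "k \<ge> 1" for k
    by (rule compactly_supported_has_integral(1)[OF cs[OF that]])
  have "2 * real p * integral UNIV (H (p + 1)) \<le> 0 + (2 * real p + real m + 1) * integral UNIV (H p)"
  proof (rule has_integral_le)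
    show "((\<lambda>z. 2 * real p * H (p + 1) z) has_integral 2 * real p * integral UNIV (H (p + 1))) UNIV"
      by (intro has_integral_mult_right i) simp
    show "((\<lambda>z. \<Psi> z + (2 * real p + real m + 1) * H p z) has_integral 0 + (2 * real p + real m + 1) * integral UNIV (H p)) UNIV"
      using compactly_supported_has_integral(1)[OF \<Psi>(1)] \<Psi>(2) by (intro has_integral_add has_integral_mult_right i p) simp
  qed (use pt in auto)
  then show "2 * real p * integral UNIV (H (p + 1)) \<le> (2 * real p + real m + 1) * integral UNIV (H p)" by simp
qed

text \<open>The energy estimate bounds every norm in the sequence \<open>p = 1, 2, ...\<close> by the previous one with a
  factor close to 1, and the supremum is the limit of these norms.\<close>

lemma sup_bound:
  assumes bd: "bounded \<Omega>" and z0: "z0 \<in> \<Omega>"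
  shows "f z0 \<le> 2"
proof (rule ccontr)
  assume "\<not> f z0 \<le> 2"
  \<comment> \<open>Strictly between 1 and f z0 / 2: then f exceeds 2 * \<theta> on a box around z0,
    and (2 * \<theta>)^(p + 1) outgrows 2^p.\<close>
  define \<theta> where "\<theta> = (1 + f z0 / 2) / 2"
  have \<theta>: "\<theta> > 1" "2 * \<theta> < f z0" unfolding \<theta>_def using \<open>\<not> f z0 \<le> 2\<close> by (auto simp: field_simps)
  have "open (\<Omega> \<inter> f -` {2 * \<theta><..})" by (rule continuous_open_preimage[OF f(1) open_\<Omega> open_greaterThan])
  moreover have "z0 \<in> \<Omega> \<inter> f -` {2 * \<theta><..}" using z0 \<theta> by simp
  ultimately obtain a b where ab: "cbox a b \<subseteq> \<Omega> \<inter> f -` {2 * \<theta><..}" "z0 \<in> box a b" by (rule open_contains_cbox)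
  have ne: "cbox a b \<noteq> {}" using ab(2) box_subset_cbox[of a b] by blast
  obtain A where A: "\<Omega> \<subseteq> cbox (- A) A" using bounded_subset_cbox_symmetric[OF bd] by blast
  define V where "V = measure lborel (cbox a b)"
  define W where "W = measure lborel (cbox (- A) A)"
  have V: "V > 0" unfolding V_def using ab(2) content_pos_lt_eq[of a b] by (auto simp: mem_box intro: less_trans)
  have W: "W \<ge> 0" unfolding W_def by simp
  have key: "\<theta> ^ (p + 1) * V \<le> 3 * W" if p: "p \<ge> m + 1" for p
  proof -
    have "1 / (real p + 1) > 0" by simp
    obtain \<eta> K where \<eta>: "compact K" "K \<subseteq> \<Omega>" "\<And>z. z \<notin> K \<Longrightarrow> \<eta> z = 0" "\<And>z. 0 \<le> \<eta> z" "\<And>z. \<eta> z \<le> (1::real)"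
      "\<And>z. z \<in> cbox a b \<Longrightarrow> \<eta> z = 1" "\<And>z. \<eta> differentiable (at z)" "\<And>v. continuous_on UNIV (\<lambda>z. DD v \<eta> z)"
      "\<And>z v. z \<in> \<Omega> \<Longrightarrow> \<bar>DD v \<eta> z\<bar> \<le> 1 / (real p + 1) * sqrt (g z v v)"
      by (rule cutoff_exists[OF compact_cbox _ ne, of "1 / (real p + 1)"]) (use ab in auto)
    define H where "H k z = (if z \<in> \<Omega> then ((\<eta> z)\<^sup>2 * f z) ^ k else 0)" for k z
    have p1: "p \<ge> 1" using p by simp
    have cs: "compactly_supported (H k)" if "k \<ge> 1" for k
      unfolding H_def[abs_def] by (rule energy_estimate(1)[OF \<eta>(1-5,7-9) p1 that])
    have en2: "2 * real p * integral UNIV (H (p + 1)) \<le> (2 * real p + real m + 1) * integral UNIV (H p)"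
      unfolding H_def[abs_def] by (rule energy_estimate(2)[OF \<eta>(1-5,7-9) p1])
    define I where "I = integral UNIV (H (p + 1))"
    have i: "(H k has_integral integral UNIV (H k)) UNIV" if "k \<ge> 1" for k
      by (rule compactly_supported_has_integral(1)[OF cs[OF that]])
    have Hnn: "0 \<le> H k z" for k z
      using f(2)[of z] by (cases "z \<in> \<Omega>") (simp_all add: H_def)
    \<comment> \<open>Splitting at the value 2 puts the factor 1/2 in front of the higher power. For
      p \<ge> m + 1 the energy estimate has factor at most 3/2, and 3/2 * 1/2 < 1, so the higher
      power is absorbed within one step from p to p + 1.\<close>
    have pt: "H p z \<le> (if z \<in> cbox (- A) A then 2 ^ p else 0) + 1/2 * H (p + 1) z" for z
    proof (cases "z \<in> \<Omega>")
      case z: True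
      define h where "h = (\<eta> z)\<^sup>2 * f z"
      have h: "0 \<le> h" unfolding h_def using f(2)[OF z] by simp
      have "h ^ p \<le> 2 ^ p + 1/2 * h ^ (p + 1)"
      proof (cases "h \<le> 2")
        case True
        then have "h ^ p \<le> 2 ^ p" using h by (intro power_mono) auto
        then show ?thesis using h by (simp add: add_increasing2)
      next
        case False
        then have "1 * h ^ p \<le> (1/2 * h) * h ^ p" by (intro mult_right_mono) auto
        moreover have "0 \<le> (2::real) ^ p" by simp
        ultimately have "h ^ p \<le> 2 ^ p + (1/2 * h) * h ^ p" by linarith
        then show ?thesis by simp
      qed
      then show ?thesis unfolding H_def using z A by (auto simp: h_def)
    qed (simp add: H_def)
    have "integral UNIV (H p) \<le> 2 ^ p * W + 1/2 * I"
    proof (rule has_integral_le[OF i])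
      have "((\<lambda>z. 2 ^ p :: real) has_integral W *\<^sub>R 2 ^ p) (cbox (- A) A)" unfolding W_def by (rule has_integral_const)
      then have "((\<lambda>z. if z \<in> cbox (- A) A then 2 ^ p else 0) has_integral 2 ^ p * W) UNIV"
        by (simp add: has_integral_restrict_UNIV mult.commute)
      then show "((\<lambda>z. (if z \<in> cbox (- A) A then 2 ^ p else 0) + 1/2 * H (p + 1) z) has_integral 2 ^ p * W + 1/2 * I) UNIV"
        unfolding I_def by (intro has_integral_add has_integral_mult_right i) simp_all
    qed (use pt p1 in auto)
    moreover have "(2 * real p + real m + 1) * integral UNIV (H p) \<le> 3 * real p * integral UNIV (H p)"
    proof -
      have "0 \<le> integral UNIV (H p)" by (rule has_integral_nonneg[OF i]) (use Hnn p1 in auto)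
      moreover have "real m + 1 \<le> real p" using p by simp
      ultimately show ?thesis by (intro mult_right_mono) auto
    qed
    moreover have "3 * real p * integral UNIV (H p) \<le> 3 * real p * (2 ^ p * W + 1/2 * I)"
      using calculation(1) by (intro mult_left_mono) auto
    ultimately have "2 * real p * I \<le> 3 * real p * (2 ^ p * W + 1/2 * I)" using en2 unfolding I_def by linarith
    then have "real p * (2 * I) \<le> real p * (3 * (2 ^ p * W + 1/2 * I))" by (simp add: mult_ac)
    then have "2 * I \<le> 3 * (2 ^ p * W + 1/2 * I)" using p1 by simp
    then have I: "I \<le> 6 * (2 ^ p * W)" by simp
    have "(2 * \<theta>) ^ (p + 1) * V \<le> I"
      unfolding I_def
    proof (rule has_integral_le[OF _ i])
      have "((\<lambda>z. (2 * \<theta>) ^ (p + 1)) has_integral V *\<^sub>R (2 * \<theta>) ^ (p + 1)) (cbox a b)"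
        unfolding V_def by (rule has_integral_const)
      then show "((\<lambda>z. if z \<in> cbox a b then (2 * \<theta>) ^ (p + 1) else 0) has_integral (2 * \<theta>) ^ (p + 1) * V) UNIV"
        by (simp add: has_integral_restrict_UNIV mult.commute)
      show "(if z \<in> cbox a b then (2 * \<theta>) ^ (p + 1) else 0) \<le> H (p + 1) z" for z
      proof (cases "z \<in> cbox a b")
        case True
        then have "z \<in> \<Omega>" "2 * \<theta> < f z" using ab(1) by auto
        then have "(2 * \<theta>) ^ (p + 1) \<le> f z ^ (p + 1)" using \<theta> by (intro power_mono) auto
        then show ?thesis unfolding H_def using True \<open>z \<in> \<Omega>\<close> \<eta>(6)[OF True] by simp
      qed (use Hnn in simp)
    qed simp
    then have "(2 * \<theta>) ^ (p + 1) * V \<le> 6 * (2 ^ p * W)" using I by linarith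
    moreover have "2 ^ (p + 1) * (\<theta> ^ (p + 1) * V) = (2 * \<theta>) ^ (p + 1) * V"
      by (simp only: power_mult_distrib mult.assoc)
    moreover have "2 ^ (p + 1) * (3 * W) = 6 * (2 ^ p * W)" by simp
    ultimately have "2 ^ (p + 1) * (\<theta> ^ (p + 1) * V) \<le> 2 ^ (p + 1) * (3 * W)" by linarith
    then show ?thesis by (rule mult_left_le_imp_le) simp
  qed
  obtain n where n: "3 * W / V < \<theta> ^ n" using real_arch_pow[OF \<theta>(1)] by blast
  have "\<theta> ^ n \<le> \<theta> ^ (max n (m + 1) + 1)" using \<theta> by (intro power_increasing) auto
  then have "3 * W / V * V < \<theta> ^ (max n (m + 1) + 1) * V" using n V by (intro mult_strict_right_mono) auto
  then show False using key[of "max n (m + 1)"] V by simp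
qed

end

end

locale kaehler_einstein_complete = kaehler_einstein_open \<Omega> g + riemannian_complete \<Omega> g
  for \<Omega> :: "(complex ^ 'n) set" and g +
  assumes bounded_\<Omega>: "bounded \<Omega>"
begin

text \<open>A Schwarz lemma: every half-space containing \<Omega> bounds g from below by the squared
  relative change of its affine function. It is the bound \<open>fq a c z \<le> 2\<close> combined
  with the Cauchy-Schwarz inequality.\<close>

lemma schwarz:
  assumes h: "\<And>z. z \<in> \<Omega> \<Longrightarrow> 0 < a \<bullet> z + c" and z: "z \<in> \<Omega>"
  shows "(a \<bullet> v)\<^sup>2 \<le> 2 * (a \<bullet> z + c)\<^sup>2 * g z v v"
proof (cases "a = 0")
  case False
  have "fq a c z \<le> 2"
  proof (rule sup_bound[OF _ _ _ _ _ bounded_\<Omega> z])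
    show "continuous_on \<Omega> (fq a c)" by (rule smooth_on_continuous_on[OF smooth_fq[OF h False]])
    show "0 < fq a c z" if "z \<in> \<Omega>" for z by (rule fq_pos[OF h False that])
    show "smooth_on (\<lambda>y. fq a c y ^ p *\<^sub>R grad (\<Lambda> a c p) y) \<Omega>" for p by (rule smooth_X[OF h False])
    show "(\<Sum>b\<in>Basis. DD b (\<lambda>y. fq a c y ^ p *\<^sub>R grad (\<Lambda> a c p) y) z \<bullet> b)
      \<ge> fq a c z ^ p * (2 * real p * fq a c z - 2 * real p - real (DIM(complex ^ 'n)) + (sqrt (dpair (\<Lambda> a c p) (\<Lambda> a c p) z))\<^sup>2)"
      if "z \<in> \<Omega>" for p z
      using divergence_X[OF h False that, of p] g_X(2)[OF h False that, of p] by simp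
    show "sqrt (g z (fq a c z ^ p *\<^sub>R grad (\<Lambda> a c p) z) (fq a c z ^ p *\<^sub>R grad (\<Lambda> a c p) z))
      \<le> fq a c z ^ p * sqrt (dpair (\<Lambda> a c p) (\<Lambda> a c p) z)" if "z \<in> \<Omega>" for p z
    proof -
      have "0 \<le> fq a c z ^ p" using fq_pos[OF h False that] by simp
      then show ?thesis using g_X(1)[OF h False that, of p] by (simp add: real_sqrt_mult)
    qed
  qed
  moreover have "0 < (a \<bullet> z + c)\<^sup>2" using h[OF z] by simp
  ultimately have "q a z \<le> 2 * (a \<bullet> z + c)\<^sup>2" using fq_def[OF h False, of z] by (simp add: pos_divide_le_eq)
  then have "q a z * g z v v \<le> 2 * (a \<bullet> z + c)\<^sup>2 * g z v v" using g_nonneg[OF z] by (intro mult_right_mono) auto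
  then show ?thesis using schwarz_form[OF z, of a v] by linarith
qed (use g_nonneg[OF z] in simp)

end

section \<open>Comparison with the size of complex discs\<close>

lemma second_derivative_local_max:
  fixes \<phi> :: "real \<Rightarrow> real"
  assumes \<delta>: "\<delta> > 0" and D1: "\<And>s. \<bar>s\<bar> < \<delta> \<Longrightarrow> (\<phi> has_field_derivative \<phi>' s) (at s)"
    and D2: "(\<phi>' has_field_derivative D) (at 0)" and le: "\<And>s. \<bar>s\<bar> < \<delta> \<Longrightarrow> \<phi> s \<le> \<phi> 0"
  shows "D \<le> 0"
proof (rule ccontr)
  assume "\<not> D \<le> 0"
  have "\<phi>' 0 = 0"
    by (rule DERIV_local_max[OF D1[of 0] \<delta>]) (use \<delta> le in auto)
  moreover obtain d where d: "d > 0" "\<And>h. 0 < h \<Longrightarrow> h < d \<Longrightarrow> \<phi>' 0 < \<phi>' h"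
    using DERIV_pos_inc_right[OF D2] \<open>\<not> D \<le> 0\<close> by auto
  moreover define h where "h = min d \<delta> / 2"
  have h: "0 < h" "h < d" "h < \<delta>" unfolding h_def using d(1) \<delta> by auto
  obtain x where x: "0 < x" "x < h" "\<phi> h - \<phi> 0 = (h - 0) * \<phi>' x"
    using MVT2[of 0 h \<phi> \<phi>'] D1 h by auto
  have "0 < \<phi>' x" using d(2)[OF x(1)] x(2) h(2) \<open>\<phi>' 0 = 0\<close> by simp
  then have "0 < (h - 0) * \<phi>' x" using h by simp
  moreover have "\<phi> h \<le> \<phi> 0" using le[of h] h by simp
  ultimately show False using x(3) by simp
qed

context kaehler_einstein_complete
begin

text \<open>The maximum principle for \<open>\<psi> z + 2 * DIM(complex ^ 'n) * ln (1 - b (z - z0) (z - z0))\<close>, which tends to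
  minus infinity at the boundary of the ellipsoid.\<close>

lemma volume_bound:
  assumes b: "inner_form b" and bJ: "\<And>v. b (J v) (J v) = b v v" and E: "\<And>w. b w w \<le> 1 \<Longrightarrow> z0 + w \<in> \<Omega>"
  shows "det (gram (g z0)) \<le> (4 * DIM(complex ^ 'n)) ^ DIM(complex ^ 'n) * det (gram b)"
proof -
  let ?m = "DIM(complex ^ 'n)"
  have bb: "bounded_bilinear b" using B_bil[OF b] by (simp add: bilinear_conv_bounded_bilinear)
  note bs = bilinear_ladd[OF B_bil[OF b]] bilinear_radd[OF B_bil[OF b]] bilinear_lmul[OF B_bil[OF b]] bilinear_rmul[OF B_bil[OF b]]
  define \<beta> where "\<beta> z = b (z - z0) (z - z0)" for z
  have c\<beta>: "continuous_on S \<beta>" for S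
    unfolding \<beta>_def by (intro bounded_bilinear.continuous_on[OF bb] continuous_intros)
  have \<beta>0: "\<beta> z0 = 0" unfolding \<beta>_def using bilinear_lzero[OF B_bil[OF b]] by simp
  define K where "K = {z. \<beta> z \<le> 1}"
  have K\<Omega>: "K \<subseteq> \<Omega>" unfolding K_def \<beta>_def using E[of "_ - z0"] by auto
  have "closed K" unfolding K_def by (intro closed_Collect_le c\<beta> continuous_on_const)
  then have K: "compact K" using bounded_subset[OF bounded_\<Omega> K\<Omega>] by (simp add: compact_eq_bounded_closed)
  \<comment> \<open>The exponential of the function M below. Unlike M it extends continuously to the
    boundary of the ellipsoid, with value 0, so a maximum exists and lies inside.\<close>
  define P where "P z = exp (\<psi> z) * (1 - \<beta> z) ^ (2 * ?m)" for z
  have "continuous_on K P"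
    unfolding P_def by (intro continuous_intros c\<beta> continuous_on_subset[OF smooth_on_continuous_on[OF smooth_\<psi>] K\<Omega>])
  moreover have z0K: "z0 \<in> K" unfolding K_def using \<beta>0 by simp
  ultimately obtain z1 where z1: "z1 \<in> K" "\<And>z. z \<in> K \<Longrightarrow> P z \<le> P z1"
    using continuous_attains_sup[OF K, of P] by blast
  have "0 < P z0" unfolding P_def \<beta>0 by simp
  then have "0 < P z1" using z1(2)[OF z0K] by linarith
  have \<beta>1: "\<beta> z1 < 1"
  proof (rule ccontr)
    assume "\<not> \<beta> z1 < 1"
    then have "\<beta> z1 = 1" using z1(1) unfolding K_def by simp
    then have "P z1 = 0" unfolding P_def by simp
    then show False using \<open>0 < P z1\<close> by simp
  qed
  have z1\<Omega>: "z1 \<in> \<Omega>" using z1(1) K\<Omega> by blast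
  define M where "M z = \<psi> z + 2 * ?m * ln (1 - \<beta> z)" for z
  have expM: "exp (M z) = P z" if "\<beta> z < 1" for z
  proof -
    have "exp (2 * ?m * ln (1 - \<beta> z)) = (1 - \<beta> z) ^ (2 * ?m)"
      using that exp_of_nat_mult[of "2 * ?m" "ln (1 - \<beta> z)"] by simp
    then show ?thesis unfolding M_def P_def exp_add by simp
  qed
  have Mle: "M z \<le> M z1" if "\<beta> z < 1" for z
  proof -
    have "exp (M z) \<le> exp (M z1)" unfolding expM[OF that] expM[OF \<beta>1] using z1(2)[of z] that unfolding K_def by simp
    then show ?thesis by simp
  qed
  define w where "w = z1 - z0"
  define \<beta>' where "\<beta>' = \<beta> z1"
  have \<beta>': "\<beta>' = b w w" "0 \<le> \<beta>'" "\<beta>' < 1" unfolding \<beta>'_def w_def using \<beta>1 B_nonneg[OF b] by (auto simp: \<beta>_def)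
  \<comment> \<open>Second derivative test for M along z1 + s v, where \<beta> is a quadratic
    polynomial in s.\<close>
  have hess: "DD v (DD v \<psi>) z1 \<le> 2 * ?m * (2 * b v v / (1 - \<beta>') + 4 * (b w v)\<^sup>2 / (1 - \<beta>')\<^sup>2)" for v
  proof -
    have U: "open {z. \<beta> z < 1}" by (intro open_Collect_less c\<beta> continuous_on_const)
    have "open ((\<lambda>s::real. z1 + s *\<^sub>R v) -` {z. \<beta> z < 1})"
      by (rule open_vimage[OF U]) (intro continuous_intros)
    moreover have "0 \<in> (\<lambda>s::real. z1 + s *\<^sub>R v) -` {z. \<beta> z < 1}" using \<beta>1 by simp
    ultimately obtain \<delta> where \<delta>: "\<delta> > 0" "ball 0 \<delta> \<subseteq> (\<lambda>s::real. z1 + s *\<^sub>R v) -` {z. \<beta> z < 1}"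
      unfolding open_contains_ball by blast
    have line\<beta>: "\<beta> (z1 + s *\<^sub>R v) = \<beta>' + 2 * s * b w v + s\<^sup>2 * b v v" for s
    proof -
      have "\<beta> (z1 + s *\<^sub>R v) = b (w + s *\<^sub>R v) (w + s *\<^sub>R v)" unfolding \<beta>_def w_def by (simp add: algebra_simps)
      then show ?thesis unfolding \<beta>'(1) by (simp add: bs B_sym[OF b, of v w] power2_eq_square algebra_simps)
    qed
    have in\<beta>: "\<beta>' + 2 * s * b w v + s\<^sup>2 * b v v < 1" if "\<bar>s\<bar> < \<delta>" for s
      using \<delta>(2) that unfolding line\<beta>[symmetric] by (auto simp: subset_iff dist_real_def)
    have in\<Omega>: "z1 + s *\<^sub>R v \<in> \<Omega>" if "\<bar>s\<bar> < \<delta>" for s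
      using in\<beta>[OF that] K\<Omega> unfolding line\<beta>[symmetric] K_def by auto
    define \<phi> where "\<phi> s = \<psi> (z1 + s *\<^sub>R v) + 2 * ?m * ln (1 - (\<beta>' + 2 * s * b w v + s\<^sup>2 * b v v))" for s
    define \<phi>' where "\<phi>' s = DD v \<psi> (z1 + s *\<^sub>R v) + 2 * ?m * (- (2 * b w v + 2 * s * b v v) / (1 - (\<beta>' + 2 * s * b w v + s\<^sup>2 * b v v)))" for s
    have "DD v (DD v \<psi>) z1 + 2 * ?m * (- (2 * b v v * (1 - \<beta>') + 2 * b w v * (2 * b w v)) / (1 - \<beta>')\<^sup>2) \<le> 0"
    proof (rule second_derivative_local_max[OF \<delta>(1), of \<phi> \<phi>'])
      fix s assume s: "\<bar>s\<bar> < \<delta>"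
      have D\<psi>: "((\<lambda>s. \<psi> (z1 + s *\<^sub>R v)) has_field_derivative DD v \<psi> (z1 + s *\<^sub>R v)) (at s)"
        by (rule line_has_field_derivative[OF smooth_on_differentiable[OF smooth_\<psi> in\<Omega>[OF s]]])
      show "(\<phi> has_field_derivative \<phi>' s) (at s)"
        unfolding \<phi>_def[abs_def] \<phi>'_def using in\<beta>[OF s]
        by (auto intro!: derivative_eq_intros D\<psi> simp: power2_eq_square divide_inverse algebra_simps)
      show "\<phi> s \<le> \<phi> 0"
      proof -
        have "\<phi> s = M (z1 + s *\<^sub>R v)" for s unfolding \<phi>_def M_def line\<beta> ..
        then show ?thesis using Mle[of "z1 + s *\<^sub>R v"] in\<beta>[OF s] unfolding line\<beta> by simp
      qed
    next
      have D\<psi>: "((\<lambda>s. DD v \<psi> (z1 + s *\<^sub>R v)) has_field_derivative DD v (DD v \<psi>) (z1 + 0 *\<^sub>R v)) (at 0)"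
        by (rule line_has_field_derivative[OF smooth_on_differentiable[OF smooth_on_dir_deriv[OF smooth_\<psi>]]]) (use z1\<Omega> in simp)
      show "(\<phi>' has_field_derivative DD v (DD v \<psi>) z1 + 2 * ?m * (- (2 * b v v * (1 - \<beta>') + 2 * b w v * (2 * b w v)) / (1 - \<beta>')\<^sup>2)) (at 0)"
        unfolding \<phi>'_def[abs_def] using D\<psi> \<beta>'(3)
        by (auto intro!: derivative_eq_intros simp: power2_eq_square algebra_simps)
    qed
    then have "DD v (DD v \<psi>) z1 \<le> 2 * ?m * ((2 * b v v * (1 - \<beta>') + 2 * b w v * (2 * b w v)) / (1 - \<beta>')\<^sup>2)"
      unfolding minus_divide_left[symmetric] mult_minus_right by linarith
    moreover have "(2 * b v v * (1 - \<beta>') + 2 * b w v * (2 * b w v)) / (1 - \<beta>')\<^sup>2 = 2 * b v v / (1 - \<beta>') + 4 * (b w v)\<^sup>2 / (1 - \<beta>')\<^sup>2"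
      using \<beta>'(3) by (simp add: add_divide_distrib power2_eq_square)
    ultimately show ?thesis by (simp only:)
  qed
  \<comment> \<open>The denominator matches the exponent 2 * ?m in P: each of the ?m factors q of
    the determinant meets one factor (1 - \<beta>')^2 and leaves the constant 4 * ?m.\<close>
  define q where "q = 4 * ?m / (1 - \<beta>')\<^sup>2"
  have q: "q > 0" unfolding q_def using \<beta>' by simp
  have gb: "g z1 v v \<le> q * b v v" for v
  proof -
    have cs: "(b w v)\<^sup>2 \<le> \<beta>' * b v v" "(b w (J v))\<^sup>2 \<le> \<beta>' * b v v"
      using cauchy_schwarz_form[OF b, of w v] cauchy_schwarz_form[OF b, of w "J v"] unfolding \<beta>'(1) bJ by auto
    have "4 * g z1 v v = DD v (DD v \<psi>) z1 + DD (J v) (DD (J v) \<psi>) z1" using hessian_\<psi>[OF z1\<Omega>] by simp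
    also have "\<dots> \<le> 2 * ?m * (2 * b v v / (1 - \<beta>') + 4 * (b w v)\<^sup>2 / (1 - \<beta>')\<^sup>2)
        + 2 * ?m * (2 * b v v / (1 - \<beta>') + 4 * (b w (J v))\<^sup>2 / (1 - \<beta>')\<^sup>2)"
      using hess[of v] hess[of "J v"] unfolding bJ by simp
    also have "\<dots> \<le> 2 * ?m * (2 * b v v / (1 - \<beta>') + 4 * (\<beta>' * b v v) / (1 - \<beta>')\<^sup>2)
        + 2 * ?m * (2 * b v v / (1 - \<beta>') + 4 * (\<beta>' * b v v) / (1 - \<beta>')\<^sup>2)"
      using cs \<beta>' by (intro add_mono mult_left_mono divide_right_mono) auto
    also have "\<dots> = 8 * ?m * ((1 + \<beta>') * b v v / (1 - \<beta>')\<^sup>2)"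
    proof -
      have "2 * b v v / (1 - \<beta>') = 2 * b v v * (1 - \<beta>') / (1 - \<beta>')\<^sup>2" using \<beta>'(3) by (simp add: power2_eq_square)
      then have "2 * b v v / (1 - \<beta>') + 4 * (\<beta>' * b v v) / (1 - \<beta>')\<^sup>2 = 2 * ((1 + \<beta>') * b v v / (1 - \<beta>')\<^sup>2)"
        by (simp add: add_divide_distrib[symmetric] algebra_simps)
      then show ?thesis by simp
    qed
    also have "\<dots> \<le> 8 * ?m * (2 * b v v / (1 - \<beta>')\<^sup>2)"
      using \<beta>' B_nonneg[OF b, of v] by (intro mult_left_mono divide_right_mono mult_right_mono) auto
    also have "\<dots> = 4 * (q * b v v)" unfolding q_def by simp
    finally show ?thesis by simp
  qed
  have qb: "inner_form (\<lambda>u v. q * b u v)"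
    using q B_pos[OF b] B_sym[OF b] unfolding inner_form_def bilinear_def
    by (auto intro!: linearI simp: bs distrib_left)
  have "det (gram (g z1)) \<le> det (gram (\<lambda>u v. q * b u v))" by (rule det_gram_mono[OF form[OF z1\<Omega>] qb gb])
  also have "\<dots> = q ^ ?m * det (gram b)" by (rule det_gram_scale)
  finally have 1: "det (gram (g z1)) \<le> q ^ ?m * det (gram b)" .
  have e\<psi>: "exp (\<psi> z) = det (gram (g z))" if "z \<in> \<Omega>" for z
    unfolding \<psi>_def using det_gram_pos[OF form[OF that]] by simp
  have "det (gram (g z0)) = P z0" unfolding P_def \<beta>0 using e\<psi> z0K K\<Omega> by auto
  also have "\<dots> \<le> P z1" by (rule z1(2)[OF z0K])
  also have "\<dots> \<le> q ^ ?m * det (gram b) * (1 - \<beta>') ^ (2 * ?m)"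
    unfolding P_def e\<psi>[OF z1\<Omega>] \<beta>'_def[symmetric] using 1 \<beta>' by (intro mult_right_mono) auto
  also have "\<dots> = (q * (1 - \<beta>')\<^sup>2) ^ ?m * det (gram b)"
    unfolding power_mult_distrib power_mult by (simp only: mult_ac)
  also have "q * (1 - \<beta>')\<^sup>2 = 4 * ?m" unfolding q_def using \<beta>' by simp
  finally show ?thesis by simp
qed

text \<open>If z + v were outside, the affine function of a separating half-space would change along
  v by at least its value at z, and \<open>schwarz\<close> would force 1 \<le> 2 * g z v v.\<close>

lemma small_in:
  assumes z: "z \<in> \<Omega>" and v: "g z v v < 1/2"
  shows "z + v \<in> \<Omega>"
proof (rule ccontr)
  assume "z + v \<notin> \<Omega>"
  then obtain a c where a: "a \<noteq> 0" "\<And>y. y \<in> \<Omega> \<Longrightarrow> a \<bullet> y \<le> c" "c \<le> a \<bullet> (z + v)"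
    using separating_hyperplane_sets[of \<Omega> "{z + v}"] convex_\<Omega> z by fastforce
  have pos: "0 < - a \<bullet> y + c" if y: "y \<in> \<Omega>" for y
  proof -
    obtain e where e: "e > 0" "cball y e \<subseteq> \<Omega>" using open_\<Omega> y open_contains_cball by blast
    have "y + (e / norm a) *\<^sub>R a \<in> cball y e" using e(1) by (simp add: dist_norm)
    then have "a \<bullet> (y + (e / norm a) *\<^sub>R a) \<le> c" using a(2) e(2) by blast
    moreover have "0 < (e / norm a) * (a \<bullet> a)" using e(1) a(1) by simp
    ultimately show ?thesis by (simp add: inner_simps)
  qed
  define h where "h = - a \<bullet> z + c"
  have h: "0 < h" "h \<le> a \<bullet> v" unfolding h_def using pos[OF z] a(3) by (auto simp: inner_simps)
  have "h\<^sup>2 \<le> (a \<bullet> v)\<^sup>2" using h by (intro power_mono) auto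
  also have "\<dots> = (- a \<bullet> v)\<^sup>2" by simp
  also have "\<dots> \<le> 2 * h\<^sup>2 * g z v v" using schwarz[OF pos z, of v] unfolding h_def by simp
  finally have "h\<^sup>2 * 1 \<le> h\<^sup>2 * (2 * g z v v)" by (simp add: mult_ac)
  then have "1 \<le> 2 * g z v v" by (rule mult_left_le_imp_le) (use h in simp)
  then show False using v by simp
qed

text \<open>The constant of \<open>volume_bound\<close> times the factor 4 * 16^(m - 1) that the
  rank one determinant leaves in \<open>disc_bound\<close>, m being the real dimension.\<close>

definition "disc_const = 4 * 16 ^ (DIM(complex ^ 'n) - 1) * (4 * DIM(complex ^ 'n)) ^ DIM(complex ^ 'n)"

text \<open>If \<open>g z v v\<close> were large, the convex hull of the disc spanned by \<open>v\<close> and a \<open>g\<close>-ball of fixed radius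
  would contain an ellipsoid violating \<open>volume_bound\<close>.\<close>

lemma disc_bound:
  assumes z: "z \<in> \<Omega>" and disc: "\<And>x y. x\<^sup>2 + y\<^sup>2 \<le> 1 \<Longrightarrow> z + x *\<^sub>R v + y *\<^sub>R J v \<in> \<Omega>"
  shows "g z v v \<le> real disc_const"
proof (cases "g z v v \<le> 1")
  case True
  have "1 \<le> disc_const" unfolding disc_const_def by (simp add: Suc_le_eq)
  then show ?thesis using True by linarith
next
  case False
  let ?m = "DIM(complex ^ 'n)"
  define t where "t = g z v v"
  have t: "t > 1" unfolding t_def using False by simp
  note bs = bilinear_ladd[OF bil[OF z]] bilinear_radd[OF bil[OF z]] bilinear_lmul[OF bil[OF z]] bilinear_rmul[OF bil[OF z]]
    bilinear_lsub[OF bil[OF z]] bilinear_rsub[OF bil[OF z]]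
  \<comment> \<open>With this k, b is 16 g on the g-orthogonal complement of v and J v, and 4/t
    times g on their span, so that b v v = 4.\<close>
  define k where "k = (16 - 4 / t) / t"
  have k: "k \<ge> 0" unfolding k_def using t by (simp add: field_simps)
  define b where "b u w = 16 * g z u w - k * (g z u v * g z w v) - k * (g z u (J v) * g z w (J v))" for u w
  have vJ: "g z v (J v) = 0" "g z (J v) v = 0" "g z (J v) (J v) = t"
    using g_J_skew[OF z, of v v] gsym[OF z, of v "J v"] g_J[OF z, of v v] unfolding t_def by auto
  have dec: "b w w = 16 * g z (w - x *\<^sub>R v - y *\<^sub>R J v) (w - x *\<^sub>R v - y *\<^sub>R J v) + 4 * (x\<^sup>2 + y\<^sup>2)"
    if "x = g z w v / t" "y = g z w (J v) / t" for w x y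
  proof -
    have e: "g z w v = x * t" "g z w (J v) = y * t" "g z v w = x * t" "g z (J v) w = y * t"
      using that t gsym[OF z, of v w] gsym[OF z, of "J v" w] by auto
    have "g z (w - x *\<^sub>R v - y *\<^sub>R J v) (w - x *\<^sub>R v - y *\<^sub>R J v) = g z w w - t * (x\<^sup>2 + y\<^sup>2)"
      by (simp add: bs e vJ t_def[symmetric] power2_eq_square algebra_simps)
    moreover have "k * (x * t * (x * t)) = (16 * t - 4) * x\<^sup>2" "k * (y * t * (y * t)) = (16 * t - 4) * y\<^sup>2"
      unfolding k_def using t by (simp_all add: field_simps power2_eq_square)
    ultimately show ?thesis unfolding b_def e by (simp add: algebra_simps)
  qed
  have b: "inner_form b"
    unfolding inner_form_def
  proof (intro conjI allI impI)
    show "bilinear b" unfolding bilinear_def b_def by (auto intro!: linearI simp: bs algebra_simps)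
    show "b u w = b w u" for u w unfolding b_def gsym[OF z, of u w] by (simp add: mult_ac)
    show "0 < b w w" if "w \<noteq> 0" for w
    proof -
      define x y where "x = g z w v / t" and "y = g z w (J v) / t"
      define w' where "w' = w - x *\<^sub>R v - y *\<^sub>R J v"
      have bw: "b w w = 16 * g z w' w' + 4 * (x\<^sup>2 + y\<^sup>2)" unfolding w'_def by (rule dec[OF x_def y_def])
      show ?thesis
      proof (cases "x = 0 \<and> y = 0")
        case True
        then have "w' = w" unfolding w'_def by simp
        then show ?thesis unfolding bw using B_pos[OF form[OF z] that] True by simp
      next
        case False
        then have "x\<^sup>2 + y\<^sup>2 > 0" by (simp add: sum_power2_gt_zero_iff)
        then show ?thesis unfolding bw using g_nonneg[OF z, of w'] by (intro add_nonneg_pos) auto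
      qed
    qed
  qed
  have bJ: "b (J w) (J w) = b w w" for w
  proof -
    have "g z (J w) v = - g z w (J v)" by (rule g_J_skew[OF z])
    then show ?thesis unfolding b_def g_J[OF z] by simp
  qed
  \<comment> \<open>z + w is the midpoint of z + 2 (x v + y J v), which lies in the disc, and z + 2
    w', which lies in \<Omega> by \<open>small_in\<close>.\<close>
  have in\<Omega>: "z + w \<in> \<Omega>" if w: "b w w \<le> 1" for w
  proof -
    define x y where "x = g z w v / t" and "y = g z w (J v) / t"
    define w' where "w' = w - x *\<^sub>R v - y *\<^sub>R J v"
    have bw: "b w w = 16 * g z w' w' + 4 * (x\<^sup>2 + y\<^sup>2)" unfolding w'_def by (rule dec[OF x_def y_def])
    have nn: "0 \<le> g z w' w'" "0 \<le> x\<^sup>2 + y\<^sup>2" using g_nonneg[OF z] by auto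
    have "(2 * x)\<^sup>2 + (2 * y)\<^sup>2 \<le> 1" using w bw nn by (simp add: power2_eq_square)
    then have 1: "z + (2 * x) *\<^sub>R v + (2 * y) *\<^sub>R J v \<in> \<Omega>" by (rule disc)
    have 2: "z + 2 *\<^sub>R w' \<in> \<Omega>"
    proof (rule small_in[OF z])
      have "16 * g z w' w' \<le> 1"
        using w zero_le_power2[of x] zero_le_power2[of y] unfolding bw distrib_left by linarith
      then show "g z (2 *\<^sub>R w') (2 *\<^sub>R w') < 1/2" by (simp add: bs)
    qed
    have "(1/2) *\<^sub>R (z + (2 * x) *\<^sub>R v + (2 * y) *\<^sub>R J v) + (1/2) *\<^sub>R (z + 2 *\<^sub>R w') \<in> \<Omega>"
      by (rule convexD[OF convex_\<Omega> 1 2]) auto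
    moreover have "(1/2) *\<^sub>R (z + (2 * x) *\<^sub>R v + (2 * y) *\<^sub>R J v) + (1/2) *\<^sub>R (z + 2 *\<^sub>R w') = z + w"
      unfolding w'_def by (simp add: algebra_simps flip: scaleR_add_left)
    ultimately show ?thesis by simp
  qed
  have 1: "det (gram (g z)) \<le> (4 * ?m) ^ ?m * det (gram b)" by (rule volume_bound[OF b bJ in\<Omega>])
  \<comment> \<open>Dropping the J v term enlarges b and leaves a rank one perturbation of 16 g with
    known determinant; a factor 4/t survives, and it is what bounds t.\<close>
  let ?C = "\<lambda>u w. 16 * g z u w - (16 - 4 / t) / t * (g z u v * g z w v)"
  have bC: "b w w \<le> ?C w w" for w unfolding b_def k_def[symmetric] using k by simp
  have C: "inner_form ?C"
    unfolding inner_form_def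
  proof (intro conjI allI impI)
    show "bilinear ?C" unfolding bilinear_def k_def[symmetric] by (auto intro!: linearI simp: bs algebra_simps)
    show "?C u w = ?C w u" for u w unfolding gsym[OF z, of u w] by (simp add: mult_ac)
    show "0 < ?C w w" if "w \<noteq> 0" for w using B_pos[OF b that] bC[of w] by linarith
  qed
  have "det (gram b) \<le> det (gram ?C)" by (rule det_gram_mono[OF b C bC])
  also have "\<dots> = 4 / t * 16 ^ (?m - 1) * det (gram (g z))"
    by (rule det_gram_rank_one[OF form[OF z] t_def[symmetric]]) (use t in simp)
  finally have 2: "det (gram b) \<le> 4 / t * 16 ^ (?m - 1) * det (gram (g z))" .
  have "real ((4 * ?m) ^ ?m) * det (gram b) \<le> (4 * ?m) ^ ?m * (4 / t * 16 ^ (?m - 1) * det (gram (g z)))"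
    by (rule mult_left_mono[OF 2]) simp
  then have "1 * det (gram (g z)) \<le> (real disc_const / t) * det (gram (g z))"
    using 1 unfolding disc_const_def by (simp add: mult_ac)
  then have "1 \<le> real disc_const / t" by (rule mult_right_le_imp_le) (rule det_gram_pos[OF form[OF z]])
  then show ?thesis using t unfolding t_def[symmetric] by (simp add: pos_le_divide_eq)
qed

end

section \<open>From inclusions of discs to inequalities for g\<close>

context kaehler_einstein_complete
begin

definition "D = sqrt (real disc_const)"

lemma D_ge_1: "1 \<le> D"
proof -
  have "1 \<le> disc_const" unfolding disc_const_def by (simp add: Suc_le_eq)
  then show ?thesis unfolding D_def by simp
qed

lemma disc_bound_sqrt:
  assumes "z \<in> \<Omega>" "\<And>x y. x\<^sup>2 + y\<^sup>2 \<le> 1 \<Longrightarrow> z + x *\<^sub>R v + y *\<^sub>R J v \<in> \<Omega>"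
  shows "sqrt (g z v v) \<le> D"
  unfolding D_def using disc_bound[OF assms] by simp

lemma g_disc:
  assumes z: "z \<in> \<Omega>"
  shows "g z (x *\<^sub>R v + y *\<^sub>R J v) (x *\<^sub>R v + y *\<^sub>R J v) = (x\<^sup>2 + y\<^sup>2) * g z v v"
proof -
  have "g z v (J v) = 0" "g z (J v) v = 0" "g z (J v) (J v) = g z v v"
    using g_J_skew[OF z, of v v] gsym[OF z, of v "J v"] g_J[OF z, of v v] by auto
  then show ?thesis
    by (simp add: bilinear_ladd[OF bil[OF z]] bilinear_radd[OF bil[OF z]] bilinear_lmul[OF bil[OF z]]
      bilinear_rmul[OF bil[OF z]] power2_eq_square algebra_simps)
qed

text \<open>If scaling by r fits the g-ball at z into \<Omega> around z', it fits the discs in this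
  ball as well, and \<open>disc_bound_sqrt\<close> measures them at z'. The vector is normalised to
  g z w w = 1/4 so that its whole disc lies in the ball; the factor 2 undoes this.\<close>

lemma expand_bound:
  assumes z: "z \<in> \<Omega>" "z' \<in> \<Omega>" and imp: "\<And>v. g z v v < 1/2 \<Longrightarrow> z' + r *\<^sub>R v \<in> \<Omega>"
  shows "sqrt (g z' (r *\<^sub>R v) (r *\<^sub>R v)) \<le> 2 * D * sqrt (g z v v)"
proof (cases "v = 0")
  case False
  define q where "q = 2 * sqrt (g z v v)"
  have q: "q > 0" unfolding q_def using B_pos[OF form[OF z(1)] False] by simp
  define w where "w = (1 / q) *\<^sub>R v"
  have v: "v = q *\<^sub>R w" unfolding w_def using q by simp
  have gw: "g z w w = 1/4"
  proof -
    have "g z w w = g z v v / q\<^sup>2"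
      unfolding w_def by (simp add: bilinear_lmul[OF bil[OF z(1)]] bilinear_rmul[OF bil[OF z(1)]] power2_eq_square)
    also have "q\<^sup>2 = 4 * g z v v" unfolding q_def using g_nonneg[OF z(1), of v] by simp
    finally show ?thesis using B_pos[OF form[OF z(1)] False] by simp
  qed
  have "sqrt (g z' (r *\<^sub>R w) (r *\<^sub>R w)) \<le> D"
  proof (rule disc_bound_sqrt[OF z(2)])
    fix x y :: real assume xy: "x\<^sup>2 + y\<^sup>2 \<le> 1"
    have "z' + r *\<^sub>R (x *\<^sub>R w + y *\<^sub>R J w) \<in> \<Omega>"
      by (rule imp) (use xy in \<open>simp add: g_disc[OF z(1)] gw\<close>)
    then show "z' + x *\<^sub>R (r *\<^sub>R w) + y *\<^sub>R J (r *\<^sub>R w) \<in> \<Omega>"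
      by (simp add: J_simps algebra_simps)
  qed
  then have "q * sqrt (g z' (r *\<^sub>R w) (r *\<^sub>R w)) \<le> q * D" using q by simp
  moreover have "sqrt (g z' (r *\<^sub>R v) (r *\<^sub>R v)) = q * sqrt (g z' (r *\<^sub>R w) (r *\<^sub>R w))"
    using g_scale[OF z(2), of q "r *\<^sub>R w"] q unfolding v by (simp add: mult.commute)
  ultimately show ?thesis unfolding q_def by (simp add: mult_ac)
qed (simp add: bilinear_lzero[OF bil] z)

section \<open>Height and radial retraction\<close>

context
  fixes o0 assumes o0: "o0 \<in> \<Omega>"
begin

definition "height z = - ln (1 - gauge_at o0 \<Omega> z)"
text \<open>A homothety of all of \<Omega>, not a truncation: points below height m are moved as
  well, but by a bounded distance, and composing two retractions multiplies their factors. The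
  constant C in \<open>radial_contraction\<close> makes room for both.\<close>

definition "retract m z = o0 + (1 - exp (- m)) *\<^sub>R (z - o0)"

lemmas gauge = gauge_at_nonneg[OF open_\<Omega> bounded_\<Omega> convex_\<Omega> o0] gauge_at_less_1[OF open_\<Omega> bounded_\<Omega> convex_\<Omega> o0]

lemma gauge_scale: "0 \<le> r \<Longrightarrow> gauge_at o0 \<Omega> (o0 + r *\<^sub>R (z - o0)) = r * gauge_at o0 \<Omega> z"
  using gauge_at_scale[OF open_\<Omega> bounded_\<Omega> convex_\<Omega> o0, of r "z - o0"] by simp

lemma height_nonneg: assumes "z \<in> \<Omega>" shows "0 \<le> height z"
  unfolding height_def using gauge(1)[of z] gauge(2)[OF assms] by simp

text \<open>The gauge itself is not differentiated. A functional attaining it at x yields a smooth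
  minorant \<phi> of the height that agrees with the height at x, and \<open>schwarz\<close> bounds
  its derivative; sqrt 2 is rounded up to 2.\<close>

lemma height_lipschitz: assumes xy: "x \<in> \<Omega>" "y \<in> \<Omega>" shows "height x - height y \<le> 2 * d x y"
proof -
  obtain a where a: "a \<in> polar_at o0 \<Omega>" "gauge_at o0 \<Omega> x = a \<bullet> (x - o0)"
    using gauge_at_attained[OF open_\<Omega> bounded_\<Omega> convex_\<Omega> o0] by blast
  have lt: "a \<bullet> (z - o0) < 1" if "z \<in> \<Omega>" for z
    using gauge_at_upper[OF open_\<Omega> bounded_\<Omega> convex_\<Omega> o0 a(1), of z] gauge(2)[OF that] by linarith
  define \<phi> where "\<phi> z = - ln (1 - a \<bullet> (z - o0))" for z
  have D\<phi>: "(\<phi> has_derivative (\<lambda>v. (a \<bullet> v) / (1 - a \<bullet> (z - o0)))) (at z)" if "z \<in> \<Omega>" for z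
    unfolding \<phi>_def[abs_def] using lt[OF that] by (auto intro!: derivative_eq_intros simp: field_simps)
  have "\<bar>\<phi> x - \<phi> y\<bar> \<le> 2 * d y x"
  proof (rule d_lipschitz[OF _ _ xy(2,1)])
    show "\<phi> differentiable (at z)" if "z \<in> \<Omega>" for z using D\<phi>[OF that] differentiableI by blast
    fix z v assume z: "z \<in> \<Omega>"
    let ?h = "1 - a \<bullet> (z - o0)"
    have pos: "0 < - a \<bullet> y + (1 + a \<bullet> o0)" if "y \<in> \<Omega>" for y using lt[OF that] by (simp add: inner_simps)
    have "(a \<bullet> v)\<^sup>2 \<le> 2 * ?h\<^sup>2 * g z v v"
      using schwarz[OF pos z, of v] by (simp add: inner_simps algebra_simps)
    also have "\<dots> \<le> (2 * (?h * sqrt (g z v v)))\<^sup>2" using g_nonneg[OF z, of v] by (simp add: power_mult_distrib)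
    finally have "\<bar>a \<bullet> v\<bar> \<le> \<bar>2 * (?h * sqrt (g z v v))\<bar>" by (rule iffD2[OF abs_le_square_iff])
    then have "\<bar>a \<bullet> v\<bar> \<le> 2 * (?h * sqrt (g z v v))"
      using lt[OF z] g_nonneg[OF z, of v] by (simp add: abs_mult)
    then have "\<bar>a \<bullet> v\<bar> / ?h \<le> 2 * sqrt (g z v v)" using lt[OF z] by (simp add: pos_divide_le_eq mult_ac)
    then show "\<bar>DD v \<phi> z\<bar> \<le> 2 * sqrt (g z v v)" using dir_deriv_eqI[OF D\<phi>[OF z], of v] lt[OF z] by (simp add: abs_divide)
  qed simp
  then have "\<phi> x - \<phi> y \<le> 2 * d x y" using d_sym[of x y] by linarith
  moreover have "height x = \<phi> x" unfolding height_def \<phi>_def a(2) ..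
  moreover have "\<phi> y \<le> height y"
    unfolding height_def \<phi>_def
    using gauge_at_upper[OF open_\<Omega> bounded_\<Omega> convex_\<Omega> o0 a(1), of y] gauge(2)[OF xy(2)] lt[OF xy(2)] by simp
  ultimately show ?thesis by linarith
qed

lemma scale01: "0 \<le> m \<Longrightarrow> 0 \<le> 1 - exp (- m) \<and> 1 - exp (- m) \<le> (1::real)"
  by simp

lemma retract_in: "0 \<le> m \<Longrightarrow> z \<in> \<Omega> \<Longrightarrow> retract m z \<in> \<Omega>"
  unfolding retract_def by (rule segment_in[OF o0]) auto

lemma height_retract: assumes "0 \<le> m" "z \<in> \<Omega>" shows "height (retract m z) \<le> m"
proof -
  have "(1 - exp (- m)) * gauge_at o0 \<Omega> z \<le> (1 - exp (- m)) * 1"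
    using gauge(2)[OF assms(2)] assms(1) by (intro mult_left_mono) auto
  then have "exp (- m) \<le> 1 - gauge_at o0 \<Omega> (retract m z)"
    unfolding retract_def using gauge_scale[of "1 - exp (- m)" z] assms(1) by simp
  then have "ln (exp (- m)) \<le> ln (1 - gauge_at o0 \<Omega> (retract m z))" by (intro ln_mono) (auto intro: less_le_trans[OF exp_gt_zero])
  then show ?thesis unfolding height_def by simp
qed

text \<open>Almost shortest paths from x to y stay within distance R of x, so the metric inequality
  is used only there.\<close>

lemma contract_dist:
  assumes xy: "x \<in> \<Omega>" "y \<in> \<Omega>" and s: "0 \<le> s" "s \<le> 1" and R: "d x y < R" and \<kappa>: "\<kappa> \<ge> 0"
    and le: "\<And>z v. z \<in> \<Omega> \<Longrightarrow> d x z < R \<Longrightarrow> sqrt (g (o0 + s *\<^sub>R (z - o0)) (s *\<^sub>R v) (s *\<^sub>R v)) \<le> \<kappa> * sqrt (g z v v)"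
  shows "d (o0 + s *\<^sub>R (x - o0)) (o0 + s *\<^sub>R (y - o0)) \<le> \<kappa> * d x y"
proof (rule field_le_epsilon)
  fix e :: real assume e: "e > 0"
  define e' where "e' = min (e / (\<kappa> + 1)) (R - d x y)"
  have e': "e' > 0" "e' \<le> e / (\<kappa> + 1)" "d x y + e' \<le> R" unfolding e'_def using e \<kappa> R by auto
  obtain L where L: "L \<in> lengths x y" "L < d x y + e'" using d_approx[OF xy e'(1)] by blast
  obtain \<gamma> where \<gamma>: "valid_path \<gamma>" "path_image \<gamma> \<subseteq> \<Omega>" "\<gamma> 0 = x" "\<gamma> 1 = y" "(speed \<gamma> has_integral L) {0..1}"
    using L(1) unfolding lengths_iff pathstart_def pathfinish_def by blast
  have in\<Omega>: "\<gamma> t \<in> \<Omega>" if "t \<in> {0..1}" for t using \<gamma>(2) that unfolding path_image_def by blast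
  have near: "d x (\<gamma> t) < R" if t: "t \<in> {0..1}" for t
  proof (cases "t = 0")
    case True
    have "0 < R" using d_nonneg[of x y] R by linarith
    then show ?thesis using True \<gamma>(3) d_self[OF xy(1)] by simp
  next
    case False
    then have "integral {0..t} (speed \<gamma>) \<in> lengths (\<gamma> 0) (\<gamma> t)" using t by (intro lengths_subpath[OF \<gamma>(1,2,5)]) auto
    then have "d x (\<gamma> t) \<le> integral {0..t} (speed \<gamma>)" using d_le_length \<gamma>(3) by blast
    also have "\<dots> \<le> integral {0..1} (speed \<gamma>)"
    proof (rule integral_subset_le)
      show "speed \<gamma> integrable_on {0..1}" using \<gamma>(5) by blast
      then show "speed \<gamma> integrable_on {0..t}" by (rule integrable_on_subinterval) (use t in auto)
    qed (use t speed_nonneg in\<Omega> in auto)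
    also have "\<dots> = L" by (rule integral_unique[OF \<gamma>(5)])
    finally show ?thesis using L(2) e'(3) by linarith
  qed
  obtain K where K: "K \<in> lengths (o0 + s *\<^sub>R (\<gamma> 0 - o0)) (o0 + s *\<^sub>R (\<gamma> 1 - o0))" "K \<le> \<kappa> * L"
    using lengths_image[OF o0 s segment_in[OF o0 in\<Omega> s] le[OF in\<Omega> near] \<gamma>(1,2,5)] by blast
  have "d (o0 + s *\<^sub>R (x - o0)) (o0 + s *\<^sub>R (y - o0)) \<le> K" using d_le_length[OF K(1)] unfolding \<gamma>(3,4) .
  also have "\<dots> \<le> \<kappa> * L" by (rule K(2))
  also have "\<dots> \<le> \<kappa> * (d x y + e / (\<kappa> + 1))" using L(2) e'(2) \<kappa> by (intro mult_left_mono) auto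
  also have "\<dots> \<le> \<kappa> * d x y + e" using e \<kappa> by (simp add: field_simps)
  finally show "d (o0 + s *\<^sub>R (x - o0)) (o0 + s *\<^sub>R (y - o0)) \<le> \<kappa> * d x y + e" .
qed

lemma retract_lipschitz:
  assumes m: "0 \<le> m" and xy: "x \<in> \<Omega>" "y \<in> \<Omega>"
  shows "d (retract m x) (retract m y) \<le> 2 * D * d x y"
  unfolding retract_def
proof (rule contract_dist[OF xy, of _ "d x y + 1"])
  fix z v assume z: "z \<in> \<Omega>"
  let ?s = "1 - exp (- m)"
  have s: "0 \<le> ?s" "?s \<le> 1" using scale01[OF m] by auto
  show "sqrt (g (o0 + ?s *\<^sub>R (z - o0)) (?s *\<^sub>R v) (?s *\<^sub>R v)) \<le> 2 * D * sqrt (g z v v)"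
  proof (rule expand_bound[OF z segment_in[OF o0 z s]])
    fix v assume "g z v v < 1/2"
    then have "z + v \<in> \<Omega>" by (rule small_in[OF z])
    from segment_in[OF o0 this s] show "o0 + ?s *\<^sub>R (z - o0) + ?s *\<^sub>R v \<in> \<Omega>" by (simp add: algebra_simps)
  qed
qed (use D_ge_1 m in auto)

text \<open>Chords of the g-ball at z centred at z can be expanded 2^k times once the centre is
  retracted to level m, because z lies at most B^-k times as deep as that level. As this holds for
  all directions, \<open>expand_bound\<close> applies with r = 2^k * s and gives the factor
  2^-k.\<close>

lemma retract_contract:
  assumes B: "B > 1" and exp: "\<And>k v u s. o0 + v + u \<in> \<Omega> \<Longrightarrow> o0 + v - u \<in> \<Omega> \<Longrightarrow> 0 \<le> s \<Longrightarrow> s \<le> 1 \<Longrightarrow>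
      B ^ k * (1 - gauge_at o0 \<Omega> (o0 + v)) \<le> 1 - s \<Longrightarrow> o0 + s *\<^sub>R (v + 2 ^ k *\<^sub>R u) \<in> \<Omega>"
    and m: "0 \<le> m" and xy: "x \<in> \<Omega>" "y \<in> \<Omega>" "d x y \<le> 1" and hx: "m + real k * (ln B + 4) \<le> height x" and k: "k \<ge> 1"
  shows "d (retract m x) (retract m y) \<le> 2 * D / 2 ^ k * d x y"
  unfolding retract_def
proof (rule contract_dist[OF xy(1,2), of _ 2])
  fix z v assume z: "z \<in> \<Omega>" "d x z < 2"
  let ?s = "1 - exp (- m)"
  have s: "0 \<le> ?s" "?s \<le> 1" using scale01[OF m] by auto
  \<comment> \<open>The summand 4 in the block height ln B + 4 pays for the height lost within
    distance 2 of x; as k \<ge> 1, at least one such summand is available.\<close>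
  have "height x - height z \<le> 4" using height_lipschitz[OF xy(1) z(1)] z(2) by linarith
  moreover have "4 \<le> real k * 4" using k by simp
  ultimately have "m + real k * ln B \<le> height z" using hx by (simp add: distrib_left)
  then have "ln (1 - gauge_at o0 \<Omega> z) \<le> - m - real k * ln B" unfolding height_def by linarith
  then have "exp (ln (1 - gauge_at o0 \<Omega> z)) \<le> exp (- m - real k * ln B)" by simp
  moreover have "exp (real k * ln B) = B ^ k" using B by (simp add: exp_of_nat_mult)
  ultimately have "1 - gauge_at o0 \<Omega> z \<le> exp (- m) / B ^ k" using gauge(2)[OF z(1)] by (simp add: exp_diff)
  then have deep: "B ^ k * (1 - gauge_at o0 \<Omega> z) \<le> 1 - ?s" using B by (simp add: field_simps)
  have "sqrt (g (o0 + ?s *\<^sub>R (z - o0)) ((2 ^ k * ?s) *\<^sub>R v) ((2 ^ k * ?s) *\<^sub>R v)) \<le> 2 * D * sqrt (g z v v)"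
  proof (rule expand_bound[OF z(1) segment_in[OF o0 z(1) s]])
    fix v assume v: "g z v v < 1/2"
    then have "g z (- v) (- v) < 1/2" by (simp add: bilinear_lneg[OF bil[OF z(1)]] bilinear_rneg[OF bil[OF z(1)]])
    with v have "z + v \<in> \<Omega>" "z - v \<in> \<Omega>" using small_in[OF z(1), of v] small_in[OF z(1), of "- v"] by auto
    then have "o0 + ?s *\<^sub>R ((z - o0) + 2 ^ k *\<^sub>R v) \<in> \<Omega>" using s deep by (intro exp) auto
    then show "o0 + ?s *\<^sub>R (z - o0) + (2 ^ k * ?s) *\<^sub>R v \<in> \<Omega>" by (simp add: scaleR_add_right mult.commute add.assoc)
  qed
  moreover have "sqrt (g (o0 + ?s *\<^sub>R (z - o0)) ((2 ^ k * ?s) *\<^sub>R v) ((2 ^ k * ?s) *\<^sub>R v))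
      = 2 ^ k * sqrt (g (o0 + ?s *\<^sub>R (z - o0)) (?s *\<^sub>R v) (?s *\<^sub>R v))"
    using g_scale[OF segment_in[OF o0 z(1) s], of "2 ^ k" "?s *\<^sub>R v"] by simp
  ultimately show "sqrt (g (o0 + ?s *\<^sub>R (z - o0)) (?s *\<^sub>R v) (?s *\<^sub>R v)) \<le> 2 * D / 2 ^ k * sqrt (g z v v)"
    by (simp add: pos_le_divide_eq mult.commute)
qed (use D_ge_1 m xy in auto)

text \<open>The convex hull of a ball about o0 and a point farther out on the ray contains a disc in
  direction x - o0 around the intermediate point, with radius proportional to its depth.
  \<open>disc_bound_sqrt\<close> turns this radius into a speed bound.\<close>

lemma radial_speed:
  obtains K where "K > 0" "\<And>x \<sigma>. x \<in> \<Omega> \<Longrightarrow> 0 \<le> \<sigma> \<Longrightarrow> \<sigma> \<le> 1 \<Longrightarrow>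
      sqrt (g (o0 + \<sigma> *\<^sub>R (x - o0)) (x - o0) (x - o0)) \<le> K / (1 - \<sigma> * gauge_at o0 \<Omega> x)"
proof -
  obtain \<rho> where \<rho>: "\<rho> > 0" "cball o0 \<rho> \<subseteq> \<Omega>" using open_\<Omega> o0 open_contains_cball by blast
  obtain b where b: "b > 0" "\<And>x. x \<in> \<Omega> \<Longrightarrow> norm x \<le> b" using bounded_\<Omega> bounded_pos by metis
  \<comment> \<open>norm (x - o0) is at most 2 * b, and a point of the disc is a combination of two
    vectors of this length; hence 4 * b.\<close>
  define r where "r = \<rho> / (4 * b)"
  have r: "r > 0" unfolding r_def using \<rho> b by simp
  have disc0: "o0 + r *\<^sub>R (a *\<^sub>R (x - o0) + c *\<^sub>R J (x - o0)) \<in> \<Omega>" if x: "x \<in> \<Omega>" and ac: "a\<^sup>2 + c\<^sup>2 \<le> 1" for x a c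
  proof -
    have "a\<^sup>2 \<le> 1" "c\<^sup>2 \<le> 1" using ac zero_le_power2[of a] zero_le_power2[of c] by linarith+
    then have "\<bar>a\<bar> \<le> 1" "\<bar>c\<bar> \<le> 1" by (simp_all add: abs_square_le_1)
    have n: "norm (x - o0) \<le> 2 * b" using norm_triangle_ineq4[of x o0] b(2)[OF x] b(2)[OF o0] by linarith
    have "norm (a *\<^sub>R (x - o0) + c *\<^sub>R J (x - o0)) \<le> \<bar>a\<bar> * norm (x - o0) + \<bar>c\<bar> * norm (x - o0)"
      using norm_triangle_ineq[of "a *\<^sub>R (x - o0)" "c *\<^sub>R J (x - o0)"] by simp
    also have "\<dots> \<le> 1 * (2 * b) + 1 * (2 * b)" using n \<open>\<bar>a\<bar> \<le> 1\<close> \<open>\<bar>c\<bar> \<le> 1\<close> by (intro add_mono mult_mono) auto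
    finally have "r * norm (a *\<^sub>R (x - o0) + c *\<^sub>R J (x - o0)) \<le> r * (4 * b)" using r by simp
    also have "\<dots> = \<rho>" unfolding r_def using b by simp
    finally show ?thesis using r \<rho>(2) by (auto simp: dist_norm)
  qed
  define K where "K = 2 * D / r"
  have "K > 0" unfolding K_def using r D_ge_1 by simp
  moreover have "sqrt (g (o0 + \<sigma> *\<^sub>R (x - o0)) (x - o0) (x - o0)) \<le> K / (1 - \<sigma> * gauge_at o0 \<Omega> x)"
    if x: "x \<in> \<Omega>" and \<sigma>: "0 \<le> \<sigma>" "\<sigma> \<le> 1" for x \<sigma>
  proof -
    define q where "q = \<sigma> * gauge_at o0 \<Omega> x"
    have "q \<le> 1 * gauge_at o0 \<Omega> x" unfolding q_def using \<sigma> gauge(1) by (intro mult_right_mono) auto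
    then have q: "0 \<le> q" "q < 1" using gauge(2)[OF x] gauge(1)[of x] \<sigma> unfolding q_def by auto
    \<comment> \<open>The midpoint of q and 1: the point of gauge q / \<tau> farther out still lies
      in \<Omega>, and 1 - \<tau> is half the depth of z.\<close>
    define \<tau> where "\<tau> = (1 + q) / 2"
    have \<tau>: "0 < \<tau>" "q < \<tau>" "\<tau> < 1" "1 - \<tau> = (1 - q) / 2" unfolding \<tau>_def using q by (auto simp: field_simps)
    define z where "z = o0 + \<sigma> *\<^sub>R (x - o0)"
    have z: "z \<in> \<Omega>" unfolding z_def by (rule segment_in[OF o0 x \<sigma>])
    have y: "o0 + (\<sigma> / \<tau>) *\<^sub>R (x - o0) \<in> \<Omega>"
    proof -
      have "gauge_at o0 \<Omega> (o0 + (\<sigma> / \<tau>) *\<^sub>R (x - o0)) = q / \<tau>" using gauge_scale[of "\<sigma> / \<tau>" x] \<sigma> \<tau> unfolding q_def by simp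
      also have "\<dots> < 1" using \<tau> by simp
      finally show ?thesis using gauge_at_less_1_iff[OF open_\<Omega> bounded_\<Omega> convex_\<Omega> o0] by blast
    qed
    define \<mu> where "\<mu> = (1 - \<tau>) * r"
    have \<mu>: "\<mu> > 0" unfolding \<mu>_def using \<tau> r by simp
    have "sqrt (g z (\<mu> *\<^sub>R (x - o0)) (\<mu> *\<^sub>R (x - o0))) \<le> D"
    proof (rule disc_bound_sqrt[OF z])
      fix a c :: real assume ac: "a\<^sup>2 + c\<^sup>2 \<le> 1"
      have "\<tau> *\<^sub>R (o0 + (\<sigma> / \<tau>) *\<^sub>R (x - o0)) + (1 - \<tau>) *\<^sub>R (o0 + r *\<^sub>R (a *\<^sub>R (x - o0) + c *\<^sub>R J (x - o0))) \<in> \<Omega>"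
        by (rule convexD[OF convex_\<Omega> y disc0[OF x ac]]) (use \<tau> in auto)
      moreover have "\<tau> *\<^sub>R (o0 + (\<sigma> / \<tau>) *\<^sub>R (x - o0)) = \<tau> *\<^sub>R o0 + \<sigma> *\<^sub>R (x - o0)" using \<tau> by (simp add: scaleR_add_right)
      moreover have "\<tau> *\<^sub>R o0 + \<sigma> *\<^sub>R (x - o0) + (1 - \<tau>) *\<^sub>R (o0 + r *\<^sub>R (a *\<^sub>R (x - o0) + c *\<^sub>R J (x - o0)))
          = z + a *\<^sub>R (\<mu> *\<^sub>R (x - o0)) + c *\<^sub>R J (\<mu> *\<^sub>R (x - o0))"
      proof -
        have "\<tau> *\<^sub>R o0 + (1 - \<tau>) *\<^sub>R o0 = o0" by (simp flip: scaleR_add_left)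
        then show ?thesis unfolding z_def \<mu>_def J_simps(4) scaleR_add_right
          by (simp add: scaleR_scaleR mult_ac add_ac)
      qed
      ultimately show "z + a *\<^sub>R (\<mu> *\<^sub>R (x - o0)) + c *\<^sub>R J (\<mu> *\<^sub>R (x - o0)) \<in> \<Omega>" by simp
    qed
    then have "\<mu> * sqrt (g z (x - o0) (x - o0)) \<le> D" unfolding g_scale[OF z] using \<mu> by simp
    then have "sqrt (g z (x - o0) (x - o0)) \<le> D / \<mu>" using \<mu> by (simp add: pos_le_divide_eq mult.commute)
    also have "D / \<mu> = K / (1 - q)" unfolding \<mu>_def \<tau>(4) K_def by (simp add: mult_ac)
    finally show ?thesis unfolding z_def q_def .
  qed
  ultimately show thesis using that by blast
qed

text \<open>Integrating the speed bound gives K / p times a difference of logarithms, where p is the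
  gauge of x. For p \<le> 1/2 the speed is at most 2 * K and the summand 1 covers the distance,
  which avoids dividing by a small p.\<close>

lemma radial_distance:
  obtains K where "K > 0" "\<And>x \<sigma> \<tau>. x \<in> \<Omega> \<Longrightarrow> 0 \<le> \<sigma> \<Longrightarrow> \<sigma> \<le> \<tau> \<Longrightarrow> \<tau> \<le> 1 \<Longrightarrow>
      d (o0 + \<sigma> *\<^sub>R (x - o0)) (o0 + \<tau> *\<^sub>R (x - o0)) \<le>
        2 * K * (ln (1 - \<sigma> * gauge_at o0 \<Omega> x) - ln (1 - \<tau> * gauge_at o0 \<Omega> x) + 1)"
proof -
  obtain K where K: "K > 0" "\<And>x \<sigma>. x \<in> \<Omega> \<Longrightarrow> 0 \<le> \<sigma> \<Longrightarrow> \<sigma> \<le> 1 \<Longrightarrow>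
      sqrt (g (o0 + \<sigma> *\<^sub>R (x - o0)) (x - o0) (x - o0)) \<le> K / (1 - \<sigma> * gauge_at o0 \<Omega> x)" using radial_speed by blast
  have "d (o0 + \<sigma> *\<^sub>R (x - o0)) (o0 + \<tau> *\<^sub>R (x - o0)) \<le>
        2 * K * (ln (1 - \<sigma> * gauge_at o0 \<Omega> x) - ln (1 - \<tau> * gauge_at o0 \<Omega> x) + 1)"
    if x: "x \<in> \<Omega>" and \<sigma>: "0 \<le> \<sigma>" "\<sigma> \<le> \<tau>" "\<tau> \<le> 1" for x \<sigma> \<tau>
  proof -
    define p where "p = gauge_at o0 \<Omega> x"
    have p: "0 \<le> p" "p < 1" unfolding p_def using gauge x by auto
    let ?y = "o0 + \<sigma> *\<^sub>R (x - o0)" and ?z = "o0 + \<tau> *\<^sub>R (x - o0)"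
    have yz: "?y \<in> \<Omega>" "?z \<in> \<Omega>" using segment_in[OF o0 x] \<sigma> by auto
    have diff: "?z - ?y = (\<tau> - \<sigma>) *\<^sub>R (x - o0)" by (simp add: scaleR_left_diff_distrib)
    have pt: "?y + t *\<^sub>R (?z - ?y) = o0 + (\<sigma> + t * (\<tau> - \<sigma>)) *\<^sub>R (x - o0)" for t
      unfolding diff by (simp add: scaleR_add_left add.assoc)
    have rng: "0 \<le> \<sigma> + t * (\<tau> - \<sigma>)" "\<sigma> + t * (\<tau> - \<sigma>) \<le> 1" "(\<sigma> + t * (\<tau> - \<sigma>)) * p \<le> p" if "0 \<le> t" "t \<le> 1" for t
    proof -
      have "t * (\<tau> - \<sigma>) \<le> 1 * (\<tau> - \<sigma>)" using that \<sigma> by (intro mult_right_mono) auto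
      then show 1: "0 \<le> \<sigma> + t * (\<tau> - \<sigma>)" "\<sigma> + t * (\<tau> - \<sigma>) \<le> 1" using that \<sigma> by auto
      show "(\<sigma> + t * (\<tau> - \<sigma>)) * p \<le> p" using mult_right_mono[OF 1(2) p(1)] by simp
    qed
    have sp: "sqrt (g (?y + t *\<^sub>R (?z - ?y)) (?z - ?y) (?z - ?y)) \<le> (\<tau> - \<sigma>) * K / (1 - (\<sigma> + t * (\<tau> - \<sigma>)) * p)"
      if t: "0 \<le> t" "t \<le> 1" for t
    proof -
      have "sqrt (g (?y + t *\<^sub>R (?z - ?y)) (?z - ?y) (?z - ?y))
          = (\<tau> - \<sigma>) * sqrt (g (o0 + (\<sigma> + t * (\<tau> - \<sigma>)) *\<^sub>R (x - o0)) (x - o0) (x - o0))"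
        unfolding pt unfolding diff g_scale[OF segment_in[OF o0 x rng(1,2)[OF t]]] using \<sigma> by simp
      also have "\<dots> \<le> (\<tau> - \<sigma>) * (K / (1 - (\<sigma> + t * (\<tau> - \<sigma>)) * p))"
        unfolding p_def using \<sigma> by (intro mult_left_mono K(2)[OF x rng(1,2)[OF t]]) auto
      finally show ?thesis by simp
    qed
    have pst: "\<sigma> * p \<le> \<tau> * p" "\<tau> * p \<le> 1 * p" by (rule mult_right_mono; use \<sigma> p in simp)+
    have lnle: "0 \<le> ln (1 - \<sigma> * p) - ln (1 - \<tau> * p)" using pst p by simp
    have "d ?y ?z \<le> 2 * K * (ln (1 - \<sigma> * p) - ln (1 - \<tau> * p) + 1)"
    proof (cases "p \<le> 1/2")
      case True
      have "d ?y ?z \<le> 2 * K"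
      proof (rule d_segment_le[OF yz])
        fix t :: real assume t: "0 \<le> t" "t \<le> 1"
        have "(\<tau> - \<sigma>) * K / (1 - (\<sigma> + t * (\<tau> - \<sigma>)) * p) \<le> 1 * K / (1/2)"
        proof (rule frac_le)
          show "(\<tau> - \<sigma>) * K \<le> 1 * K" using \<sigma> K(1) by (intro mult_right_mono) auto
          show "1/2 \<le> 1 - (\<sigma> + t * (\<tau> - \<sigma>)) * p" using rng(3)[OF t] True by linarith
        qed (use K(1) \<sigma> in auto)
        then show "sqrt (g (?y + t *\<^sub>R (?z - ?y)) (?z - ?y) (?z - ?y)) \<le> 2 * K" using sp[OF t] by simp
      qed
      also have "\<dots> \<le> 2 * K * (ln (1 - \<sigma> * p) - ln (1 - \<tau> * p) + 1)" using lnle K(1) by simp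
      finally show ?thesis .
    next
      case False
      define F where "F t = - (K / p) * ln (1 - (\<sigma> + t * (\<tau> - \<sigma>)) * p)" for t
      have "((\<lambda>t. (\<tau> - \<sigma>) * K / (1 - (\<sigma> + t * (\<tau> - \<sigma>)) * p)) has_integral (F 1 - F 0)) {0..1}"
      proof (rule fundamental_theorem_of_calculus)
        fix t :: real assume t: "t \<in> {0..1}"
        have "0 < 1 - (\<sigma> + t * (\<tau> - \<sigma>)) * p" using rng(3)[of t] t p by auto
        then have "(F has_real_derivative (\<tau> - \<sigma>) * K / (1 - (\<sigma> + t * (\<tau> - \<sigma>)) * p)) (at t within {0..1})"
          unfolding F_def[abs_def] using False by (auto intro!: derivative_eq_intros)
        then show "(F has_vector_derivative (\<tau> - \<sigma>) * K / (1 - (\<sigma> + t * (\<tau> - \<sigma>)) * p)) (at t within {0..1})"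
          by (simp add: has_real_derivative_iff_has_vector_derivative)
      qed simp
      moreover have "((\<lambda>t. sqrt (g (?y + t *\<^sub>R (?z - ?y)) (?z - ?y) (?z - ?y))) has_integral
          integral {0..1} (\<lambda>t. sqrt (g (?y + t *\<^sub>R (?z - ?y)) (?z - ?y) (?z - ?y)))) {0..1}"
        by (intro integrable_integral integrable_continuous_real continuous_on_real_sqrt g_continuous continuous_intros)
          (use segment_in[OF yz] in auto)
      ultimately have "integral {0..1} (\<lambda>t. sqrt (g (?y + t *\<^sub>R (?z - ?y)) (?z - ?y) (?z - ?y))) \<le> F 1 - F 0"
        using sp by (elim has_integral_le[rotated 1]) auto
      then have "d ?y ?z \<le> F 1 - F 0" using d_le_length[OF lengths_segment[OF yz]] by linarith
      also have "\<dots> = K / p * (ln (1 - \<sigma> * p) - ln (1 - \<tau> * p))" unfolding F_def by (simp add: right_diff_distrib)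
      also have "\<dots> \<le> 2 * K * (ln (1 - \<sigma> * p) - ln (1 - \<tau> * p))"
      proof (rule mult_right_mono[OF _ lnle])
        have "K * 1 \<le> K * (2 * p)" using False K(1) by (intro mult_left_mono) auto
        then show "K / p \<le> 2 * K" using False by (simp add: pos_divide_le_eq mult_ac)
      qed
      also have "\<dots> \<le> 2 * K * (ln (1 - \<sigma> * p) - ln (1 - \<tau> * p) + 1)" using K(1) by simp
      finally show ?thesis .
    qed
    then show ?thesis unfolding p_def .
  qed
  then show thesis using that K(1) by blast
qed

end

theorem hyperbolic_of_hilbert:
  assumes ne: "\<Omega> \<noteq> {}" and hyp: "gromov_hyperbolic \<Omega> (hilbert_dist \<Omega>)"
  shows "gromov_hyperbolic \<Omega> d"
proof -
  obtain o0 where o0: "o0 \<in> \<Omega>" using ne by blast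
  obtain B where B: "B > 1" "\<And>k v u s. o0 + v + u \<in> \<Omega> \<Longrightarrow> o0 + v - u \<in> \<Omega> \<Longrightarrow> 0 \<le> s \<Longrightarrow> s \<le> 1 \<Longrightarrow>
      B ^ k * (1 - gauge_at o0 \<Omega> (o0 + v)) \<le> 1 - s \<Longrightarrow> o0 + s *\<^sub>R (v + 2 ^ k *\<^sub>R u) \<in> \<Omega>"
    by (rule hilbert_hyperbolic_expansion[OF open_\<Omega> bounded_\<Omega> convex_\<Omega> o0 hyp]) blast
  obtain K where K: "K > 0" "\<And>x \<sigma> \<tau>. x \<in> \<Omega> \<Longrightarrow> 0 \<le> \<sigma> \<Longrightarrow> \<sigma> \<le> \<tau> \<Longrightarrow> \<tau> \<le> 1 \<Longrightarrow>
      d (o0 + \<sigma> *\<^sub>R (x - o0)) (o0 + \<tau> *\<^sub>R (x - o0)) \<le>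
        2 * K * (ln (1 - \<sigma> * gauge_at o0 \<Omega> x) - ln (1 - \<tau> * gauge_at o0 \<Omega> x) + 1)"
    using radial_distance[OF o0] by blast
  define C where "C = 2 + 4 * K + 2 * D"
  have C: "2 \<le> C" "4 * K \<le> C" "2 * D \<le> C" unfolding C_def using K(1) D_ge_1 by auto
  have ln2: "ln 2 \<le> (1::real)" using ln_le_minus_one[of "2::real"] by simp
  let ?p = "gauge_at o0 \<Omega>"
  note gauge = gauge_at_nonneg[OF open_\<Omega> bounded_\<Omega> convex_\<Omega> o0] gauge_at_less_1[OF open_\<Omega> bounded_\<Omega> convex_\<Omega> o0]
  interpret radial_contraction \<Omega> d "retract o0" "height o0" o0 C "ln B + 4"
  proof
    show "0 \<le> d x y" for x y by (rule d_nonneg)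
    show "d x x = 0" if "x \<in> \<Omega>" for x by (rule d_self[OF that])
    show "d x y = d y x" for x y by (rule d_sym)
    show "d x z \<le> d x y + d y z" if "x \<in> \<Omega>" "y \<in> \<Omega>" "z \<in> \<Omega>" for x y z by (rule d_tri[OF that])
    show "1 \<le> C" using C(1) by simp
    show "0 < ln B + 4" using B(1) by (simp add: add_pos_pos)
    show "o0 \<in> \<Omega>" by (rule o0)
    show "0 \<le> height o0 x" if "x \<in> \<Omega>" for x by (rule height_nonneg[OF o0 that])
    have "?p o0 = 0" using gauge_scale[OF o0, of 0 o0] by simp
    then show "height o0 o0 = 0" unfolding height_def[OF o0] by simp
    show "\<bar>height o0 x - height o0 y\<bar> \<le> C * d x y" if xy: "x \<in> \<Omega>" "y \<in> \<Omega>" for x y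
    proof -
      have "\<bar>height o0 x - height o0 y\<bar> \<le> 2 * d x y"
        using height_lipschitz[OF o0 xy] height_lipschitz[OF o0 xy(2,1)] d_sym[of x y] by (simp add: abs_le_iff)
      also have "\<dots> \<le> C * d x y" using C(1) d_nonneg by (intro mult_right_mono) auto
      finally show ?thesis .
    qed
    show "retract o0 m x \<in> \<Omega>" if "0 \<le> m" "x \<in> \<Omega>" for m x by (rule retract_in[OF o0 that])
    show "retract o0 0 x = o0" for x unfolding retract_def[OF o0] by simp
    show "height o0 (retract o0 m x) \<le> m" if "0 \<le> m" "x \<in> \<Omega>" for m x by (rule height_retract[OF o0 that])
    show "d x (retract o0 m x) \<le> C * (max 0 (height o0 x - m) + 1)" if m: "0 \<le> m" and x: "x \<in> \<Omega>" for m x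
    proof -
      let ?s = "1 - exp (- m)"
      have s: "0 \<le> ?s" "?s \<le> 1" using m by auto
      have p: "0 \<le> ?p x" "?p x < 1" using gauge x by auto
      have "d x (retract o0 m x) = d (o0 + ?s *\<^sub>R (x - o0)) (o0 + 1 *\<^sub>R (x - o0))"
        unfolding retract_def[OF o0] by (subst d_sym) simp
      also have "\<dots> \<le> 2 * K * (ln (1 - ?s * ?p x) - ln (1 - 1 * ?p x) + 1)"
        by (rule K(2)[OF x s]) simp
      also have "\<dots> \<le> 2 * K * (2 * (max 0 (height o0 x - m) + 1))"
      proof (rule mult_left_mono)
        \<comment> \<open>The depth of the retracted point is at most the sum of the depth of x and
          exp (- m), hence at most twice the larger one; the resulting ln 2 is at most 1.\<close>
        define M where "M = max (1 - ?p x) (exp (- m))"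
        have M: "M > 0" unfolding M_def by (simp add: less_max_iff_disj)
        have "1 - ?s * ?p x = (1 - ?p x) + exp (- m) * ?p x" by (simp add: algebra_simps)
        also have "exp (- m) * ?p x \<le> exp (- m) * 1" using p by (intro mult_left_mono) auto
        finally have "1 - ?s * ?p x \<le> (1 - ?p x) + exp (- m)" by simp
        moreover have "1 - ?p x \<le> M" "exp (- m) \<le> M" unfolding M_def by auto
        ultimately have "1 - ?s * ?p x \<le> 2 * M" by linarith
        moreover have "?s * ?p x \<le> 1 * ?p x" using s p by (intro mult_right_mono) auto
        ultimately have "ln (1 - ?s * ?p x) \<le> ln (2 * M)" using p by (intro ln_mono) auto
        also have "\<dots> = ln 2 + ln M" using M by (simp add: ln_mult)
        finally have 1: "ln (1 - ?s * ?p x) \<le> ln 2 + ln M" .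
        have "ln M - ln (1 - ?p x) \<le> max 0 (height o0 x - m)"
          unfolding M_def height_def[OF o0] by (simp add: max_def)
        with 1 have 2: "ln (1 - ?s * ?p x) - ln (1 - ?p x) \<le> ln 2 + max 0 (height o0 x - m)" by linarith
        show "ln (1 - ?s * ?p x) - ln (1 - 1 * ?p x) + 1 \<le> 2 * (max 0 (height o0 x - m) + 1)"
        proof -
          have "a - b + 1 \<le> 2 * (e + 1)" if "a - b \<le> l + e" "0 \<le> e" "l \<le> 1" for a b e l :: real
            using that by simp
          from this[OF 2 _ ln2] show ?thesis by simp
        qed
      qed (use K(1) in simp)
      also have "\<dots> = 4 * K * (max 0 (height o0 x - m) + 1)" by simp
      also have "\<dots> \<le> C * (max 0 (height o0 x - m) + 1)" using C(2) by (intro mult_right_mono) auto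
      finally show ?thesis .
    qed
    show "d (retract o0 m (retract o0 m' x)) (retract o0 m x) \<le> C" if m: "0 \<le> m" "m \<le> m'" and x: "x \<in> \<Omega>" for m m' x
    proof -
      let ?s = "1 - exp (- m)" and ?s' = "1 - exp (- m')"
      have s: "0 \<le> ?s" "?s \<le> 1" "0 \<le> ?s'" "?s' \<le> 1" using m by auto
      have p: "0 \<le> ?p x" "?p x < 1" using gauge x by auto
      have ss: "0 \<le> ?s * ?s'" "?s * ?s' \<le> ?s" using s mult_left_mono[OF s(4) s(1)] by auto
      have "d (retract o0 m (retract o0 m' x)) (retract o0 m x) = d (o0 + (?s * ?s') *\<^sub>R (x - o0)) (o0 + ?s *\<^sub>R (x - o0))"
        unfolding retract_def[OF o0] by simp
      also have "\<dots> \<le> 2 * K * (ln (1 - ?s * ?s' * ?p x) - ln (1 - ?s * ?p x) + 1)"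
        by (rule K(2)[OF x ss s(2)])
      also have "\<dots> \<le> 2 * K * 2"
      proof (rule mult_left_mono)
        have sp: "?s * ?p x \<le> 1 * ?p x" "?s * ?p x \<le> ?s * 1"
          using mult_right_mono[OF s(2) p(1)] mult_left_mono[OF less_imp_le[OF p(2)] s(1)] by auto
        have ssp: "?s * ?s' * ?p x \<le> 1 * ?p x" by (rule mult_right_mono[OF order_trans[OF ss(2) s(2)] p(1)])
        \<comment> \<open>Since m \<le> m', the composite is deeper than
          \<open>retract o0 m x\<close> by at most exp (- m), which is at most the depth of the
          latter; so the depth at most doubles.\<close>
        have "1 - ?s * ?s' * ?p x = (1 - ?s * ?p x) + exp (- m') * (?s * ?p x)" by (simp add: algebra_simps)
        also have "exp (- m') * (?s * ?p x) \<le> exp (- m) * 1" using sp s p m by (intro mult_mono) auto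
        also have "exp (- m) * 1 \<le> 1 - ?s * ?p x" using sp(2) by simp
        finally have "1 - ?s * ?s' * ?p x \<le> 2 * (1 - ?s * ?p x)" by (simp add: mult.commute)
        then have "ln (1 - ?s * ?s' * ?p x) \<le> ln (2 * (1 - ?s * ?p x))" using ssp p by (intro ln_mono) auto
        also have "\<dots> = ln 2 + ln (1 - ?s * ?p x)" by (rule ln_mult_pos) (use sp p in auto)
        finally show "ln (1 - ?s * ?s' * ?p x) - ln (1 - ?s * ?p x) + 1 \<le> 2" using ln2 by linarith
      qed (use K(1) in simp)
      finally show ?thesis using C(2) by simp
    qed
    show lip: "d (retract o0 m x) (retract o0 m y) \<le> C * d x y" if "0 \<le> m" "x \<in> \<Omega>" "y \<in> \<Omega>" for m x y
    proof -
      have "d (retract o0 m x) (retract o0 m y) \<le> 2 * D * d x y" by (rule retract_lipschitz[OF o0 that])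
      also have "\<dots> \<le> C * d x y" using C(3) d_nonneg by (intro mult_right_mono) auto
      finally show ?thesis .
    qed
    show "d (retract o0 m x) (retract o0 m y) \<le> C / 2 ^ k * d x y"
      if m: "0 \<le> m" and xy: "x \<in> \<Omega>" "y \<in> \<Omega>" "d x y \<le> 1" and hx: "m + real k * (ln B + 4) \<le> height o0 x" for m k x y
    proof (cases "k = 0")
      case True
      then show ?thesis using lip[OF m xy(1,2)] by simp
    next
      case False
      then have "d (retract o0 m x) (retract o0 m y) \<le> 2 * D / 2 ^ k * d x y"
        by (intro retract_contract[OF o0 B m xy hx]) auto
      also have "\<dots> \<le> C / 2 ^ k * d x y" using C(3) d_nonneg by (intro mult_right_mono divide_right_mono) auto
      finally show ?thesis .
    qed
    show "\<exists>N p. p 0 = x \<and> p N = y \<and> (\<forall>i\<le>N. p i \<in> \<Omega>) \<and> (\<forall>i<N. d (p i) (p (Suc i)) \<le> 1) \<and>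
        (\<Sum>i<N. d (p i) (p (Suc i))) \<le> d x y + 1" if "x \<in> \<Omega>" "y \<in> \<Omega>" for x y
      by (rule chain_exists[OF that]) simp
  qed
  show ?thesis by (rule hyperbolic)
qed

end

theorem corollary1p11:
  fixes \<Omega> :: "(complex ^ 'n) set"
    and g :: "complex ^ 'n \<Rightarrow> complex ^ 'n \<Rightarrow> complex ^ 'n \<Rightarrow> real"
  assumes "open \<Omega>" "\<Omega> \<noteq> {}" "bounded \<Omega>" "convex \<Omega>"
    and "kaehler_einstein_metric_on (-1) \<Omega> g"
    and "complete_riemannian_metric_on \<Omega> g"
    and "gromov_hyperbolic \<Omega> (hilbert_dist \<Omega>)"
  shows "gromov_hyperbolic \<Omega> (riemannian_dist \<Omega> g)"
proof -
  have ke: "kaehler_metric_on \<Omega> g" "\<And>z v w. z \<in> \<Omega> \<Longrightarrow> ricci_curvature g z v w = - g z v w"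
    using assms(5) unfolding kaehler_einstein_metric_on_def by auto
  have "riemannian_metric_on \<Omega> g" "Metric_space.mcomplete \<Omega> (riemannian_dist \<Omega> g)"
    using assms(6) unfolding complete_riemannian_metric_on_def by auto
  then interpret kaehler_einstein_complete \<Omega> g
    by unfold_locales (use assms ke in auto)
  show ?thesis by (rule hyperbolic_of_hilbert[OF assms(2,7)])
qed

end
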